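(* Let $H$ be a two-player game graph with state set $Q$ and $\tau$ transitions, and let $\mathcal F_{\mathcal A}=\{F_{\mathcal A}^1,\dots,F_{\mathcal A}^m\}$, $\mathcal F_{\mathcal G}=\{F_{\mathcal G}^1,\dots,F_{\mathcal G}^n\}$. Whether there exists a winning non-conflicting system strategy $f^1$ (i.e. one with $\emptyset\neq\mathcal L(H,f^1)\subseteq\overline{\mathcal L(H,\mathcal F_{\mathcal A})}\cup\mathcal L(H,\mathcal F_{\mathcal G})$ and $\mathrm{pre}(\mathcal L(H,f^1))=\mathrm{pre}(\mathcal L(H,f^1)\cap\mathcal L(H,\mathcal F_{\mathcal A}))$) can be checked by a symbolic algorithm performing $O(|Q|^2\,|\mathcal F_{\mathcal G}|\,|\mathcal F_{\mathcal A}|)$ next-step (predecessor) computations, and by an enumerative algorithm running in time $O(\tau\,|Q|^2\,|\mathcal F_{\mathcal G}|\,|\mathcal F_{\mathcal A}|)$.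
   Context: Game graph $H=(Q^0,Q^1,\delta^0,\delta^1,q_0)$: finite disjoint $Q^0$ (environment) and $Q^1$ (system), $Q=Q^0\cup Q^1$, $\delta^0:Q^0\to2^{Q^1}$, $\delta^1:Q^1\to2^{Q^0}$, initial state $q_0\in Q^0$. Plays are infinite state sequences from $q_0$ following the transition functions; a system strategy maps finite play prefixes ending in $Q^1$ to $Q^0$, and $\mathcal L(H,f^1)$ is the set of plays from $q_0$ whose system moves follow $f^1$. $\mathcal L(H,\mathcal F)$ is the set of plays visiting every set of the family $\mathcal F$ infinitely often; $\overline{\mathcal L}$ is complement among infinite sequences; $\mathrm{pre}(\mathcal L)$ is the set of finite prefixes of words in $\mathcal L$. A next-step computation is one evaluation of a one-step predecessor operator on a set of states. *)

theory Defs
  imports Main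
begin

subsection \<open>Game graphs, plays and strategies\<close>

record 'q game =
  env_states :: "'q set"
  sys_states :: "'q set"
  env_moves :: "'q \<Rightarrow> 'q set"
  sys_moves :: "'q \<Rightarrow> 'q set"
  initial :: 'q

definition game_graph :: "'q game \<Rightarrow> bool" where
  "game_graph H \<longleftrightarrow>
     finite (env_states H) \<and> finite (sys_states H) \<and> env_states H \<inter> sys_states H = {} \<and>
     (\<forall>q \<in> env_states H. env_moves H q \<subseteq> sys_states H) \<and>
     (\<forall>q \<in> sys_states H. sys_moves H q \<subseteq> env_states H) \<and>
     initial H \<in> env_states H"

definition states :: "'q game \<Rightarrow> 'q set" where
  "states H = env_states H \<union> sys_states H"

definition moves :: "'q game \<Rightarrow> 'q \<Rightarrow> 'q set" where
  "moves H q = (if q \<in> env_states H then env_moves H q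
                else if q \<in> sys_states H then sys_moves H q else {})"

definition transitions :: "'q game \<Rightarrow> ('q \<times> 'q) set" where
  "transitions H = {(q, q'). q \<in> states H \<and> q' \<in> moves H q}"

definition plays :: "'q game \<Rightarrow> (nat \<Rightarrow> 'q) set" where
  "plays H = {\<pi>. \<pi> 0 = initial H \<and> (\<forall>k. \<pi> (Suc k) \<in> moves H (\<pi> k))}"

definition finite_play :: "'q game \<Rightarrow> 'q list \<Rightarrow> bool" where
  "finite_play H w \<longleftrightarrow> w \<noteq> [] \<and> hd w = initial H \<and>
     (\<forall>k. Suc k < length w \<longrightarrow> w ! Suc k \<in> moves H (w ! k))"

text \<open>States without successors are allowed. A strategy has to propose a legal move whenever there
  is one: otherwise the system could discard plays by proposing a move that does not exist.\<close>

definition sys_strategy :: "'q game \<Rightarrow> ('q list \<Rightarrow> 'q) \<Rightarrow> bool" where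
  "sys_strategy H f \<longleftrightarrow>
     (\<forall>w. finite_play H w \<and> last w \<in> sys_states H \<longrightarrow>
        f w \<in> env_states H \<and> (sys_moves H (last w) \<noteq> {} \<longrightarrow> f w \<in> sys_moves H (last w)))"

definition compliant :: "'q game \<Rightarrow> ('q list \<Rightarrow> 'q) \<Rightarrow> (nat \<Rightarrow> 'q) set" where
  "compliant H f =
     {\<pi> \<in> plays H. \<forall>k. \<pi> k \<in> sys_states H \<longrightarrow> \<pi> (Suc k) = f (map \<pi> [0..<Suc k])}"

definition gen_buchi :: "'q game \<Rightarrow> 'q set list \<Rightarrow> (nat \<Rightarrow> 'q) set" where
  "gen_buchi H Fs = {\<pi> \<in> plays H. \<forall>F \<in> set Fs. infinite {k. \<pi> k \<in> F}}"

definition prefixes :: "(nat \<Rightarrow> 'q) set \<Rightarrow> 'q list set" where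
  "prefixes L = {map \<pi> [0..<k] | \<pi> k. \<pi> \<in> L}"

definition winning :: "'q game \<Rightarrow> 'q set list \<Rightarrow> 'q set list \<Rightarrow> ('q list \<Rightarrow> 'q) \<Rightarrow> bool" where
  "winning H FA FG f \<longleftrightarrow>
     compliant H f \<noteq> {} \<and> compliant H f \<subseteq> - gen_buchi H FA \<union> gen_buchi H FG"

definition non_conflicting :: "'q game \<Rightarrow> 'q set list \<Rightarrow> ('q list \<Rightarrow> 'q) \<Rightarrow> bool" where
  "non_conflicting H FA f \<longleftrightarrow>
     prefixes (compliant H f) = prefixes (compliant H f \<inter> gen_buchi H FA)"

definition synthesizable :: "'q game \<Rightarrow> 'q set list \<Rightarrow> 'q set list \<Rightarrow> bool" where
  "synthesizable H FA FG \<longleftrightarrow>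
     (\<exists>f. sys_strategy H f \<and> winning H FA FG f \<and> non_conflicting H FA f)"

definition instance_of :: "'q game \<Rightarrow> 'q set list \<Rightarrow> 'q set list \<Rightarrow> bool" where
  "instance_of H FA FG \<longleftrightarrow>
     game_graph H \<and> FA \<noteq> [] \<and> FG \<noteq> [] \<and> (\<forall>F \<in> set FA \<union> set FG. F \<subseteq> states H)"


subsection \<open>Structured programs with a cost measure\<close>

datatype ('a, 't) prog =
    Skip
  | Do 'a
  | Seq "('a, 't) prog" "('a, 't) prog"
  | Cond 't "('a, 't) prog" "('a, 't) prog"
  | Loop 't "('a, 't) prog"

text \<open>The judgement \<open>run act ca tst ct p s c s'\<close> says that \<open>p\<close>, started in \<open>s\<close>, terminates in \<open>s'\<close>
  with total cost \<open>c\<close>, where \<open>act\<close> and \<open>tst\<close> interpret basic actions and tests and \<open>ca\<close> and \<open>ct\<close>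
  give the cost of one execution of them.\<close>

inductive run :: "('a \<Rightarrow> 's \<Rightarrow> 's) \<Rightarrow> ('a \<Rightarrow> nat) \<Rightarrow> ('t \<Rightarrow> 's \<Rightarrow> bool) \<Rightarrow> ('t \<Rightarrow> nat)
    \<Rightarrow> ('a, 't) prog \<Rightarrow> 's \<Rightarrow> nat \<Rightarrow> 's \<Rightarrow> bool"
  for act ca tst ct where
  Skip: "run act ca tst ct Skip s 0 s"
| Do: "run act ca tst ct (Do a) s (ca a) (act a s)"
| Seq: "run act ca tst ct p s c s' \<Longrightarrow> run act ca tst ct p' s' c' s''
    \<Longrightarrow> run act ca tst ct (Seq p p') s (c + c') s''"
| CondT: "tst t s \<Longrightarrow> run act ca tst ct p s c s'
    \<Longrightarrow> run act ca tst ct (Cond t p p') s (ct t + c) s'"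
| CondF: "\<not> tst t s \<Longrightarrow> run act ca tst ct p' s c s'
    \<Longrightarrow> run act ca tst ct (Cond t p p') s (ct t + c) s'"
| LoopF: "\<not> tst t s \<Longrightarrow> run act ca tst ct (Loop t p) s (ct t) s"
| LoopT: "tst t s \<Longrightarrow> run act ca tst ct p s c s' \<Longrightarrow> run act ca tst ct (Loop t p) s' c' s''
    \<Longrightarrow> run act ca tst ct (Loop t p) s (ct t + c + c') s''"

inductive_cases run_SkipE: "run act ca tst ct Skip s c s'"
inductive_cases run_DoE: "run act ca tst ct (Do a) s c s'"
inductive_cases run_SeqE: "run act ca tst ct (Seq p p') s c s'"
inductive_cases run_CondE: "run act ca tst ct (Cond t p p') s c s'"
inductive_cases run_LoopE: "run act ca tst ct (Loop t p) s c s'"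

lemma run_deterministic:
  assumes "run act ca tst ct p s c s'" and "run act ca tst ct p s d u"
  shows "c = d \<and> s' = u"
  using assms
proof (induction arbitrary: d u rule: run.induct)
  case (Skip s)
  then show ?case by (auto elim: run_SkipE)
next
  case (Do a s)
  then show ?case by (auto elim: run_DoE)
next
  case (Seq p s c s' p' c' s'')
  from Seq.prems obtain x y v where "run act ca tst ct p s x v" "run act ca tst ct p' v y u" "d = x + y"
    by (auto elim: run_SeqE)
  with Seq.IH show ?case by blast
next
  case (CondT t s p c s' p')
  from CondT.prems CondT.hyps obtain x where "run act ca tst ct p s x u" "d = ct t + x"
    by (auto elim: run_CondE)
  with CondT.IH show ?case by blast
next
  case (CondF t s p' c s' p)
  from CondF.prems CondF.hyps obtain x where "run act ca tst ct p' s x u" "d = ct t + x"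
    by (auto elim: run_CondE)
  with CondF.IH show ?case by blast
next
  case (LoopF t s p)
  from LoopF.prems LoopF.hyps show ?case by (auto elim: run_LoopE)
next
  case (LoopT t s p c s' c' s'')
  from LoopT.prems LoopT.hyps obtain x y v
    where "run act ca tst ct p s x v" "run act ca tst ct (Loop t p) v y u" "d = ct t + x + y"
    by (auto elim: run_LoopE)
  with LoopT.IH show ?case by blast
qed

text \<open>Memory consists of named arrays; a scalar is the cell with index 0 of an array.\<close>

type_synonym memory = "string \<Rightarrow> nat \<Rightarrow> nat"

definition accepts :: "memory \<Rightarrow> bool" where
  "accepts m \<longleftrightarrow> m ''out'' 0 = 1"

definition set_cell :: "(string \<Rightarrow> nat \<Rightarrow> 'v) \<Rightarrow> string \<Rightarrow> nat \<Rightarrow> 'v \<Rightarrow> string \<Rightarrow> nat \<Rightarrow> 'v" where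
  "set_cell m x i v = m(x := (m x)(i := v))"

datatype nexp = Lit nat | Cell string nexp | Plus nexp nexp | Minus nexp nexp

fun nval :: "nexp \<Rightarrow> memory \<Rightarrow> nat" where
  "nval (Lit k) m = k"
| "nval (Cell x e) m = m x (nval e m)"
| "nval (Plus e e') m = nval e m + nval e' m"
| "nval (Minus e e') m = nval e m - nval e' m"

fun ncost :: "nexp \<Rightarrow> nat" where
  "ncost (Lit k) = 1"
| "ncost (Cell x e) = 1 + ncost e"
| "ncost (Plus e e') = 1 + ncost e + ncost e'"
| "ncost (Minus e e') = 1 + ncost e + ncost e'"


subsection \<open>Enumerative algorithms: random access machines with unit cost\<close>

datatype ram_action = Assign string nexp nexp  \<comment> \<open>array, index, value\<close>

fun ram_act :: "ram_action \<Rightarrow> memory \<Rightarrow> memory" where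
  "ram_act (Assign x i e) m = set_cell m x (nval i m) (nval e m)"

fun ram_act_cost :: "ram_action \<Rightarrow> nat" where
  "ram_act_cost (Assign x i e) = 1 + ncost i + ncost e"

datatype ram_test = Less nexp nexp | Neg ram_test

fun ram_tst :: "ram_test \<Rightarrow> memory \<Rightarrow> bool" where
  "ram_tst (Less e e') m \<longleftrightarrow> nval e m < nval e' m"
| "ram_tst (Neg t) m \<longleftrightarrow> \<not> ram_tst t m"

fun ram_tst_cost :: "ram_test \<Rightarrow> nat" where
  "ram_tst_cost (Less e e') = 1 + ncost e + ncost e'"
| "ram_tst_cost (Neg t) = 1 + ram_tst_cost t"

abbreviation ram_run :: "(ram_action, ram_test) prog \<Rightarrow> memory \<Rightarrow> nat \<Rightarrow> memory \<Rightarrow> bool" where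
  "ram_run \<equiv> run ram_act ram_act_cost ram_tst ram_tst_cost"

text \<open>The input is given by an arbitrary numbering of the states, the transitions as an edge list
  in arbitrary order, and the sets of the two families as bit vectors stored one after the other.\<close>

definition ram_input :: "'q game \<Rightarrow> 'q set list \<Rightarrow> 'q set list \<Rightarrow> memory \<Rightarrow> bool" where
  "ram_input H FA FG m \<longleftrightarrow>
     (\<exists>e. bij_betw e (states H) {..<card (states H)} \<and>
        m ''nQ'' 0 = card (states H) \<and>
        m ''nT'' 0 = card (transitions H) \<and>
        m ''nA'' 0 = length FA \<and>
        m ''nG'' 0 = length FG \<and>
        m ''init'' 0 = e (initial H) \<and>
        (\<forall>q \<in> states H. m ''sys'' (e q) = of_bool (q \<in> sys_states H)) \<and>
        bij_betw (\<lambda>k. (m ''src'' k, m ''tgt'' k)) {..<card (transitions H)}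
          (map_prod e e ` transitions H) \<and>
        (\<forall>i < length FA. \<forall>q \<in> states H.
           m ''A'' (i * card (states H) + e q) = of_bool (q \<in> FA ! i)) \<and>
        (\<forall>i < length FG. \<forall>q \<in> states H.
           m ''G'' (i * card (states H) + e q) = of_bool (q \<in> FG ! i))) \<and>
     (\<forall>x i. x \<notin> {''nQ'', ''nT'', ''nA'', ''nG'', ''init'', ''sys'', ''src'', ''tgt'', ''A'', ''G''}
        \<longrightarrow> m x i = 0)"


subsection \<open>Symbolic algorithms\<close>

text \<open>A symbolic algorithm accesses the game only through set operations. Besides numbers it stores
  sets of states; its cost is the number of evaluated predecessor operators. Universal, controllable
  and conditional predecessors are Boolean combinations of a fixed number of applications of
  the existential predecessor \<open>pre\<close>, the only one provided.\<close>

definition pre :: "'q game \<Rightarrow> 'q set \<Rightarrow> 'q set" where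
  "pre H T = {q \<in> states H. moves H q \<inter> T \<noteq> {}}"

datatype sexp =
    AllStates | SysStates | InitState | Asm nexp | Gua nexp | SCell string nexp
  | Cup sexp sexp | Cap sexp sexp | Diff sexp sexp | Pre sexp

fun sval :: "'q game \<Rightarrow> 'q set list \<Rightarrow> 'q set list \<Rightarrow> sexp
    \<Rightarrow> memory \<times> (string \<Rightarrow> nat \<Rightarrow> 'q set) \<Rightarrow> 'q set" where
  "sval H FA FG AllStates s = states H"
| "sval H FA FG SysStates s = sys_states H"
| "sval H FA FG InitState s = {initial H}"
| "sval H FA FG (Asm e) s = (let i = nval e (fst s) in if i < length FA then FA ! i else {})"
| "sval H FA FG (Gua e) s = (let i = nval e (fst s) in if i < length FG then FG ! i else {})"
| "sval H FA FG (SCell x e) s = snd s x (nval e (fst s))"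
| "sval H FA FG (Cup S S') s = sval H FA FG S s \<union> sval H FA FG S' s"
| "sval H FA FG (Cap S S') s = sval H FA FG S s \<inter> sval H FA FG S' s"
| "sval H FA FG (Diff S S') s = sval H FA FG S s - sval H FA FG S' s"
| "sval H FA FG (Pre S) s = pre H (sval H FA FG S s)"

fun pre_count :: "sexp \<Rightarrow> nat" where
  "pre_count (Cup S S') = pre_count S + pre_count S'"
| "pre_count (Cap S S') = pre_count S + pre_count S'"
| "pre_count (Diff S S') = pre_count S + pre_count S'"
| "pre_count (Pre S) = 1 + pre_count S"
| "pre_count _ = 0"

datatype sym_action = NAssign string nexp nexp | SAssign string nexp sexp

fun sym_act :: "'q game \<Rightarrow> 'q set list \<Rightarrow> 'q set list \<Rightarrow> sym_action
    \<Rightarrow> memory \<times> (string \<Rightarrow> nat \<Rightarrow> 'q set) \<Rightarrow> memory \<times> (string \<Rightarrow> nat \<Rightarrow> 'q set)" where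
  "sym_act H FA FG (NAssign x i e) s =
     (set_cell (fst s) x (nval i (fst s)) (nval e (fst s)), snd s)"
| "sym_act H FA FG (SAssign x i S) s =
     (fst s, set_cell (snd s) x (nval i (fst s)) (sval H FA FG S s))"

fun sym_act_cost :: "sym_action \<Rightarrow> nat" where
  "sym_act_cost (NAssign x i e) = 0"
| "sym_act_cost (SAssign x i S) = pre_count S"

datatype sym_test = NLess nexp nexp | Subset sexp sexp | SNeg sym_test

fun sym_tst :: "'q game \<Rightarrow> 'q set list \<Rightarrow> 'q set list \<Rightarrow> sym_test
    \<Rightarrow> memory \<times> (string \<Rightarrow> nat \<Rightarrow> 'q set) \<Rightarrow> bool" where
  "sym_tst H FA FG (NLess e e') s \<longleftrightarrow> nval e (fst s) < nval e' (fst s)"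
| "sym_tst H FA FG (Subset S S') s \<longleftrightarrow> sval H FA FG S s \<subseteq> sval H FA FG S' s"
| "sym_tst H FA FG (SNeg t) s \<longleftrightarrow> \<not> sym_tst H FA FG t s"

fun sym_tst_cost :: "sym_test \<Rightarrow> nat" where
  "sym_tst_cost (NLess e e') = 0"
| "sym_tst_cost (Subset S S') = pre_count S + pre_count S'"
| "sym_tst_cost (SNeg t) = sym_tst_cost t"

abbreviation sym_run :: "'q game \<Rightarrow> 'q set list \<Rightarrow> 'q set list \<Rightarrow> (sym_action, sym_test) prog
    \<Rightarrow> memory \<times> (string \<Rightarrow> nat \<Rightarrow> 'q set) \<Rightarrow> nat
    \<Rightarrow> memory \<times> (string \<Rightarrow> nat \<Rightarrow> 'q set) \<Rightarrow> bool" where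
  "sym_run H FA FG \<equiv>
     run (sym_act H FA FG) sym_act_cost (sym_tst H FA FG) sym_tst_cost"

definition sym_input :: "'q set list \<Rightarrow> 'q set list
    \<Rightarrow> memory \<times> (string \<Rightarrow> nat \<Rightarrow> 'q set)" where
  "sym_input FA FG =
     (set_cell (set_cell (\<lambda>x i. 0) ''nA'' 0 (length FA)) ''nG'' 0 (length FG), \<lambda>x i. {})"

end

theory Submission
  imports Defs
begin

text \<open>Call a state dead if the system can force a deadlock from it; stuck plays do not count, so an
  environment move into a dead state is harmless. Requiring non-conflictingness amounts to
  requiring that the plays of the strategy can always be continued to visit every assumption.
  Hence a strategy exists iff the initial state lies in the greatest set \<open>Z\<close> from which each of the
  following jobs \<open>(T, As)\<close> can be carried out without leaving \<open>Z\<close>: come to \<open>T\<close>, or else stay forever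
  outside some \<open>A \<in> As\<close>, and in either case keep a cooperative path to \<open>T\<close> open. There is a job
  \<open>(G, \<F>\<^sub>A)\<close> for each guarantee \<open>G\<close> and a job \<open>(A, {A})\<close> for each assumption \<open>A\<close>, and the set in
  question is the fixed point \<open>\<nu>Z. \<Inter>(T, As). \<mu>Y. \<Union>A \<in> As. \<nu>X. \<mu>W\<close> of a controllable predecessor \<open>cpre W X\<close>
  (some successor is in \<open>W\<close>; at environment states all live successors are in \<open>X\<close>). A strategy cycles
  through the jobs, decreasing the rank in \<open>Y\<close> or, while avoiding \<open>A\<close>, the rank in \<open>W\<close>.

  A symbolic evaluation needs only \<open>3 |Q|\<close> predecessors, however often it iterates, since
  predecessors of the blocks of a partition are cached. The enumerative one stores, for each job, each
  index \<open>j < |Q|\<close> of the iteration of \<open>Y\<close> and each \<open>A\<close>, the states removed from \<open>X\<close>. These remain removed when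
  \<open>Z\<close> shrinks, so each linear-time backward search for \<open>W\<close> removes a further state or is the last one of
  its pass, and there are at most \<open>|Q| + 1\<close> passes over \<open>Z\<close>.\<close>

subsection \<open>Fixed points and schedules on finite sets\<close>

text \<open>The enumerative bound forces three choices. A search costs |Q| + \<tau>, which is not
  O(\<tau>) when states lack transitions. But every state of a computed set has a successor, and the
  set \<open>succs\<close> of such states has at most |Q| and at most \<tau> elements, so |succs|
  (|Q| + \<tau>) is at most 2 \<tau> |Q|; therefore removals and passes are counted by
  \<open>succs\<close>. Removed states can be kept over the passes only if an index denotes iterates
  that shrink together with \<open>Z\<close>; therefore \<open>Y\<close> is iterated exactly |Q|
  times in every pass, without stopping early. The sets found in a pass then need not be the exact
  fixed points for the current \<open>Z\<close>. They lie between those for the final and for the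
  current \<open>Z\<close>, and this gap closes in the pass that removes nothing. An assumption job
  avoids only its own set, so that at most 2 |Q| m n removal sets exist for m assumptions and n
  guarantees.\<close>

lemma lfp_finite_iterate:
  fixes F :: "'a set \<Rightarrow> 'a set"
  assumes "mono F" "F U \<subseteq> U" "finite U"
  shows "lfp F = (F ^^ card U) {}"
proof -
  have sub: "(F ^^ n) {} \<subseteq> U" for n
    by (induction n) (use assms in \<open>auto, blast dest: monoD\<close>)
  have inc: "(F ^^ n) {} \<subseteq> (F ^^ Suc n) {}" for n
  proof (induction n)
    case (Suc n)
    from monoD[OF assms(1) this] show ?case by simp
  qed simp
  \<comment> \<open>A chain that still grew after \<open>card U\<close> steps would reach a subset
    of \<open>U\<close> with more than \<open>card U\<close> elements.\<close>
  have "\<exists>n \<le> card U. (F ^^ Suc n) {} = (F ^^ n) {}"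
  proof (rule ccontr)
    assume *: "\<not> ?thesis"
    have "n \<le> Suc (card U) \<Longrightarrow> n \<le> card ((F ^^ n) {})" for n
    proof (induction n)
      case (Suc n)
      then have "(F ^^ n) {} \<subset> (F ^^ Suc n) {}"
        using * inc[of n] by (metis Suc_le_mono psubsetI)
      moreover have "finite ((F ^^ Suc n) {})"
        using sub \<open>finite U\<close> finite_subset by blast
      ultimately have "card ((F ^^ n) {}) < card ((F ^^ Suc n) {})"
        by (rule psubset_card_mono[rotated])
      with Suc show ?case by simp
    qed simp
    from this[of "Suc (card U)"] card_mono[OF \<open>finite U\<close> sub[of "Suc (card U)"]]
    show False by simp
  qed
  then obtain n where n: "n \<le> card U" "(F ^^ Suc n) {} = (F ^^ n) {}" by blast
  have "(F ^^ (n + i)) {} = (F ^^ n) {}" for i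
    by (induction i) (use n(2) in auto)
  from this[of "card U - n"] n(1) have "(F ^^ card U) {} = (F ^^ n) {}" by simp
  with lfp_Kleene_iter[OF assms(1) n(2)[folded bot_set_def]] show ?thesis by (simp add: bot_set_def)
qed

text \<open>Dual to the previous lemma by complement within \<open>U\<close>. Here
  \<open>F X\<close> must lie in \<open>U\<close> for every \<open>X\<close>, since a greatest fixed
  point could otherwise contain points outside \<open>U\<close>.\<close>

lemma gfp_finite_iterate:
  fixes F :: "'a set \<Rightarrow> 'a set"
  assumes "mono F" "\<And>X. F X \<subseteq> U" "finite U"
  shows "gfp F = (F ^^ card U) U"
proof -
  define G where "G X = U - F (U - X)" for X
  have "mono G"
    unfolding G_def by (intro monoI Diff_mono order_refl monoD[OF assms(1)])
  then have "lfp G = (G ^^ card U) {}"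
    by (rule lfp_finite_iterate) (auto simp: G_def assms(3))
  moreover have "(G ^^ n) {} = U - (F ^^ n) U \<and> (F ^^ n) U \<subseteq> U" for n
  proof (induction n)
    case (Suc n)
    then have "U - (G ^^ n) {} = (F ^^ n) U" by (simp add: double_diff)
    with assms(2)[of "(F ^^ n) U"] show ?case
      by (simp add: G_def[of "(G ^^ n) {}"])
  qed simp
  ultimately have "U - lfp G = (F ^^ card U) U"
    by (simp add: double_diff)
  moreover have "gfp F = U - lfp G"
  proof (rule antisym)
    have unf: "F (gfp F) = gfp F" by (rule gfp_unfold[OF assms(1), symmetric])
    with assms(2)[of "gfp F"] have "gfp F \<subseteq> U" by simp
    moreover from this have "lfp G \<subseteq> U - gfp F"
      by (intro lfp_lowerbound) (simp add: G_def double_diff unf)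
    ultimately show "gfp F \<subseteq> U - lfp G" by blast
    show "U - lfp G \<subseteq> gfp F"
    proof (rule gfp_upperbound)
      have "U - F (U - lfp G) = lfp G"
        using lfp_unfold[OF \<open>mono G\<close>] by (simp only: G_def)
      then show "U - lfp G \<subseteq> F (U - lfp G)" by blast
    qed
  qed
  ultimately show ?thesis by simp
qed

lemma iterate_le_lfp:
  fixes F :: "'a set \<Rightarrow> 'a set"
  assumes "mono F"
  shows "(F ^^ n) {} \<subseteq> lfp F"
proof (induction n)
  case (Suc n)
  from monoD[OF assms this] show ?case by (simp flip: lfp_unfold[OF assms])
qed simp

text \<open>Dependent choice gives words that properly extend one another; letter \<open>i\<close>
  of \<open>\<pi>\<close> is read off word \<open>Suc i\<close>, which is long enough because the
  lengths increase strictly. \<open>P\<close> receives the stage number so that a requirement can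
  depend on it, such as the assumption whose turn it is.\<close>

lemma extension_limit:
  assumes "P 0 w" "\<And>n w. P n w \<Longrightarrow> \<exists>v. v \<noteq> [] \<and> P (Suc n) (w @ v)"
  obtains \<pi> g where "strict_mono g" "g 0 = length w" "map \<pi> [0..<length w] = w"
    "\<And>n. P n (map \<pi> [0..<g n])"
proof -
  have "\<exists>ws. \<forall>n. (P n (ws n) \<and> (n = 0 \<longrightarrow> ws n = w)) \<and>
      (\<exists>v. v \<noteq> [] \<and> ws (Suc n) = ws n @ v)"
  proof (rule dependent_nat_choice)
    fix n u assume "P n u \<and> (n = 0 \<longrightarrow> u = w)"
    with assms(2) obtain v where "v \<noteq> []" "P (Suc n) (u @ v)" by blast
    then show "\<exists>u'. (P (Suc n) u' \<and> (Suc n = 0 \<longrightarrow> u' = w)) \<and>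
        (\<exists>v. v \<noteq> [] \<and> u' = u @ v)" by blast
  qed (use assms(1) in blast)
  then obtain ws where ws: "\<And>n. P n (ws n)" "ws 0 = w"
    "\<And>n. \<exists>v. v \<noteq> [] \<and> ws (Suc n) = ws n @ v" by blast
  define g where "g n = length (ws n)" for n
  have g: "strict_mono g"
    unfolding strict_mono_Suc_iff g_def using ws(3) by (metis length_append length_greater_0_conv less_add_same_cancel1)
  have ext: "\<exists>v. ws (n + d) = ws n @ v" for n d
  proof (induction d)
    case (Suc d)
    with ws(3)[of "n + d"] show ?case by auto
  qed simp
  have nth: "ws n ! i = ws n' ! i" if "n \<le> n'" "i < g n" for n n' i
    using ext[of n "n' - n"] that by (auto simp: nth_append g_def)
  define \<pi> where "\<pi> i = ws (Suc i) ! i" for i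
  have "map \<pi> [0..<g n] = ws n" for n
  proof (rule nth_equalityI)
    fix i assume "i < length (map \<pi> [0..<g n])"
    then have i: "i < g n" by simp
    have "i < g (Suc i)" using strict_mono_imp_increasing[OF g, of "Suc i"] by simp
    then have "ws (Suc i) ! i = ws n ! i"
      using nth[of n "Suc i" i] nth[of "Suc i" n i] i by (metis nat_le_linear)
    with i show "map \<pi> [0..<g n] ! i = ws n ! i" by (simp add: \<pi>_def)
  qed (simp add: g_def)
  with that[of g \<pi>] g ws show thesis by (metis g_def)
qed

text \<open>The counter moves only at hits, so it keeps its value up to the next hit, and
  \<open>d\<close> further hits advance it by \<open>d\<close> modulo \<open>K\<close>.\<close>

lemma cyclic_schedule:
  fixes k :: "nat \<Rightarrow> nat"
  assumes step: "\<And>i. k (Suc i) = (if hit i then Suc (k i) mod K else k i)"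
    and k0: "k 0 < K" and prog: "\<And>i. \<exists>i' \<ge> i. hit i'" and "j < K"
  shows "infinite {i. hit i \<and> k i = j}"
proof -
  have lt: "k i < K" for i
    by (induction i) (use k0 in \<open>auto simp: step\<close>)
  have next_hit: "\<exists>i' \<ge> i. hit i' \<and> k i' = k i" for i
  proof -
    define i' where "i' = (LEAST i'. i \<le> i' \<and> hit i')"
    have i': "i \<le> i'" "hit i'" unfolding i'_def using LeastI_ex[OF prog[of i]] by auto
    have "k (i + d) = k i" if "i + d \<le> i'" for d
      using that
    proof (induction d)
      case (Suc d)
      then have "\<not> hit (i + d)"
        using not_less_Least[of "i + d" "\<lambda>i'. i \<le> i' \<and> hit i'"] by (auto simp: i'_def)
      with Suc step[of "i + d"] show ?case by simp
    qed simp
    from this[of "i' - i"] i' show ?thesis by auto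
  qed
  have reach: "\<exists>i' \<ge> i. hit i' \<and> k i' = (k i + d) mod K" for i d
  proof (induction d)
    case 0
    then show ?case using next_hit[of i] lt[of i] by auto
  next
    case (Suc d)
    then obtain i' where i': "i \<le> i'" "hit i'" "k i' = (k i + d) mod K" by blast
    then have "k (Suc i') = (k i + Suc d) mod K" using step[of i'] by (simp add: mod_Suc_eq)
    with next_hit[of "Suc i'"] i'(1) show ?case by (metis Suc_leD le_trans)
  qed
  \<comment> \<open>\<open>K - k i + j\<close> hits take the counter from \<open>k i\<close> to
    \<open>j\<close> modulo \<open>K\<close>.\<close>
  have "\<exists>i' \<ge> i. hit i' \<and> k i' = j" for i
    using reach[of i "K - k i + j"] lt[of i] \<open>j < K\<close> by simp
  then show ?thesis by (auto simp: finite_nat_set_iff_bounded) (meson not_le)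
qed

subsection \<open>The fixed point\<close>

locale arena =
  fixes U :: "'v set" and E :: "('v \<times> 'v) set" and S :: "'v set"
  assumes finite_U: "finite U" and E_sub: "E \<subseteq> U \<times> U"
begin

text \<open>States without successors enter through the first disjunct, which holds vacuously. The
  second one expresses that the system may choose its move.\<close>

definition dead_step :: "'v set \<Rightarrow> 'v set" where
  "dead_step D = {q \<in> U. (\<forall>q'. (q, q') \<in> E \<longrightarrow> q' \<in> D) \<or> (q \<in> S \<and>
      (\<exists>q' \<in> D. (q, q') \<in> E))}"

definition dead :: "'v set" where
  "dead = lfp dead_step"

text \<open>\<open>W\<close> receives the move that keeps a cooperative path open, \<open>X\<close>
  bounds what the environment can do. Moves into \<open>dead\<close> are tolerated because no
  infinite play uses them. A system state needs no condition on \<open>X\<close>, as the system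
  moves into \<open>W\<close> itself.\<close>

definition cpre :: "'v set \<Rightarrow> 'v set \<Rightarrow> 'v set" where
  "cpre W X = {q. (\<exists>q' \<in> W. (q, q') \<in> E) \<and> (q \<in> S \<or>
      (\<forall>q'. (q, q') \<in> E \<longrightarrow> q' \<in> X \<union> dead))}"

text \<open>\<open>cpre Y Y\<close> is not reduced by an assumption set: a step that lowers the rank
  in \<open>Y\<close> is also allowed from inside that set.\<close>

definition base :: "'v set \<Rightarrow> 'v set \<Rightarrow> 'v set" where
  "base T Y = T \<union> Y \<union> cpre Y Y"

definition w_step :: "'v set \<Rightarrow> 'v set \<Rightarrow> 'v set \<Rightarrow> 'v set \<Rightarrow> 'v set" where
  "w_step B A X W = B \<union> (cpre W X - A)"

definition x_step :: "'v set \<Rightarrow> 'v set \<Rightarrow> 'v set \<Rightarrow> 'v set" where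
  "x_step B A X = lfp (w_step B A X)"

definition avoid :: "'v set \<Rightarrow> 'v set \<Rightarrow> 'v set" where
  "avoid B A = gfp (x_step B A)"

definition y_step :: "'v set \<Rightarrow> 'v set set \<Rightarrow> 'v set \<Rightarrow> 'v set" where
  "y_step T As Y = (\<Union>A \<in> As. avoid (base T Y) A)"

definition stage :: "'v set \<Rightarrow> 'v set set \<Rightarrow> 'v set \<Rightarrow> 'v set" where
  "stage T As Z = lfp (y_step (T \<inter> cpre Z Z) As)"

definition z_step :: "('v set \<times> 'v set set) set \<Rightarrow> 'v set \<Rightarrow> 'v set" where
  "z_step J Z = (\<Inter>(T, As) \<in> J. stage T As Z)"

definition solution :: "('v set \<times> 'v set set) set \<Rightarrow> 'v set" where
  "solution J = gfp (z_step J)"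

section \<open>Monotonicity, bounds and finite iterates\<close>

lemma mono_dead_step: "mono dead_step"
  unfolding mono_def dead_step_def by blast

lemma cpre_mono: "W \<subseteq> W' \<Longrightarrow> X \<subseteq> X' \<Longrightarrow> cpre W X \<subseteq> cpre W' X'"
  unfolding cpre_def by blast

lemma base_mono: "T \<subseteq> T' \<Longrightarrow> Y \<subseteq> Y' \<Longrightarrow> base T Y \<subseteq> base T' Y'"
  unfolding base_def using cpre_mono[of Y Y' Y Y'] by blast

lemma w_step_mono: "B \<subseteq> B' \<Longrightarrow> X \<subseteq> X' \<Longrightarrow>
    W \<subseteq> W' \<Longrightarrow> w_step B A X W \<subseteq> w_step B' A X' W'"
  unfolding w_step_def using cpre_mono[of W W' X X'] by blast

lemma mono_w_step: "mono (w_step B A X)"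
  by (simp add: mono_def w_step_mono)

lemma x_step_mono: "B \<subseteq> B' \<Longrightarrow> X \<subseteq> X' \<Longrightarrow>
    x_step B A X \<subseteq> x_step B' A X'"
  unfolding x_step_def by (intro lfp_mono w_step_mono) auto

lemma mono_x_step: "mono (x_step B A)"
  by (simp add: mono_def x_step_mono)

lemma avoid_mono: "B \<subseteq> B' \<Longrightarrow> avoid B A \<subseteq> avoid B' A"
  unfolding avoid_def by (intro gfp_mono x_step_mono) auto

lemma y_step_mono: "T \<subseteq> T' \<Longrightarrow> Y \<subseteq> Y' \<Longrightarrow>
    y_step T As Y \<subseteq> y_step T' As Y'"
  unfolding y_step_def using avoid_mono[OF base_mono, of T T' Y Y'] by blast

lemma mono_y_step: "mono (y_step T As)"
  by (simp add: mono_def y_step_mono)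

lemma stage_mono: "Z \<subseteq> Z' \<Longrightarrow> stage T As Z \<subseteq> stage T As Z'"
  unfolding stage_def using cpre_mono[of Z Z' Z Z'] by (intro lfp_mono y_step_mono) auto

lemma mono_z_step: "mono (z_step J)"
  unfolding mono_def z_step_def by (auto dest: stage_mono[THEN subsetD])

lemma dead_step_sub: "dead_step D \<subseteq> U"
  unfolding dead_step_def by blast

lemma cpre_sub: "cpre W X \<subseteq> U"
  unfolding cpre_def using E_sub by blast

lemma base_sub: "T \<subseteq> U \<Longrightarrow> Y \<subseteq> U \<Longrightarrow> base T Y \<subseteq> U"
  unfolding base_def using cpre_sub by blast

lemma w_step_sub: "B \<subseteq> U \<Longrightarrow> w_step B A X W \<subseteq> U"
  unfolding w_step_def using cpre_sub by blast

lemma x_step_sub: "B \<subseteq> U \<Longrightarrow> x_step B A X \<subseteq> U"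
  unfolding x_step_def by (rule lfp_lowerbound) (rule w_step_sub)

lemma avoid_sub: "B \<subseteq> U \<Longrightarrow> avoid B A \<subseteq> U"
  unfolding avoid_def by (subst gfp_unfold[OF mono_x_step]) (rule x_step_sub)

lemma y_step_sub: "T \<subseteq> U \<Longrightarrow> Y \<subseteq> U \<Longrightarrow> y_step T As Y \<subseteq> U"
  unfolding y_step_def using avoid_sub[OF base_sub] by blast

lemma stage_sub: "stage T As Z \<subseteq> U"
  unfolding stage_def using cpre_sub by (intro lfp_lowerbound y_step_sub) auto

lemma base_le_avoid: "B \<subseteq> avoid B A"
  unfolding avoid_def
proof (rule gfp_upperbound)
  show "B \<subseteq> x_step B A B"
    unfolding x_step_def by (subst lfp_unfold[OF mono_w_step]) (simp add: w_step_def)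
qed

lemma dead_iterate: "dead = (dead_step ^^ card U) {}"
  unfolding dead_def using mono_dead_step dead_step_sub finite_U by (rule lfp_finite_iterate)

lemma stage_iterate: "stage T As Z = (y_step (T \<inter> cpre Z Z) As ^^ card U) {}"
  unfolding stage_def
  by (intro lfp_finite_iterate mono_y_step finite_U y_step_sub) (use cpre_sub in blast)+

lemma x_step_iterate: "B \<subseteq> U \<Longrightarrow> x_step B A X = (w_step B A X ^^ card U) {}"
  unfolding x_step_def using mono_w_step w_step_sub finite_U by (rule lfp_finite_iterate)

lemma avoid_iterate: "B \<subseteq> U \<Longrightarrow> avoid B A = (x_step B A ^^ card U) U"
  unfolding avoid_def using mono_x_step x_step_sub finite_U by (rule gfp_finite_iterate)

lemma solution_iterate: "J \<noteq> {} \<Longrightarrow> solution J = (z_step J ^^ card U) U"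
  unfolding solution_def using stage_sub
  by (intro gfp_finite_iterate mono_z_step finite_U) (auto simp: z_step_def, blast)

text \<open>The nested iteration is turned into ranks. \<open>\<rho>\<close> orders states by the
  index of their \<open>Y\<close>-iterate and then by the index of the assumption avoided there, so
  it determines this assumption, \<open>\<alpha> (\<rho> q)\<close>; \<open>\<omega>\<close> is the
  index in the iteration of \<open>W\<close>. No tolerated move raises \<open>\<rho>\<close>, and
  \<open>\<rho>\<close> stays the same only when the assumption is not being visited. Some move
  lowers the pair.\<close>

lemma stage_ranks:
  assumes "finite As"
  obtains \<rho> \<omega> :: "'v \<Rightarrow> nat" and \<alpha> :: "nat \<Rightarrow> 'v set" where
    "\<And>q. q \<in> stage T As Z \<Longrightarrow> \<alpha> (\<rho> q) \<in> As"
    "\<And>q. q \<in> stage T As Z \<Longrightarrow> q \<in> T \<inter> cpre Z Z \<or>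
       q \<in> cpre {q' \<in> stage T As Z. \<rho> q' < \<rho> q \<or> \<rho> q' = \<rho> q \<and>
           q \<notin> \<alpha> (\<rho> q) \<and> \<omega> q' < \<omega> q}
                {q' \<in> stage T As Z. \<rho> q' < \<rho> q \<or> \<rho> q' = \<rho> q \<and> q \<notin> \<alpha>
                    (\<rho> q)}"
proof -
  obtain as where as: "set as = As" using finite_list[OF assms] by blast
  define n where "n = length as"
  define G where "G = T \<inter> cpre Z Z"
  have G: "G \<subseteq> U" using cpre_sub by (auto simp: G_def)
  define Y where "Y j = (y_step G As ^^ j) {}" for j
  have Y_U: "Y j \<subseteq> U" for j
    by (induction j) (use y_step_sub[OF G] in \<open>auto simp: Y_def\<close>)
  have Y_Suc: "Y (Suc j) = (\<Union>A \<in> As. avoid (base G (Y j)) A)" for j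
    by (simp add: Y_def y_step_def)
  have Y_inc: "Y j \<subseteq> Y (Suc j)" for j
    by (induction j) (use y_step_mono[of G G] in \<open>auto simp: Y_def\<close>)
  have Y_mono: "i \<le> j \<Longrightarrow> Y i \<subseteq> Y j" for i j
    using lift_Suc_mono_le[of Y] Y_inc by blast
  have stg: "stage T As Z = Y (card U)"
    unfolding stage_iterate Y_def G_def ..
  have Y_stage: "Y j \<subseteq> stage T As Z" for j
    unfolding stage_def G_def[symmetric] Y_def by (rule iterate_le_lfp[OF mono_y_step])
  \<comment> \<open>\<open>Y 0\<close> is empty, so \<open>jr q\<close> is the index of the last
    iterate without \<open>q\<close>, the one from which the \<open>base\<close> for
    \<open>q\<close> is formed.\<close>
  define jr where "jr q = (LEAST j. q \<in> Y (Suc j))" for q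
  have jr: "q \<in> Y (Suc (jr q))" "q \<notin> Y (jr q)" if q: "q \<in> stage T As Z" for q
  proof -
    from q have q_card: "q \<in> Y (card U)" by (simp add: stg)
    then have "card U \<noteq> 0" by (auto simp: Y_def intro: ccontr)
    with q_card have "q \<in> Y (Suc (card U - 1))" by simp
    then show "q \<in> Y (Suc (jr q))" unfolding jr_def by (rule LeastI)
    show "q \<notin> Y (jr q)"
    proof (cases "jr q")
      case (Suc j)
      then show ?thesis using not_less_Least[of j "\<lambda>j. q \<in> Y (Suc j)"] by (simp add: jr_def)
    qed (simp add: Y_def)
  qed
  have jr_less: "jr q' < j" if "q' \<in> Y j" for q' j
    using that jr(2)[of q'] Y_stage[of j] Y_mono[of j "jr q'"] by (meson not_le subsetD)
  define B where "B q = base G (Y (jr q))" for q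
  have B_U: "B q \<subseteq> U" for q unfolding B_def by (intro base_sub G Y_U)
  \<comment> \<open>Minimality matters: every state of \<open>avoid (B q) (A q)\<close> with the
    same \<open>jr\<close> has an index of at most \<open>ir q\<close>, so moves within this set do
    not raise the rank.\<close>
  define ir where "ir q = (LEAST i. i < n \<and> q \<in> avoid (B q) (as ! i))" for q
  have ir: "ir q < n" "q \<in> avoid (B q) (as ! ir q)" if q: "q \<in> stage T As Z" for q
  proof -
    from jr(1)[OF q] obtain i where "i < n \<and> q \<in> avoid (B q) (as ! i)"
      by (auto simp: Y_Suc B_def as[symmetric] in_set_conv_nth n_def)
    then show "ir q < n" "q \<in> avoid (B q) (as ! ir q)"
      unfolding ir_def by (metis (mono_tags, lifting) LeastI)+
  qed
  define A where "A q = as ! ir q" for q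
  define Wf where "Wf q = w_step (B q) (A q) (avoid (B q) (A q))" for q
  have avoid_eq: "avoid (B q) (A q) = (Wf q ^^ card U) {}" for q
    unfolding Wf_def x_step_iterate[OF B_U, symmetric] avoid_def by (rule gfp_unfold[OF mono_x_step])
  have Wf_avoid: "(Wf q ^^ i) {} \<subseteq> avoid (B q) (A q)" for q i
  proof -
    have "x_step (B q) (A q) (avoid (B q) (A q)) = avoid (B q) (A q)"
      unfolding avoid_def by (rule gfp_unfold[OF mono_x_step, symmetric])
    with iterate_le_lfp[OF mono_w_step, of i "B q" "A q" "avoid (B q) (A q)"] show ?thesis
      unfolding Wf_def x_step_def by simp
  qed
  define \<omega> where "\<omega> q = (LEAST i. q \<in> (Wf q ^^ Suc i) {})" for q
  have \<omega>: "q \<in> Wf q ((Wf q ^^ \<omega> q) {})" if q: "q \<in> stage T As Z" for q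
  proof -
    have "q \<in> (Wf q ^^ card U) {}" using ir(2)[OF q] avoid_eq[of q] by (simp add: A_def)
    moreover then have "card U \<noteq> 0" by (auto intro: ccontr)
    ultimately have "q \<in> (Wf q ^^ Suc (card U - 1)) {}" by simp
    then have "q \<in> (Wf q ^^ Suc (\<omega> q)) {}" unfolding \<omega>_def by (rule LeastI)
    then show ?thesis by simp
  qed
  \<comment> \<open>Values of \<open>\<omega>\<close> can be compared only between states of the
    same iteration \<open>Wf\<close>; equal \<open>jr\<close> and \<open>ir\<close> ensure
    this.\<close>
  have \<omega>_less: "\<omega> q' < i" if "q' \<in> (Wf q ^^ i) {}" "Wf q' = Wf q" for q q' i
  proof (cases i)
    case (Suc j)
    with that have "\<omega> q' \<le> j" unfolding \<omega>_def by (metis Least_le)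
    with Suc show ?thesis by simp
  qed (use that in simp)
  \<comment> \<open>The lexicographic pair as a single number. As \<open>ir q < n\<close>, the
    assumption can be recovered from it modulo \<open>n\<close>.\<close>
  define \<rho> where "\<rho> q = jr q * n + ir q" for q
  define \<alpha> where "\<alpha> r = as ! (r mod n)" for r
  have \<alpha>: "\<alpha> (\<rho> q) = A q" if "q \<in> stage T As Z" for q
    using ir(1)[OF that] by (simp add: \<alpha>_def \<rho>_def A_def)
  show thesis
  proof (rule that[of \<alpha> \<rho> \<omega>])
    fix q assume q: "q \<in> stage T As Z"
    show "\<alpha> (\<rho> q) \<in> As"
      using \<alpha>[OF q] ir(1)[OF q] as by (auto simp: A_def n_def)
    have low: "q' \<in> stage T As Z \<and> \<rho> q' < \<rho> q" if "jr q' < jr q" "q' \<in> stage T As Z" for q'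
    proof -
      have "\<rho> q' < Suc (jr q') * n" using ir(1)[OF that(2)] by (simp add: \<rho>_def)
      also have "\<dots> \<le> jr q * n" using that(1) by (intro mult_le_mono1) simp
      finally show ?thesis using that(2) by (simp add: \<rho>_def)
    qed
    have YL: "q' \<in> stage T As Z \<and> \<rho> q' < \<rho> q" if "q' \<in> Y (jr q)" for q'
      using low jr_less[OF that] Y_stage that by blast
    have XM: "q' \<in> stage T As Z \<and> (\<rho> q' < \<rho> q \<or> \<rho> q' = \<rho> q \<and> Wf q' = Wf q)"
      if q': "q' \<in> avoid (B q) (A q)" for q'
    proof -
      have "avoid (B q) (A q) \<subseteq> Y (Suc (jr q))"
        unfolding Y_Suc B_def A_def as[symmetric] using ir(1)[OF q] by (intro UN_upper) (simp add: n_def)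
      with q' have "q' \<in> Y (Suc (jr q))" by blast
      then have st: "q' \<in> stage T As Z" and "jr q' \<le> jr q"
        using Y_stage jr_less[of q' "Suc (jr q)"] by auto
      then consider "jr q' < jr q" | "jr q' = jr q" by linarith
      then show ?thesis
      proof cases
        case 2
        then have B: "B q' = B q" by (simp add: B_def)
        with q' ir(1)[OF q] have "ir q' \<le> ir q"
          unfolding ir_def[of q'] by (intro Least_le) (simp add: A_def)
        then consider "ir q' < ir q" | "ir q' = ir q" by linarith
        then show ?thesis using 2 B st by cases (auto simp: \<rho>_def Wf_def A_def)
      qed (use low st in blast)
    qed
    let ?W = "{q' \<in> stage T As Z. \<rho> q' < \<rho> q \<or> \<rho> q' = \<rho> q \<and>
        q \<notin> \<alpha> (\<rho> q) \<and> \<omega> q' < \<omega> q}"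
    let ?X = "{q' \<in> stage T As Z. \<rho> q' < \<rho> q \<or> \<rho> q' = \<rho> q \<and> q \<notin> \<alpha> (\<rho> q)}"
    from \<omega>[OF q] jr(2)[OF q] consider "q \<in> G" | "q \<in> cpre (Y (jr q)) (Y (jr q))"
      | "q \<in> cpre ((Wf q ^^ \<omega> q) {}) (avoid (B q) (A q))" "q \<notin> A q"
      unfolding Wf_def[of q, THEN fun_cong] w_step_def B_def base_def by blast
    then show "q \<in> T \<inter> cpre Z Z \<or> q \<in> cpre ?W ?X"
    proof cases
      case 1
      then show ?thesis by (simp add: G_def)
    next
      case 2
      moreover have "cpre (Y (jr q)) (Y (jr q)) \<subseteq> cpre ?W ?X"
        by (intro cpre_mono) (use YL in auto)
      ultimately show ?thesis by blast
    next
      case 3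
      moreover have "cpre ((Wf q ^^ \<omega> q) {}) (avoid (B q) (A q)) \<subseteq> cpre ?W ?X"
      proof (intro cpre_mono subsetI)
        fix q' assume q': "q' \<in> (Wf q ^^ \<omega> q) {}"
        then have "q' \<in> avoid (B q) (A q)" using Wf_avoid by blast
        from XM[OF this] \<omega>_less[OF q'] 3(2) \<alpha>[OF q] show "q' \<in> ?W" by auto
      next
        fix q' assume "q' \<in> avoid (B q) (A q)"
        from XM[OF this] 3(2) \<alpha>[OF q] show "q' \<in> ?X" by auto
      qed
      ultimately show ?thesis by blast
    qed
  qed
qed

text \<open>\<open>\<delta>\<close> is the index in the iteration of \<open>dead\<close>. A system
  that always lowers it when it can choose leaves no infinite play through
  \<open>dead\<close>.\<close>

lemma dead_rank:
  obtains \<delta> :: "'v \<Rightarrow> nat" where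
    "\<And>q. q \<in> dead \<Longrightarrow> (\<forall>q'. (q, q') \<in> E \<longrightarrow> q' \<in> dead \<and>
        \<delta> q' < \<delta> q) \<or>
        (q \<in> S \<and> (\<exists>q'. (q, q') \<in> E \<and> q' \<in> dead \<and> \<delta> q' < \<delta> q))"
proof -
  define D where "D n = (dead_step ^^ n) {}" for n
  have D_dead: "D n \<subseteq> dead" for n
    unfolding D_def dead_def by (rule iterate_le_lfp[OF mono_dead_step])
  define \<delta> where "\<delta> q = (LEAST n. q \<in> D n)" for q
  have less: "q' \<in> D n \<Longrightarrow> q' \<in> dead \<and> \<delta> q' < Suc n" for q' n
    using D_dead[of n] Least_le[of "\<lambda>n. q' \<in> D n" n] by (auto simp: \<delta>_def less_Suc_eq_le)
  show thesis
  proof (rule that[of \<delta>])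
    fix q assume "q \<in> dead"
    then have "q \<in> D (card U)" by (simp only: D_def dead_iterate)
    then have q: "q \<in> D (\<delta> q)" unfolding \<delta>_def by (rule LeastI)
    then obtain n where n: "\<delta> q = Suc n" by (cases "\<delta> q") (auto simp: D_def)
    with q have "q \<in> dead_step (D n)" by (simp add: D_def)
    with less[of _ n] n show "(\<forall>q'. (q, q') \<in> E \<longrightarrow> q' \<in> dead \<and>
        \<delta> q' < \<delta> q) \<or>
        (q \<in> S \<and> (\<exists>q'. (q, q') \<in> E \<and> q' \<in> dead \<and> \<delta> q' < \<delta> q))"
      unfolding dead_step_def by auto
  qed
qed

end

subsection \<open>Correctness of the fixed point\<close>

definition jobs :: "'v set list \<Rightarrow> 'v set list \<Rightarrow> ('v set \<times> 'v set set) set" where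
  "jobs FA FG = (\<lambda>G. (G, set FA)) ` set FG \<union> (\<lambda>A. (A, {A})) ` set FA"

text \<open>The finite analogue of \<open>compliant\<close>. In contrast to prefixes of compliant
  plays, it includes words that can only run into a deadlock.\<close>

inductive history :: "'q game \<Rightarrow> ('q list \<Rightarrow> 'q) \<Rightarrow> 'q list \<Rightarrow> bool"
    for H f where
  history_initial: "history H f [initial H]"
| history_snoc: "history H f w \<Longrightarrow> q \<in> moves H (last w) \<Longrightarrow>
    (last w \<in> sys_states H \<Longrightarrow> q = f w)
    \<Longrightarrow> history H f (w @ [q])"

lemma history_not_Nil: "history H f w \<Longrightarrow> w \<noteq> []"
  by (induction rule: history.induct) auto

lemma history_snocD:
  assumes "history H f (w @ [q])" "w \<noteq> []"
  shows "history H f w" "q \<in> moves H (last w)" "last w \<in> sys_states H \<Longrightarrow> q = f w"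
  using assms by (auto elim: history.cases)

lemma history_prefix: "history H f (w @ v) \<Longrightarrow> w \<noteq> [] \<Longrightarrow> history H f w"
  by (induction v rule: rev_induct) (auto simp flip: append_assoc dest: history_snocD(1))

lemma history_finite_play: "history H f w \<Longrightarrow> finite_play H w"
proof (induction rule: history.induct)
  case (history_snoc w q)
  then have "w ! (length w - Suc 0) = last w" by (auto simp: finite_play_def last_conv_nth)
  with history_snoc show ?case
    by (auto simp: finite_play_def nth_append less_Suc_eq Suc_diff_Suc)
      (metis One_nat_def Suc_lessI diff_Suc_1)
qed (simp add: finite_play_def)

lemma compliant_iff_histories:
  "\<pi> \<in> compliant H f \<longleftrightarrow> (\<forall>n. history H f (map \<pi> [0..<Suc n]))"
proof
  assume \<pi>: "\<pi> \<in> compliant H f"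
  show "\<forall>n. history H f (map \<pi> [0..<Suc n])"
  proof
    fix n show "history H f (map \<pi> [0..<Suc n])"
    proof (induction n)
      case 0
      from \<pi> show ?case by (simp add: compliant_def plays_def history_initial)
    next
      case (Suc n)
      have "history H f (map \<pi> [0..<Suc n] @ [\<pi> (Suc n)])"
        by (rule history_snoc[OF Suc]) (use \<pi> in \<open>auto simp: compliant_def plays_def\<close>)
      then show ?case by simp
    qed
  qed
next
  assume h: "\<forall>n. history H f (map \<pi> [0..<Suc n])"
  have "\<pi> (Suc k) \<in> moves H (\<pi> k) \<and> (\<pi> k \<in> sys_states H \<longrightarrow>
      \<pi> (Suc k) = f (map \<pi> [0..<Suc k]))" for k
    using history_snocD[of H f "map \<pi> [0..<Suc k]" "\<pi> (Suc k)"] h[THEN spec, of "Suc k"] by simp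
  moreover have "\<pi> 0 = initial H"
    using history_finite_play[OF h[THEN spec, of 0]] by (simp add: finite_play_def)
  ultimately show "\<pi> \<in> compliant H f" by (auto simp: compliant_def plays_def)
qed

lemma compliant_limit:
  fixes g :: "nat \<Rightarrow> nat"
  assumes "strict_mono g" "\<And>n. history H f (map \<pi> [0..<g n])"
  shows "\<pi> \<in> compliant H f"
  unfolding compliant_iff_histories
proof
  fix n
  have "Suc n \<le> g (Suc n)" by (rule strict_mono_imp_increasing[OF assms(1)])
  then obtain d where "g (Suc n) = Suc n + d" using le_Suc_ex by blast
  then have "map \<pi> [0..<g (Suc n)] = map \<pi> [0..<Suc n] @ map \<pi> [Suc n..<g (Suc n)]"
    by (simp only: map_append[symmetric] upt_add_eq_append[OF le0])
  then show "history H f (map \<pi> [0..<Suc n])"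
    using assms(2)[of "Suc n"] history_prefix by (metis Zero_not_Suc length_0_conv length_map length_upt minus_nat.diff_0)
qed

locale game_arena =
  fixes H :: "'q game"
  assumes game: "game_graph H"
begin

sublocale arena "states H" "transitions H" "sys_states H"
  using game by unfold_locales
    (auto simp: game_graph_def states_def transitions_def moves_def subset_iff split: if_splits)

lemma transition_iff: "(q, q') \<in> transitions H \<longleftrightarrow> q' \<in> moves H q"
  unfolding transitions_def moves_def states_def by (auto split: if_splits)

lemma sys_moves_eq: "q \<in> sys_states H \<Longrightarrow> moves H q = sys_moves H q"
  using game by (auto simp: moves_def game_graph_def)

lemma history_last: "history H f w \<Longrightarrow> last w \<in> states H"
  by (induction rule: history.induct)
    (use game transition_iff E_sub in \<open>auto simp: states_def game_graph_def\<close>)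

text \<open>Outside \<open>dead\<close> the environment has a move that stays outside, and no legal
  system move enters \<open>dead\<close>, since one such move would make the state dead already.
  Hence an environment move that lies on no compliant play leads into \<open>dead\<close>, which is
  why \<open>cpre\<close> tolerates exactly these.\<close>

lemma history_infinite_extension:
  assumes f: "sys_strategy H f" and w: "history H f w" and last_w: "last w \<notin> dead"
  obtains \<pi> where "\<pi> \<in> compliant H f" "map \<pi> [0..<length w] = w"
proof -
  define P where "P n w \<longleftrightarrow> history H f w \<and> last w \<notin> dead" for n :: nat and w
  have step: "\<exists>v. v \<noteq> [] \<and> P (Suc n) (w @ v)" if "P n w" for n w
  proof -
    from that have w: "history H f w" and nd: "last w \<notin> dead_step dead" and st: "last w \<in> states H"
      using history_last lfp_unfold[OF mono_dead_step] by (auto simp: P_def dead_def)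
    from nd st obtain q where q: "q \<in> moves H (last w)" "q \<notin> dead"
      unfolding dead_step_def by (auto simp: transition_iff)
    have "\<exists>q. history H f (w @ [q]) \<and> q \<notin> dead"
    proof (cases "last w \<in> sys_states H")
      case True
      with f q history_finite_play[OF w] have "f w \<in> moves H (last w)"
        by (auto simp: sys_strategy_def sys_moves_eq)
      moreover from this True nd st have "f w \<notin> dead"
        unfolding dead_step_def by (auto simp: transition_iff)
      ultimately show ?thesis using history_snoc[OF w] by blast
    qed (use q history_snoc[OF w] in blast)
    then show ?thesis by (force simp: P_def)
  qed
  from w last_w have "P 0 w" by (simp add: P_def)
  from extension_limit[of P, OF this step] obtain \<pi> g where "strict_mono g"
      "map \<pi> [0..<length w] = w" "\<And>n. P n (map \<pi> [0..<g n])" by metis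
  with that compliant_limit[of g H f \<pi>] show thesis by (auto simp: P_def)
qed

text \<open>The end states \<open>V\<close> of the nonempty prefixes of compliant plays form a
  post-fixed point of \<open>z_step\<close>. Non-conflictingness enters in \<open>visit\<close>, the
  winning condition in the guarantee jobs.\<close>

lemma synthesizable_imp_solution:
  assumes FA: "FA \<noteq> []" and syn: "synthesizable H FA FG"
  shows "initial H \<in> solution (jobs FA FG)"
proof -
  from syn obtain f where f: "sys_strategy H f" and win: "winning H FA FG f"
    and nc: "non_conflicting H FA f" by (auto simp: synthesizable_def)
  define L where "L = compliant H f"
  define live where "live w \<longleftrightarrow> w \<noteq> [] \<and>
      (\<exists>\<pi> \<in> L. map \<pi> [0..<length w] = w)" for w
  have live_history: "history H f w" if "live w" for w
    using that compliant_iff_histories[of _ H f] unfolding live_def L_def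
    by (metis Suc_pred length_greater_0_conv)
  have live_snoc: "\<exists>q. live (w @ [q])" if "live w" for w
    using that unfolding live_def by (auto simp: exI[of _ "_ (length w)"])
  have live_nc: "\<exists>\<pi> \<in> L \<inter> gen_buchi H FA. map \<pi> [0..<length w] = w" if "live w" for w
  proof -
    from that have "w \<in> prefixes L" unfolding live_def prefixes_def by (metis (mono_tags, lifting) mem_Collect_eq)
    with nc obtain \<pi> k where "w = map \<pi> [0..<k]" "\<pi> \<in> L \<inter> gen_buchi H FA"
      by (auto simp: non_conflicting_def prefixes_def L_def)
    then show ?thesis by (intro bexI[of _ \<pi>]) auto
  qed
  have live_prefix: "live w" if "live (w @ v)" "w \<noteq> []" for w v
  proof -
    from that obtain \<pi> where \<pi>: "\<pi> \<in> L" "map \<pi> [0..<length (w @ v)] = w @ v" by (auto simp: live_def)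
    have "map \<pi> [0..<length w] = take (length w) (map \<pi> [0..<length (w @ v)])"
      by (simp add: take_map)
    with \<pi> that show ?thesis by (auto simp: live_def)
  qed
  \<comment> \<open>A legal environment move continues the history. Either it is live and lies in
    \<open>X\<close>, or it cannot be extended to an infinite play and lies in
    \<open>dead\<close>.\<close>
  have in_cpre: "last w \<in> cpre W X"
    if lw: "live w" "live (w @ [q])" "q \<in> W" and X: "\<And>q. live (w @ [q]) \<Longrightarrow> q \<in> X" for w q W X
  proof -
    have w: "history H f w" "w \<noteq> []" using lw(1) live_history history_not_Nil by auto
    have "q \<in> moves H (last w)" using history_snocD(2)[OF live_history[OF lw(2)] w(2)] .
    moreover have "q' \<in> X \<union> dead" if q': "q' \<in> moves H (last w)" "last w \<notin> sys_states H" for q'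
    proof (rule ccontr)
      assume *: "q' \<notin> X \<union> dead"
      have "history H f (w @ [q'])" by (rule history_snoc) (use w q' in auto)
      from history_infinite_extension[OF f this] * have "live (w @ [q'])"
        unfolding live_def L_def by (metis UnI2 append_is_Nil_conv last_snoc not_Cons_self2)
      with X * show False by blast
    qed
    ultimately show ?thesis unfolding cpre_def transition_iff using lw(3) by blast
  qed
  define V where "V = {last w | w. live w}"
  have V_cpre: "V \<subseteq> cpre V V"
  proof
    fix q assume "q \<in> V"
    then obtain w where w: "live w" "q = last w" by (auto simp: V_def)
    obtain q' where "live (w @ [q'])" using live_snoc[OF w(1)] by blast
    moreover have "r \<in> V" if "live (w @ [r])" for r
      using that unfolding V_def by (auto intro!: exI[of _ "w @ [r]"])
    ultimately show "q \<in> cpre V V" unfolding w(2) using in_cpre[OF w(1)] by blast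
  qed
  \<comment> \<open>The core of this direction: outside the stage every assumption of the job can be
    visited without entering the stage. Otherwise the states reachable outside \<open>Y\<close>,
    together with \<open>Y\<close>, would be a post-fixed point of the iteration of \<open>X\<close>
    and hence lie in \<open>avoid\<close>, which is part of \<open>Y\<close>.\<close>
  have visit: "\<exists>v. v \<noteq> [] \<and> live (w @ v) \<and> set v \<inter> Y = {} \<and> last (w @ v) \<in> A"
    if Y: "Y = stage T As V" and w: "live w" "last w \<notin> Y" and A: "A \<in> As" "A \<in> set FA" for T As Y w A
  proof -
    define G where "G = T \<inter> cpre V V"
    have "y_step G As Y = Y"
      unfolding Y stage_def G_def by (rule lfp_unfold[OF mono_y_step, symmetric])
    then have avoid_Y: "avoid (base G Y) A \<subseteq> Y" using A by (auto simp: y_step_def)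
    then have base_Y: "base G Y \<subseteq> Y" using base_le_avoid by blast
    \<comment> \<open>One step is split off because \<open>last w\<close> may lie in
      \<open>A\<close> itself, whereas the words of \<open>R\<close> below are to end outside
      \<open>A\<close>.\<close>
    have "\<exists>q. live (w @ [q]) \<and> q \<notin> Y"
    proof (rule ccontr)
      assume *: "\<nexists>q. live (w @ [q]) \<and> q \<notin> Y"
      moreover obtain q where "live (w @ [q])" using live_snoc[OF w(1)] by blast
      ultimately have "last w \<in> cpre Y Y" using in_cpre[OF w(1)] by blast
      with base_Y w(2) show False by (auto simp: base_def)
    qed
    then obtain q where q: "live (w @ [q])" "q \<notin> Y" by blast
    define R where "R = {w @ q # v | v. live (w @ q # v) \<and> set v \<inter> Y = {}}"
    have "\<exists>u \<in> R. last u \<in> A"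
    proof (rule ccontr)
      assume none: "\<not> ?thesis"
      define X where "X = last ` R \<union> Y"
      have R_live: "live u \<and> u \<noteq> [] \<and> last u \<notin> Y" if "u \<in> R" for u
        using that q(2) by (auto simp: R_def disjoint_iff split: if_splits)
      have R_step: "u @ [q'] \<in> R \<or> q' \<in> Y" if "u \<in> R" "live (u @ [q'])" for u q'
        using that unfolding R_def by auto
      define W where "W = lfp (w_step (base G Y) A X)"
      have W_step: "w_step (base G Y) A X W = W"
        unfolding W_def by (rule lfp_unfold[OF mono_w_step, symmetric])
      then have W: "base G Y \<subseteq> W" "cpre W X - A \<subseteq> W" "Y \<subseteq> W"
        by (auto simp: w_step_def base_def)
      \<comment> \<open>By non-conflictingness \<open>u\<close> extends to a play that visits
        \<open>A\<close> infinitely often, so the play must leave \<open>R\<close>. It can do so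
        only into \<open>Y\<close>, which is part of \<open>W\<close>; membership in
        \<open>W\<close> is then carried backwards along the play to the end of
        \<open>u\<close>.\<close>
      have R_W: "last u \<in> W" if u: "u \<in> R" for u
      proof -
        obtain \<pi> where \<pi>: "\<pi> \<in> L" "\<pi> \<in> gen_buchi H FA" "map \<pi> [0..<length u] = u"
          using live_nc R_live[OF u] by blast
        have inf: "infinite {k. \<pi> k \<in> A}" using \<pi>(2) A(2) by (auto simp: gen_buchi_def)
        have pi_live: "live (map \<pi> [0..<n])" if "n > 0" for n
          using \<pi>(1) that by (auto simp: live_def)
        have ex: "\<exists>n \<ge> length u. map \<pi> [0..<n] \<notin> R"
        proof -
          obtain k where "k > length u" "\<pi> k \<in> A"
            using inf by (auto simp: finite_nat_set_iff_bounded_le) (meson not_le)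
          then have "map \<pi> [0..<Suc k] \<notin> R" using none by force
          then show ?thesis using \<open>k > length u\<close> by (meson less_SucI less_imp_le)
        qed
        define n where "n = (LEAST n. length u \<le> n \<and> map \<pi> [0..<n] \<notin> R)"
        have n: "length u \<le> n" "map \<pi> [0..<n] \<notin> R"
          unfolding n_def using LeastI_ex[OF ex] by auto
        have before: "map \<pi> [0..<k] \<in> R" if "length u \<le> k" "k < n" for k
          using not_less_Least[of k "\<lambda>n. length u \<le> n \<and> map \<pi> [0..<n] \<notin> R"] that
              by (auto simp: n_def)
        have "n \<noteq> length u" using n u \<pi>(3) by auto
        with n(1) have u_n: "length u < n" by simp
        have "\<pi> (n - Suc d) \<in> W" if "length u \<le> n - d" "d \<le> n" for d
          using that
        proof (induction d)
          case 0
          from u_n have eq: "map \<pi> [0..<n] = map \<pi> [0..<n - 1] @ [\<pi> (n - 1)]"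
            by (cases n) auto
          have "\<pi> (n - 1) \<in> Y"
            using R_step[OF before[of "n - 1"], of "\<pi> (n - 1)"] pi_live[of n] n(2) u_n eq by auto
          then show ?case using W(3) by auto
        next
          case (Suc d)
          define k where "k = n - Suc d"
          have k: "length u \<le> k" "k < n" "k > 0" using Suc.prems R_live[OF u]
              by (auto simp: k_def simp flip: length_greater_0_conv)
          have kR: "map \<pi> [0..<k] \<in> R" using before k by blast
          have eq: "map \<pi> [0..<Suc k] = map \<pi> [0..<k] @ [\<pi> k]" by simp
          have last: "last (map \<pi> [0..<k]) = \<pi> (n - Suc (Suc d))"
            using k by (simp add: last_map k_def)
          have "\<pi> k \<in> W" using Suc by (simp add: k_def)
          then have "last (map \<pi> [0..<k]) \<in> cpre W X"
          proof (rule in_cpre[rotated 2])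
            show "live (map \<pi> [0..<k])" using R_live[OF kR] by blast
            show "live (map \<pi> [0..<k] @ [\<pi> k])" using pi_live[of "Suc k"] eq by simp
            fix q' assume "live (map \<pi> [0..<k] @ [q'])"
            from R_step[OF kR this] show "q' \<in> X" unfolding X_def by force
          qed
          moreover have "last (map \<pi> [0..<k]) \<notin> A" using none kR by blast
          ultimately show ?case using W(2) unfolding last by blast
        qed
        from this[of "n - length u"] u_n have "\<pi> (length u - 1) \<in> W" by simp
        moreover have "\<pi> (length u - 1) = last u"
          using arg_cong[OF \<pi>(3), of last] R_live[OF u] by (simp add: last_map)
        ultimately show ?thesis by simp
      qed
      have "X \<subseteq> x_step (base G Y) A X"
        using R_W W(3) unfolding x_step_def W_def[symmetric] by (auto simp: X_def)
      then have "X \<subseteq> avoid (base G Y) A" unfolding avoid_def by (rule gfp_upperbound)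
      moreover have "q \<in> X" using q(1) by (auto simp: X_def R_def intro!: rev_image_eqI[of "w @ [q]"])
      ultimately show False using avoid_Y q(2) by blast
    qed
    then obtain v where "live (w @ q # v)" "set v \<inter> Y = {}" "last (w @ q # v) \<in> A"
      by (auto simp: R_def)
    with q(2) show ?thesis by (intro exI[of _ "q # v"]) auto
  qed
  have target: "q \<in> stage T As V" if "q \<in> V" "q \<in> T" "As \<noteq> {}" for q T As
  proof -
    have "T \<inter> cpre V V \<subseteq> stage T As V"
    proof -
      let ?Y = "stage T As V"
      have "y_step (T \<inter> cpre V V) As ?Y = ?Y"
        unfolding stage_def by (rule lfp_unfold[OF mono_y_step, symmetric])
      moreover have "T \<inter> cpre V V \<subseteq> y_step (T \<inter> cpre V V) As ?Y"
        using that(3) base_le_avoid[of "base (T \<inter> cpre V V) ?Y"]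
        by (fastforce simp: y_step_def base_def)
      ultimately show ?thesis by blast
    qed
    then show ?thesis using that V_cpre by blast
  qed
  \<comment> \<open>Otherwise \<open>visit\<close> leads to a state of \<open>A\<close> outside the
    stage, although \<open>target\<close> puts every state of \<open>V\<close> in \<open>A\<close>
    inside.\<close>
  have "V \<subseteq> stage A {A} V" if A: "A \<in> set FA" for A
  proof
    fix q assume "q \<in> V"
    then obtain w where w: "live w" "q = last w" by (auto simp: V_def)
    show "q \<in> stage A {A} V"
    proof (rule ccontr)
      assume "q \<notin> stage A {A} V"
      then obtain v where v: "v \<noteq> []" "live (w @ v)" "set v \<inter> stage A {A} V = {}" "last (w @ v) \<in> A"
        using visit[OF refl w(1) _ _ A, of A "{A}"] w(2) by auto
      then have "last (w @ v) \<in> V" by (auto simp: V_def)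
      from target[OF this v(4), of "{A}"] v(1,3) show False by (auto simp: disjoint_iff)
    qed
  qed
  moreover have "V \<subseteq> stage G (set FA) V" if G: "G \<in> set FG" for G
  proof
    fix q assume "q \<in> V"
    then obtain w where w: "live w" "q = last w" by (auto simp: V_def)
    let ?Y = "stage G (set FA) V"
    show "q \<in> ?Y"
    proof (rule ccontr)
      assume q: "q \<notin> ?Y"
      \<comment> \<open>Outside the stage the assumptions are visited in turn: construction step
        \<open>n > 0\<close> ends in assumption number \<open>n - 1\<close> modulo their number. The
        limit satisfies all assumptions, so it must visit \<open>G\<close>, yet it never enters the
        stage, which contains every state of \<open>V\<close> in \<open>G\<close>.\<close>
      define P where "P n u \<longleftrightarrow> live u \<and> last u \<notin> ?Y \<and> length w \<le> length u \<and>
        (n > 0 \<longrightarrow> last u \<in> FA ! ((n - 1) mod length FA)) \<and>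
        (\<forall>i<length u. length w \<le> i \<longrightarrow> u ! i \<notin> ?Y)" for n u
      have P0: "P 0 w" using w q by (simp add: P_def)
      have step: "\<exists>v. v \<noteq> [] \<and> P (Suc n) (u @ v)" if "P n u" for n u
      proof -
        let ?A = "FA ! (n mod length FA)"
        have "?A \<in> set FA" using FA by simp
        then obtain v where v: "v \<noteq> []" "live (u @ v)" "set v \<inter> ?Y = {}" "last (u @ v) \<in> ?A"
          using visit[OF refl, of u G "set FA" ?A] \<open>P n u\<close> by (auto simp: P_def)
        then have "last (u @ v) \<notin> ?Y" by (auto simp: disjoint_iff)
        moreover have "(u @ v) ! i \<notin> ?Y" if "length w \<le> i" "i < length (u @ v)" for i
          using that \<open>P n u\<close> v(3) by (auto simp: P_def nth_append disjoint_iff)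
        ultimately show ?thesis using v \<open>P n u\<close> by (auto simp: P_def intro!: exI[of _ v])
      qed
      obtain \<pi> g where \<pi>: "strict_mono g" "\<And>n. P n (map \<pi> [0..<g n])"
        using extension_limit[of P, OF P0 step] by metis
      have "\<pi> \<in> L" unfolding L_def using \<pi>(2) live_history by (intro compliant_limit[OF \<pi>(1)])
          (auto simp: P_def)
      have gpos: "g n > 0" for n using \<pi>(2)[of n] by (auto simp: P_def live_def)
      have "infinite {k. \<pi> k \<in> A}" if A: "A \<in> set FA" for A
      proof -
        obtain b where b: "b < length FA" "A = FA ! b" using A by (auto simp: in_set_conv_nth)
        have "\<exists>k \<ge> n. \<pi> k \<in> A" for n
        proof -
          define l where "l = Suc (n * length FA + b)"
          have "last (map \<pi> [0..<g l]) \<in> A" using \<pi>(2)[of l] b by (simp add: P_def l_def)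
          then have "\<pi> (g l - 1) \<in> A" using gpos[of l] by (simp add: last_map)
          moreover have "n < l" using FA by (cases "length FA") (auto simp: l_def)
          then have "n \<le> g l - 1" using strict_mono_imp_increasing[OF \<pi>(1), of l] by linarith
          ultimately show ?thesis by blast
        qed
        then show ?thesis by (auto simp: finite_nat_set_iff_bounded) (meson not_le)
      qed
      then have "\<pi> \<in> gen_buchi H FA" using \<open>\<pi> \<in> L\<close>
          by (auto simp: gen_buchi_def L_def compliant_def)
      with win \<open>\<pi> \<in> L\<close> have "infinite {k. \<pi> k \<in> G}"
        using G by (auto simp: winning_def gen_buchi_def L_def)
      then obtain k where k: "length w \<le> k" "\<pi> k \<in> G"
        by (auto simp: finite_nat_set_iff_bounded) (meson not_le)
      have "k < g (Suc k)" using strict_mono_imp_increasing[OF \<pi>(1), of "Suc k"] by simp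
      with \<pi>(2)[of "Suc k"] k(1) have "\<pi> k \<notin> ?Y" by (auto simp: P_def)
      moreover have "\<pi> k \<in> V"
        using \<open>\<pi> \<in> L\<close> by (auto simp: V_def live_def intro!: exI[of _ "map \<pi> [0..<Suc k]"])
      ultimately show False using target[OF _ k(2), of "set FA"] FA by auto
    qed
  qed
  ultimately have "V \<subseteq> z_step (jobs FA FG) V" by (auto simp: z_step_def jobs_def)
  then have "V \<subseteq> solution (jobs FA FG)" unfolding solution_def by (rule gfp_upperbound)
  moreover have "initial H \<in> V"
  proof -
    from win obtain \<pi> where "\<pi> \<in> L" by (auto simp: winning_def L_def)
    moreover from this have "\<pi> 0 = initial H" by (simp add: L_def compliant_def plays_def)
    ultimately show ?thesis by (auto simp: V_def live_def intro!: exI[of _ "[initial H]"])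
  qed
  ultimately show ?thesis by blast
qed

text \<open>Within a job the system moves into \<open>tgt\<close>, where the ranks decrease, while
  the environment is confined only to \<open>ok\<close>. Infinitely many completed jobs satisfy all
  guarantees and assumptions; otherwise one assumption is eventually avoided. In both cases
  cooperation would still complete the current job.\<close>

lemma solution_imp_synthesizable:
  assumes FA: "FA \<noteq> []" and init: "initial H \<in> solution (jobs FA FG)"
  shows "synthesizable H FA FG"
proof -
  define Z where "Z = solution (jobs FA FG)"
  obtain js where js: "set js = jobs FA FG"
    using finite_list[of "jobs FA FG"] by (auto simp: jobs_def)
  define K where "K = length js"
  have K: "K > 0" using js FA by (auto simp: K_def jobs_def)
  define St where "St k = stage (fst (js ! k)) (snd (js ! k)) Z" for k
  have "z_step (jobs FA FG) Z = Z"
    unfolding Z_def solution_def by (rule gfp_unfold[OF mono_z_step, symmetric])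
  then have Z_St: "Z \<subseteq> St k" if "k < K" for k
    using that js nth_mem[of k js] by (force simp: z_step_def St_def K_def split_beta)
  have avoided: "snd (js ! k) \<subseteq> set FA" if "k < K" for k
    using that js nth_mem[of k js] by (auto simp: jobs_def K_def)
  define L where "L \<rho> \<omega> \<alpha> k q =
    {q' \<in> St k. \<rho> q' < \<rho> q \<or> \<rho> q' = \<rho> q \<and> q \<notin> \<alpha> (\<rho> q) \<and>
        \<omega> q' < \<omega> q}"
    for \<rho> \<omega> :: "'q \<Rightarrow> nat" and \<alpha> :: "nat \<Rightarrow> 'q set" and k q
  define M where "M \<rho> \<alpha> k q = {q' \<in> St k. \<rho> q' < \<rho> q \<or> \<rho> q' = \<rho> q \<and>
      q \<notin> \<alpha> (\<rho> q)}"
    for \<rho> :: "'q \<Rightarrow> nat" and \<alpha> :: "nat \<Rightarrow> 'q set" and k q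
  define hit where "hit k q \<longleftrightarrow> q \<in> fst (js ! k) \<inter> cpre Z Z" for k q
  have "\<exists>\<rho> \<omega> \<alpha>. \<forall>q \<in> St k. \<alpha> (\<rho> q) \<in> set FA \<and>
      (hit k q \<or> q \<in> cpre (L \<rho> \<omega> \<alpha> k q) (M \<rho> \<alpha> k q))"
    if k: "k < K" for k
  proof -
    have fin: "finite (snd (js ! k))" using avoided[OF k] finite_subset by blast
    obtain \<rho> \<omega> :: "'q \<Rightarrow> nat" and \<alpha> where
      "\<And>q. q \<in> St k \<Longrightarrow> \<alpha> (\<rho> q) \<in> snd (js ! k)"
      "\<And>q. q \<in> St k \<Longrightarrow> hit k q \<or>
          q \<in> cpre (L \<rho> \<omega> \<alpha> k q) (M \<rho> \<alpha> k q)"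
      unfolding St_def hit_def L_def M_def
    proof (rule stage_ranks[OF fin, of "fst (js ! k)" Z], goal_cases)
      case 1
      show thesis by (rule 1(1)[OF 1(2,3)])
    qed
    with avoided[OF k] show ?thesis by blast
  qed
  then obtain \<rho> \<omega> \<alpha> where ranks: "\<And>k q. k < K \<Longrightarrow>
      q \<in> St k \<Longrightarrow> \<alpha> k (\<rho> k q) \<in> set FA"
    "\<And>k q. k < K \<Longrightarrow> q \<in> St k \<Longrightarrow> hit k q \<or>
        q \<in> cpre (L (\<rho> k) (\<omega> k) (\<alpha> k) k q) (M (\<rho> k) (\<alpha> k) k q)"
    by metis
  define tgt where "tgt k q = (if hit k q then Z else L (\<rho> k) (\<omega> k) (\<alpha> k) k q)" for k q
  define ok where "ok k q = (if hit k q then Z else M (\<rho> k) (\<alpha> k) k q)" for k q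
  define nxt where "nxt k q = (if hit k q then Suc k mod K else k)" for k q
  have nxt: "nxt k q < K" if "k < K" for k q
    using that K by (simp add: nxt_def)
  have tgt_ok: "tgt k q \<subseteq> ok k q" for k q by (auto simp: tgt_def ok_def L_def M_def)
  \<comment> \<open>A completed job leaves the play in \<open>Z\<close>, which is part of the region
    of the next job; this is where the fixed point property of \<open>Z\<close> is used.\<close>
  have ok_St: "ok k q \<subseteq> St (nxt k q)" if "k < K" for k q
    using that Z_St K by (auto simp: ok_def nxt_def M_def)
  have St_cpre: "q \<in> cpre (tgt k q) (ok k q)" if "k < K" "q \<in> St k" for k q
    using ranks(2)[OF that] by (auto simp: tgt_def ok_def hit_def)
  obtain \<delta> :: "'q \<Rightarrow> nat" where \<delta>: "\<And>q. q \<in> dead \<Longrightarrow>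
      (\<forall>q'. (q, q') \<in> transitions H \<longrightarrow> q' \<in> dead \<and> \<delta> q' < \<delta> q) \<or>
      (q \<in> sys_states H \<and> (\<exists>q'. (q, q') \<in> transitions H \<and> q' \<in> dead \<and>
          \<delta> q' < \<delta> q))"
    by (rule dead_rank) blast
  text \<open>The memory of the strategy is the current job, or \<open>None\<close> once the environment has left
    the region of that job, from where the system forces a deadlock.\<close>
  define upd where "upd q' s = (case fst s of None \<Rightarrow> None
      | Some k \<Rightarrow> if q' \<in> ok k (snd s) then Some (nxt k (snd s)) else None,
          q')" for q' and s :: "nat option \<times> 'q"
  define st where "st w = fold upd (tl w) (Some 0, hd w)" for w
  have st_snoc: "st (w @ [q]) = upd q (st w)" if "w \<noteq> []" for w q
    using that by (simp add: st_def)
  have snd_st: "snd (st w) = last w" if "w \<noteq> []" for w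
    using that by (induction w rule: rev_induct) (auto simp: st_def upd_def fold_append tl_append split: list.splits)
  define md where "md w = fst (st w)" for w
  have md_init: "md [q] = Some 0" for q by (simp add: md_def st_def)
  have md_snoc: "md (w @ [q]) = (case md w of None \<Rightarrow> None
      | Some k \<Rightarrow> if q \<in> ok k (last w) then Some (nxt k (last w)) else None)" if "w \<noteq> []" for w q
    unfolding md_def st_snoc[OF that] upd_def snd_st[OF that] by simp
  \<comment> \<open>\<open>sys_strategy\<close> demands an environment state even where no legal
    move exists; \<open>initial H\<close> is a default of this kind.\<close>
  define any where "any q = (if moves H q = {} then initial H else (SOME q'. q' \<in> moves H q))" for q
  define pick where "pick X q = (if X \<inter> moves H q = {} then any q else (SOME q'. q' \<in> X \<inter> moves
      H q))" for X q
  have pick: "pick X q \<in> X \<inter> moves H q" if "X \<inter> moves H q \<noteq> {}" for X q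
    using that unfolding pick_def by (metis some_in_eq)
  define f where "f w = (case md w of Some k \<Rightarrow> pick (tgt k (last w)) (last w)
      | None \<Rightarrow> pick {q'. q' \<in> dead \<and> \<delta> q' < \<delta> (last w)} (last w))" for w
  have pick_move: "pick X q \<in> moves H q" if "moves H q \<noteq> {}" for X q
  proof (cases "X \<inter> moves H q = {}")
    case True
    with that show ?thesis by (simp add: pick_def any_def some_in_eq)
  qed (use pick in blast)
  have pick_none: "pick X q = initial H" if "moves H q = {}" for X q
    using that by (simp add: pick_def any_def)
  have f: "sys_strategy H f"
    unfolding sys_strategy_def
  proof (intro allI impI conjI; elim conjE)
    fix w assume w: "last w \<in> sys_states H"
    have "f w \<in> moves H (last w) \<or> (moves H (last w) = {} \<and> f w = initial H)"
      by (cases "moves H (last w) = {}") (simp_all add: f_def pick_move pick_none split: option.splits)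
    then show "f w \<in> env_states H"
      using game w sys_moves_eq[OF w] by (auto simp: game_graph_def)
    assume "sys_moves H (last w) \<noteq> {}"
    with sys_moves_eq[OF w] pick_move[of "last w"] show "f w \<in> sys_moves H (last w)"
      by (auto simp: f_def split: option.splits)
  qed
  have f_Some: "f w \<in> tgt k (last w) \<inter> moves H (last w)"
    if "md w = Some k" "k < K" "last w \<in> St k" for w k
  proof -
    have "tgt k (last w) \<inter> moves H (last w) \<noteq> {}"
      using St_cpre[OF that(2,3)] by (auto simp: cpre_def transition_iff)
    from pick[OF this] show ?thesis using that(1) by (simp add: f_def)
  qed
  have f_None: "q \<in> dead \<and> \<delta> q < \<delta> (last w)"
    if "md w = None" "last w \<in> dead" "history H f (w @ [q])" "w \<noteq> []" for w q
  proof -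
    note h = history_snocD[OF that(3,4)]
    show ?thesis
    proof (cases "\<forall>q'. (last w, q') \<in> transitions H \<longrightarrow> q' \<in> dead \<and>
        \<delta> q' < \<delta> (last w)")
      case False
      let ?X = "{q'. q' \<in> dead \<and> \<delta> q' < \<delta> (last w)}"
      from False \<delta>[OF that(2)] have "last w \<in> sys_states H" "?X \<inter> moves H (last w) \<noteq> {}"
        by (auto simp: transition_iff)
      with h(3) pick[of ?X] that(1) show ?thesis by (auto simp: f_def)
    qed (use h(2) in \<open>auto simp: transition_iff\<close>)
  qed
  have inv: "case md w of None \<Rightarrow> last w \<in> dead | Some k \<Rightarrow> k < K \<and> last w \<in> St k"
    if "history H f w" for w
    using that
  proof (induction rule: history.induct)
    case history_initial
    then show ?case using K Z_St[OF K] init by (auto simp: md_init Z_def)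
  next
    case (history_snoc w q)
    have w: "w \<noteq> []" using history_snoc.hyps(1) by (rule history_not_Nil)
    have wq: "history H f (w @ [q])" using history_snoc.hyps by (rule history.history_snoc)
    show ?case
    proof (cases "md w")
      case None
      with history_snoc.IH f_None[OF None _ wq w] show ?thesis by (simp add: md_snoc[OF w])
    next
      case (Some k)
      with history_snoc.IH have k: "k < K" "last w \<in> St k" by auto
      show ?thesis
      proof (cases "q \<in> ok k (last w)")
        case True
        then show ?thesis using Some nxt[OF k(1)] ok_St[OF k(1)] by (auto simp: md_snoc[OF w])
      next
        case False
        then have "last w \<notin> sys_states H"
          using history_snoc.hyps(3) f_Some[OF Some k] tgt_ok by blast
        with St_cpre[OF k] False history_snoc.hyps(2) have "q \<in> dead"
          by (auto simp: cpre_def transition_iff)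
        then show ?thesis using Some False by (simp add: md_snoc[OF w])
      qed
    qed
  qed
  \<comment> \<open>Once the memory is \<open>None\<close> it remains so, and
    \<open>\<delta>\<close> drops with every step; an infinite play never reaches this mode.\<close>
  have alive: "\<exists>k. md (map \<pi> [0..<Suc i]) = Some k \<and> k < K \<and> \<pi> i \<in> St k"
      if \<pi>: "\<pi> \<in> compliant H f" for \<pi> i
  proof -
    note h = \<pi>[unfolded compliant_iff_histories, rule_format]
    have False if None: "md (map \<pi> [0..<Suc i]) = None"
    proof -
      have "md (map \<pi> [0..<Suc (i + n)]) = None \<and> \<pi> (i + n) \<in> dead \<and>
          \<delta> (\<pi> (i + n)) + n \<le> \<delta> (\<pi> i)" for n
      proof (induction n)
        case 0
        then show ?case using inv[OF h[of i]] None by simp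
      next
        case (Suc n)
        have "md (map \<pi> [0..<Suc (i + n)] @ [\<pi> (Suc (i + n))]) = None"
          by (subst md_snoc) (use Suc in auto)
        moreover have "\<pi> (Suc (i + n)) \<in> dead \<and> \<delta> (\<pi> (Suc (i + n))) < \<delta> (\<pi> (i + n))"
          using f_None[of "map \<pi> [0..<Suc (i + n)]" "\<pi> (Suc (i + n))"] h[of "Suc (i + n)"] Suc by simp
        ultimately show ?case using Suc by simp
      qed
      from this[of "Suc (\<delta> (\<pi> i))"] show False by simp
    qed
    then show ?thesis using inv[OF h[of i]] by (cases "md (map \<pi> [0..<Suc i])") auto
  qed
  define job where "job \<pi> i = the (md (map \<pi> [0..<Suc i]))" for \<pi> i
  have job: "md (map \<pi> [0..<Suc i]) = Some (job \<pi> i)" "job \<pi> i < K" "\<pi> i \<in> St (job \<pi> i)"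
    if "\<pi> \<in> compliant H f" for \<pi> i
    using alive[OF that, of i] by (auto simp: job_def)
  have job0: "job \<pi> 0 = 0" for \<pi> by (simp add: job_def md_init)
  have job_Suc: "job \<pi> (Suc i) = nxt (job \<pi> i) (\<pi> i)" "\<pi> (Suc i) \<in> ok (job \<pi> i) (\<pi> i)"
    if "\<pi> \<in> compliant H f" for \<pi> i
    using md_snoc[of "map \<pi> [0..<Suc i]" "\<pi> (Suc i)"] job(1)[OF that, of i] job(1)[OF that, of "Suc i"]
    by (auto split: if_splits)
  have buchi: "\<pi> \<in> gen_buchi H FA \<inter> gen_buchi H FG"
    if \<pi>: "\<pi> \<in> compliant H f" and hits: "\<And>i. \<exists>i' \<ge> i. hit (job \<pi> i') (\<pi> i')" for \<pi>
  proof -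
    have "infinite {i. hit (job \<pi> i) (\<pi> i) \<and> job \<pi> i = j}" if "j < K" for j
      by (rule cyclic_schedule[of "job \<pi>" "\<lambda>i. hit (job \<pi> i) (\<pi> i)" K])
        (use K that hits in \<open>auto simp: job0 job_Suc[OF \<pi>] nxt_def\<close>)
    moreover have "{i. hit (job \<pi> i) (\<pi> i) \<and> job \<pi> i = j} \<subseteq> {i. \<pi> i \<in> fst (js ! j)}" for j
      by (auto simp: hit_def)
    ultimately have inf: "infinite {i. \<pi> i \<in> fst (js ! j)}" if "j < K" for j
      using that infinite_super by blast
    have "infinite {i. \<pi> i \<in> F}" if "F \<in> set FA \<union> set FG" for F
    proof -
      from that have "F \<in> fst ` set js" unfolding js by (force simp: jobs_def image_Un image_image)
      then obtain j where "j < K" "F = fst (js ! j)" by (auto simp: in_set_conv_nth K_def)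
      with inf show ?thesis by blast
    qed
    with \<pi> show ?thesis by (auto simp: gen_buchi_def compliant_def)
  qed
  have stuck: "job \<pi> (i + n) = job \<pi> i"
    if "\<pi> \<in> compliant H f" "\<And>i'. i' \<ge> i \<Longrightarrow> \<not> hit (job \<pi> i') (\<pi> i')"
        for \<pi> i n
  proof (induction n)
    case (Suc n)
    with that(2)[of "i + n"] job_Suc(1)[OF that(1), of "i + n"] show ?case by (simp add: nxt_def)
  qed simp
  \<comment> \<open>If the hits ceased, the job would be fixed and \<open>\<rho>\<close> could not
    increase. From a minimum at \<open>i0\<close> on it is constant, so the play stays outside the
    assumption that \<open>\<alpha>\<close> assigns to this value and violates that
    assumption.\<close>
  have win: "\<pi> \<in> gen_buchi H FG" if \<pi>: "\<pi> \<in> compliant H f" and A: "\<pi> \<in> gen_buchi H FA" for \<pi>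
  proof -
    have "\<exists>i' \<ge> i. hit (job \<pi> i') (\<pi> i')" for i
    proof (rule ccontr)
      assume "\<not> ?thesis"
      then have nohit: "\<And>i'. i' \<ge> i \<Longrightarrow> \<not> hit (job \<pi> i') (\<pi> i')" by blast
      define k where "k = job \<pi> i"
      have k: "job \<pi> i' = k" if "i' \<ge> i" for i'
        using stuck[OF \<pi> nohit, of i "i' - i"] that by (simp add: k_def)
      have M: "\<pi> (Suc i') \<in> M (\<rho> k) (\<alpha> k) k (\<pi> i')" if "i' \<ge> i" for i'
        using job_Suc(2)[OF \<pi>, of i'] k[OF that] nohit[OF that] by (simp add: ok_def)
      obtain i0 where i0: "i0 \<ge> i" "\<And>i'. i' \<ge> i \<Longrightarrow> \<rho> k (\<pi> i0) \<le> \<rho> k (\<pi> i')"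
        using ex_has_least_nat[of "\<lambda>i'. i' \<ge> i" i "\<lambda>i'. \<rho> k (\<pi> i')"] by auto
      have const: "\<rho> k (\<pi> (i0 + n)) = \<rho> k (\<pi> i0)" for n
      proof (induction n)
        case (Suc n)
        then show ?case using M[of "i0 + n"] i0(1) i0(2)[of "Suc (i0 + n)"] by (auto simp: M_def)
      qed simp
      have "\<pi> (i0 + n) \<notin> \<alpha> k (\<rho> k (\<pi> i0))" for n
        using M[of "i0 + n"] i0(1) const[of n] const[of "Suc n"] by (auto simp: M_def)
      then have "{l. \<pi> l \<in> \<alpha> k (\<rho> k (\<pi> i0))} \<subseteq> {..<i0}"
        by (metis (mono_tags, lifting) le_Suc_ex lessThan_iff linorder_not_less mem_Collect_eq subsetI)
      then have "finite {l. \<pi> l \<in> \<alpha> k (\<rho> k (\<pi> i0))}" by (rule finite_subset) simp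
      moreover have "\<alpha> k (\<rho> k (\<pi> i0)) \<in> set FA"
        using ranks(1)[OF job(2,3)[OF \<pi>, of i0]] k[OF i0(1)] by simp
      ultimately show False using A by (auto simp: gen_buchi_def)
    qed
    from buchi[OF \<pi> this] show ?thesis by blast
  qed
  \<comment> \<open>Now the environment also moves into \<open>tgt\<close>. As long as no job is
    completed, each step decreases the lexicographic pair of \<open>\<rho>\<close> and
    \<open>\<omega>\<close>, so jobs are completed again and again.\<close>
  have coop: "\<exists>\<pi> \<in> compliant H f \<inter> gen_buchi H FA. map \<pi> [0..<length w] = w"
    if w: "history H f w" "md w \<noteq> None" for w
  proof -
    define P where "P n u \<longleftrightarrow> history H f u \<and> md u \<noteq> None \<and> length w \<le> length u \<and>
      (\<forall>i<length u. length w \<le> i \<longrightarrow> u ! i \<in> tgt (the (md (take i u)))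
          (last (take i u)))" for n :: nat and u
    have P0: "P 0 w" using w by (simp add: P_def)
    have step: "\<exists>v. v \<noteq> [] \<and> P (Suc n) (u @ v)" if P: "P n u" for n u
    proof -
      from P obtain k where u: "history H f u" "u \<noteq> []" "md u = Some k" "k < K" "last u \<in> St k"
        using inv[of u] history_not_Nil[of H f u] by (auto simp: P_def)
      define q where "q = pick (tgt k (last u)) (last u)"
      have q: "q \<in> tgt k (last u)" "q \<in> moves H (last u)" "f u = q"
        using f_Some[OF u(3-5)] u(3) by (auto simp: q_def f_def)
      then have "history H f (u @ [q])" using history_snoc[OF u(1)] by blast
      moreover have "md (u @ [q]) \<noteq> None" using tgt_ok q(1) u(3) by (auto simp: md_snoc[OF u(2)])
      ultimately have "P (Suc n) (u @ [q])"
        using P q(1) u(3) by (auto simp: P_def nth_append less_Suc_eq)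
      then show ?thesis by blast
    qed
    obtain \<pi> g where \<pi>: "strict_mono g" "map \<pi> [0..<length w] = w" "\<And>n. P n (map \<pi> [0..<g n])"
      using extension_limit[of P, OF P0 step] by metis
    have c: "\<pi> \<in> compliant H f"
      using \<pi>(3) by (intro compliant_limit[OF \<pi>(1)]) (auto simp: P_def)
    have tgt: "\<pi> (Suc i) \<in> tgt (job \<pi> i) (\<pi> i)" if "length w \<le> Suc i" for i
    proof -
      have "Suc i < g (Suc (Suc i))" using strict_mono_imp_increasing[OF \<pi>(1), of "Suc (Suc i)"] by simp
      with \<pi>(3)[of "Suc (Suc i)"] that show ?thesis
        by (auto simp: P_def take_map job_def simp del: upt_Suc dest!: spec[of _ "Suc i"]) (simp add: last_map)
    qed
    have "\<exists>i' \<ge> i. hit (job \<pi> i') (\<pi> i')" for i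
    proof (rule ccontr)
      assume no: "\<not> ?thesis"
      define i0 where "i0 = i + length w"
      have nohit: "\<And>i'. i' \<ge> i0 \<Longrightarrow> \<not> hit (job \<pi> i') (\<pi> i')" using no
          by (auto simp: i0_def)
      define k where "k = job \<pi> i0"
      have "\<pi> (Suc (i0 + n)) \<in> L (\<rho> k) (\<omega> k) (\<alpha> k) k (\<pi> (i0 + n))" for n
        using tgt[of "i0 + n"] stuck[OF c nohit, of i0 n] nohit[of "i0 + n"] by (simp add: tgt_def k_def i0_def)
      moreover define r where "r n = (\<rho> k (\<pi> (i0 + n)), \<omega> k (\<pi> (i0 + n)))" for n
      ultimately have down: "(r (Suc n), r n) \<in> less_than <*lex*> less_than" for n
        by (auto simp: L_def)
      show False
        by (rule wf_no_infinite_down_chainE[OF wf_lex_prod[OF wf_less_than wf_less_than], of r])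
          (use down in blast)
    qed
    from buchi[OF c this] c \<pi>(2) show ?thesis by blast
  qed
  have "compliant H f \<noteq> {}"
    using coop[OF history_initial] by (auto simp: md_init)
  moreover have "prefixes (compliant H f) \<subseteq> prefixes (compliant H f \<inter> gen_buchi H FA)"
  proof
    fix w assume "w \<in> prefixes (compliant H f)"
    then obtain \<pi> n where \<pi>: "\<pi> \<in> compliant H f" "w = map \<pi> [0..<n]" by (auto simp: prefixes_def)
    have "history H f (map \<pi> [0..<Suc n])" using \<pi>(1) compliant_iff_histories by blast
    from coop[OF this] job(1)[OF \<pi>(1), of n] obtain \<pi>'
        where \<pi>': "\<pi>' \<in> compliant H f \<inter> gen_buchi H FA"
      "map \<pi>' [0..<Suc n] = map \<pi> [0..<Suc n]" by auto
    then have "w = map \<pi>' [0..<n]" using \<pi>(2) by simp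
    with \<pi>'(1) show "w \<in> prefixes (compliant H f \<inter> gen_buchi H FA)" by (auto simp: prefixes_def)
  qed
  then have "non_conflicting H FA f" by (auto simp: non_conflicting_def prefixes_def)
  ultimately show ?thesis
    using f win by (auto simp: synthesizable_def winning_def)
qed

theorem synthesizable_iff_solution:
  "FA \<noteq> [] \<Longrightarrow> synthesizable H FA FG \<longleftrightarrow> initial H \<in> solution (jobs FA FG)"
  using synthesizable_imp_solution solution_imp_synthesizable by blast

end

subsection \<open>Renumbering of states\<close>

locale arena_iso = A: arena U E S + B: arena U' E' S'
  for U :: "'v set" and E S and U' :: "'w set" and E' S' +
  fixes e :: "'v \<Rightarrow> 'w"
  assumes e_bij: "bij_betw e U U'" and E'_eq: "E' = map_prod e e ` E"
    and S'_iff: "\<And>q. q \<in> U \<Longrightarrow> e q \<in> S' \<longleftrightarrow> q \<in> S"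
begin

text \<open>The preimage under the numbering sees only the part of a set inside \<open>U'\<close>.
  Fixed points are therefore transferred through their iterates within \<open>U'\<close>; by equal
  cardinality the number of iterations agrees on both sides.\<close>

definition pull :: "'w set \<Rightarrow> 'v set" where
  "pull X = {q \<in> U. e q \<in> X}"

lemma pull_simps [simp]:
  "pull {} = {}" "pull U' = U" "pull (X \<union> Y) = pull X \<union> pull Y" "pull (X \<inter> Y) = pull X \<inter> pull Y"
  "pull (X - Y) = pull X - pull Y" "pull (\<Union>(f ` I)) = (\<Union>i \<in> I. pull (f i))"
  using bij_betw_apply[OF e_bij] by (auto simp: pull_def)

lemma card_U': "card U' = card U"
  using bij_betw_same_card[OF e_bij] ..

lemma edge_iff: "q \<in> U \<Longrightarrow> (e q, y) \<in> E' \<longleftrightarrow>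
    (\<exists>q'. (q, q') \<in> E \<and> y = e q')"
  using A.E_sub bij_betw_imp_inj_on[OF e_bij] unfolding E'_eq by (auto dest: inj_onD)

lemma in_pull_iff: "(q, q') \<in> E \<Longrightarrow> q' \<in> pull X \<longleftrightarrow> e q' \<in> X"
  using A.E_sub by (auto simp: pull_def)

lemma pull_succ:
  assumes "q \<in> U"
  shows "(\<forall>y. (e q, y) \<in> E' \<longrightarrow> y \<in> X) \<longleftrightarrow>
      (\<forall>q'. (q, q') \<in> E \<longrightarrow> q' \<in> pull X)"
    "(\<exists>y \<in> X. (e q, y) \<in> E') \<longleftrightarrow> (\<exists>q' \<in> pull X. (q, q') \<in> E)"
  using edge_iff[OF assms] in_pull_iff[of q _ X] by (metis (no_types, lifting))+

lemma pull_iterate: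
  assumes "\<And>X. X \<subseteq> U' \<Longrightarrow> pull (F' X) = F (pull X)"
      "\<And>X. X \<subseteq> U' \<Longrightarrow> F' X \<subseteq> U'" "X \<subseteq> U'"
  shows "pull ((F' ^^ n) X) = (F ^^ n) (pull X)"
proof -
  have "(F' ^^ n) X \<subseteq> U' \<and> pull ((F' ^^ n) X) = (F ^^ n) (pull X)"
    by (induction n) (use assms in auto)
  then show ?thesis by blast
qed

lemma pull_dead: "pull B.dead = A.dead"
proof -
  have "pull (B.dead_step X) = A.dead_step (pull X)" for X
  proof -
    have "q \<in> pull (B.dead_step X) \<longleftrightarrow> q \<in> A.dead_step (pull X)" if "q \<in> U" for q
      using that bij_betw_apply[OF e_bij that] unfolding A.dead_step_def B.dead_step_def
      by (simp add: pull_succ[OF that] S'_iff pull_def[of "Collect _"])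
    then show ?thesis using A.dead_step_sub by (auto simp: pull_def[of "B.dead_step X"])
  qed
  then show ?thesis
    unfolding A.dead_iterate B.dead_iterate card_U' using B.dead_step_sub by (subst pull_iterate) auto
qed

lemma pull_cpre: "pull (B.cpre W X) = A.cpre (pull W) (pull X)"
proof -
  have "q \<in> pull (B.cpre W X) \<longleftrightarrow> q \<in> A.cpre (pull W) (pull X)" if q: "q \<in> U" for q
    using q unfolding A.cpre_def B.cpre_def pull_dead[symmetric] pull_simps(3)[symmetric]
    by (simp add: pull_def[of "Collect _"] pull_succ[OF q] S'_iff del: Un_iff pull_simps(3))
  then show ?thesis using A.cpre_sub by (auto simp: pull_def)
qed

lemma pull_base: "pull (B.base T Y) = A.base (pull T) (pull Y)"
  by (simp add: A.base_def B.base_def pull_cpre)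

lemma pull_x_step:
  assumes "D \<subseteq> U'"
  shows "pull (B.x_step D G X) = A.x_step (pull D) (pull G) (pull X)"
proof -
  have "pull D \<subseteq> U" by (auto simp: pull_def)
  then show ?thesis
    unfolding A.x_step_iterate[OF \<open>pull D \<subseteq> U\<close>] B.x_step_iterate[OF assms] card_U'
    by (subst pull_iterate)
      (auto simp: A.w_step_def B.w_step_def pull_cpre dest: subsetD[OF assms] subsetD[OF B.cpre_sub])
qed

lemma pull_avoid:
  assumes "D \<subseteq> U'"
  shows "pull (B.avoid D G) = A.avoid (pull D) (pull G)"
proof -
  have "pull D \<subseteq> U" by (auto simp: pull_def)
  then show ?thesis
    unfolding A.avoid_iterate[OF \<open>pull D \<subseteq> U\<close>] B.avoid_iterate[OF assms] card_U'
    by (subst pull_iterate) (auto simp: pull_x_step[OF assms] dest: subsetD[OF B.x_step_sub[OF assms]])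
qed

lemma pull_stage: "pull (B.stage T As Z) = A.stage (pull T) (pull ` As) (pull Z)"
proof -
  have sub: "T \<inter> B.cpre Z Z \<subseteq> U'" using B.cpre_sub by blast
  have "pull (B.y_step (T \<inter> B.cpre Z Z) As Y) = A.y_step (pull T \<inter> A.cpre (pull Z) (pull Z))
      (pull ` As) (pull Y)"
    if "Y \<subseteq> U'" for Y
    unfolding A.y_step_def B.y_step_def
    by (simp add: pull_avoid[OF B.base_sub[OF sub that]] pull_base pull_cpre)
  then show ?thesis
    unfolding A.stage_iterate B.stage_iterate card_U'
    using B.y_step_sub[OF sub] by (subst pull_iterate) auto
qed

lemma pull_solution:
  assumes "J \<noteq> {}"
  shows "pull (B.solution J) = A.solution ((\<lambda>(T, As). (pull T, pull ` As)) ` J)"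
proof -
  have "B.z_step J Z \<subseteq> U'" for Z
    using assms B.stage_sub by (fastforce simp: B.z_step_def)
  moreover have "pull (B.z_step J Z) = A.z_step ((\<lambda>(T, As). (pull T, pull ` As)) ` J) (pull Z)" for Z
  proof -
    obtain j where "j \<in> J" using assms by blast
    \<comment> \<open>For an empty family the left side would be \<open>U\<close> and the right side
      the whole type.\<close>
    have "pull (\<Inter>j \<in> J. f j) = (\<Inter>j \<in> J. pull (f j))" for f :: "_ \<Rightarrow> 'w set"
      using \<open>j \<in> J\<close> by (auto simp: pull_def)
    then show ?thesis
      by (simp add: A.z_step_def B.z_step_def split_beta pull_stage)
  qed
  moreover have "(\<lambda>(T, As). (pull T, pull ` As)) ` J \<noteq> {}" using assms by simp
  ultimately show ?thesis
    unfolding A.solution_iterate[OF \<open>_ ` J \<noteq> {}\<close>] B.solution_iterate[OF assms] card_U'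
    by (subst pull_iterate) auto
qed

end

subsection \<open>The symbolic algorithm\<close>

context
  fixes act :: "'a \<Rightarrow> 's \<Rightarrow> 's" and ca :: "'a \<Rightarrow> nat"
      and tst :: "'t \<Rightarrow> 's \<Rightarrow> bool" and ct :: "'t \<Rightarrow> nat"
begin

text \<open>One terminating run with a suitable result is enough, as \<open>run\<close> is
  deterministic.\<close>

definition wp :: "('a, 't) prog \<Rightarrow> 's \<Rightarrow> (nat \<Rightarrow> 's \<Rightarrow> bool)
    \<Rightarrow> bool" where
  "wp p s Q \<longleftrightarrow> (\<exists>c s'. run act ca tst ct p s c s' \<and> Q c s')"

lemma wp_Skip: "Q 0 s \<Longrightarrow> wp Skip s Q"
  unfolding wp_def by (blast intro: run.Skip)

lemma wp_Do: "Q (ca a) (act a s) \<Longrightarrow> wp (Do a) s Q"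
  unfolding wp_def by (blast intro: run.Do)

lemma wp_Seq: "wp p s (\<lambda>c s'. wp p' s' (\<lambda>c'. Q (c + c'))) \<Longrightarrow> wp (Seq p p') s Q"
  unfolding wp_def by (blast intro: run.Seq)

lemma wp_Cond:
  assumes "tst t s \<Longrightarrow> wp p s (\<lambda>c. Q (ct t + c))" "\<not> tst t s \<Longrightarrow>
      wp p' s (\<lambda>c. Q (ct t + c))"
  shows "wp (Cond t p p') s Q"
  using assms unfolding wp_def by (cases "tst t s") (blast intro: run.CondT run.CondF)+

lemma wp_mono: "wp p s Q \<Longrightarrow> (\<And>c s'. Q c s' \<Longrightarrow> Q' c s') \<Longrightarrow> wp p s Q'"
  unfolding wp_def by blast

text \<open>Invariant and measure see the cost spent so far in this loop, so the same rule covers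
  amortised bounds.\<close>

lemma wp_Loop:
  fixes \<mu> :: "nat \<Rightarrow> 's \<Rightarrow> nat"
  assumes "I 0 s"
    and body: "\<And>c s. I c s \<Longrightarrow> tst t s \<Longrightarrow>
        wp p s (\<lambda>c' s'. I (c + ct t + c') s' \<and> \<mu> (c + ct t + c') s' < \<mu> c s)"
    and exit: "\<And>c s. I c s \<Longrightarrow> \<not> tst t s \<Longrightarrow> Q (c + ct t) s"
  shows "wp (Loop t p) s Q"
proof -
  have "wp (Loop t p) s (\<lambda>d. Q (c + d))" if "I c s" for c s
    using that
  proof (induction "\<mu> c s" arbitrary: c s rule: less_induct)
    case less
    show ?case
    proof (cases "tst t s")
      case True
      from body[OF less.prems this] obtain c' s' where c': "run act ca tst ct p s c' s'"
        "I (c + ct t + c') s'" "\<mu> (c + ct t + c') s' < \<mu> c s" unfolding wp_def by blast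
      from less.hyps[OF c'(3,2)] obtain d s'' where "run act ca tst ct (Loop t p) s' d s''"
        "Q (c + ct t + c' + d) s''" unfolding wp_def by blast
      with run.LoopT[where tst = tst and ct = ct, OF True c'(1)] show ?thesis
        unfolding wp_def by (metis add.assoc)
    next
      case False
      with exit[OF less.prems] run.LoopF[where tst = tst and ct = ct] show ?thesis unfolding wp_def by metis
    qed
  qed
  from this[OF assms(1)] show ?thesis by simp
qed

end

lemma set_cell_same [simp]: "set_cell m x i v x = (m x)(i := v)"
  by (simp add: set_cell_def)

lemma set_cell_other [simp]: "y \<noteq> x \<Longrightarrow> set_cell m x i v y = m y"
  by (simp add: set_cell_def)

abbreviation var :: "string \<Rightarrow> nexp" where "var x \<equiv> Cell x (Lit 0)"
abbreviation svar :: "string \<Rightarrow> sexp" where "svar x \<equiv> SCell x (Lit 0)"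
abbreviation sset :: "string \<Rightarrow> sexp \<Rightarrow> (sym_action, sym_test) prog" where
  "sset x S \<equiv> Do (SAssign x (Lit 0) S)"
abbreviation nset :: "string \<Rightarrow> nexp \<Rightarrow> (sym_action, sym_test) prog" where
  "nset x e \<equiv> Do (NAssign x (Lit 0) e)"

fun seqs :: "('a, 't) prog list \<Rightarrow> ('a, 't) prog" where
  "seqs [] = Skip" | "seqs [p] = p" | "seqs (p # ps) = Seq p (seqs ps)"

text \<open>The blocks of a partition are kept together with their predecessors. Predecessors of a
  set are obtained from those of its blocks after splitting the blocks that it cuts, which costs
  two applications of \<open>Pre\<close> per split; so the total cost is bounded by the number of states.\<close>

definition split_block :: "(sym_action, sym_test) prog" where
  "split_block = seqs [
     Do (SAssign ''B'' (var ''k'') (Diff (SCell ''B'' (var ''i'')) (svar ''T''))),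
     Do (SAssign ''P'' (var ''k'') (Pre (SCell ''B'' (var ''k'')))),
     Do (SAssign ''B'' (var ''i'') (Cap (SCell ''B'' (var ''i'')) (svar ''T''))),
     Do (SAssign ''P'' (var ''i'') (Pre (SCell ''B'' (var ''i'')))),
     nset ''k'' (Plus (var ''k'') (Lit 1))]"

definition cut_block :: "(sym_action, sym_test) prog" where
  "cut_block = Cond (Subset (SCell ''B'' (var ''i'')) (svar ''T'')) Skip
     (Cond (Subset (Cap (SCell ''B'' (var ''i'')) (svar ''T'')) (Diff AllStates AllStates)) Skip split_block)"

definition collect_block :: "(sym_action, sym_test) prog" where
  "collect_block = Cond (Subset (SCell ''B'' (var ''i'')) (svar ''T''))
     (sset ''R'' (Cup (svar ''R'') (SCell ''P'' (var ''i'')))) Skip"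

text \<open>\<open>n\<close> freezes the number of blocks at the start: the pieces split off during
  the scan lie outside \<open>T\<close> and need no visit. Restricted to \<open>AllStates\<close>,
  \<open>T\<close> is a union of blocks once all cuts are made.\<close>

definition cached_pre :: "sexp \<Rightarrow> (sym_action, sym_test) prog" where
  "cached_pre S = seqs [sset ''T'' (Cap S AllStates), sset ''R'' (Diff AllStates AllStates),
     nset ''n'' (var ''k''), nset ''i'' (Lit 0),
     Loop (NLess (var ''i'') (var ''n''))
       (seqs [cut_block, collect_block, nset ''i'' (Plus (var ''i'') (Lit 1))])]"

locale sym_game = game_arena H for H :: "'q game" +
  fixes FA FG :: "'q set list"
  assumes FA: "FA \<noteq> []" and FG: "FG \<noteq> []"
    and F_sub: "\<And>F. F \<in> set FA \<union> set FG \<Longrightarrow> F \<subseteq> states H"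
begin

type_synonym 'a sym_state = "memory \<times> (string \<Rightarrow> nat \<Rightarrow> 'a set)"

abbreviation swp where "swp \<equiv> wp (sym_act H FA FG) sym_act_cost (sym_tst H FA FG) sym_tst_cost"

definition inv :: "'q sym_state \<Rightarrow> bool" where
  "inv s \<longleftrightarrow> fst s ''nA'' 0 = length FA \<and> fst s ''nG'' 0 = length FG \<and>
     (\<forall>i < fst s ''k'' 0. snd s ''B'' i \<noteq> {} \<and> snd s ''P'' i = pre H (snd s ''B'' i)) \<and>
     (\<forall>i < fst s ''k'' 0. \<forall>j < fst s ''k'' 0. i \<noteq> j \<longrightarrow>
         snd s ''B'' i \<inter> snd s ''B'' j = {}) \<and>
     (\<Union>i < fst s ''k'' 0. snd s ''B'' i) = states H"

definition same :: "string set \<Rightarrow> string set \<Rightarrow> 'q sym_state \<Rightarrow> 'q sym_state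
    \<Rightarrow> bool" where
  "same M V s s' \<longleftrightarrow> (\<forall>x. x \<notin> M \<longrightarrow> fst s' x = fst s x) \<and>
      (\<forall>x. x \<notin> V \<longrightarrow> snd s' x = snd s x)"

text \<open>The balance is an equation: each new block pays for two predecessors and nothing else
  costs anything. Loops therefore need only a termination argument and no bound on their number of
  iterations.\<close>

definition tri :: "string set \<Rightarrow> string set \<Rightarrow> 'q sym_state \<Rightarrow> (sym_action, sym_test) prog
    \<Rightarrow> ('q sym_state \<Rightarrow> bool) \<Rightarrow> bool" where
  "tri M V s p Q \<longleftrightarrow> swp p s (\<lambda>c s'. inv s' \<and>
      c + 2 * fst s ''k'' 0 = 2 * fst s' ''k'' 0 \<and> same M V s s' \<and> Q s')"

lemma same_refl: "same M V s s" by (simp add: same_def)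

lemma same_trans: "same M V s s' \<Longrightarrow> same M V s' s'' \<Longrightarrow> same M V s s''" by (simp add: same_def)

lemma same_fst: "same M V s s' \<Longrightarrow> x \<notin> M \<Longrightarrow> fst s' x = fst s x" by (simp add: same_def)
lemma same_snd: "same M V s s' \<Longrightarrow> x \<notin> V \<Longrightarrow> snd s' x = snd s x" by (simp add: same_def)

lemma inv_bound:
  assumes "inv s"
  shows "fst s ''k'' 0 \<le> card (states H)"
proof -
  let ?k = "fst s ''k'' 0" and ?B = "snd s ''B''"
  have fin: "finite (?B i)" if "i < ?k" for i
    using assms that finite_U by (intro finite_subset[of "?B i" "states H"]) (auto simp: inv_def)
  have "(\<Sum>i < ?k. 1) \<le> (\<Sum>i < ?k. card (?B i))"
    by (rule sum_mono) (use assms fin in \<open>auto simp: inv_def Suc_le_eq card_gt_0_iff\<close>)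
  also have "\<dots> = card (\<Union>i < ?k. ?B i)"
    by (rule card_UN_disjoint[symmetric]) (use assms fin in \<open>auto simp: inv_def\<close>)
  finally show ?thesis using assms by (simp add: inv_def)
qed

lemma tri_weaken:
  assumes "tri M V s p R" "M \<subseteq> M'" "V \<subseteq> V'" "\<And>s'. inv s' \<Longrightarrow>
      same M V s s' \<Longrightarrow> R s' \<Longrightarrow> Q s'"
  shows "tri M' V' s p Q"
proof -
  have "same M' V' s s'" if "same M V s s'" for s'
    using that assms(2,3) unfolding same_def by blast
  with assms(1,4) show ?thesis unfolding tri_def by (auto elim!: wp_mono)
qed

lemma tri_Seq:
  assumes "tri M V s p R" "\<And>s'. inv s' \<Longrightarrow> same M V s s' \<Longrightarrow>
      R s' \<Longrightarrow> tri M V s' p' Q"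
  shows "tri M V s (Seq p p') Q"
  unfolding tri_def
  apply (rule wp_Seq, rule wp_mono[OF assms(1)[unfolded tri_def]], elim conjE)
  subgoal for c s'
    by (rule wp_mono[OF assms(2)[unfolded tri_def]]) (auto intro: same_trans)
  done

lemma tri_Seq_weaken:
  assumes "tri M V s p R" "M \<subseteq> M'" "V \<subseteq> V'"
    "\<And>s'. inv s' \<Longrightarrow> same M V s s' \<Longrightarrow> R s' \<Longrightarrow> tri M' V' s' p' Q"
  shows "tri M' V' s (Seq p p') Q"
  by (rule tri_Seq[where R = "\<lambda>s'. same M V s s' \<and> R s'"])
    (use assms in \<open>auto intro: tri_weaken\<close>)

lemma tri_Skip: "inv s \<Longrightarrow> Q s \<Longrightarrow> tri M V s Skip Q"
  unfolding tri_def by (rule wp_Skip) (simp add: same_refl)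

lemma tri_Cond:
  assumes "sym_tst_cost t = 0" "sym_tst H FA FG t s \<Longrightarrow>
      tri M V s p Q" "\<not> sym_tst H FA FG t s \<Longrightarrow> tri M V s p' Q"
  shows "tri M V s (Cond t p p') Q"
  using assms unfolding tri_def by (intro wp_Cond) simp_all

lemma inv_cong:
  assumes "inv s" "\<And>x. x \<in> {''nA'', ''nG'', ''k''} \<Longrightarrow> fst s' x = fst s x"
      "\<And>x. x \<in> {''B'', ''P''} \<Longrightarrow> snd s' x = snd s x"
  shows "inv s'"
  using assms unfolding inv_def by simp

lemma tri_sset:
  assumes "inv s" "x \<in> V" "x \<notin> {''B'', ''P''}" "pre_count S = 0"
    "Q (fst s, set_cell (snd s) x 0 (sval H FA FG S s))"
  shows "tri M V s (sset x S) Q"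
  unfolding tri_def
  by (rule wp_Do) (use assms in \<open>auto simp: same_def set_cell_def intro: inv_cong[OF assms(1)]\<close>)

lemma tri_nset:
  assumes "inv s" "x \<in> M" "x \<notin> {''nA'', ''nG'', ''k''}" "Q (set_cell (fst s) x 0 (nval e (fst s)), snd s)"
  shows "tri M V s (nset x e) Q"
  unfolding tri_def
  by (rule wp_Do) (use assms in \<open>auto simp: same_def set_cell_def intro: inv_cong[OF assms(1)]\<close>)

lemma tri_sset_Seq:
  assumes "inv s" "x \<in> V" "x \<notin> {''B'', ''P''}" "pre_count S = 0"
    "\<And>s'. s' = (fst s, set_cell (snd s) x 0 (sval H FA FG S s)) \<Longrightarrow> inv s' \<Longrightarrow>
        tri M V s' p Q"
  shows "tri M V s (Seq (sset x S) p) Q"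
  by (rule tri_Seq, rule tri_sset[OF assms(1-4) refl]) (use assms(5) in blast)

lemma tri_nset_Seq:
  assumes "inv s" "x \<in> M" "x \<notin> {''nA'', ''nG'', ''k''}"
    "\<And>s'. s' = (set_cell (fst s) x 0 (nval e (fst s)), snd s) \<Longrightarrow> inv s' \<Longrightarrow> tri M V s' p Q"
  shows "tri M V s (Seq (nset x e) p) Q"
  by (rule tri_Seq, rule tri_nset[OF assms(1-3) refl]) (use assms(4) in blast)

lemma tri_Loop:
  fixes \<mu> :: "'q sym_state \<Rightarrow> nat"
  assumes "sym_tst_cost t = 0" "inv s" "I s"
    and body: "\<And>s'. inv s' \<Longrightarrow> same M V s s' \<Longrightarrow> I s' \<Longrightarrow>
        sym_tst H FA FG t s' \<Longrightarrow>
      tri M V s' p (\<lambda>s''. I s'' \<and> \<mu> s'' < \<mu> s')"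
    and exit: "\<And>s'. inv s' \<Longrightarrow> same M V s s' \<Longrightarrow> I s' \<Longrightarrow>
        \<not> sym_tst H FA FG t s' \<Longrightarrow> Q s'"
  shows "tri M V s (Loop t p) Q"
  unfolding tri_def
proof (rule wp_Loop[where \<mu> = "\<lambda>c. \<mu>"
      and I = "\<lambda>c s'. inv s' \<and> c + 2 * fst s ''k'' 0 = 2 * fst s' ''k'' 0 \<and> same M V s s' \<and> I s'"])
  fix c s' assume s': "inv s' \<and> c + 2 * fst s ''k'' 0 = 2 * fst s' ''k'' 0 \<and> same M V s s' \<and> I s'"
    and t: "sym_tst H FA FG t s'"
  then have "tri M V s' p (\<lambda>s''. I s'' \<and> \<mu> s'' < \<mu> s')" using body by blast
  then show "swp p s' (\<lambda>c' s''. (inv s'' \<and>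
      c + sym_tst_cost t + c' + 2 * fst s ''k'' 0 = 2 * fst s'' ''k'' 0 \<and>
      same M V s s'' \<and> I s'') \<and> \<mu> s'' < \<mu> s')"
    unfolding tri_def by (rule wp_mono) (use s' assms(1) in \<open>auto intro: same_trans\<close>)
qed (use assms in \<open>auto simp: same_refl\<close>)

lemma pre_eq: "pre H X = {q. \<exists>q' \<in> X. (q, q') \<in> transitions H}"
  unfolding pre_def transitions_def by blast

text \<open>The part outside \<open>T\<close> goes to the fresh index first, since block
  \<open>i\<close> is then overwritten by its part inside \<open>T\<close>. Both parts are nonempty
  by the last two assumptions, as \<open>inv\<close> requires.\<close>

lemma split_block:
  assumes "inv s" "i = fst s ''i'' 0" "i < fst s ''k'' 0"
    "snd s ''B'' i \<inter> snd s ''T'' 0 \<noteq> {}" "\<not> snd s ''B'' i \<subseteq> snd s ''T'' 0"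
  shows "tri {''k''} {''B'', ''P''} s split_block (\<lambda>s'. fst s' ''k'' 0 = Suc (fst s ''k'' 0) \<and>
    (\<forall>j < fst s ''k'' 0. snd s' ''B'' j = (if j = i then snd s ''B'' i \<inter> snd s ''T'' 0 else snd s
        ''B'' j)) \<and>
    snd s' ''B'' (fst s ''k'' 0) = snd s ''B'' i - snd s ''T'' 0)"
proof -
  define k where "k = fst s ''k'' 0"
  define B where "B = snd s ''B''"
  define P where "P = snd s ''P''"
  define T where "T = snd s ''T'' 0"
  define s' where "s' = (set_cell (fst s) ''k'' 0 (Suc k),
    (snd s)(''B'' := B(k := B i - T, i := B i \<inter> T), ''P'' := P(k := pre H (B i - T), i := pre H (B i \<inter> T))))"
  have i: "i < k" "B i \<inter> T \<noteq> {}" "\<not> B i \<subseteq> T" "fst s ''i'' 0 = i" "fst s ''k'' 0 = k"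
    using assms by (auto simp: k_def B_def T_def)
  have B: "\<forall>j<k. B j \<noteq> {} \<and> P j = pre H (B j)" "\<And>j l. j < k \<Longrightarrow>
      l < k \<Longrightarrow> j \<noteq> l \<Longrightarrow> B j \<inter> B l = {}"
    "(\<Union>j<k. B j) = states H"
    using assms(1) by (auto simp: inv_def B_def k_def P_def)
  have "inv s'"
    unfolding inv_def
  proof (intro conjI)
    have "(\<Union>j < Suc k. (B(k := B i - T, i := B i \<inter> T)) j) = (\<Union>j<k. B j)"
      using i(1) by (auto simp: less_Suc_eq split: if_splits)
    then show "(\<Union>j < fst s' ''k'' 0. snd s' ''B'' j) = states H" using B(3) by (simp add: s'_def)
    have "(B(k := B i - T, i := B i \<inter> T)) j \<inter> (B(k := B i - T, i := B i \<inter> T)) l = {}"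
      if "j < Suc k" "l < Suc k" "j \<noteq> l" for j l
      using B(2)[of j l] B(2)[of i j] B(2)[of i l] that i(1) by (auto simp: less_Suc_eq)
    then show "\<forall>j < fst s' ''k'' 0. \<forall>l < fst s' ''k'' 0. j \<noteq> l \<longrightarrow>
        snd s' ''B'' j \<inter> snd s' ''B'' l = {}"
      by (simp add: s'_def)
  qed (use assms(1) B(1) i in \<open>auto simp: s'_def less_Suc_eq inv_def\<close>)
  have "snd (x :: 'q sym_state) ''B'' = B \<Longrightarrow> snd x = (snd x)(''B'' := B)" for x by auto
  have fin: "set_cell (set_cell (set_cell (set_cell (snd s) ''B'' k (B i - T)) ''P'' k (pre H (B i - T)))
      ''B'' i (B i \<inter> T)) ''P'' i (pre H (B i \<inter> T)) = snd s'"
    by (auto simp: s'_def set_cell_def B_def P_def fun_eq_iff)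
  show ?thesis
    unfolding tri_def split_block_def seqs.simps
    apply (rule wp_Seq wp_Do)+
    using i \<open>inv s'\<close> fin
    apply (simp add: B_def[symmetric] T_def[symmetric])
    apply (auto simp: s'_def same_def)
    done
qed

text \<open>Predecessors commute with unions. After the cuts every block lies inside or outside
  \<open>T\<close>, and the cached predecessors of the blocks inside are collected.\<close>

lemma cached_pre:
  assumes "inv s" "pre_count S = 0"
  shows "tri {''k'', ''n'', ''i''} {''B'', ''P'', ''T'', ''R''} s (cached_pre S)
    (\<lambda>s'. snd s' ''R'' 0 = pre H (sval H FA FG S s))"
proof -
  define T where "T = sval H FA FG S s \<inter> states H"
  have pre_T: "pre H (sval H FA FG S s) = pre H T"
    unfolding pre_eq T_def using E_sub by blast
  let ?M = "{''k'', ''n'', ''i''}" and ?V = "{''B'', ''P'', ''T'', ''R''}"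
  define n0 where "n0 = fst s ''k'' 0"
  define I where "I i s' \<longleftrightarrow> snd s' ''T'' 0 = T \<and> fst s' ''n'' 0 = n0 \<and> n0 \<le>
      fst s' ''k'' 0 \<and> i \<le> n0 \<and>
     (\<forall>j < i. snd s' ''B'' j \<subseteq> T \<or> snd s' ''B'' j \<inter> T = {}) \<and>
     (\<forall>j. n0 \<le> j \<and> j < fst s' ''k'' 0 \<longrightarrow> snd s' ''B'' j \<inter> T = {}) \<and>
     snd s' ''R'' 0 = (\<Union>j \<in> {j. j < i \<and> snd s' ''B'' j \<subseteq> T}. pre H
         (snd s' ''B'' j))" for i and s' :: "'q sym_state"
  have cut: "tri ?M ?V s' cut_block (\<lambda>s''. I i s'' \<and> fst s'' ''i'' 0 = i \<and>
      (snd s'' ''B'' i \<subseteq> T \<or> snd s'' ''B'' i \<inter> T = {}))"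
    if s': "inv s'" "I i s'" "i = fst s' ''i'' 0" "i < n0" for i s'
  proof -
    have "tri ?M ?V s' split_block (\<lambda>s''. I i s'' \<and> fst s'' ''i'' 0 = i \<and>
        (snd s'' ''B'' i \<subseteq> T \<or> snd s'' ''B'' i \<inter> T = {}))"
      if c: "snd s' ''B'' i \<inter> T \<noteq> {}" "\<not> snd s' ''B'' i \<subseteq> T"
    proof (rule tri_weaken[OF split_block[OF s'(1,3)]])
      fix s'' assume s'': "inv s''" "same {''k''} {''B'', ''P''} s' s''" "fst s'' ''k'' 0 = Suc (fst s' ''k'' 0) \<and>
        (\<forall>j < fst s' ''k'' 0. snd s'' ''B'' j = (if j = i then snd s' ''B'' i \<inter> snd s' ''T'' 0 else
            snd s' ''B'' j)) \<and>
        snd s'' ''B'' (fst s' ''k'' 0) = snd s' ''B'' i - snd s' ''T'' 0"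
      note eqs = same_fst[OF s''(2)] same_snd[OF s''(2)]
      have k: "n0 \<le> fst s' ''k'' 0" "snd s' ''T'' 0 = T" using s'(2) by (auto simp: I_def)
      have B: "snd s'' ''B'' j = snd s' ''B'' j" if "j < i" for j
        using s''(3) that s'(4) k by auto
      have "(\<Union>j \<in> {j. j < i \<and> snd s'' ''B'' j \<subseteq> T}. pre H (snd s'' ''B'' j)) =
          (\<Union>j \<in> {j. j < i \<and> snd s' ''B'' j \<subseteq> T}. pre H (snd s' ''B'' j))"
        using B by auto
      moreover have "snd s'' ''B'' j \<inter> T = {}" if "n0 \<le> j" "j < fst s'' ''k'' 0" for j
        using that s''(3) s'(2,4) k by (cases "j = fst s' ''k'' 0") (auto simp: I_def)
      moreover have "snd s'' ''B'' i \<subseteq> T" using s''(3) s'(4) k by auto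
      ultimately show "I i s'' \<and> fst s'' ''i'' 0 = i \<and> (snd s'' ''B'' i \<subseteq> T \<or>
          snd s'' ''B'' i \<inter> T = {})"
        using s'(2,3) B s''(3) by (simp add: I_def eqs)
    qed (use s' c in \<open>auto simp: I_def\<close>)
    then show ?thesis
      unfolding cut_block_def using s'
      by (intro tri_Cond tri_Skip) (auto simp: I_def)
  qed
  have collect: "tri ?M ?V s' collect_block (\<lambda>s''. I (Suc i) s'' \<and> fst s'' ''i'' 0 = i)"
    if s': "inv s'" "I i s'" "fst s' ''i'' 0 = i" "snd s' ''B'' i \<subseteq> T \<or>
        snd s' ''B'' i \<inter> T = {}" "i < n0" for i s'
  proof -
    have "snd s' ''P'' i = pre H (snd s' ''B'' i)" using s' by (auto simp: inv_def I_def)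
    moreover have "{j. j < Suc i \<and> snd s' ''B'' j \<subseteq> T} =
        {j. j < i \<and> snd s' ''B'' j \<subseteq> T} \<union> (if snd s' ''B'' i \<subseteq> T then {i} else {})"
      by (auto simp: less_Suc_eq)
    ultimately show ?thesis
      unfolding collect_block_def using s'
      by (intro tri_Cond tri_Skip tri_sset) (auto simp: I_def less_Suc_eq)
  qed
  have loop: "tri ?M ?V s0 (Loop (NLess (var ''i'') (var ''n''))
      (seqs [cut_block, collect_block, nset ''i'' (Plus (var ''i'') (Lit 1))])) (\<lambda>s'. snd s' ''R'' 0 = pre H T)"
    if s0: "inv s0" "I 0 s0" "fst s0 ''i'' 0 = 0" for s0
  proof (rule tri_Loop[where I = "\<lambda>s'. I (fst s' ''i'' 0) s'" and \<mu> = "\<lambda>s. n0 - fst s ''i'' 0"])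
    fix s' assume s': "inv s'" "I (fst s' ''i'' 0) s'" "sym_tst H FA FG (NLess (var ''i'') (var ''n'')) s'"
    define i where "i = fst s' ''i'' 0"
    have i: "i < n0" using s'(2,3) by (simp add: I_def i_def)
    show "tri ?M ?V s' (seqs [cut_block, collect_block, nset ''i'' (Plus (var ''i'') (Lit 1))])
        (\<lambda>s''. I (fst s'' ''i'' 0) s'' \<and> n0 - fst s'' ''i'' 0 < n0 - fst s' ''i'' 0)"
      unfolding seqs.simps
    proof (rule tri_Seq[OF cut[OF s'(1,2) refl]])
      fix s1 assume s1: "inv s1" "I (fst s' ''i'' 0) s1 \<and> fst s1 ''i'' 0 = fst s' ''i'' 0 \<and>
        (snd s1 ''B'' (fst s' ''i'' 0) \<subseteq> T \<or> snd s1 ''B'' (fst s' ''i'' 0) \<inter> T = {})"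
      show "tri ?M ?V s1 (Seq collect_block (nset ''i'' (Plus (var ''i'') (Lit 1))))
        (\<lambda>s''. I (fst s'' ''i'' 0) s'' \<and> n0 - fst s'' ''i'' 0 < n0 - fst s' ''i'' 0)"
      proof (rule tri_Seq[OF collect[of s1 i]])
        fix s2 assume "inv s2" "I (Suc i) s2 \<and> fst s2 ''i'' 0 = i"
        then show "tri ?M ?V s2 (nset ''i'' (Plus (var ''i'') (Lit 1)))
          (\<lambda>s''. I (fst s'' ''i'' 0) s'' \<and> n0 - fst s'' ''i'' 0 < n0 - fst s' ''i'' 0)"
          using i by (intro tri_nset) (auto simp: I_def i_def)
      qed (use s1 i in \<open>auto simp: i_def\<close>)
    qed (use i in \<open>simp add: i_def\<close>)
  next
    fix s' assume s': "inv s'" "I (fst s' ''i'' 0) s'" "\<not> sym_tst H FA FG (NLess (var ''i'') (var ''n'')) s'"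
    have i: "fst s' ''i'' 0 = n0" using s'(2,3) by (simp add: I_def)
    have "pre H T = (\<Union>j \<in> {j. j < n0 \<and> snd s' ''B'' j \<subseteq> T}. pre H (snd s' ''B'' j))"
    proof (intro antisym subsetI)
      fix q assume "q \<in> pre H T"
      then obtain q' where q': "q' \<in> T" "(q, q') \<in> transitions H" by (auto simp: pre_eq)
      then have "q' \<in> (\<Union>j < fst s' ''k'' 0. snd s' ''B'' j)" using s'(1) by (simp add: T_def inv_def)
      then obtain j where j: "j < fst s' ''k'' 0" "q' \<in> snd s' ''B'' j" by blast
      \<comment> \<open>A block that meets \<open>T\<close> is not one of those split off during the
        scan, so it has been visited and lies within \<open>T\<close>.\<close>
      have "snd s' ''B'' j \<inter> T \<noteq> {}" using j q' by blast
      then have "j < n0 \<and> snd s' ''B'' j \<subseteq> T"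
        using s'(2) i j(1) unfolding I_def by (meson not_le)
      with j q' show "q \<in> (\<Union>j \<in> {j. j < n0 \<and> snd s' ''B'' j \<subseteq> T}. pre H (snd s' ''B'' j))"
        by (auto simp: pre_eq)
    qed (auto simp: pre_eq)
    with s'(2) i show "snd s' ''R'' 0 = pre H T" by (simp add: I_def)
  qed (use s0 in simp_all)
  show ?thesis
    unfolding cached_pre_def seqs.simps(3)[of "sset _ _"] seqs.simps(3)[of "nset _ _"] seqs.simps(2)[of "Loop _ _"] pre_T
    apply (rule tri_sset_Seq[OF assms(1)], simp, simp, simp add: assms)
    apply (rule tri_sset_Seq, assumption, simp, simp, simp)
    apply (rule tri_nset_Seq, assumption, simp, simp)
    apply (rule tri_nset_Seq, assumption, simp, simp)
    apply (rule loop, assumption)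
     apply (auto simp: I_def n0_def T_def)
    done
qed

end

section \<open>The symbolic program for the nested fixed point\<close>

definition cpre_prog :: "string \<Rightarrow> string \<Rightarrow> (sym_action, sym_test) prog" where
  "cpre_prog w x = seqs [cached_pre (svar w), sset ''V'' (svar ''R''),
     cached_pre (Diff AllStates (Cup (svar x) (svar ''D''))),
     sset ''C'' (Cap (svar ''V'') (Cup SysStates (Diff AllStates (svar ''R''))))]"

text \<open>The body precedes the first test because \<open>xo\<close> may still hold a value from
  an earlier use.\<close>

definition repeat_until :: "string \<Rightarrow> string \<Rightarrow> sym_test \<Rightarrow>
    (sym_action, sym_test) prog \<Rightarrow> (sym_action, sym_test) prog" where
  "repeat_until x xo t p = Seq (Seq (sset xo (svar x)) p) (Loop (SNeg t) (Seq (sset xo (svar x)) p))"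

definition lfp_prog :: "string \<Rightarrow> string \<Rightarrow> (sym_action, sym_test) prog \<Rightarrow>
    (sym_action, sym_test) prog" where
  "lfp_prog x xo p = Seq (sset x (Diff AllStates AllStates)) (repeat_until x xo (Subset (svar x) (svar xo)) p)"

definition gfp_prog :: "string \<Rightarrow> string \<Rightarrow> (sym_action, sym_test) prog \<Rightarrow>
    (sym_action, sym_test) prog" where
  "gfp_prog x xo p = Seq (sset x AllStates) (repeat_until x xo (Subset (svar xo) (svar x)) p)"

definition dead_prog :: "(sym_action, sym_test) prog" where
  "dead_prog = lfp_prog ''D'' ''Do'' (seqs [cached_pre (Diff AllStates (svar ''D'')), sset ''V'' (svar ''R''),
     cached_pre (svar ''D''), sset ''D'' (Cup (Diff AllStates (svar ''V'')) (Cap SysStates (svar ''R'')))])"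

text \<open>Each inner fixed point is recomputed from scratch whenever it is needed. This repetition
  is free, since only uncached predecessors are charged.\<close>

definition w_prog :: "(sym_action, sym_test) prog" where
  "w_prog = lfp_prog ''W'' ''Wo'' (Seq (cpre_prog ''W'' ''X'')
     (sset ''W'' (Cup (svar ''Bs'') (Diff (svar ''C'') (Asm (var ''b''))))))"

definition x_prog :: "(sym_action, sym_test) prog" where
  "x_prog = gfp_prog ''X'' ''Xo'' (Seq w_prog (sset ''X'' (svar ''W'')))"

text \<open>The interval from \<open>lo\<close> to \<open>hi\<close> selects the sets to be avoided
  in the job: all assumptions for a guarantee, a single one for an assumption.\<close>

definition b_prog :: "(sym_action, sym_test) prog" where
  "b_prog = Seq (sset ''Yn'' (Diff AllStates AllStates)) (Seq (nset ''b'' (var ''lo''))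
     (Loop (NLess (var ''b'') (var ''hi'')) (Seq x_prog (Seq (sset ''Yn'' (Cup (svar ''Yn'') (svar ''X'')))
       (nset ''b'' (Plus (var ''b'') (Lit 1)))))))"

definition y_prog :: "(sym_action, sym_test) prog" where
  "y_prog = lfp_prog ''Y'' ''Yo'' (Seq (cpre_prog ''Y'' ''Y'')
     (Seq (sset ''Bs'' (Cup (svar ''Tg'') (Cup (svar ''Y'') (svar ''C'')))) (Seq b_prog (sset ''Y'' (svar ''Yn'')))))"

definition stage_prog :: "(sym_action, sym_test) prog" where
  "stage_prog = Seq (cpre_prog ''Z'' ''Z'') (Seq (sset ''Tg'' (Cap (svar ''J'') (svar ''C''))) y_prog)"

definition guarantee_prog :: "(sym_action, sym_test) prog" where
  "guarantee_prog = Seq (sset ''J'' (Gua (var ''g''))) (Seq (nset ''lo'' (Lit 0)) (Seq (nset ''hi'' (var ''nA''))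
      stage_prog))"

definition assumption_prog :: "(sym_action, sym_test) prog" where
  "assumption_prog = Seq (sset ''J'' (Asm (var ''g''))) (Seq (nset ''lo'' (var ''g''))
     (Seq (nset ''hi'' (Plus (var ''g'') (Lit 1))) stage_prog))"

definition stage_loop :: "string \<Rightarrow> (sym_action, sym_test) prog \<Rightarrow> (sym_action, sym_test) prog" where
  "stage_loop x p = Loop (NLess (var ''g'') (var x)) (Seq p
     (Seq (sset ''Zn'' (Cap (svar ''Zn'') (svar ''Y''))) (nset ''g'' (Plus (var ''g'') (Lit 1)))))"

definition z_prog :: "(sym_action, sym_test) prog" where
  "z_prog = gfp_prog ''Z'' ''Zo'' (Seq (sset ''Zn'' AllStates)
     (Seq (nset ''g'' (Lit 0)) (Seq (stage_loop ''nG'' guarantee_prog)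
     (Seq (nset ''g'' (Lit 0)) (Seq (stage_loop ''nA'' assumption_prog)
     (sset ''Z'' (svar ''Zn'')))))))"

definition sym_prog :: "(sym_action, sym_test) prog" where
  "sym_prog = Seq (sset ''B'' AllStates) (Seq (sset ''P'' (Pre AllStates)) (Seq (nset ''k'' (Lit 1))
     (Seq dead_prog (Seq z_prog (Cond (Subset InitState (svar ''Z'')) (nset ''out'' (Lit 1)) Skip)))))"

section \<open>Correctness and cost of the symbolic program\<close>

context sym_game
begin

lemma cpre_prog:
  assumes "inv s" "snd s ''D'' 0 = dead" "w \<notin> {''B'', ''P'', ''T'', ''R'', ''V'', ''C''}"
      "x \<notin> {''B'', ''P'', ''T'', ''R'', ''V'', ''C''}"
  shows "tri {''k'', ''n'', ''i''} {''B'', ''P'', ''T'', ''R'', ''V'', ''C''} s (cpre_prog w x)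
    (\<lambda>s'. snd s' ''C'' 0 = cpre (snd s w 0) (snd s x 0))"
  unfolding cpre_prog_def seqs.simps
proof (rule tri_Seq_weaken[OF cached_pre[OF assms(1)]], simp, simp, simp)
  fix s1 assume s1: "inv s1" "same {''k'', ''n'', ''i''} {''B'', ''P'', ''T'', ''R''} s s1"
    "snd s1 ''R'' 0 = pre H (sval H FA FG (svar w) s)"
  let ?Q = "\<lambda>s'. snd s' ''C'' 0 = cpre (snd s w 0) (snd s x 0)"
  show "tri {''k'', ''n'', ''i''} {''B'', ''P'', ''T'', ''R'', ''V'', ''C''} s1 (Seq (sset ''V'' (svar ''R''))
     (Seq (cached_pre (Diff AllStates (Cup (svar x) (svar ''D''))))
     (sset ''C'' (Cap (svar ''V'') (Cup SysStates (Diff AllStates (svar ''R''))))))) ?Q"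
  proof (rule tri_sset_Seq[OF s1(1)])
    fix s2 assume s2: "s2 = (fst s1, set_cell (snd s1) ''V'' 0 (sval H FA FG (svar ''R'') s1))" "inv s2"
    show "tri {''k'', ''n'', ''i''} {''B'', ''P'', ''T'', ''R'', ''V'', ''C''} s2
     (Seq (cached_pre (Diff AllStates (Cup (svar x) (svar ''D''))))
     (sset ''C'' (Cap (svar ''V'') (Cup SysStates (Diff AllStates (svar ''R'')))))) ?Q"
    proof (rule tri_Seq_weaken[OF cached_pre[OF s2(2)]], simp, simp, simp)
      fix s3 assume s3: "inv s3" "same {''k'', ''n'', ''i''} {''B'', ''P'', ''T'', ''R''} s2 s3"
        "snd s3 ''R'' 0 = pre H (sval H FA FG (Diff AllStates (Cup (svar x) (svar ''D''))) s2)"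
      have "snd s2 x 0 = snd s x 0" "snd s2 ''D'' 0 = dead" "snd s2 ''V'' 0 = pre H (snd s w 0)"
        using same_snd[OF s1(2)] s1(3) assms by (auto simp: s2(1))
      with s3(3) same_snd[OF s3(2)] have "snd s3 ''V'' 0 = pre H (snd s w 0)"
          "snd s3 ''R'' 0 = pre H (states H - (snd s x 0 \<union> dead))" by simp_all
      \<comment> \<open>The universal part of \<open>cpre\<close> as the complement of an
        existential predecessor of the forbidden states.\<close>
      moreover have "pre H X \<inter> (sys_states H \<union> (states H - pre H (states H - (Y \<union> dead)))) =
          cpre X Y" for X Y
        unfolding pre_eq cpre_def using E_sub by blast
      ultimately show "tri {''k'', ''n'', ''i''} {''B'', ''P'', ''T'', ''R'', ''V'', ''C''} s3
        (sset ''C'' (Cap (svar ''V'') (Cup SysStates (Diff AllStates (svar ''R''))))) ?Q"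
        using s3(1) by (intro tri_sset) auto
    qed
  qed auto
qed

text \<open>The iterates descend from all states and stay above the greatest fixed point. In a
  descending chain one inclusion decides whether the last step changed anything, and
  \<open>card\<close> of the previous iterate is the measure.\<close>

lemma repeat_until_gfp:
  assumes F: "mono F" "\<And>X. F X \<subseteq> states H" and s: "inv s"
    and x: "x \<in> V" "xo \<in> V" "x \<noteq> xo" "x \<notin> {''B'', ''P''}" "xo \<notin> {''B'', ''P''}"
    and body: "\<And>s'. inv s' \<Longrightarrow> same M V s s' \<Longrightarrow>
        snd s' x 0 \<subseteq> states H \<Longrightarrow>
      tri M V s' p (\<lambda>s''. snd s'' x 0 = F (snd s' x 0) \<and> snd s'' xo = snd s' xo)"
  shows "tri M V s (gfp_prog x xo p) (\<lambda>s'. snd s' x 0 = gfp F)"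
  unfolding gfp_prog_def
proof (rule tri_sset_Seq[OF s x(1,4)])
  fix s0 assume s0: "s0 = (fst s, set_cell (snd s) x 0 (sval H FA FG AllStates s))" "inv s0"
  have same0: "same M V s s0" using x by (auto simp: s0 same_def set_cell_def)
  let ?p = "Seq (sset xo (svar x)) p"
  have step: "tri M V s' ?p (\<lambda>s''. snd s'' x 0 = F (snd s' x 0) \<and> snd s'' xo 0 = snd s' x 0)"
    if "inv s'" "same M V s s'" "snd s' x 0 \<subseteq> states H" for s'
  proof (rule tri_sset_Seq[OF that(1) x(2,5)])
    fix s1 assume s1: "s1 = (fst s', set_cell (snd s') xo 0 (sval H FA FG (svar x) s'))" "inv s1"
    have "same M V s s1" using that(2) x by (auto simp: s1 same_def set_cell_def)
    moreover have "snd s1 x 0 = snd s' x 0" "snd s1 xo 0 = snd s' x 0" using x by (auto simp: s1)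
    ultimately show "tri M V s1 p (\<lambda>s''. snd s'' x 0 = F (snd s' x 0) \<and> snd s'' xo 0 = snd s' x 0)"
      using body[OF s1(2)] that(3) by (intro tri_weaken[OF body[OF s1(2)]]) auto
  qed simp
  define I where "I s' \<longleftrightarrow> snd s' x 0 = F (snd s' xo 0) \<and> snd s' x 0 \<subseteq> snd s' xo 0 \<and>
    gfp F \<subseteq> snd s' x 0 \<and> snd s' xo 0 \<subseteq> states H" for s' :: "'q sym_state"
  have gF: "F (gfp F) = gfp F" by (rule gfp_unfold[OF F(1), symmetric])
  show "tri M V s0 (repeat_until x xo (Subset (svar xo) (svar x)) p) (\<lambda>s'. snd s' x 0 = gfp F)"
    unfolding repeat_until_def
  proof (rule tri_Seq[where R = I])
    have "gfp F \<subseteq> F (states H)"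
      using monoD[OF F(1), of "gfp F" "states H"] F(2)[of "gfp F"] gF by simp
    then show "tri M V s0 ?p I"
      by (intro tri_weaken[OF step[OF s0(2) same0]]) (use F(2) in \<open>auto simp: s0 I_def\<close>)
  next
    fix s1 assume s1: "inv s1" "same M V s0 s1" "I s1"
    show "tri M V s1 (Loop (SNeg (Subset (svar xo) (svar x))) ?p) (\<lambda>s'. snd s' x 0 = gfp F)"
    proof (rule tri_Loop[where I = I and \<mu> = "\<lambda>s'. card (snd s' xo 0)"])
      fix s' assume s': "inv s'" "same M V s1 s'" "I s'" "sym_tst H FA FG (SNeg (Subset (svar xo) (svar x))) s'"
      have same': "same M V s s'" using same0 s1(2) s'(2) same_trans by blast
      have lt: "card (snd s' x 0) < card (snd s' xo 0)"
        using s'(3,4) finite_subset[OF _ finite_U] by (intro psubset_card_mono) (auto simp: I_def)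
      have sub: "snd s' x 0 \<subseteq> states H" using s'(3) by (auto simp: I_def)
      have "F (snd s' x 0) \<subseteq> snd s' x 0" "gfp F \<subseteq> F (snd s' x 0)"
        using s'(3) monoD[OF F(1), of "snd s' x 0" "snd s' xo 0"] monoD[OF F(1), of "gfp F" "snd s' x 0"] gF
        by (auto simp: I_def)
      with lt sub show "tri M V s' ?p (\<lambda>s''. I s'' \<and> card (snd s'' xo 0) < card (snd s' xo 0))"
        by (intro tri_weaken[OF step[OF s'(1) same' sub]]) (auto simp: I_def)
    next
      fix s' assume "I s'" "\<not> sym_tst H FA FG (SNeg (Subset (svar xo) (svar x))) s'"
      then show "snd s' x 0 = gfp F"
        using gfp_upperbound[of "snd s' x 0" F] by (auto simp: I_def)
    qed (use s1 in auto)
  qed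
qed simp

lemma repeat_until_lfp:
  assumes F: "mono F" "F (states H) \<subseteq> states H" and s: "inv s"
    and x: "x \<in> V" "xo \<in> V" "x \<noteq> xo" "x \<notin> {''B'', ''P''}" "xo \<notin> {''B'', ''P''}"
    and body: "\<And>s'. inv s' \<Longrightarrow> same M V s s' \<Longrightarrow>
        snd s' x 0 \<subseteq> states H \<Longrightarrow>
      tri M V s' p (\<lambda>s''. snd s'' x 0 = F (snd s' x 0) \<and> snd s'' xo = snd s' xo)"
  shows "tri M V s (lfp_prog x xo p) (\<lambda>s'. snd s' x 0 = lfp F)"
  unfolding lfp_prog_def
proof (rule tri_sset_Seq[OF s x(1,4)])
  fix s0 assume s0: "s0 = (fst s, set_cell (snd s) x 0 (sval H FA FG (Diff AllStates AllStates) s))" "inv s0"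
  have same0: "same M V s s0" using x by (auto simp: s0 same_def set_cell_def)
  let ?p = "Seq (sset xo (svar x)) p"
  have step: "tri M V s' ?p (\<lambda>s''. snd s'' x 0 = F (snd s' x 0) \<and> snd s'' xo 0 = snd s' x 0)"
    if "inv s'" "same M V s s'" "snd s' x 0 \<subseteq> states H" for s'
  proof (rule tri_sset_Seq[OF that(1) x(2,5)])
    fix s1 assume s1: "s1 = (fst s', set_cell (snd s') xo 0 (sval H FA FG (svar x) s'))" "inv s1"
    have "same M V s s1" using that(2) x by (auto simp: s1 same_def set_cell_def)
    moreover have "snd s1 x 0 = snd s' x 0" "snd s1 xo 0 = snd s' x 0" using x by (auto simp: s1)
    ultimately show "tri M V s1 p (\<lambda>s''. snd s'' x 0 = F (snd s' x 0) \<and> snd s'' xo 0 = snd s' x 0)"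
      using body[OF s1(2)] that(3) by (intro tri_weaken[OF body[OF s1(2)]]) auto
  qed simp
  have lF: "F (lfp F) = lfp F" by (rule lfp_unfold[OF F(1), symmetric])
  have lU: "lfp F \<subseteq> states H" using F(2) by (rule lfp_lowerbound)
  define I where "I s' \<longleftrightarrow> snd s' x 0 = F (snd s' xo 0) \<and> snd s' xo 0 \<subseteq> snd s' x 0 \<and>
    snd s' x 0 \<subseteq> lfp F" for s' :: "'q sym_state"
  show "tri M V s0 (repeat_until x xo (Subset (svar x) (svar xo)) p) (\<lambda>s'. snd s' x 0 = lfp F)"
    unfolding repeat_until_def
  proof (rule tri_Seq[where R = I])
    have "F {} \<subseteq> lfp F"
      using monoD[OF F(1), of "{}" "lfp F"] lF by simp
    then show "tri M V s0 ?p I"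
      by (intro tri_weaken[OF step[OF s0(2) same0]]) (auto simp: s0 I_def)
  next
    fix s1 assume s1: "inv s1" "same M V s0 s1" "I s1"
    show "tri M V s1 (Loop (SNeg (Subset (svar x) (svar xo))) ?p) (\<lambda>s'. snd s' x 0 = lfp F)"
    proof (rule tri_Loop[where I = I and \<mu> = "\<lambda>s'. card (states H - snd s' xo 0)"])
      fix s' assume s': "inv s'" "same M V s1 s'" "I s'" "sym_tst H FA FG (SNeg (Subset (svar x) (svar xo))) s'"
      have same': "same M V s s'" using same0 s1(2) s'(2) same_trans by blast
      have sub: "snd s' x 0 \<subseteq> states H" using s'(3) lU by (auto simp: I_def)
      have lt: "card (states H - snd s' x 0) < card (states H - snd s' xo 0)"
        using s'(3,4) finite_U sub by (intro psubset_card_mono) (auto simp: I_def)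
      have "snd s' x 0 \<subseteq> F (snd s' x 0)" "F (snd s' x 0) \<subseteq> lfp F"
        using s'(3) monoD[OF F(1), of "snd s' xo 0" "snd s' x 0"] monoD[OF F(1), of "snd s' x 0" "lfp F"] lF
        by (auto simp: I_def)
      with lt show "tri M V s' ?p (\<lambda>s''. I s'' \<and>
          card (states H - snd s'' xo 0) < card (states H - snd s' xo 0))"
        by (intro tri_weaken[OF step[OF s'(1) same' sub]]) (auto simp: I_def)
    next
      fix s' assume "I s'" "\<not> sym_tst H FA FG (SNeg (Subset (svar x) (svar xo))) s'"
      then show "snd s' x 0 = lfp F"
        using lfp_lowerbound[of F "snd s' x 0"] by (auto simp: I_def)
    qed (use s1 in auto)
  qed
qed simp

lemma dead_prog:
  assumes "inv s"
  shows "tri {''k'', ''n'', ''i''} {''B'', ''P'', ''T'', ''R'', ''V'', ''D'', ''Do''} s dead_prog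
      (\<lambda>s'. snd s' ''D'' 0 = dead)"
  unfolding dead_prog_def dead_def seqs.simps
proof (rule repeat_until_lfp[OF mono_dead_step dead_step_sub assms])
  let ?M = "{''k'', ''n'', ''i''}" and ?V = "{''B'', ''P'', ''T'', ''R'', ''V'', ''D'', ''Do''}"
  fix s' assume s': "inv s'" "snd s' ''D'' 0 \<subseteq> states H"
  let ?Q = "\<lambda>s''. snd s'' ''D'' 0 = dead_step (snd s' ''D'' 0) \<and> snd s'' ''Do'' = snd s' ''Do''"
  show "tri ?M ?V s' (Seq (cached_pre (Diff AllStates (svar ''D''))) (Seq (sset ''V'' (svar ''R''))
     (Seq (cached_pre (svar ''D'')) (sset ''D'' (Cup (Diff AllStates (svar ''V'')) (Cap SysStates (svar ''R''))))))) ?Q"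
  proof (rule tri_Seq_weaken[OF cached_pre[OF s'(1)]], simp, simp, simp)
    fix s1 assume s1: "inv s1" "same {''k'', ''n'', ''i''} {''B'', ''P'', ''T'', ''R''} s' s1"
      "snd s1 ''R'' 0 = pre H (sval H FA FG (Diff AllStates (svar ''D'')) s')"
    note [simp] = same_snd[OF s1(2)]
    show "tri ?M ?V s1 (Seq (sset ''V'' (svar ''R''))
     (Seq (cached_pre (svar ''D'')) (sset ''D'' (Cup (Diff AllStates (svar ''V'')) (Cap SysStates (svar ''R'')))))) ?Q"
    proof (rule tri_sset_Seq[OF s1(1)], simp, simp, simp)
      fix s2 assume s2: "s2 = (fst s1, set_cell (snd s1) ''V'' 0 (sval H FA FG (svar ''R'') s1))" "inv s2"
      have s2': "snd s2 ''V'' 0 = pre H (states H - snd s' ''D'' 0)" "snd s2 ''D'' = snd s' ''D''"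
          "snd s2 ''Do'' = snd s' ''Do''"
        using s1(3) by (simp_all add: s2(1))
      show "tri ?M ?V s2 (Seq (cached_pre (svar ''D'')) (sset ''D'' (Cup (Diff AllStates (svar ''V''))
          (Cap SysStates (svar ''R''))))) ?Q"
      proof (rule tri_Seq_weaken[OF cached_pre[OF s2(2)]], simp, simp, simp)
        fix s3 assume s3: "inv s3" "same {''k'', ''n'', ''i''} {''B'', ''P'', ''T'', ''R''} s2 s3"
          "snd s3 ''R'' 0 = pre H (sval H FA FG (svar ''D'') s2)"
        have "(states H - pre H (states H - D)) \<union> (sys_states H \<inter> pre H D) = dead_step D" for D
          unfolding pre_eq dead_step_def using E_sub by blast
        then show "tri ?M ?V s3 (sset ''D'' (Cup (Diff AllStates (svar ''V'')) (Cap SysStates (svar ''R'')))) ?Q"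
          using s3(1,3) s2' by (intro tri_sset) (simp_all add: same_snd[OF s3(2)])
      qed
    qed
  qed
qed simp_all

lemma w_prog:
  assumes "inv s" "snd s ''D'' 0 = dead" "fst s ''b'' 0 < length FA" "snd s ''Bs'' 0 \<subseteq> states H"
  shows "tri {''k'', ''n'', ''i''} {''B'', ''P'', ''T'', ''R'', ''V'', ''C'', ''W'', ''Wo''} s w_prog
    (\<lambda>s'. snd s' ''W'' 0 = x_step (snd s ''Bs'' 0) (FA ! fst s ''b'' 0) (snd s ''X'' 0))"
  unfolding w_prog_def x_step_def
proof (rule repeat_until_lfp[OF mono_w_step w_step_sub[OF assms(4)] assms(1)])
  let ?M = "{''k'', ''n'', ''i''}" and ?V = "{''B'', ''P'', ''T'', ''R'', ''V'', ''C'', ''W'', ''Wo''}"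
  fix s' assume s': "inv s'" "same ?M ?V s s'"
  note [simp] = same_snd[OF s'(2)] same_fst[OF s'(2)]
  show "tri ?M ?V s' (Seq (cpre_prog ''W'' ''X'') (sset ''W'' (Cup (svar ''Bs'') (Diff (svar ''C'') (Asm (var ''b''))))))
    (\<lambda>s''. snd s'' ''W'' 0 = w_step (snd s ''Bs'' 0) (FA ! fst s ''b'' 0) (snd s ''X'' 0) (snd s' ''W'' 0)
        \<and> snd s'' ''Wo'' = snd s' ''Wo'')"
  proof (rule tri_Seq_weaken[OF cpre_prog[OF s'(1)]])
    fix s1 assume s1: "inv s1" "same {''k'', ''n'', ''i''} {''B'', ''P'', ''T'', ''R'', ''V'', ''C''} s' s1"
      "snd s1 ''C'' 0 = cpre (snd s' ''W'' 0) (snd s' ''X'' 0)"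
    then show "tri ?M ?V s1 (sset ''W'' (Cup (svar ''Bs'') (Diff (svar ''C'') (Asm (var ''b'')))))
      (\<lambda>s''. snd s'' ''W'' 0 = w_step (snd s ''Bs'' 0) (FA ! fst s ''b'' 0) (snd s ''X'' 0)
          (snd s' ''W'' 0) \<and> snd s'' ''Wo'' = snd s' ''Wo'')"
      using assms(3) by (intro tri_sset) (simp_all add: same_snd[OF s1(2)] same_fst[OF s1(2)] w_step_def)
  qed (use assms(2) in simp_all)
qed simp_all

lemma x_prog:
  assumes "inv s" "snd s ''D'' 0 = dead" "fst s ''b'' 0 < length FA" "snd s ''Bs'' 0 \<subseteq> states H"
  shows "tri {''k'', ''n'', ''i''} {''B'', ''P'', ''T'', ''R'', ''V'', ''C'', ''W'', ''Wo'', ''X'', ''Xo''} s x_prog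
    (\<lambda>s'. snd s' ''X'' 0 = avoid (snd s ''Bs'' 0) (FA ! fst s ''b'' 0))"
  unfolding x_prog_def avoid_def
proof (rule repeat_until_gfp[OF mono_x_step x_step_sub[OF assms(4)] assms(1)])
  let ?M = "{''k'', ''n'', ''i''}" and ?V = "{''B'', ''P'', ''T'', ''R'', ''V'', ''C'', ''W'', ''Wo'', ''X'', ''Xo''}"
  fix s' assume s': "inv s'" "same ?M ?V s s'"
  note [simp] = same_snd[OF s'(2)] same_fst[OF s'(2)]
  show "tri ?M ?V s' (Seq w_prog (sset ''X'' (svar ''W'')))
    (\<lambda>s''. snd s'' ''X'' 0 = x_step (snd s ''Bs'' 0) (FA ! fst s ''b'' 0) (snd s' ''X'' 0) \<and>
        snd s'' ''Xo'' = snd s' ''Xo'')"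
  proof (rule tri_Seq_weaken[OF w_prog[OF s'(1)]])
    fix s1 assume s1: "inv s1" "same {''k'', ''n'', ''i''} {''B'', ''P'', ''T'', ''R'', ''V'', ''C'', ''W'', ''Wo''} s' s1"
      "snd s1 ''W'' 0 = x_step (snd s' ''Bs'' 0) (FA ! fst s' ''b'' 0) (snd s' ''X'' 0)"
    then show "tri ?M ?V s1 (sset ''X'' (svar ''W''))
      (\<lambda>s''. snd s'' ''X'' 0 = x_step (snd s ''Bs'' 0) (FA ! fst s ''b'' 0) (snd s' ''X'' 0) \<and>
          snd s'' ''Xo'' = snd s' ''Xo'')"
      by (intro tri_sset) (simp_all add: same_snd[OF s1(2)])
  qed (use assms in simp_all)
qed simp_all

lemma b_prog:
  assumes "inv s" "snd s ''D'' 0 = dead" "fst s ''lo'' 0 \<le> fst s ''hi'' 0" "fst s ''hi'' 0 \<le>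
      length FA" "snd s ''Bs'' 0 \<subseteq> states H"
  shows "tri {''k'', ''n'', ''i'', ''b''} {''B'', ''P'', ''T'', ''R'', ''V'', ''C'', ''W'', ''Wo'', ''X'', ''Xo'', ''Yn''} s b_prog
    (\<lambda>s'. snd s' ''Yn'' 0 = (\<Union>b \<in> {fst s ''lo'' 0..<fst s ''hi'' 0}. avoid (snd s ''Bs'' 0) (FA ! b)))"
  unfolding b_prog_def
proof (rule tri_sset_Seq[OF assms(1)], simp, simp, simp, rule tri_nset_Seq, assumption, simp, simp)
  let ?M = "{''k'', ''n'', ''i'', ''b''}" and ?V =
      "{''B'', ''P'', ''T'', ''R'', ''V'', ''C'', ''W'', ''Wo'', ''X'', ''Xo'', ''Yn''}"
  let ?lo = "fst s ''lo'' 0" and ?hi = "fst s ''hi'' 0"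
      and ?U = "\<lambda>n. \<Union>b \<in> {fst s ''lo'' 0..<n}. avoid (snd s ''Bs'' 0) (FA ! b)"
  fix s1 s2
  assume s2: "s1 = (fst s, set_cell (snd s) ''Yn'' 0 (sval H FA FG (Diff AllStates AllStates) s))"
    "s2 = (set_cell (fst s1) ''b'' 0 (nval (var ''lo'') (fst s1)), snd s1)" "inv s2"
  have same2: "same ?M ?V s s2" by (simp add: s2 same_def)
  let ?p = "Seq x_prog (Seq (sset ''Yn'' (Cup (svar ''Yn'') (svar ''X''))) (nset ''b'' (Plus (var ''b'') (Lit 1))))"
  define I where "I s' \<longleftrightarrow> ?lo \<le> fst s' ''b'' 0 \<and> fst s' ''b'' 0 \<le> ?hi \<and>
      snd s' ''Yn'' 0 = ?U (fst s' ''b'' 0)" for s' :: "'q sym_state"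
  show "tri ?M ?V s2 (Loop (NLess (var ''b'') (var ''hi'')) ?p) (\<lambda>s'. snd s' ''Yn'' 0 = ?U ?hi)"
  proof (rule tri_Loop[where I = I and \<mu> = "\<lambda>s'. ?hi - fst s' ''b'' 0"])
    fix s' assume s': "inv s'" "same ?M ?V s2 s'" "I s'" "sym_tst H FA FG (NLess (var ''b'') (var ''hi'')) s'"
    note same' = same_trans[OF same2 s'(2)]
    note [simp] = same_snd[OF same'] same_fst[OF same']
    have b: "fst s' ''b'' 0 < ?hi" using s'(4) by simp
    show "tri ?M ?V s' ?p (\<lambda>s''. I s'' \<and> ?hi - fst s'' ''b'' 0 < ?hi - fst s' ''b'' 0)"
    proof (rule tri_Seq_weaken[OF x_prog[OF s'(1)]])
      fix s3 assume s3: "inv s3" "same {''k'', ''n'', ''i''}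
          {''B'', ''P'', ''T'', ''R'', ''V'', ''C'', ''W'', ''Wo'', ''X'', ''Xo''} s' s3"
        "snd s3 ''X'' 0 = avoid (snd s' ''Bs'' 0) (FA ! fst s' ''b'' 0)"
      have *: "{?lo..<Suc (fst s' ''b'' 0)} = insert (fst s' ''b'' 0) {?lo..<fst s' ''b'' 0}"
        using s'(3) by (auto simp: I_def)
      show "tri ?M ?V s3 (Seq (sset ''Yn'' (Cup (svar ''Yn'') (svar ''X''))) (nset ''b'' (Plus (var ''b'') (Lit 1))))
          (\<lambda>s''. I s'' \<and> ?hi - fst s'' ''b'' 0 < ?hi - fst s' ''b'' 0)"
        using s'(3) s3(1,3) b * by (intro tri_sset_Seq tri_nset) (simp_all add: I_def same_snd[OF s3(2)]
            same_fst[OF s3(2)] Un_commute diff_less_mono2)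
    qed (use assms b in simp_all)
  next
    fix s' assume s': "inv s'" "same ?M ?V s2 s'" "I s'" "\<not> sym_tst H FA FG (NLess (var ''b'') (var ''hi'')) s'"
    note same' = same_trans[OF same2 s'(2)]
    have "fst s' ''b'' 0 = ?hi" using s'(3,4) by (simp add: I_def same_fst[OF same'])
    with s'(3) show "snd s' ''Yn'' 0 = ?U ?hi" by (simp add: I_def)
  qed (use s2 assms in \<open>auto simp: I_def\<close>)
qed

lemma y_prog:
  assumes "inv s" "snd s ''D'' 0 = dead" "fst s ''lo'' 0 \<le> fst s ''hi'' 0" "fst s ''hi'' 0 \<le>
      length FA" "snd s ''Tg'' 0 \<subseteq> states H"
  shows "tri {''k'', ''n'', ''i'', ''b''} {''B'', ''P'', ''T'', ''R'', ''V'', ''C'', ''W'', ''Wo'', ''X'', ''Xo'', ''Yn'', ''Bs'', ''Y'', ''Yo''} s y_prog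
    (\<lambda>s'. snd s' ''Y'' 0 = lfp (y_step (snd s ''Tg'' 0) ((!) FA ` {fst s ''lo'' 0..<fst s ''hi'' 0})))"
  unfolding y_prog_def
proof (rule repeat_until_lfp[OF mono_y_step y_step_sub[OF assms(5) order_refl] assms(1)])
  let ?M = "{''k'', ''n'', ''i'', ''b''}" and ?V =
      "{''B'', ''P'', ''T'', ''R'', ''V'', ''C'', ''W'', ''Wo'', ''X'', ''Xo'', ''Yn'', ''Bs'', ''Y'', ''Yo''}"
  fix s' assume s': "inv s'" "same ?M ?V s s'" "snd s' ''Y'' 0 \<subseteq> states H"
  note [simp] = same_snd[OF s'(2)] same_fst[OF s'(2)]
  let ?Q = "\<lambda>s''. snd s'' ''Y'' 0 = y_step (snd s ''Tg'' 0) ((!) FA ` {fst s ''lo'' 0..<fst s ''hi'' 0})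
      (snd s' ''Y'' 0) \<and> snd s'' ''Yo'' = snd s' ''Yo''"
  show "tri ?M ?V s' (Seq (cpre_prog ''Y'' ''Y'') (Seq (sset ''Bs'' (Cup (svar ''Tg'') (Cup (svar ''Y'') (svar ''C''))))
      (Seq b_prog (sset ''Y'' (svar ''Yn''))))) ?Q"
  proof (rule tri_Seq_weaken[OF cpre_prog[OF s'(1)]])
    fix s1 assume s1: "inv s1" "same {''k'', ''n'', ''i''} {''B'', ''P'', ''T'', ''R'', ''V'', ''C''} s' s1"
      "snd s1 ''C'' 0 = cpre (snd s' ''Y'' 0) (snd s' ''Y'' 0)"
    note eq1 = same_snd[OF s1(2)] same_fst[OF s1(2)]
    show "tri ?M ?V s1 (Seq (sset ''Bs'' (Cup (svar ''Tg'') (Cup (svar ''Y'') (svar ''C''))))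
        (Seq b_prog (sset ''Y'' (svar ''Yn'')))) ?Q"
    proof (rule tri_sset_Seq[OF s1(1)], simp, simp, simp)
      fix s2 assume s2: "s2 = (fst s1, set_cell (snd s1) ''Bs'' 0
          (sval H FA FG (Cup (svar ''Tg'') (Cup (svar ''Y'') (svar ''C''))) s1))" "inv s2"
      have Bs: "snd s2 ''Bs'' 0 = base (snd s ''Tg'' 0) (snd s' ''Y'' 0)"
        using s1(3) by (simp add: s2(1) base_def eq1 Un_assoc)
      have eq2: "snd s2 ''D'' 0 = dead" "fst s2 ''lo'' 0 = fst s ''lo'' 0" "fst s2 ''hi'' 0 = fst s ''hi'' 0"
          "snd s2 ''Yo'' = snd s' ''Yo''"
        using assms(2) by (simp_all add: s2(1) eq1)
      show "tri ?M ?V s2 (Seq b_prog (sset ''Y'' (svar ''Yn''))) ?Q"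
      proof (rule tri_Seq_weaken[OF b_prog[OF s2(2)]])
        fix s3 assume s3: "inv s3" "same {''k'', ''n'', ''i'', ''b''}
            {''B'', ''P'', ''T'', ''R'', ''V'', ''C'', ''W'', ''Wo'', ''X'', ''Xo'', ''Yn''} s2 s3"
          "snd s3 ''Yn'' 0 = (\<Union>b \<in> {fst s2 ''lo'' 0..<fst s2 ''hi'' 0}. avoid (snd s2 ''Bs'' 0) (FA ! b))"
        then show "tri ?M ?V s3 (sset ''Y'' (svar ''Yn'')) ?Q"
          using eq2 Bs by (intro tri_sset) (simp_all add: same_snd[OF s3(2)] y_step_def)
      qed (use assms eq2 Bs base_sub[OF assms(5) s'(3)] in simp_all)
    qed
  qed (use assms in simp_all)
qed simp_all

lemma stage_prog:
  assumes "inv s" "snd s ''D'' 0 = dead" "fst s ''lo'' 0 \<le> fst s ''hi'' 0" "fst s ''hi'' 0 \<le> length FA"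
  shows "tri {''k'', ''n'', ''i'', ''b''} {''B'', ''P'', ''T'', ''R'', ''V'', ''C'', ''W'', ''Wo'', ''X'', ''Xo'', ''Yn'', ''Bs'', ''Y'', ''Yo'', ''Tg''} s stage_prog
    (\<lambda>s'. snd s' ''Y'' 0 = stage (snd s ''J'' 0) ((!) FA ` {fst s ''lo'' 0..<fst s ''hi'' 0}) (snd s ''Z'' 0))"
  unfolding stage_prog_def stage_def
proof (rule tri_Seq_weaken[OF cpre_prog[OF assms(1)]])
  let ?M = "{''k'', ''n'', ''i'', ''b''}" and ?V =
      "{''B'', ''P'', ''T'', ''R'', ''V'', ''C'', ''W'', ''Wo'', ''X'', ''Xo'', ''Yn'', ''Bs'', ''Y'', ''Yo'', ''Tg''}"
  fix s1 assume s1: "inv s1" "same {''k'', ''n'', ''i''} {''B'', ''P'', ''T'', ''R'', ''V'', ''C''} s s1"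
    "snd s1 ''C'' 0 = cpre (snd s ''Z'' 0) (snd s ''Z'' 0)"
  note [simp] = same_snd[OF s1(2)] same_fst[OF s1(2)]
  let ?Q = "\<lambda>s'. snd s' ''Y'' 0 = lfp (y_step (snd s ''J'' 0 \<inter> cpre (snd s ''Z'' 0)
      (snd s ''Z'' 0)) ((!) FA ` {fst s ''lo'' 0..<fst s ''hi'' 0}))"
  show "tri ?M ?V s1 (Seq (sset ''Tg'' (Cap (svar ''J'') (svar ''C''))) y_prog) ?Q"
  proof (rule tri_sset_Seq[OF s1(1)], simp, simp, simp)
    fix s2 assume s2: "s2 = (fst s1, set_cell (snd s1) ''Tg'' 0 (sval H FA FG (Cap (svar ''J'') (svar ''C'')) s1))" "inv s2"
    have eq: "snd s2 ''Tg'' 0 = snd s ''J'' 0 \<inter> cpre (snd s ''Z'' 0) (snd s ''Z'' 0)" "snd s2 ''D'' 0 = dead"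
      "fst s2 ''lo'' 0 = fst s ''lo'' 0" "fst s2 ''hi'' 0 = fst s ''hi'' 0"
      using assms(2) s1(3) by (simp_all add: s2(1))
    show "tri ?M ?V s2 y_prog ?Q"
      by (rule tri_weaken[OF y_prog[OF s2(2)]]) (use assms eq cpre_sub in \<open>simp_all add: le_infI2\<close>)
  qed
qed (use assms in simp_all)

text \<open>Common to both kinds of jobs; \<open>P\<close> is asked only to leave the stage of job
  number \<open>g\<close> in \<open>Y\<close>.\<close>

lemma stage_loop:
  fixes P :: "(sym_action, sym_test) prog" and Zs :: "nat \<Rightarrow> 'q set"
  assumes s: "inv s" "fst s ''g'' 0 = 0" "fst s x 0 = n" "x \<in> {''nA'', ''nG''}"
    and P: "\<And>s' M V. inv s' \<Longrightarrow>
        same {''k'', ''n'', ''i'', ''b'', ''lo'', ''hi'', ''g''} {''B'', ''P'', ''T'', ''R'', ''V'', ''C'', ''W'',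
        ''Wo'', ''X'', ''Xo'', ''Yn'', ''Bs'', ''Y'', ''Yo'', ''Tg'', ''J'', ''Zn''} s s' \<Longrightarrow>
      fst s' ''g'' 0 < n \<Longrightarrow>
      tri {''k'', ''n'', ''i'', ''b'', ''lo'', ''hi''} {''B'', ''P'', ''T'', ''R'', ''V'', ''C'', ''W'', ''Wo'',
          ''X'', ''Xo'', ''Yn'', ''Bs'', ''Y'', ''Yo'', ''Tg'', ''J''} s' P
        (\<lambda>s''. snd s'' ''Y'' 0 = Zs (fst s' ''g'' 0))"
  shows "tri {''k'', ''n'', ''i'', ''b'', ''lo'', ''hi'', ''g''}
      {''B'', ''P'', ''T'', ''R'', ''V'', ''C'', ''W'', ''Wo'', ''X'', ''Xo'', ''Yn'', ''Bs'', ''Y'', ''Yo'',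
      ''Tg'', ''J'', ''Zn''} s
    (stage_loop x P)
    (\<lambda>s'. snd s' ''Zn'' 0 = snd s ''Zn'' 0 \<inter> (\<Inter>g<n. Zs g))"
proof -
  define I where "I s' \<longleftrightarrow> fst s' ''g'' 0 \<le> n \<and>
      snd s' ''Zn'' 0 = snd s ''Zn'' 0 \<inter> (\<Inter>g < fst s' ''g'' 0. Zs g)" for s' :: "'q sym_state"
  show ?thesis
    unfolding stage_loop_def
  proof (rule tri_Loop[where I = I and \<mu> = "\<lambda>s'. n - fst s' ''g'' 0"])
    let ?M = "{''k'', ''n'', ''i'', ''b'', ''lo'', ''hi'', ''g''}"
        and ?V = "{''B'', ''P'', ''T'', ''R'', ''V'', ''C'', ''W'', ''Wo'', ''X'', ''Xo'', ''Yn'', ''Bs'', ''Y'', ''Yo'', ''Tg'', ''J'', ''Zn''}"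
    fix s' assume s': "inv s'" "same ?M ?V s s'" "I s'" "sym_tst H FA FG (NLess (var ''g'') (var x)) s'"
    have g: "fst s' ''g'' 0 < n" using s'(4) s(3,4) by (auto simp: same_fst[OF s'(2)])
    show "tri ?M ?V s' (Seq P (Seq (sset ''Zn'' (Cap (svar ''Zn'') (svar ''Y''))) (nset ''g'' (Plus (var ''g'') (Lit 1)))))
      (\<lambda>s''. I s'' \<and> n - fst s'' ''g'' 0 < n - fst s' ''g'' 0)"
    proof (rule tri_Seq_weaken[OF P[OF s'(1,2) g]])
      fix s1 assume s1: "inv s1" "same {''k'', ''n'', ''i'', ''b'', ''lo'', ''hi''}
          {''B'', ''P'', ''T'', ''R'', ''V'', ''C'', ''W'', ''Wo'', ''X'', ''Xo'', ''Yn'', ''Bs'', ''Y'', ''Yo'',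
          ''Tg'', ''J''} s' s1"
        "snd s1 ''Y'' 0 = Zs (fst s' ''g'' 0)"
      show "tri ?M ?V s1 (Seq (sset ''Zn'' (Cap (svar ''Zn'') (svar ''Y''))) (nset ''g'' (Plus (var ''g'') (Lit 1))))
        (\<lambda>s''. I s'' \<and> n - fst s'' ''g'' 0 < n - fst s' ''g'' 0)"
        using s1(1,3) g s'(3)
        by (intro tri_sset_Seq tri_nset) (auto simp: I_def same_snd[OF s1(2)] same_fst[OF s1(2)] lessThan_Suc)
    qed simp_all
  next
    fix s' assume s': "same {''k'', ''n'', ''i'', ''b'', ''lo'', ''hi'', ''g''}
        {''B'', ''P'', ''T'', ''R'', ''V'', ''C'', ''W'', ''Wo'', ''X'', ''Xo'', ''Yn'', ''Bs'', ''Y'', ''Yo'',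
        ''Tg'', ''J'', ''Zn''} s s'"
      "I s'" "\<not> sym_tst H FA FG (NLess (var ''g'') (var x)) s'"
    then have "fst s' ''g'' 0 = n" using s(3,4) by (auto simp: same_fst[OF s'(1)] I_def)
    with s'(2) show "snd s' ''Zn'' 0 = snd s ''Zn'' 0 \<inter> (\<Inter>g<n. Zs g)" by (simp add: I_def)
  qed (use s in \<open>auto simp: I_def\<close>)
qed

text \<open>The form in which the program computes the step: the accumulator \<open>Zn\<close>
  starts from all states and is cut down by one job after the other.\<close>

lemma z_step_jobs:
  "z_step (jobs FA FG) Z = states H \<inter> (\<Inter>g < length FG. stage (FG ! g) (set FA) Z) \<inter>
     (\<Inter>g < length FA. stage (FA ! g) {FA ! g} Z)"
proof -
  have "z_step (jobs FA FG) Z = (\<Inter>G \<in> set FG. stage G (set FA) Z) \<inter> (\<Inter>A \<in> set FA.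
      stage A {A} Z)"
    by (auto simp: z_step_def jobs_def)
  also have "\<dots> = (\<Inter>g < length FG. stage (FG ! g) (set FA) Z) \<inter> (\<Inter>g < length FA. stage
      (FA ! g) {FA ! g} Z)"
    by (force simp: set_conv_nth)
  also have "(\<Inter>g < length FA. stage (FA ! g) {FA ! g} Z) \<subseteq> states H"
  proof -
    have "(\<Inter>g < length FA. stage (FA ! g) {FA ! g} Z) \<subseteq> stage (FA ! 0) {FA ! 0} Z"
      using FA by (intro INF_lower) simp
    then show ?thesis using stage_sub by blast
  qed
  ultimately show ?thesis by blast
qed

lemma z_prog:
  assumes s: "inv s" "snd s ''D'' 0 = dead"
  shows "tri {''k'', ''n'', ''i'', ''b'', ''lo'', ''hi'', ''g''}
      {''B'', ''P'', ''T'', ''R'', ''V'', ''C'', ''W'', ''Wo'', ''X'', ''Xo'', ''Yn'', ''Bs'', ''Y'', ''Yo'',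
      ''Tg'', ''J'', ''Zn'', ''Z'', ''Zo''} s z_prog
    (\<lambda>s'. snd s' ''Z'' 0 = solution (jobs FA FG))"
  unfolding z_prog_def solution_def
proof (rule repeat_until_gfp[OF mono_z_step _ s(1)])
  show "z_step (jobs FA FG) Z \<subseteq> states H" for Z unfolding z_step_jobs by blast
  let ?M = "{''k'', ''n'', ''i'', ''b'', ''lo'', ''hi'', ''g''}"
      and ?V = "{''B'', ''P'', ''T'', ''R'', ''V'', ''C'', ''W'', ''Wo'', ''X'', ''Xo'', ''Yn'', ''Bs'', ''Y'', ''Yo'', ''Tg'', ''J'', ''Zn'', ''Z'', ''Zo''}"
  let ?V1 = "{''B'', ''P'', ''T'', ''R'', ''V'', ''C'', ''W'', ''Wo'', ''X'', ''Xo'', ''Yn'', ''Bs'', ''Y'', ''Yo'', ''Tg'', ''J'', ''Zn''}"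
  fix s' assume s': "inv s'" "same ?M ?V s s'"
  note eq = same_snd[OF s'(2)] same_fst[OF s'(2)]
  let ?Z = "snd s' ''Z'' 0"
  show "tri ?M ?V s' (Seq (sset ''Zn'' AllStates)
     (Seq (nset ''g'' (Lit 0)) (Seq (stage_loop ''nG'' guarantee_prog)
     (Seq (nset ''g'' (Lit 0)) (Seq (stage_loop ''nA'' assumption_prog)
     (sset ''Z'' (svar ''Zn'')))))))
    (\<lambda>s''. snd s'' ''Z'' 0 = z_step (jobs FA FG) (snd s' ''Z'' 0) \<and> snd s'' ''Zo'' = snd s'
        ''Zo'')" (is "tri _ _ _ _ ?Q")
  proof (rule tri_sset_Seq[OF s'(1)], simp, simp, simp, rule tri_nset_Seq, assumption, simp, simp)
    fix s1 s2 assume s2: "s1 = (fst s', set_cell (snd s') ''Zn'' 0 (sval H FA FG AllStates s'))"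
      "s2 = (set_cell (fst s1) ''g'' 0 (nval (Lit 0) (fst s1)), snd s1)" "inv s2"
    have D: "snd s' ''D'' 0 = dead" using s(2) by (simp add: eq)
    have n: "fst s2 ''nA'' 0 = length FA" "fst s2 ''nG'' 0 = length FG" using s2(3) by (auto simp: inv_def)
    show "tri ?M ?V s2 (Seq (stage_loop ''nG'' guarantee_prog)
     (Seq (nset ''g'' (Lit 0)) (Seq (stage_loop ''nA'' assumption_prog) (sset ''Z'' (svar ''Zn''))))) ?Q"
    proof (rule tri_Seq_weaken[OF stage_loop[where Zs = "\<lambda>g. stage (FG ! g) (set FA) ?Z" and n = "length FG"]])
      fix s3 assume s3: "inv s3" "same ?M ?V1 s2 s3" "fst s3 ''g'' 0 < length FG"
      note eq3 = same_snd[OF s3(2)] same_fst[OF s3(2)]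
      show "tri {''k'', ''n'', ''i'', ''b'', ''lo'', ''hi''}
          {''B'', ''P'', ''T'', ''R'', ''V'', ''C'', ''W'', ''Wo'', ''X'', ''Xo'', ''Yn'', ''Bs'', ''Y'', ''Yo'',
          ''Tg'', ''J''}
          s3 guarantee_prog (\<lambda>s''. snd s'' ''Y'' 0 = stage (FG ! (fst s3 ''g'' 0)) (set FA) ?Z)"
        unfolding guarantee_prog_def
      proof (rule tri_sset_Seq[OF s3(1)], simp, simp, simp, rule tri_nset_Seq, assumption, simp, simp,
          rule tri_nset_Seq, assumption, simp, simp)
        fix t1 t2 t3 assume t: "t1 = (fst s3, set_cell (snd s3) ''J'' 0 (sval H FA FG (Gua (var ''g'')) s3))"
          "t2 = (set_cell (fst t1) ''lo'' 0 (nval (Lit 0) (fst t1)), snd t1)"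
          "t3 = (set_cell (fst t2) ''hi'' 0 (nval (var ''nA'') (fst t2)), snd t2)" "inv t3"
        have "fst s3 ''nA'' 0 = length FA" using s3(1) by (simp add: inv_def)
        then have "snd t3 ''D'' 0 = dead" "fst t3 ''lo'' 0 = 0" "fst t3 ''hi'' 0 = length FA" "snd t3 ''Z'' 0 = ?Z"
            "snd t3 ''J'' 0 = FG ! fst s3 ''g'' 0"
          using D s3(3) by (simp_all add: t(1-3) eq3 s2(1,2))
        moreover have "(!) FA ` {0..<length FA} = set FA" by (auto simp: set_conv_nth)
        ultimately show "tri {''k'', ''n'', ''i'', ''b'', ''lo'', ''hi''}
            {''B'', ''P'', ''T'', ''R'', ''V'', ''C'', ''W'', ''Wo'', ''X'', ''Xo'', ''Yn'', ''Bs'', ''Y'',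
            ''Yo'', ''Tg'', ''J''}
          t3 stage_prog (\<lambda>s''. snd s'' ''Y'' 0 = stage (FG ! (fst s3 ''g'' 0)) (set FA) ?Z)"
          by (intro tri_weaken[OF stage_prog[OF t(4)]]) simp_all
      qed
    next
      fix s3 assume s3: "inv s3" "same ?M ?V1 s2 s3"
        "snd s3 ''Zn'' 0 = snd s2 ''Zn'' 0 \<inter> (\<Inter>g < length FG. stage (FG ! g) (set FA) ?Z)"
      note eq3 = same_snd[OF s3(2)] same_fst[OF s3(2)]
      show "tri ?M ?V s3 (Seq (nset ''g'' (Lit 0)) (Seq (stage_loop ''nA'' assumption_prog) (sset ''Z'' (svar ''Zn'')))) ?Q"
      proof (rule tri_nset_Seq[OF s3(1)], simp, simp)
        fix s4 assume s4: "s4 = (set_cell (fst s3) ''g'' 0 (nval (Lit 0) (fst s3)), snd s3)" "inv s4"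
        show "tri ?M ?V s4 (Seq (stage_loop ''nA'' assumption_prog) (sset ''Z'' (svar ''Zn''))) ?Q"
        proof (rule tri_Seq_weaken[OF stage_loop[where Zs = "\<lambda>g. stage (FA ! g) {FA ! g} ?Z" and n = "length FA"]])
          fix s5 assume s5: "inv s5" "same ?M ?V1 s4 s5" "fst s5 ''g'' 0 < length FA"
          note eq5 = same_snd[OF s5(2)] same_fst[OF s5(2)]
          show "tri {''k'', ''n'', ''i'', ''b'', ''lo'', ''hi''}
              {''B'', ''P'', ''T'', ''R'', ''V'', ''C'', ''W'', ''Wo'', ''X'', ''Xo'', ''Yn'', ''Bs'', ''Y'',
              ''Yo'', ''Tg'', ''J''}
              s5 assumption_prog (\<lambda>s''. snd s'' ''Y'' 0 = stage (FA ! (fst s5 ''g'' 0)) {FA ! (fst s5 ''g'' 0)} ?Z)"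
            unfolding assumption_prog_def
          proof (rule tri_sset_Seq[OF s5(1)], simp, simp, simp, rule tri_nset_Seq, assumption, simp, simp,
              rule tri_nset_Seq, assumption, simp, simp)
            fix t1 t2 t3 assume t: "t1 = (fst s5, set_cell (snd s5) ''J'' 0 (sval H FA FG (Asm (var ''g'')) s5))"
              "t2 = (set_cell (fst t1) ''lo'' 0 (nval (var ''g'') (fst t1)), snd t1)"
              "t3 = (set_cell (fst t2) ''hi'' 0 (nval (Plus (var ''g'') (Lit 1)) (fst t2)), snd t2)" "inv t3"
            have "snd t3 ''D'' 0 = dead" "fst t3 ''lo'' 0 = fst s5 ''g'' 0" "fst t3 ''hi'' 0 = Suc (fst s5 ''g'' 0)"
              "snd t3 ''Z'' 0 = ?Z" "snd t3 ''J'' 0 = FA ! fst s5 ''g'' 0"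
              using D s5(3) by (simp_all add: t(1-3) eq5 s4(1) eq3 s2(1,2))
            moreover have "(!) FA ` {g..<Suc g} = {FA ! g}" for g by simp
            ultimately show "tri {''k'', ''n'', ''i'', ''b'', ''lo'', ''hi''}
                {''B'', ''P'', ''T'', ''R'', ''V'', ''C'', ''W'', ''Wo'', ''X'', ''Xo'', ''Yn'', ''Bs'', ''Y'',
                ''Yo'', ''Tg'', ''J''}
              t3 stage_prog (\<lambda>s''. snd s'' ''Y'' 0 = stage (FA ! (fst s5 ''g'' 0)) {FA ! (fst s5 ''g'' 0)} ?Z)"
              using s5(3) by (intro tri_weaken[OF stage_prog[OF t(4)]]) simp_all
          qed
        next
          fix s5 assume s5: "inv s5" "same ?M ?V1 s4 s5"
            "snd s5 ''Zn'' 0 = snd s4 ''Zn'' 0 \<inter> (\<Inter>g < length FA. stage (FA ! g) {FA ! g} ?Z)"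
          have "snd s5 ''Zn'' 0 = z_step (jobs FA FG) ?Z" "snd s5 ''Zo'' = snd s' ''Zo''"
            using s5(3) s3(3) by (simp_all add: same_snd[OF s5(2)] s4(1) eq3 s2(1,2) z_step_jobs)
          then show "tri ?M ?V s5 (sset ''Z'' (svar ''Zn'')) ?Q"
            using s5(1) by (intro tri_sset) simp_all
        qed (use s4 n in \<open>simp_all add: eq3\<close>)
      qed
    qed (use s2 n in simp_all)
  qed
qed simp_all

lemma sym_prog_correct:
  "\<exists>c s. sym_run H FA FG sym_prog (sym_input FA FG) c s \<and>
     (accepts (fst s) \<longleftrightarrow> initial H \<in> solution (jobs FA FG)) \<and> c \<le> 3 * card (states H)"
proof -
  let ?s = "sym_input FA FG :: 'q sym_state"
  \<comment> \<open>The first block consists of all states, and its predecessor is the one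
    evaluation outside the balance. With \<open>k\<close> blocks at the end the total is
    \<open>2 * k - 1\<close>, well below three times the number of states.\<close>
  define s1 where "s1 = (set_cell (fst ?s) ''k'' 0 1,
    set_cell (set_cell (snd ?s) ''B'' 0 (states H)) ''P'' 0 (pre H (states H)))"
  have init: "initial H \<in> states H" using game by (auto simp: game_graph_def states_def)
  have inv1: "inv s1"
    using init by (auto simp: inv_def s1_def sym_input_def set_cell_def)
  let ?M = "{''k'', ''n'', ''i'', ''b'', ''lo'', ''hi'', ''g'', ''out''}"
  let ?V = "{''B'', ''P'', ''T'', ''R'', ''V'', ''C'', ''W'', ''Wo'', ''X'', ''Xo'', ''Yn'', ''Bs'', ''Y'', ''Yo'', ''Tg'', ''J'', ''Zn'', ''Z'', ''Zo'', ''D'', ''Do''}"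
  let ?Q = "\<lambda>s. accepts (fst s) \<longleftrightarrow> initial H \<in> solution (jobs FA FG)"
  let ?p = "Cond (Subset InitState (svar ''Z'')) (nset ''out'' (Lit 1)) Skip"
  have "tri ?M ?V s1 (Seq dead_prog (Seq z_prog ?p)) ?Q"
  proof (rule tri_Seq_weaken[OF dead_prog[OF inv1]])
    fix s2 assume s2: "inv s2" "same {''k'', ''n'', ''i''} {''B'', ''P'', ''T'', ''R'', ''V'', ''D'', ''Do''} s1
        s2" "snd s2 ''D'' 0 = dead"
    show "tri ?M ?V s2 (Seq z_prog ?p) ?Q"
    proof (rule tri_Seq_weaken[OF z_prog[OF s2(1,3)]])
      fix s3 assume s3: "inv s3" "same {''k'', ''n'', ''i'', ''b'', ''lo'', ''hi'', ''g''}
          {''B'', ''P'', ''T'', ''R'', ''V'', ''C'', ''W'', ''Wo'', ''X'', ''Xo'', ''Yn'', ''Bs'', ''Y'', ''Yo'',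
          ''Tg'', ''J'', ''Zn'', ''Z'', ''Zo''} s2 s3"
        "snd s3 ''Z'' 0 = solution (jobs FA FG)"
      have "fst s3 ''out'' 0 = 0"
        by (simp add: same_fst[OF s3(2)] same_fst[OF s2(2)] s1_def sym_input_def)
      then show "tri ?M ?V s3 ?p ?Q"
        using s3(1,3) by (intro tri_Cond tri_nset tri_Skip) (auto simp: accepts_def)
    qed simp_all
  qed simp_all
  then have run1: "swp (Seq dead_prog (Seq z_prog ?p)) s1 (\<lambda>c s. ?Q s \<and> Suc c \<le> 3 * card (states H))"
    unfolding tri_def
  proof (rule wp_mono)
    fix c s assume *: "inv s \<and> c + 2 * fst s1 ''k'' 0 = 2 * fst s ''k'' 0 \<and> same ?M ?V s1 s \<and> ?Q s"
    then have "fst s ''k'' 0 \<le> card (states H)" using inv_bound by blast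
    with * show "?Q s \<and> Suc c \<le> 3 * card (states H)" by (simp add: s1_def)
  qed
  have "swp sym_prog ?s (\<lambda>c s. ?Q s \<and> c \<le> 3 * card (states H))"
    unfolding sym_prog_def
    by (rule wp_Seq, rule wp_Do, rule wp_Seq, rule wp_Do, rule wp_Seq, rule wp_Do)
      (use run1 in \<open>simp add: s1_def\<close>)
  then show ?thesis unfolding wp_def by auto
qed

end

subsection \<open>The enumerative algorithm\<close>

text \<open>Boolean values are encoded as zero and nonzero numbers.\<close>

definition not_e :: "nexp \<Rightarrow> nexp" where "not_e a = Minus (Lit 1) a"
definition or_e :: "nexp \<Rightarrow> nexp \<Rightarrow> nexp" where "or_e a b = Plus a b"
definition and_e :: "nexp \<Rightarrow> nexp \<Rightarrow> nexp" where "and_e a b = not_e (or_e (not_e a) (not_e b))"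

lemma nval_not_e [simp]: "nval (not_e a) m = of_bool (nval a m = 0)"
  by (simp add: not_e_def)

lemma nval_or_e [simp]: "nval (or_e a b) m = nval a m + nval b m"
  by (simp add: or_e_def)

lemma nval_and_e [simp]: "nval (and_e a b) m = of_bool (nval a m \<noteq> 0 \<and> nval b m \<noteq> 0)"
  by (simp add: and_e_def)

lemma ncost_bool [simp]:
  "ncost (not_e a) = 2 + ncost a" "ncost (or_e a b) = 1 + ncost a + ncost b" "ncost (and_e a b) = 7 + ncost a + ncost b"
  by (simp_all add: not_e_def or_e_def and_e_def)

abbreviation aset :: "string \<Rightarrow> nexp \<Rightarrow> nexp \<Rightarrow> (ram_action, ram_test) prog" where
  "aset x i e \<equiv> Do (Assign x i e)"
abbreviation vset :: "string \<Rightarrow> nexp \<Rightarrow> (ram_action, ram_test) prog" where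
  "vset x e \<equiv> Do (Assign x (Lit 0) e)"
abbreviation true_t :: "nexp \<Rightarrow> ram_test" where
  "true_t e \<equiv> Less (Lit 0) e"

definition for_prog :: "string \<Rightarrow> nexp \<Rightarrow> (ram_action, ram_test) prog \<Rightarrow>
    (ram_action, ram_test) prog" where
  "for_prog i e p = Seq (vset i (Lit 0)) (Loop (Less (var i) e) (Seq p (vset i (Plus (var i) (Lit 1)))))"

definition map_prog :: "string \<Rightarrow> nexp \<Rightarrow> nexp \<Rightarrow> (ram_action, ram_test) prog" where
  "map_prog x a e = for_prog ''i'' (var ''nQ'') (aset x (Plus a (var ''i'')) e)"

definition scan_prog :: "string \<Rightarrow> ram_test \<Rightarrow> (ram_action, ram_test) prog" where
  "scan_prog x t = for_prog ''i'' (var ''nT'') (Cond t (aset x (Cell ''src'' (var ''i'')) (Lit 1)) Skip)"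

text \<open>\<open>gd\<close> marks states with a good successor, one in \<open>x\<close>;
  \<open>bd\<close> marks those with a bad one, outside both \<open>x\<close> and \<open>D\<close>.
  Two scans of the edge list thus give all that \<open>cpre\<close> asks about single
  states.\<close>

definition succ_prog :: "string \<Rightarrow> (ram_action, ram_test) prog" where
  "succ_prog x = Seq (map_prog ''gd'' (Lit 0) (Lit 0)) (Seq (map_prog ''bd'' (Lit 0) (Lit 0))
     (Seq (scan_prog ''gd'' (true_t (Cell x (Cell ''tgt'' (var ''i'')))))
       (scan_prog ''bd'' (true_t (not_e (or_e (Cell x (Cell ''tgt'' (var ''i'')))
           (Cell ''D'' (Cell ''tgt'' (var ''i'')))))))))"

text \<open>With \<open>D\<close> itself as argument, \<open>bd\<close> refers to successors outside
  \<open>D\<close> alone, which is the test in \<open>dead_step\<close>. The number of rounds is the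
  one of \<open>dead_iterate\<close>.\<close>

definition ram_dead_prog :: "(ram_action, ram_test) prog" where
  "ram_dead_prog = Seq (map_prog ''D'' (Lit 0) (Lit 0)) (for_prog ''j'' (var ''nQ'') (Seq (succ_prog ''D'')
     (map_prog ''D'' (Lit 0) (or_e (not_e (Cell ''bd'' (var ''i''))) (and_e (Cell ''sys'' (var ''i''))
         (Cell ''gd'' (var ''i'')))))))"

text \<open>The predecessors of \<open>q\<close> are the first \<open>cnt[q]\<close> entries of \<open>PL\<close> from \<open>row[q] = q * T\<close> on; \<open>Qu\<close> is
  the queue, with tail \<open>tl\<close>, of a search of the states \<open>W\<close> backwards from \<open>bs\<close> through \<open>al\<close>.\<close>

definition row_prog :: "(ram_action, ram_test) prog" where
  "row_prog = Seq (vset ''acc'' (Lit 0)) (for_prog ''i'' (var ''nQ'')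
     (Seq (aset ''row'' (var ''i'') (var ''acc'')) (vset ''acc'' (Plus (var ''acc'') (var ''nT'')))))"

definition fill_prog :: "(ram_action, ram_test) prog" where
  "fill_prog = Seq (map_prog ''cnt'' (Lit 0) (Lit 0)) (for_prog ''i'' (var ''nT'')
     (Seq (aset ''PL'' (Plus (Cell ''row'' (Cell ''tgt'' (var ''i''))) (Cell ''cnt'' (Cell ''tgt'' (var ''i''))))
         (Cell ''src'' (var ''i'')))
       (aset ''cnt'' (Cell ''tgt'' (var ''i'')) (Plus (Cell ''cnt'' (Cell ''tgt'' (var ''i''))) (Lit 1)))))"

definition push_prog :: "nexp \<Rightarrow> (ram_action, ram_test) prog" where
  "push_prog p = Seq (aset ''W'' p (Lit 1)) (Seq (aset ''Qu'' (var ''tl'') p) (vset ''tl'' (Plus (var ''tl'') (Lit 1))))"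

definition visit_prog :: "(ram_action, ram_test) prog" where
  "visit_prog = for_prog ''i'' (Cell ''cnt'' (var ''t''))
      (Seq (vset ''p'' (Cell ''PL'' (Plus (Cell ''row'' (var ''t'')) (var ''i''))))
     (Cond (true_t (and_e (Cell ''al'' (var ''p'')) (not_e (Cell ''W'' (var ''p''))))) (push_prog (var ''p'')) Skip))"

definition bfs_prog :: "(ram_action, ram_test) prog" where
  "bfs_prog = Seq (vset ''tl'' (Lit 0)) (Seq (for_prog ''i'' (var ''nQ'')
       (Cond (true_t (Cell ''bs'' (var ''i''))) (push_prog (var ''i'')) (aset ''W'' (var ''i'') (Lit 0))))
     (Seq (vset ''h'' (Lit 0)) (Loop (Less (var ''h'') (var ''tl''))
       (Seq (vset ''t'' (Cell ''Qu'' (var ''h''))) (Seq visit_prog (vset ''h'' (Plus (var ''h'') (Lit 1))))))))"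

definition inputs :: "string set" where
  "inputs = {''nQ'', ''nT'', ''nA'', ''nG'', ''init'', ''sys'', ''src'', ''tgt'', ''A'', ''G''}"

text \<open>\<open>0 < T\<close> lets constant overheads be charged to the edge list; a game without
  transitions is dismissed by the first test of the program.\<close>

locale ram_arena =
  fixes m0 :: memory and N T nA nG :: nat
  assumes m0: "m0 ''nQ'' 0 = N" "m0 ''nT'' 0 = T" "m0 ''nA'' 0 = nA" "m0 ''nG'' 0 = nG"
    and src_less: "\<And>k. k < T \<Longrightarrow> m0 ''src'' k < N"
        and tgt_less: "\<And>k. k < T \<Longrightarrow> m0 ''tgt'' k < N"
    and pos: "0 < N" "0 < T" "0 < nA" "0 < nG"
begin

definition edges :: "(nat \<times> nat) set" where
  "edges = {(m0 ''src'' k, m0 ''tgt'' k) | k. k < T}"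

definition system :: "nat set" where
  "system = {q. q < N \<and> m0 ''sys'' q \<noteq> 0}"

lemma system_iff: "q < N \<Longrightarrow> q \<in> system \<longleftrightarrow> m0 ''sys'' q \<noteq> 0"
  by (simp add: system_def)

sublocale arena "{..<N}" edges system
  by unfold_locales (use src_less tgt_less in \<open>auto simp: edges_def\<close>)

section \<open>Cost triples with frames for machine programs\<close>

abbreviation rwp where "rwp \<equiv> wp ram_act ram_act_cost ram_tst ram_tst_cost"

definition ok :: "memory \<Rightarrow> bool" where
  "ok m \<longleftrightarrow> (\<forall>x \<in> inputs. m x = m0 x)"

definition keep :: "string set \<Rightarrow> memory \<Rightarrow> memory \<Rightarrow> bool" where
  "keep M m m' \<longleftrightarrow> (\<forall>x. x \<notin> M \<longrightarrow> m' x = m x)"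

definition rt :: "string set \<Rightarrow> memory \<Rightarrow> (ram_action, ram_test) prog \<Rightarrow>
    (nat \<Rightarrow> memory \<Rightarrow> bool) \<Rightarrow> bool" where
  "rt M m p Q \<longleftrightarrow> rwp p m (\<lambda>c m'. ok m' \<and> keep M m m' \<and> Q c m')"

lemma ok_simps:
  assumes "ok m"
  shows "m ''nQ'' 0 = N" "m ''nT'' 0 = T" "m ''nA'' 0 = nA" "m ''nG'' 0 = nG" "m ''sys'' = m0 ''sys''"
    "m ''src'' = m0 ''src''" "m ''tgt'' = m0 ''tgt''" "m ''A'' = m0 ''A''" "m ''G'' = m0 ''G''" "m ''init'' = m0 ''init''"
  using assms m0 by (auto simp: ok_def inputs_def)

lemma keep_refl: "keep M m m" by (simp add: keep_def)
lemma keep_trans: "keep M m m' \<Longrightarrow> keep M m' m'' \<Longrightarrow> keep M m m''" by (simp add: keep_def)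
lemma keep_mono: "keep M m m' \<Longrightarrow> M \<subseteq> M' \<Longrightarrow> keep M' m m'" by (auto simp: keep_def)
lemma keepD: "keep M m m' \<Longrightarrow> x \<notin> M \<Longrightarrow> m' x = m x" by (simp add: keep_def)
lemma keep_set_cell: "x \<in> M \<Longrightarrow> keep M m (set_cell m x i v)" by (auto simp: keep_def set_cell_def)

lemma ok_set_cell: "ok m \<Longrightarrow> x \<notin> inputs \<Longrightarrow> ok (set_cell m x i v)"
  by (auto simp: ok_def set_cell_def)

lemma rt_weaken:
  assumes "rt M m p R" "M \<subseteq> M'" "\<And>c m'. ok m' \<Longrightarrow> keep M m m' \<Longrightarrow>
      R c m' \<Longrightarrow> Q c m'"
  shows "rt M' m p Q"
  using assms keep_mono[OF _ assms(2)] unfolding rt_def by (auto elim!: wp_mono)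

lemma rt_Seq:
  assumes "rt M m p R" "M \<subseteq> M'"
    "\<And>c m'. ok m' \<Longrightarrow> keep M m m' \<Longrightarrow> R c m' \<Longrightarrow>
        rt M' m' p' (\<lambda>d. Q (c + d))"
  shows "rt M' m (Seq p p') Q"
  unfolding rt_def
  apply (rule wp_Seq, rule wp_mono[OF assms(1)[unfolded rt_def]], elim conjE)
  subgoal for c m'
    by (rule wp_mono[OF assms(3)[unfolded rt_def]]) (auto intro: keep_trans keep_mono[OF _ assms(2)])
  done

lemma rt_Do:
  assumes "ok m" "x \<in> M" "x \<notin> inputs" "Q (1 + ncost i + ncost e) (set_cell m x (nval i m) (nval e m))"
  shows "rt M m (aset x i e) Q"
  unfolding rt_def by (rule wp_Do) (use assms in \<open>simp add: ok_set_cell keep_set_cell\<close>)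

lemma rt_Do_Seq:
  assumes "ok m" "x \<in> M" "x \<notin> inputs"
    "\<And>m'. m' = set_cell m x (nval i m) (nval e m) \<Longrightarrow> ok m' \<Longrightarrow>
        rt M m' p (\<lambda>d. Q (1 + ncost i + ncost e + d))"
  shows "rt M m (Seq (aset x i e) p) Q"
  by (rule rt_Seq[OF rt_Do[OF assms(1-3), where Q = "\<lambda>c m'. c = 1 + ncost i + ncost e \<and>
      m' = set_cell m x (nval i m) (nval e m)"]])
    (use assms(4) in auto)

lemma rt_Skip: "ok m \<Longrightarrow> Q 0 m \<Longrightarrow> rt M m Skip Q"
  unfolding rt_def by (rule wp_Skip) (simp add: keep_refl)

lemma rt_Cond:
  assumes "ram_tst t m \<Longrightarrow> rt M m p (\<lambda>c. Q (ram_tst_cost t + c))"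
      "\<not> ram_tst t m \<Longrightarrow> rt M m p' (\<lambda>c. Q (ram_tst_cost t + c))"
  shows "rt M m (Cond t p p') Q"
  using assms unfolding rt_def by (intro wp_Cond) simp_all

lemma rt_Loop:
  fixes \<mu> :: "nat \<Rightarrow> memory \<Rightarrow> nat"
  assumes "ok m" "I 0 m"
    and body: "\<And>c m'. ok m' \<Longrightarrow> keep M m m' \<Longrightarrow> I c m' \<Longrightarrow>
        ram_tst t m' \<Longrightarrow>
      rt M m' p (\<lambda>c' m''. I (c + ram_tst_cost t + c') m'' \<and> \<mu> (c + ram_tst_cost t + c') m'' < \<mu> c m')"
    and exit: "\<And>c m'. ok m' \<Longrightarrow> keep M m m' \<Longrightarrow> I c m' \<Longrightarrow>
        \<not> ram_tst t m' \<Longrightarrow> Q (c + ram_tst_cost t) m'"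
  shows "rt M m (Loop t p) Q"
  unfolding rt_def
proof (rule wp_Loop[where \<mu> = \<mu> and I = "\<lambda>c m'. ok m' \<and> keep M m m' \<and> I c m'"])
  fix c m' assume m': "ok m' \<and> keep M m m' \<and> I c m'" and t: "ram_tst t m'"
  show "rwp p m' (\<lambda>c' m''. (ok m'' \<and> keep M m m'' \<and> I (c + ram_tst_cost t + c') m'') \<and>
      \<mu> (c + ram_tst_cost t + c') m'' < \<mu> c m')"
    using body[of m' c] m' t unfolding rt_def by (auto elim!: wp_mono intro: keep_trans)
qed (use assms in \<open>auto simp: keep_refl\<close>)

text \<open>The invariant counts the cost of the bodies only. Loop control adds 3 for the initial
  assignment, \<open>3 + ncost e\<close> for each of the \<open>n + 1\<close> tests and 6 for each
  increment.\<close>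

lemma rt_for_amortized:
  assumes m: "ok m" "i \<in> M" "i \<notin> inputs" and init: "I 0 0 (set_cell m i 0 0)"
    and bound: "\<And>k c m'. ok m' \<Longrightarrow> keep M m m' \<Longrightarrow> I k c m' \<Longrightarrow>
        k \<le> n \<Longrightarrow> m' i 0 = k \<Longrightarrow> nval e m' = n"
    and step: "\<And>k c m'. ok m' \<Longrightarrow> keep M m m' \<Longrightarrow> k < n \<Longrightarrow>
        m' i 0 = k \<Longrightarrow> I k c m' \<Longrightarrow>
      rt M m' p (\<lambda>c' m''. m'' i 0 = k \<and> I (Suc k) (c + c') (set_cell m'' i 0 (Suc k)))"
    and exit: "\<And>c m'. ok m' \<Longrightarrow> keep M m m' \<Longrightarrow> I n c m' \<Longrightarrow>
        Q (c + n * (9 + ncost e) + (6 + ncost e)) m'"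
  shows "rt M m (for_prog i e p) Q"
  unfolding for_prog_def
proof (rule rt_Do_Seq[OF m])
  fix m1 assume m1: "m1 = set_cell m i (nval (Lit 0) m) (nval (Lit 0) m)" "ok m1"
  have keep1: "keep M m m1" unfolding m1 using m(2) by (rule keep_set_cell)
  define J where "J C m' \<longleftrightarrow> (\<exists>k c. k \<le> n \<and> m' i 0 = k \<and> I k c m' \<and>
      C = c + k * (9 + ncost e))" for C m'
  show "rt M m1 (Loop (Less (var i) e) (Seq p (vset i (Plus (var i) (Lit 1)))))
      (\<lambda>d. Q (1 + ncost (Lit 0) + ncost (Lit 0) + d))"
  proof (rule rt_Loop[where I = J and \<mu> = "\<lambda>C m'. n - m' i 0"])
    fix C m' assume m': "ok m'" "keep M m1 m'" "J C m'" "ram_tst (Less (var i) e) m'"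
    note keep' = keep_trans[OF keep1 m'(2)]
    from m'(3) obtain k c where k: "k \<le> n" "m' i 0 = k" "I k c m'" "C = c + k * (9 + ncost e)"
      by (auto simp: J_def)
    with bound[OF m'(1) keep' k(3,1,2)] m'(4) have "k < n" by simp
    let ?R = "\<lambda>c' m''. J (C + ram_tst_cost (Less (var i) e) + c') m'' \<and> n - m'' i 0 < n - m' i 0"
    show "rt M m' (Seq p (vset i (Plus (var i) (Lit 1)))) ?R"
    proof (rule rt_Seq[OF step[OF m'(1) keep' \<open>k < n\<close> k(2,3)] order_refl])
      fix c' m'' assume "ok m''" and m'': "m'' i 0 = k \<and> I (Suc k) (c + c') (set_cell m'' i 0 (Suc k))"
      then show "rt M m'' (vset i (Plus (var i) (Lit 1))) (\<lambda>d. ?R (c' + d))"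
        using m k \<open>k < n\<close>
        by (intro rt_Do) (auto simp: J_def intro!: exI[of _ "c + c'"])
    qed
  next
    fix C m' assume m': "ok m'" "keep M m1 m'" "J C m'" "\<not> ram_tst (Less (var i) e) m'"
    note keep' = keep_trans[OF keep1 m'(2)]
    from m'(3) obtain k c where k: "k \<le> n" "m' i 0 = k" "I k c m'" "C = c + k * (9 + ncost e)"
      by (auto simp: J_def)
    with bound[OF m'(1) keep' k(3,1,2)] m'(4) have "k = n" by simp
    have "1 + ncost (Lit 0) + ncost (Lit 0) + (C + ram_tst_cost (Less (var i) e)) =
        c + n * (9 + ncost e) + (6 + ncost e)" using k(4) \<open>k = n\<close> by simp
    with exit[OF m'(1) keep', of c] k(3) \<open>k = n\<close>
    show "Q (1 + ncost (Lit 0) + ncost (Lit 0) + (C + ram_tst_cost (Less (var i) e))) m'" by metis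
  qed (use m1 init in \<open>auto simp: J_def\<close>)
qed

lemma rt_for:
  assumes m: "ok m" "i \<in> M" "i \<notin> inputs" and init: "I 0 (set_cell m i 0 0)"
    and bound: "\<And>k m'. ok m' \<Longrightarrow> keep M m m' \<Longrightarrow> I k m' \<Longrightarrow> nval e m' = n"
    and step: "\<And>k m'. ok m' \<Longrightarrow> keep M m m' \<Longrightarrow> k < n \<Longrightarrow>
        m' i 0 = k \<Longrightarrow> I k m' \<Longrightarrow>
      rt M m' p (\<lambda>c m''. c \<le> b \<and> m'' i 0 = k \<and> I (Suc k) (set_cell m'' i 0 (Suc k)))"
    and exit: "\<And>c m'. ok m' \<Longrightarrow> keep M m m' \<Longrightarrow> I n m' \<Longrightarrow> c \<le>
        n * (b + 9 + ncost e) + 6 + ncost e \<Longrightarrow> Q c m'"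
  shows "rt M m (for_prog i e p) Q"
proof (rule rt_for_amortized[where I = "\<lambda>k c m'. c \<le> k * b \<and> I k m'" and n = n, OF m])
  fix k c m' assume "ok m'" "keep M m m'" "k < n" "m' i 0 = k" "c \<le> k * b \<and> I k m'"
  then show "rt M m' p (\<lambda>c' m''. m'' i 0 = k \<and> c + c' \<le> Suc k * b \<and>
      I (Suc k) (set_cell m'' i 0 (Suc k)))"
    by (intro rt_weaken[OF step]) auto
qed (use init bound exit in \<open>auto simp: algebra_simps\<close>)

text \<open>The hypothesis on \<open>e\<close> supplies the old value of the cell that is about to
  be overwritten, so that an array can be updated in terms of itself.\<close>

lemma map_prog:
  assumes m: "ok m" "x \<notin> inputs" "x \<noteq> ''i''"
    and a: "\<And>m'. ok m' \<Longrightarrow> keep {x, ''i''} m m' \<Longrightarrow> nval a m' = off"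
    and e: "\<And>q m'. q < N \<Longrightarrow> ok m' \<Longrightarrow> keep {x, ''i''} m m' \<Longrightarrow>
        m' ''i'' 0 = q \<Longrightarrow> m' x (off + q) = m x (off + q) \<Longrightarrow> nval e m' = v q"
  shows "rt {x, ''i''} m (map_prog x a e) (\<lambda>c m'. c \<le> (ncost a + ncost e + 23) * N \<and>
    (\<forall>q<N. m' x (off + q) = v q) \<and> (\<forall>j. \<not> (off \<le> j \<and> j < off + N)
        \<longrightarrow> m' x j = m x j))"
  unfolding map_prog_def
proof (rule rt_for[where n = N and b = "4 + ncost a + ncost e" and
      I = "\<lambda>k m'. \<forall>j. m' x j = (if off \<le> j \<and> j < off + k then v (j - off) else m x j)"])
  fix k m' assume "ok m'" "keep {x, ''i''} m m'" "k < N" "m' ''i'' 0 = k"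
    "\<forall>j. m' x j = (if off \<le> j \<and> j < off + k then v (j - off) else m x j)"
  then show "rt {x, ''i''} m' (aset x (Plus a (var ''i'')) e) (\<lambda>c m''. c \<le>
      4 + ncost a + ncost e \<and> m'' ''i'' 0 = k \<and>
      (\<forall>j. set_cell m'' ''i'' 0 (Suc k) x j = (if off \<le> j \<and> j < off + Suc k then v (j - off) else m x j)))"
    using m a[of m'] e[of k m'] by (intro rt_Do) auto
next
  fix c and m' :: memory assume "c \<le> N * (4 + ncost a + ncost e + 9 + ncost (var ''nQ'')) + 6 + ncost (var ''nQ'')"
  \<comment> \<open>The cost of leaving the loop, 8, is spread over the \<open>N\<close> positive
    iterations; this is how the constant 23 arises from 15.\<close>
  moreover have "8 \<le> 8 * N" using pos by simp
  ultimately have "c \<le> (ncost a + ncost e + 23) * N" by (simp add: algebra_simps)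
  moreover assume "\<forall>j. m' x j = (if off \<le> j \<and> j < off + N then v (j - off) else m x j)"
  ultimately show "c \<le> (ncost a + ncost e + 23) * N \<and>
    (\<forall>q<N. m' x (off + q) = v q) \<and> (\<forall>j. \<not> (off \<le> j \<and> j < off + N)
        \<longrightarrow> m' x j = m x j)" by simp
qed (use m in \<open>auto simp: ok_simps inputs_def\<close>)

lemma scan_prog:
  assumes m: "ok m" "x \<notin> inputs" "x \<noteq> ''i''"
    and t: "\<And>k m'. k < T \<Longrightarrow> ok m' \<Longrightarrow> keep {x, ''i''} m m' \<Longrightarrow>
        m' ''i'' 0 = k \<Longrightarrow> ram_tst t m' \<longleftrightarrow> P k"
  shows "rt {x, ''i''} m (scan_prog x t) (\<lambda>c m'. c \<le> (ram_tst_cost t + 24) * T \<and>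
    (\<forall>q. m' x q = (if \<exists>k<T. m0 ''src'' k = q \<and> P k then 1 else m x q)))"
  unfolding scan_prog_def
proof (rule rt_for[where n = T and b = "5 + ram_tst_cost t" and
      I = "\<lambda>k m'. \<forall>q. m' x q = (if \<exists>l<k. m0 ''src'' l = q \<and> P l then 1 else m x q)"])
  fix k m' assume "ok m'" "keep {x, ''i''} m m'" "k < T" "m' ''i'' 0 = k"
    "\<forall>q. m' x q = (if \<exists>l<k. m0 ''src'' l = q \<and> P l then 1 else m x q)"
  then show "rt {x, ''i''} m' (Cond t (aset x (Cell ''src'' (var ''i'')) (Lit 1)) Skip) (\<lambda>c m''. c \<le>
      5 + ram_tst_cost t \<and> m'' ''i'' 0 = k \<and>
      (\<forall>q. set_cell m'' ''i'' 0 (Suc k) x q = (if \<exists>l<Suc k. m0 ''src'' l = q \<and> P l then 1 else m x q)))"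
    using m t[of k m'] by (intro rt_Cond rt_Do rt_Skip) (auto simp: less_Suc_eq ok_simps)
next
  fix c and m' :: memory assume "c \<le> T * (5 + ram_tst_cost t + 9 + ncost (var ''nT'')) + 6 + ncost (var ''nT'')"
  moreover have "8 \<le> 8 * T" using pos by simp
  ultimately have "c \<le> (ram_tst_cost t + 24) * T" by (simp add: algebra_simps)
  moreover assume "\<forall>q. m' x q = (if \<exists>l<T. m0 ''src'' l = q \<and> P l then 1 else m x q)"
  ultimately show "c \<le> (ram_tst_cost t + 24) * T \<and>
    (\<forall>q. m' x q = (if \<exists>k<T. m0 ''src'' k = q \<and> P k then 1 else m x q))" by simp
qed (use m in \<open>auto simp: ok_simps inputs_def\<close>)

section \<open>Successor scans, dead states and predecessor lists\<close>

definition elems :: "string \<Rightarrow> memory \<Rightarrow> nat set" where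
  "elems x m = {q. q < N \<and> m x q \<noteq> 0}"

lemma elems_keep: "keep M m m' \<Longrightarrow> x \<notin> M \<Longrightarrow> elems x m' = elems x m"
  by (simp add: elems_def keepD)

lemma succ_prog:
  assumes m: "ok m" "x \<notin> {''gd'', ''bd'', ''i''}"
  shows "rt {''gd'', ''bd'', ''i''} m (succ_prog x) (\<lambda>c m'. c \<le> 100 * (N + T) \<and>
    (\<forall>q<N. m' ''gd'' q \<noteq> 0 \<longleftrightarrow> (\<exists>q' \<in> elems x m. (q, q') \<in> edges)) \<and>
    (\<forall>q<N. m' ''bd'' q = 0 \<longleftrightarrow> (\<forall>q'. (q, q') \<in> edges \<longrightarrow>
        q' \<in> elems x m \<union> elems ''D'' m)))"
  unfolding succ_prog_def
proof (rule rt_Seq[OF map_prog[OF m(1), where off = 0 and v = "\<lambda>_. 0"]])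
  let ?M = "{''gd'', ''bd'', ''i''}"
  let ?Q = "\<lambda>c m'. c \<le> 100 * (N + T) \<and>
    (\<forall>q<N. m' ''gd'' q \<noteq> 0 \<longleftrightarrow> (\<exists>q' \<in> elems x m. (q, q') \<in> edges)) \<and>
    (\<forall>q<N. m' ''bd'' q = 0 \<longleftrightarrow> (\<forall>q'. (q, q') \<in> edges \<longrightarrow>
        q' \<in> elems x m \<union> elems ''D'' m))"
  let ?tg = "Cell ''tgt'' (var ''i'')"
  fix c1 m1 assume m1: "ok m1" "keep {''gd'', ''i''} m m1" "c1 \<le> (ncost (Lit 0) + ncost (Lit 0) + 23) * N \<and>
    (\<forall>q<N. m1 ''gd'' (0 + q) = 0) \<and> (\<forall>j. \<not> (0 \<le> j \<and> j < 0 + N)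
        \<longrightarrow> m1 ''gd'' j = m ''gd'' j)"
  show "rt ?M m1 (Seq (map_prog ''bd'' (Lit 0) (Lit 0)) (Seq (scan_prog ''gd'' (true_t (Cell x ?tg)))
       (scan_prog ''bd'' (true_t (not_e (or_e (Cell x ?tg) (Cell ''D'' ?tg))))))) (\<lambda>d. ?Q (c1 + d))"
  proof (rule rt_Seq[OF map_prog[OF m1(1), where off = 0 and v = "\<lambda>_. 0"]])
    fix c2 m2 assume m2: "ok m2" "keep {''bd'', ''i''} m1 m2" "c2 \<le> (ncost (Lit 0) + ncost (Lit 0) + 23) * N \<and>
      (\<forall>q<N. m2 ''bd'' (0 + q) = 0) \<and> (\<forall>j. \<not> (0 \<le> j \<and> j < 0 + N)
          \<longrightarrow> m2 ''bd'' j = m1 ''bd'' j)"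
    have x2: "m2 x = m x" "m2 ''D'' = m ''D''" "\<And>q. q < N \<Longrightarrow> m2 ''gd'' q = 0"
      using m(2) m1(3) by (auto simp: keepD[OF m2(2)] keepD[OF m1(2)])
    show "rt ?M m2 (Seq (scan_prog ''gd'' (true_t (Cell x ?tg)))
       (scan_prog ''bd'' (true_t (not_e (or_e (Cell x ?tg) (Cell ''D'' ?tg)))))) (\<lambda>d. ?Q (c1 + (c2 + d)))"
    proof (rule rt_Seq[OF scan_prog[OF m2(1), where P = "\<lambda>k. m x (m0 ''tgt'' k) \<noteq> 0"]])
      fix c3 m3 assume m3: "ok m3" "keep {''gd'', ''i''} m2 m3" "c3 \<le>
          (ram_tst_cost (true_t (Cell x ?tg)) + 24) * T \<and>
        (\<forall>q. m3 ''gd'' q = (if \<exists>k<T. m0 ''src'' k = q \<and> m x (m0 ''tgt'' k) \<noteq> 0 then 1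
            else m2 ''gd'' q))"
      have x3: "m3 x = m x" "m3 ''D'' = m ''D''" "\<And>q. q < N \<Longrightarrow> m3 ''bd'' q = 0"
        using m(2) m2(3) x2 by (auto simp: keepD[OF m3(2)])
      show "rt ?M m3 (scan_prog ''bd'' (true_t (not_e (or_e (Cell x ?tg) (Cell ''D'' ?tg)))))
          (\<lambda>d. ?Q (c1 + (c2 + (c3 + d))))"
      proof (rule rt_weaken[OF scan_prog[OF m3(1), where P = "\<lambda>k. m x (m0 ''tgt'' k) = 0 \<and>
          m ''D'' (m0 ''tgt'' k) = 0"]])
        fix c4 m4 assume m4: "ok m4" "keep {''bd'', ''i''} m3 m4"
          "c4 \<le> (ram_tst_cost (true_t (not_e (or_e (Cell x ?tg) (Cell ''D'' ?tg)))) + 24) * T \<and>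
          (\<forall>q. m4 ''bd'' q = (if \<exists>k<T. m0 ''src'' k = q \<and> m x (m0 ''tgt'' k) = 0 \<and>
              m ''D'' (m0 ''tgt'' k) = 0 then 1 else m3 ''bd'' q))"
        have "m4 ''gd'' = m3 ''gd''" by (simp add: keepD[OF m4(2)])
        then show "?Q (c1 + (c2 + (c3 + c4))) m4"
          using m1(3) m2(3) m3(3) m4(3) x2(3) x3(3) tgt_less
          by (auto simp: elems_def edges_def)
      qed (use m x3 in \<open>auto simp: inputs_def ok_simps keepD\<close>)
    qed (use m x2 in \<open>auto simp: inputs_def ok_simps keepD\<close>)
  qed (auto simp: inputs_def)
qed (auto simp: inputs_def)

lemma ram_dead_prog:
  assumes m: "ok m"
  shows "rt {''gd'', ''bd'', ''i'', ''j'', ''D''} m ram_dead_prog (\<lambda>c m'. c \<le>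
      300 * (N * (N + T)) \<and> elems ''D'' m' = dead)"
  unfolding ram_dead_prog_def
proof (rule rt_Seq[OF map_prog[OF m, where off = 0 and v = "\<lambda>_. 0"]])
  let ?M = "{''gd'', ''bd'', ''i'', ''j'', ''D''}"
  let ?e = "or_e (not_e (Cell ''bd'' (var ''i''))) (and_e (Cell ''sys'' (var ''i'')) (Cell ''gd'' (var ''i'')))"
  fix c1 m1 assume m1: "ok m1" "keep {''D'', ''i''} m m1" "c1 \<le> (ncost (Lit 0) + ncost (Lit 0) + 23) * N \<and>
    (\<forall>q<N. m1 ''D'' (0 + q) = 0) \<and> (\<forall>j. \<not> (0 \<le> j \<and> j < 0 + N) \<longrightarrow>
        m1 ''D'' j = m ''D'' j)"
  show "rt ?M m1 (for_prog ''j'' (var ''nQ'') (Seq (succ_prog ''D'') (map_prog ''D'' (Lit 0) ?e)))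
     (\<lambda>d m'. c1 + d \<le> 300 * (N * (N + T)) \<and> elems ''D'' m' = dead)"
  proof (rule rt_for[where n = N and b = "150 * (N + T)" and I = "\<lambda>k m'. elems ''D'' m' = (dead_step ^^ k) {}"])
    show "elems ''D'' (set_cell m1 ''j'' 0 0) = (dead_step ^^ 0) {}" using m1(3) by (simp add: elems_def)
  next
    fix k m' assume m': "ok m'" "keep ?M m1 m'" "k < N" "m' ''j'' 0 = k" "elems ''D'' m' = (dead_step ^^ k) {}"
    let ?R = "\<lambda>c m''. c \<le> 150 * (N + T) \<and> m'' ''j'' 0 = k \<and>
        elems ''D'' (set_cell m'' ''j'' 0 (Suc k)) = (dead_step ^^ Suc k) {}"
    show "rt ?M m' (Seq (succ_prog ''D'') (map_prog ''D'' (Lit 0) ?e)) ?R"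
    proof (rule rt_Seq[OF succ_prog[OF m'(1)]])
      fix c2 m2 assume m2: "ok m2" "keep {''gd'', ''bd'', ''i''} m' m2" "c2 \<le> 100 * (N + T) \<and>
        (\<forall>q<N. m2 ''gd'' q \<noteq> 0 \<longleftrightarrow> (\<exists>q' \<in> elems ''D'' m'. (q, q')
            \<in> edges)) \<and>
        (\<forall>q<N. m2 ''bd'' q = 0 \<longleftrightarrow> (\<forall>q'. (q, q') \<in> edges \<longrightarrow>
            q' \<in> elems ''D'' m' \<union> elems ''D'' m'))"
      show "rt ?M m2 (map_prog ''D'' (Lit 0) ?e) (\<lambda>d. ?R (c2 + d))"
      proof (rule rt_weaken[OF map_prog[OF m2(1), where off = 0
          and v = "\<lambda>q. of_bool (m2 ''bd'' q = 0) + of_bool (m0 ''sys'' q \<noteq> 0 \<and>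
          m2 ''gd'' q \<noteq> 0)"]])
        fix c3 m3 assume m3: "ok m3" "keep {''D'', ''i''} m2 m3" "c3 \<le> (ncost (Lit 0) + ncost ?e + 23) * N \<and>
          (\<forall>q<N. m3 ''D'' (0 + q) = of_bool (m2 ''bd'' q = 0) + of_bool (m0 ''sys'' q \<noteq> 0 \<and>
              m2 ''gd'' q \<noteq> 0)) \<and>
          (\<forall>j. \<not> (0 \<le> j \<and> j < 0 + N) \<longrightarrow> m3 ''D'' j = m2 ''D'' j)"
        have "m3 ''D'' q \<noteq> 0 \<longleftrightarrow> q \<in> dead_step (elems ''D'' m')" if "q < N" for q
          using that m3(3) m2(3) by (simp add: dead_step_def system_iff)
        then have "elems ''D'' m3 = dead_step (elems ''D'' m')"
          using dead_step_sub[of "elems ''D'' m'"] unfolding elems_def[of _ m3] by auto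
        moreover have "c2 + c3 \<le> 150 * (N + T)" using m2(3) m3(3) by simp
        moreover have "m3 ''j'' 0 = k" using m'(4) by (simp add: keepD[OF m3(2)] keepD[OF m2(2)])
        ultimately show "?R (c2 + c3) m3" using m'(5) by (simp add: elems_def)
      qed (use m2 in \<open>auto simp: inputs_def ok_simps keepD\<close>)
    qed simp_all
  next
    fix c m' assume *: "elems ''D'' m' = (dead_step ^^ N) {}" "c \<le>
        N * (150 * (N + T) + 9 + ncost (var ''nQ'')) + 6 + ncost (var ''nQ'')"
    have "N \<le> N * (N + T)" "1 \<le> N * (N + T)" using pos by simp_all
    with *(2) m1(3) have "c1 + c \<le> 300 * (N * (N + T))" by (simp add: algebra_simps)
    with *(1) show "c1 + c \<le> 300 * (N * (N + T)) \<and> elems ''D'' m' = dead" by (simp add: dead_iterate)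
  qed (use m1 in \<open>auto simp: inputs_def ok_simps\<close>)
qed (auto simp: inputs_def)

text \<open>The last equation bounds the total length of all lists, on which the linear time of a
  search rests.\<close>

definition adj :: "memory \<Rightarrow> bool" where
  "adj m \<longleftrightarrow> (\<forall>q<N. (\<forall>p. (p, q) \<in> edges \<longleftrightarrow>
      (\<exists>j < m ''cnt'' q. m ''PL'' (m ''row'' q + j) = p))) \<and>
     (\<Sum>q<N. m ''cnt'' q) = T"

lemma adj_keep: "adj m \<Longrightarrow> keep M m m' \<Longrightarrow> ''cnt'' \<notin> M \<Longrightarrow>
    ''PL'' \<notin> M \<Longrightarrow> ''row'' \<notin> M \<Longrightarrow> adj m'"
  by (simp add: adj_def keepD)

text \<open>Expressions have no product, so multiples such as \<open>q * T\<close> are accumulated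
  by addition; the offsets into the other arrays are maintained in the same way.\<close>

lemma row_prog:
  assumes m: "ok m"
  shows "rt {''acc'', ''i'', ''row''} m row_prog (\<lambda>c m'. c \<le> 100 * N \<and>
      (\<forall>q<N. m' ''row'' q = q * T))"
  unfolding row_prog_def
proof (rule rt_Do_Seq[OF m])
  let ?M = "{''acc'', ''i'', ''row''}"
  fix m1 assume m1: "m1 = set_cell m ''acc'' (nval (Lit 0) m) (nval (Lit 0) m)" "ok m1"
  show "rt ?M m1 (for_prog ''i'' (var ''nQ'') (Seq (aset ''row'' (var ''i'') (var ''acc''))
      (vset ''acc'' (Plus (var ''acc'') (var ''nT'')))))
     (\<lambda>d m'. 1 + ncost (Lit 0) + ncost (Lit 0) + d \<le> 100 * N \<and> (\<forall>q<N. m' ''row'' q = q * T))"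
  proof (rule rt_for[where n = N and b = 20 and I = "\<lambda>k m'. m' ''acc'' 0 = k * T \<and>
      (\<forall>q<k. m' ''row'' q = q * T)"])
    fix k m' assume "ok m'" "keep ?M m1 m'" "k < N" "m' ''i'' 0 = k" "m' ''acc'' 0 = k * T \<and>
        (\<forall>q<k. m' ''row'' q = q * T)"
    then show "rt ?M m' (Seq (aset ''row'' (var ''i'') (var ''acc'')) (vset ''acc'' (Plus (var ''acc'') (var ''nT''))))
      (\<lambda>c m''. c \<le> 20 \<and> m'' ''i'' 0 = k \<and> set_cell m'' ''i'' 0 (Suc k) ''acc'' 0 = Suc k * T \<and>
        (\<forall>q<Suc k. set_cell m'' ''i'' 0 (Suc k) ''row'' q = q * T))"
      by (intro rt_Do_Seq rt_Do) (auto simp: inputs_def ok_simps less_Suc_eq)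
  qed (use m1 pos in \<open>auto simp: inputs_def ok_simps\<close>)
qed (auto simp: inputs_def)

text \<open>Each row has room for all \<open>T\<close> transitions, so rows cannot overlap without
  any counting beforehand. Cells beyond \<open>cnt\<close> are never read, hence the large table
  needs no initialisation and the time stays linear.\<close>

lemma fill_prog:
  assumes m: "ok m" "\<forall>q<N. m ''row'' q = q * T"
  shows "rt {''i'', ''cnt'', ''PL''} m fill_prog (\<lambda>c m'. c \<le> 100 * (N + T) \<and> adj m')"
  unfolding fill_prog_def
proof (rule rt_Seq[OF map_prog[OF m(1), where off = 0 and v = "\<lambda>_. 0"]])
  let ?M = "{''i'', ''cnt'', ''PL''}"
  fix c1 m1 assume m1: "ok m1" "keep {''cnt'', ''i''} m m1" "c1 \<le> (ncost (Lit 0) + ncost (Lit 0) + 23) * N \<and>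
    (\<forall>q<N. m1 ''cnt'' (0 + q) = 0) \<and> (\<forall>j. \<not> (0 \<le> j \<and> j < 0 + N)
        \<longrightarrow> m1 ''cnt'' j = m ''cnt'' j)"
  let ?in = "\<lambda>k q. {e. e < k \<and> m0 ''tgt'' e = q}"
  define I where "I k m' \<longleftrightarrow> (\<forall>q<N. m' ''cnt'' q = card (?in k q) \<and>
      (\<forall>p. (\<exists>e \<in> ?in k q. m0 ''src'' e = p) \<longleftrightarrow>
          (\<exists>j < m' ''cnt'' q. m' ''PL'' (q * T + j) = p)))" for k and m' :: memory
  let ?tg = "Cell ''tgt'' (var ''i'')"
  let ?p = "Seq (aset ''PL'' (Plus (Cell ''row'' ?tg) (Cell ''cnt'' ?tg)) (Cell ''src'' (var ''i'')))
     (aset ''cnt'' ?tg (Plus (Cell ''cnt'' ?tg) (Lit 1)))"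
  have row: "m' ''row'' q = q * T" if "keep ?M m1 m'" "q < N" for m' q
    using m(2) that by (simp add: keepD[OF that(1)] keepD[OF m1(2)])
  show "rt ?M m1 (for_prog ''i'' (var ''nT'') ?p) (\<lambda>d m'. c1 + d \<le> 100 * (N + T) \<and> adj m')"
  proof (rule rt_for[where n = T and b = 30 and I = I])
    show "I 0 (set_cell m1 ''i'' 0 0)" using m1(3) by (simp add: I_def)
  next
    fix k m' assume m': "ok m'" "keep ?M m1 m'" "k < T" "m' ''i'' 0 = k" "I k m'"
    define t where "t = m0 ''tgt'' k"
    have t: "t < N" using tgt_less m'(3) by (simp add: t_def)
    \<comment> \<open>Strict, because transition \<open>k\<close> has not been entered yet: there is
      still a free cell in the row.\<close>
    have cnt_less: "m' ''cnt'' q < T" if "q < N" for q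
    proof -
      have "card (?in k q) \<le> card {..<k}" by (rule card_mono) auto
      then show ?thesis using m'(3,5) that by (simp add: I_def)
    qed
    define m2 where "m2 = set_cell (set_cell m' ''PL'' (t * T + m' ''cnt'' t) (m0 ''src'' k)) ''cnt'' t (Suc (m' ''cnt'' t))"
    have m2_cnt: "m2 ''cnt'' q = (if q = t then Suc (m' ''cnt'' t) else m' ''cnt'' q)" for q
      by (simp add: m2_def)
    have m2_PL: "m2 ''PL'' (q * T + j) = (if q = t \<and> j = m' ''cnt'' t then m0 ''src'' k else m' ''PL'' (q * T + j))"
      if "q < N" "j \<le> m' ''cnt'' q" for q j
    proof -
      \<comment> \<open>Division by \<open>T\<close> recovers the row from the address, as all
        positions within a row are below \<open>T\<close>.\<close>
      have "q = t \<and> j = m' ''cnt'' t" if eq: "q * T + j = t * T + m' ''cnt'' t"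
      proof -
        have "(q * T + j) div T = q" using cnt_less[OF \<open>q < N\<close>] \<open>j \<le> m' ''cnt'' q\<close> by simp
        moreover have "(t * T + m' ''cnt'' t) div T = t" using cnt_less[OF t] by simp
        ultimately have "q = t" using eq by simp
        with eq show ?thesis by simp
      qed
      then show ?thesis by (auto simp: m2_def)
    qed
    have "I (Suc k) m2"
      unfolding I_def
    proof (intro allI impI)
      fix q assume q: "q < N"
      have ins: "?in (Suc k) q = (if q = t then insert k (?in k q) else ?in k q)"
        by (auto simp: less_Suc_eq t_def)
      have Ik: "m' ''cnt'' q = card (?in k q)"
        "\<And>p. (\<exists>e \<in> ?in k q. m0 ''src'' e = p) \<longleftrightarrow>
            (\<exists>j < m' ''cnt'' q. m' ''PL'' (q * T + j) = p)"
        using m'(5) q by (auto simp: I_def)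
      have "m2 ''cnt'' q = card (?in (Suc k) q)"
        using Ik(1) by (auto simp: ins m2_cnt)
      moreover have "(\<exists>e \<in> ?in (Suc k) q. m0 ''src'' e = p) \<longleftrightarrow>
          (\<exists>j < m2 ''cnt'' q. m2 ''PL'' (q * T + j) = p)" for p
      proof (cases "q = t")
        case True
        have "(\<exists>j < Suc n. f j = p) \<longleftrightarrow> (\<exists>j < n. f j = p) \<or> f n = p"
            for f :: "nat \<Rightarrow> nat" and n
          by (auto simp: less_Suc_eq)
        moreover have "(\<exists>j < m' ''cnt'' q. m2 ''PL'' (q * T + j) = p) \<longleftrightarrow>
            (\<exists>j < m' ''cnt'' q. m' ''PL'' (q * T + j) = p)"
          by (intro ex_cong1 conj_cong) (use m2_PL[OF q] True in auto)
        ultimately have "(\<exists>j < m2 ''cnt'' q. m2 ''PL'' (q * T + j) = p) \<longleftrightarrow>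
            (\<exists>j < m' ''cnt'' q. m' ''PL'' (q * T + j) = p) \<or> m0 ''src'' k = p"
          using m2_PL[OF q, of "m' ''cnt'' q"] True by (simp add: m2_cnt)
        with True Ik(2)[of p] show ?thesis unfolding ins by auto
      next
        case False
        have "(\<exists>j < m' ''cnt'' q. m2 ''PL'' (q * T + j) = p) \<longleftrightarrow>
            (\<exists>j < m' ''cnt'' q. m' ''PL'' (q * T + j) = p)"
          by (intro ex_cong1 conj_cong) (use m2_PL[OF q] False in auto)
        with False Ik(2)[of p] show ?thesis unfolding ins by (simp add: m2_cnt)
      qed
      ultimately show "m2 ''cnt'' q = card (?in (Suc k) q) \<and>
        (\<forall>p. (\<exists>e \<in> ?in (Suc k) q. m0 ''src'' e = p) \<longleftrightarrow>
            (\<exists>j < m2 ''cnt'' q. m2 ''PL'' (q * T + j) = p))" by blast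
    qed
    then have "I (Suc k) (set_cell m2 ''i'' 0 (Suc k))" by (simp add: I_def)
    then show "rt ?M m' ?p (\<lambda>c m''. c \<le> 30 \<and> m'' ''i'' 0 = k \<and>
        I (Suc k) (set_cell m'' ''i'' 0 (Suc k)))"
      using m'(1,4) row[OF m'(2) t]
      by (intro rt_Do_Seq rt_Do) (simp_all add: inputs_def ok_simps t_def m2_def)
  next
    fix c m' assume *: "keep ?M m1 m'" "I T m'" "c \<le> T * (30 + 9 + ncost (var ''nT'')) + 6 + ncost (var ''nT'')"
    have "(\<Sum>q<N. m' ''cnt'' q) = (\<Sum>q<N. card (?in T q))" using *(2) by (simp add: I_def)
    also have "\<dots> = card (\<Union>q<N. ?in T q)" by (rule card_UN_disjoint[symmetric]) auto
    also have "(\<Union>q<N. ?in T q) = {..<T}" using tgt_less by auto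
    finally have "(\<Sum>q<N. m' ''cnt'' q) = T" by simp
    moreover have "(p, q) \<in> edges \<longleftrightarrow>
        (\<exists>j < m' ''cnt'' q. m' ''PL'' (m' ''row'' q + j) = p)" if "q < N" for p q
    proof -
      have "(p, q) \<in> edges \<longleftrightarrow> (\<exists>e \<in> ?in T q. m0 ''src'' e = p)" by (auto simp: edges_def)
      also have "\<dots> \<longleftrightarrow> (\<exists>j < m' ''cnt'' q. m' ''PL'' (q * T + j) = p)"
          using *(2) that by (simp add: I_def)
      finally show ?thesis by (simp add: row[OF *(1) that])
    qed
    moreover have "c1 + c \<le> 100 * (N + T)" using *(3) m1(3) pos by simp
    ultimately show "c1 + c \<le> 100 * (N + T) \<and> adj m'" by (simp add: adj_def)
  qed (use m1 in \<open>auto simp: inputs_def ok_simps\<close>)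
qed (auto simp: inputs_def)

section \<open>Backward reachability and the queue invariant\<close>

definition reach :: "nat set \<Rightarrow> nat set \<Rightarrow> nat set" where
  "reach B Al = lfp (\<lambda>W. B \<union> {p \<in> Al. \<exists>q \<in> W. (p, q) \<in> edges})"

lemma reach_intros:
  "q \<in> B \<Longrightarrow> q \<in> reach B Al"
  "p \<in> Al \<Longrightarrow> q \<in> reach B Al \<Longrightarrow> (p, q) \<in> edges \<Longrightarrow> p \<in> reach B Al"
proof -
  have "mono (\<lambda>W. B \<union> {p \<in> Al. \<exists>q \<in> W. (p, q) \<in> edges})" by (auto simp: mono_def)
  note unf = lfp_unfold[OF this, folded reach_def]
  show "q \<in> B \<Longrightarrow> q \<in> reach B Al" by (subst unf) blast
  show "p \<in> Al \<Longrightarrow> q \<in> reach B Al \<Longrightarrow> (p, q) \<in> edges \<Longrightarrow>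
      p \<in> reach B Al" by (subst unf) blast
qed

lemma reach_least:
  assumes "B \<subseteq> W" "\<And>p q. p \<in> Al \<Longrightarrow> q \<in> W \<Longrightarrow>
      (p, q) \<in> edges \<Longrightarrow> p \<in> W"
  shows "reach B Al \<subseteq> W"
  unfolding reach_def by (rule lfp_lowerbound) (use assms in blast)

text \<open>The head \<open>h\<close> is a parameter and not the cell of that name, since the
  invariant is needed before the cell is set and advances to \<open>Suc h\<close> before the cell is
  incremented.\<close>

definition bfs_inv :: "nat set \<Rightarrow> nat set \<Rightarrow> nat \<Rightarrow> memory \<Rightarrow> bool" where
  "bfs_inv B Al h m \<longleftrightarrow> h \<le> m ''tl'' 0 \<and> inj_on (m ''Qu'') {..<m ''tl'' 0} \<and>
      m ''Qu'' ` {..<m ''tl'' 0} = elems ''W'' m \<and>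
     B \<subseteq> elems ''W'' m \<and> elems ''W'' m \<subseteq> reach B Al \<and>
     (\<forall>l<h. \<forall>p \<in> Al. (p, m ''Qu'' l) \<in> edges \<longrightarrow> p \<in> elems ''W'' m)"

lemma bfs_inv_push:
  assumes "bfs_inv B Al h m" "p < N" "m ''W'' p = 0" "p \<in> reach B Al"
  defines "m' \<equiv> set_cell (set_cell (set_cell m ''W'' p 1) ''Qu'' (m ''tl'' 0) p) ''tl'' 0 (Suc (m ''tl'' 0))"
  shows "bfs_inv B Al h m'" "elems ''W'' m' = insert p (elems ''W'' m)" "\<And>l. l < m ''tl'' 0 \<Longrightarrow>
      m' ''Qu'' l = m ''Qu'' l"
proof -
  let ?t = "m ''tl'' 0"
  show W: "elems ''W'' m' = insert p (elems ''W'' m)"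
    using assms(2) by (auto simp: elems_def m'_def)
  show Qu: "\<And>l. l < ?t \<Longrightarrow> m' ''Qu'' l = m ''Qu'' l" by (simp add: m'_def)
  have "p \<notin> m ''Qu'' ` {..<?t}" using assms(1,3) by (auto simp: bfs_inv_def elems_def)
  moreover have "m' ''Qu'' ` {..<?t} = m ''Qu'' ` {..<?t}" using Qu by (intro image_cong) auto
  moreover have "inj_on (m' ''Qu'') {..<?t} = inj_on (m ''Qu'') {..<?t}" using Qu by (intro inj_on_cong) auto
  moreover have "m' ''tl'' 0 = Suc ?t" "m' ''Qu'' ?t = p" by (simp_all add: m'_def)
  ultimately show "bfs_inv B Al h m'"
    using assms(1,4) W Qu unfolding bfs_inv_def by (auto simp: lessThan_Suc)
qed

end

text \<open>\<open>XR\<close> holds the states removed from \<open>X\<close>, in a block of its own at offset \<open>o\<close> for each iteration;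
  it survives the iteration of \<open>Z\<close>.\<close>

definition prune_prog :: "(ram_action, ram_test) prog" where
  "prune_prog = for_prog ''i'' (var ''nQ'') (Cond (true_t (and_e (Cell ''X'' (var ''i'')) (not_e (Cell ''W'' (var ''i'')))))
     (Seq (aset ''X'' (var ''i'') (Lit 0)) (Seq (aset ''XR'' (Plus (var ''o'') (var ''i'')) (Lit 1))
         (vset ''fl'' (Lit 1)))) Skip)"

text \<open>\<open>X\<close> restarts from the states that no earlier pass has removed for this
  block. The flag is set initially so that at least one search takes place.\<close>

definition avoid_prog :: "(ram_action, ram_test) prog" where
  "avoid_prog = Seq (map_prog ''X'' (Lit 0) (and_e (Cell ''Z0'' (var ''i''))
      (not_e (Cell ''XR'' (Plus (var ''o'') (var ''i''))))))
     (Seq (vset ''fl'' (Lit 1)) (Loop (true_t (var ''fl'')) (Seq (succ_prog ''X'')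
       (Seq (map_prog ''al'' (Lit 0) (and_e (not_e (Cell ''A'' (Plus (var ''oa'') (var ''i''))))
          (or_e (Cell ''sys'' (var ''i'')) (not_e (Cell ''bd'' (var ''i''))))))
       (Seq bfs_prog (Seq (vset ''fl'' (Lit 0)) prune_prog))))))"

section \<open>Linear-time search and the pruning of \<open>X\<close>\<close>

context ram_arena
begin

definition unit :: nat where "unit = N + T"

lemma unit_ge: "N \<le> unit" "T \<le> unit" "1 \<le> unit"
  using pos by (auto simp: unit_def)

lemma adj_edge:
  "adj m \<Longrightarrow> q < N \<Longrightarrow> (p, q) \<in> edges \<longleftrightarrow>
      (\<exists>j < m ''cnt'' q. m ''PL'' (m ''row'' q + j) = p)"
  by (simp add: adj_def)

lemma bfs_inv_Suc:
  assumes "bfs_inv B Al h m" "h < m ''tl'' 0" "\<And>p. p \<in> Al \<Longrightarrow>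
      (p, m ''Qu'' h) \<in> edges \<Longrightarrow> p \<in> elems ''W'' m"
  shows "bfs_inv B Al (Suc h) m"
proof -
  have "p \<in> elems ''W'' m" if "l < Suc h" "p \<in> Al" "(p, m ''Qu'' l) \<in> edges" for l p
  proof (cases "l = h")
    case True
    with assms(3) that(2,3) show ?thesis by simp
  next
    case False
    with that(1) have "l < h" by simp
    with assms(1) that(2,3) show ?thesis unfolding bfs_inv_def by blast
  qed
  with assms(1,2) show ?thesis unfolding bfs_inv_def by simp
qed

text \<open>New entries are pushed behind position \<open>h\<close>. That the entries up to
  \<open>h\<close> stay unchanged is recorded because the cost account of the whole search sums over
  them.\<close>

lemma visit_prog:
  assumes m: "ok m" "adj m" "bfs_inv B Al h m" "h < m ''tl'' 0" "m ''t'' 0 = m ''Qu'' h" "elems ''al'' m = Al"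
      "m ''Qu'' h < N"
  shows "rt {''i'', ''p'', ''W'', ''Qu'', ''tl''} m visit_prog (\<lambda>c m'. c \<le> 60 * m ''cnt'' (m ''Qu'' h) + 9 \<and>
    bfs_inv B Al (Suc h) m' \<and> (\<forall>l\<le>h. m' ''Qu'' l = m ''Qu'' l))"
  unfolding visit_prog_def
proof (rule rt_for[where n = "m ''cnt'' (m ''Qu'' h)" and b = "45" and
      I = "\<lambda>k m'. bfs_inv B Al h m' \<and> h < m' ''tl'' 0 \<and> (\<forall>l\<le>h. m' ''Qu'' l = m ''Qu'' l) \<and>
        (\<forall>j<k. m ''PL'' (m ''row'' (m ''Qu'' h) + j) \<in> Al \<longrightarrow>
            m ''PL'' (m ''row'' (m ''Qu'' h) + j) \<in> elems ''W'' m')"])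
  let ?M = "{''i'', ''p'', ''W'', ''Qu'', ''tl''}" and ?t = "m ''Qu'' h"
  define I where "I k m' \<longleftrightarrow> bfs_inv B Al h m' \<and> h < m' ''tl'' 0 \<and>
      (\<forall>l\<le>h. m' ''Qu'' l = m ''Qu'' l) \<and>
        (\<forall>j<k. m ''PL'' (m ''row'' ?t + j) \<in> Al \<longrightarrow> m ''PL'' (m ''row'' ?t + j) \<in>
            elems ''W'' m')" for k and m' :: memory
  have I_cong: "I k m'' = I k m'" if "m'' ''tl'' = m' ''tl''" "m'' ''Qu'' = m' ''Qu''" "m'' ''W'' = m' ''W''" for k m' m''
    using that unfolding I_def bfs_inv_def elems_def by simp
  fix k m' assume m': "ok m'" "keep ?M m m'" "k < m ''cnt'' ?t" "m' ''i'' 0 = k"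
    "bfs_inv B Al h m' \<and> h < m' ''tl'' 0 \<and> (\<forall>l\<le>h. m' ''Qu'' l = m ''Qu'' l) \<and>
        (\<forall>j<k. m ''PL'' (m ''row'' ?t + j) \<in> Al \<longrightarrow> m ''PL'' (m ''row'' ?t + j) \<in>
            elems ''W'' m')"
  have Ik: "I k m'" using m'(5) by (simp add: I_def)
  define p where "p = m ''PL'' (m ''row'' ?t + k)"
  have edge: "(p, ?t) \<in> edges" unfolding adj_edge[OF m(2,7)] p_def using m'(3) by blast
  then have p: "p < N" using E_sub by auto
  let ?R = "\<lambda>c m''. c \<le> 45 \<and> m'' ''i'' 0 = k \<and> I (Suc k) (set_cell m'' ''i'' 0 (Suc k))"
  have "rt ?M m' (Seq (vset ''p'' (Cell ''PL'' (Plus (Cell ''row'' (var ''t'')) (var ''i''))))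
     (Cond (true_t (and_e (Cell ''al'' (var ''p'')) (not_e (Cell ''W'' (var ''p''))))) (push_prog (var ''p'')) Skip)) ?R"
  proof (rule rt_Do_Seq[OF m'(1)])
    fix m1 assume m1: "m1 = set_cell m' ''p'' (nval (Lit 0) m')
        (nval (Cell ''PL'' (Plus (Cell ''row'' (var ''t'')) (var ''i''))) m')" "ok m1"
    have "I k m1 = I k m'" by (rule I_cong) (simp_all add: m1(1))
    then have eq1: "m1 ''p'' 0 = p" "m1 ''i'' 0 = k" "m1 ''al'' = m ''al''" "I k m1"
      using m'(4) m(5) Ik by (simp_all add: m1(1) keepD[OF m'(2)] p_def)
    have al: "m1 ''al'' p \<noteq> 0 \<longleftrightarrow> p \<in> Al" using m(6) p eq1(3) by (auto simp: elems_def)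
    have W: "m1 ''W'' p \<noteq> 0 \<longleftrightarrow> p \<in> elems ''W'' m1" using p by (simp add: elems_def)
    have Suc: "I (Suc k) m''" if "I k m''" "p \<in> Al \<longrightarrow> p \<in> elems ''W'' m''" for m''
      using that by (auto simp: I_def less_Suc_eq p_def)
    show "rt ?M m1 (Cond (true_t (and_e (Cell ''al'' (var ''p'')) (not_e (Cell ''W'' (var ''p'')))))
        (push_prog (var ''p'')) Skip)
      (\<lambda>d. ?R (1 + ncost (Lit 0) + ncost (Cell ''PL'' (Plus (Cell ''row'' (var ''t'')) (var ''i''))) + d))"
    proof (rule rt_Cond)
      assume "ram_tst (true_t (and_e (Cell ''al'' (var ''p'')) (not_e (Cell ''W'' (var ''p''))))) m1"
      then have new: "p \<in> Al" "m1 ''W'' p = 0" using al by (auto simp: eq1(1) split: if_splits)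
      have inv1: "bfs_inv B Al h m1" and tl1: "h < m1 ''tl'' 0" and Qu1: "\<forall>l\<le>h. m1 ''Qu'' l = m ''Qu'' l"
        and prev: "\<forall>j<k. m ''PL'' (m ''row'' ?t + j) \<in> Al \<longrightarrow>
            m ''PL'' (m ''row'' ?t + j) \<in> elems ''W'' m1"
        using eq1(4) unfolding I_def by blast+
      have "m1 ''Qu'' ` {..<m1 ''tl'' 0} = elems ''W'' m1" "elems ''W'' m1 \<subseteq> reach B Al"
        using inv1 unfolding bfs_inv_def by blast+
      moreover have "m1 ''Qu'' h \<in> m1 ''Qu'' ` {..<m1 ''tl'' 0}" using tl1 by (intro imageI) simp
      ultimately have "?t \<in> reach B Al" using Qu1 by auto
      then have "p \<in> reach B Al" by (rule reach_intros(2)[OF new(1) _ edge])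
      let ?m2 = "set_cell (set_cell (set_cell m1 ''W'' p 1) ''Qu'' (m1 ''tl'' 0) p) ''tl'' 0 (Suc (m1 ''tl'' 0))"
      note push = bfs_inv_push[OF inv1 p new(2) \<open>p \<in> reach B Al\<close>]
      have "I (Suc k) ?m2"
      proof (rule Suc)
        have "h < ?m2 ''tl'' 0" using tl1 by simp
        moreover have "\<forall>l\<le>h. ?m2 ''Qu'' l = m ''Qu'' l" using push(3)[OF le_less_trans[OF _ tl1]] Qu1 by simp
        moreover have "\<forall>j<k. m ''PL'' (m ''row'' ?t + j) \<in> Al \<longrightarrow>
            m ''PL'' (m ''row'' ?t + j) \<in> elems ''W'' ?m2"
          using prev unfolding push(2) by simp
        ultimately show "I k ?m2" using push(1) unfolding I_def by blast
        show "p \<in> Al \<longrightarrow> p \<in> elems ''W'' ?m2" unfolding push(2) by blast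
      qed
      then have "I (Suc k) (set_cell ?m2 ''i'' 0 (Suc k))" by (subst I_cong[of _ ?m2]) auto
      then show "rt ?M m1 (push_prog (var ''p'')) (\<lambda>c. ?R (1 + ncost (Lit 0) + ncost
          (Cell ''PL'' (Plus (Cell ''row'' (var ''t'')) (var ''i''))) +
          (ram_tst_cost (true_t (and_e (Cell ''al'' (var ''p'')) (not_e (Cell ''W'' (var ''p''))))) + c)))"
        unfolding push_prog_def using m1(2) eq1
        by (intro rt_Do_Seq rt_Do) (simp_all add: inputs_def)
    next
      assume "\<not> ram_tst (true_t (and_e (Cell ''al'' (var ''p'')) (not_e (Cell ''W'' (var ''p''))))) m1"
      then have "p \<in> Al \<longrightarrow> p \<in> elems ''W'' m1" using al W by (auto simp: eq1(1) split: if_splits)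
      from Suc[OF eq1(4) this] have "I (Suc k) (set_cell m1 ''i'' 0 (Suc k))" by (subst I_cong[of _ m1]) auto
      then show "rt ?M m1 Skip (\<lambda>c. ?R (1 + ncost (Lit 0) + ncost
          (Cell ''PL'' (Plus (Cell ''row'' (var ''t'')) (var ''i''))) +
          (ram_tst_cost (true_t (and_e (Cell ''al'' (var ''p'')) (not_e (Cell ''W'' (var ''p''))))) + c)))"
        using m1(2) eq1 by (intro rt_Skip) simp_all
    qed
  qed (simp_all add: inputs_def)
  then show "rt ?M m' (Seq (vset ''p'' (Cell ''PL'' (Plus (Cell ''row'' (var ''t'')) (var ''i''))))
     (Cond (true_t (and_e (Cell ''al'' (var ''p'')) (not_e (Cell ''W'' (var ''p''))))) (push_prog (var ''p'')) Skip))
     (\<lambda>c m''. c \<le> 45 \<and> m'' ''i'' 0 = k \<and> bfs_inv B Al h (set_cell m'' ''i'' 0 (Suc k))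
         \<and> h < set_cell m'' ''i'' 0 (Suc k) ''tl'' 0 \<and>
        (\<forall>l\<le>h. set_cell m'' ''i'' 0 (Suc k) ''Qu'' l = m ''Qu'' l) \<and>
        (\<forall>j<Suc k. m ''PL'' (m ''row'' ?t + j) \<in> Al \<longrightarrow> m ''PL'' (m ''row'' ?t + j)
            \<in> elems ''W'' (set_cell m'' ''i'' 0 (Suc k))))"
    unfolding I_def .
next
  fix c m' assume m': "bfs_inv B Al h m' \<and> h < m' ''tl'' 0 \<and> (\<forall>l\<le>h. m' ''Qu'' l = m ''Qu'' l) \<and>
        (\<forall>j<m ''cnt'' (m ''Qu'' h). m ''PL'' (m ''row'' (m ''Qu'' h) + j) \<in> Al \<longrightarrow>
            m ''PL'' (m ''row'' (m ''Qu'' h) + j) \<in> elems ''W'' m')"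
    "c \<le> m ''cnt'' (m ''Qu'' h) * (45 + 9 + ncost (Cell ''cnt'' (var ''t''))) + 6 + ncost (Cell ''cnt'' (var ''t''))"
  have "p \<in> elems ''W'' m'" if "p \<in> Al" "(p, m ''Qu'' h) \<in> edges" for p
    using adj_edge[OF m(2,7), of p] m'(1) that by blast
  then have "bfs_inv B Al (Suc h) m'"
    using m'(1) by (intro bfs_inv_Suc) simp_all
  with m' show "c \<le> 60 * m ''cnt'' (m ''Qu'' h) + 9 \<and> bfs_inv B Al (Suc h) m' \<and>
      (\<forall>l\<le>h. m' ''Qu'' l = m ''Qu'' l)"
    by simp
next
  show "bfs_inv B Al h (set_cell m ''i'' 0 0) \<and> h < set_cell m ''i'' 0 0 ''tl'' 0 \<and>
      (\<forall>l\<le>h. set_cell m ''i'' 0 0 ''Qu'' l = m ''Qu'' l) \<and>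
      (\<forall>j<0. m ''PL'' (m ''row'' (m ''Qu'' h) + j) \<in> Al \<longrightarrow>
          m ''PL'' (m ''row'' (m ''Qu'' h) + j) \<in> elems ''W'' (set_cell m ''i'' 0 0))"
    using m(3,4) by (simp add: bfs_inv_def elems_def)
next
  fix m' assume "keep {''i'', ''p'', ''W'', ''Qu'', ''tl''} m m'"
  then show "nval (Cell ''cnt'' (var ''t'')) m' = m ''cnt'' (m ''Qu'' h)" using m(5) by (simp add: keepD)
qed (use m(1) in \<open>simp_all add: inputs_def\<close>)

lemma bfs_inv_bounds:
  assumes "bfs_inv B Al h m"
  shows "m ''tl'' 0 \<le> N" "l < m ''tl'' 0 \<Longrightarrow> m ''Qu'' l < N"
proof -
  have sub: "m ''Qu'' ` {..<m ''tl'' 0} \<subseteq> {..<N}" using assms by (auto simp: bfs_inv_def elems_def)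
  then show "l < m ''tl'' 0 \<Longrightarrow> m ''Qu'' l < N" by auto
  have "card {..<m ''tl'' 0} \<le> card {..<N}"
    by (rule card_inj_on_le[OF _ sub]) (use assms in \<open>auto simp: bfs_inv_def\<close>)
  then show "m ''tl'' 0 \<le> N" by simp
qed

text \<open>The queue has no repetitions, so each list is scanned at most once; by
  \<open>adj\<close> the scanned lists have total length at most \<open>T\<close>.\<close>

lemma bfs_prog:
  assumes m: "ok m" "adj m" "elems ''bs'' m = B" "elems ''al'' m = Al"
  shows "rt {''i'', ''p'', ''W'', ''Qu'', ''tl'', ''h'', ''t''} m bfs_prog (\<lambda>c m'. c \<le>
      200 * unit \<and> elems ''W'' m' = reach B Al)"
  unfolding bfs_prog_def
proof (rule rt_Do_Seq[OF m(1)])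
  let ?M = "{''i'', ''p'', ''W'', ''Qu'', ''tl'', ''h'', ''t''}"
  let ?loop = "Loop (Less (var ''h'') (var ''tl''))
       (Seq (vset ''t'' (Cell ''Qu'' (var ''h''))) (Seq visit_prog (vset ''h'' (Plus (var ''h'') (Lit 1)))))"
  let ?init = "Cond (true_t (Cell ''bs'' (var ''i''))) (push_prog (var ''i'')) (aset ''W'' (var ''i'') (Lit 0))"
  fix m1 assume m1: "m1 = set_cell m ''tl'' (nval (Lit 0) m) (nval (Lit 0) m)" "ok m1"
  have keep1: "keep ?M m m1" unfolding m1 by (rule keep_set_cell) simp
  define I where "I k m' \<longleftrightarrow> inj_on (m' ''Qu'') {..<m' ''tl'' 0} \<and>
      m' ''Qu'' ` {..<m' ''tl'' 0} = {q. q < k \<and> m ''bs'' q \<noteq> 0} \<and>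
    (\<forall>q<k. m' ''W'' q = of_bool (m ''bs'' q \<noteq> 0))" for k and m' :: memory
  have "rt ?M m1 (for_prog ''i'' (var ''nQ'') ?init) (\<lambda>c m'. c \<le> 60 * N \<and> bfs_inv B Al 0 m')"
  proof (rule rt_for[where n = N and b = "30" and I = I])
    show "I 0 (set_cell m1 ''i'' 0 0)" by (simp add: I_def m1)
  next
    fix k m' assume m': "ok m'" "keep ?M m1 m'" "k < N" "m' ''i'' 0 = k" "I k m'"
    have bs: "m' ''bs'' = m ''bs''" by (simp add: keepD[OF m'(2)] keepD[OF keep1])
    let ?t = "m' ''tl'' 0"
    let ?m2 = "set_cell (set_cell (set_cell m' ''W'' k 1) ''Qu'' ?t k) ''tl'' 0 (Suc ?t)"
    have "I (Suc k) (set_cell ?m2 ''i'' 0 (Suc k))" if "m ''bs'' k \<noteq> 0"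
    proof -
      have old: "m' ''Qu'' ` {..<?t} = {q. q < k \<and> m ''bs'' q \<noteq> 0}" "inj_on (m' ''Qu'') {..<?t}"
        "\<forall>q<k. m' ''W'' q = of_bool (m ''bs'' q \<noteq> 0)"
        using m'(5) unfolding I_def by blast+
      define Qu where "Qu = (m' ''Qu'')(?t := k)"
      have "inj_on Qu {..<?t} = inj_on (m' ''Qu'') {..<?t}" by (rule inj_on_cong) (simp add: Qu_def)
      moreover have img: "Qu ` {..<?t} = {q. q < k \<and> m ''bs'' q \<noteq> 0}"
        unfolding old(1)[symmetric] by (rule image_cong) (simp_all add: Qu_def)
      moreover have Qu_t: "Qu ?t = k" by (simp add: Qu_def)
      ultimately have inj: "inj_on Qu {..<Suc ?t}" using old(2) by (simp add: lessThan_Suc)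
      have "Qu ` {..<Suc ?t} = {q. q < Suc k \<and> m ''bs'' q \<noteq> 0}"
        unfolding lessThan_Suc image_insert img Qu_t using that by (auto simp: less_Suc_eq)
      moreover have "set_cell ?m2 ''i'' 0 (Suc k) ''Qu'' = Qu" "set_cell ?m2 ''i'' 0 (Suc k) ''tl'' 0 = Suc ?t"
        "set_cell ?m2 ''i'' 0 (Suc k) ''W'' = (m' ''W'')(k := 1)"
        by (simp_all add: Qu_def fun_upd_def)
      ultimately show ?thesis using inj old(3) that unfolding I_def by (simp add: less_Suc_eq)
    qed
    moreover have "I (Suc k) (set_cell (set_cell m' ''W'' k 0) ''i'' 0 (Suc k))" if "m ''bs'' k = 0"
    proof -
      have "{q. q < Suc k \<and> 0 < m ''bs'' q} = {q. q < k \<and> 0 < m ''bs'' q}" using that by (auto simp: less_Suc_eq)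
      then show ?thesis using m'(5) that by (auto simp: I_def less_Suc_eq)
    qed
    ultimately show "rt ?M m' ?init (\<lambda>c m''. c \<le> 30 \<and> m'' ''i'' 0 = k \<and>
        I (Suc k) (set_cell m'' ''i'' 0 (Suc k)))"
      unfolding push_prog_def using m'(1,4) bs
      by (intro rt_Cond rt_Do_Seq rt_Do) (simp_all add: inputs_def)
  next
    fix c m' assume *: "I N m'" "c \<le> N * (30 + 9 + ncost (var ''nQ'')) + 6 + ncost (var ''nQ'')"
    have "elems ''W'' m' = B" using *(1) m(3) by (auto simp: I_def elems_def)
    moreover have "{q. q < N \<and> m ''bs'' q \<noteq> 0} = B" using m(3) by (simp add: elems_def)
    moreover have "B \<subseteq> reach B Al" using reach_intros(1) by blast
    ultimately have "bfs_inv B Al 0 m'" using *(1) by (simp add: bfs_inv_def I_def)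
    then show "c \<le> 60 * N \<and> bfs_inv B Al 0 m'" using *(2) pos by simp
  qed (use m1 in \<open>auto simp: inputs_def ok_simps\<close>)
  then show "rt ?M m1 (Seq (for_prog ''i'' (var ''nQ'') ?init) (Seq (vset ''h'' (Lit 0)) ?loop))
      (\<lambda>d m'. 1 + ncost (Lit 0) + ncost (Lit 0) + d \<le> 200 * unit \<and> elems ''W'' m' = reach B Al)"
  proof (rule rt_Seq)
    fix c2 m2 assume m2: "ok m2" "keep ?M m1 m2" "c2 \<le> 60 * N \<and> bfs_inv B Al 0 m2"
    note keep2 = keep_trans[OF keep1 m2(2)]
    show "rt ?M m2 (Seq (vset ''h'' (Lit 0)) ?loop)
      (\<lambda>d m'. 1 + ncost (Lit 0) + ncost (Lit 0) + (c2 + d) \<le> 200 * unit \<and> elems ''W'' m' = reach B Al)"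
    proof (rule rt_Do_Seq[OF m2(1)])
      fix m3 assume m3: "m3 = set_cell m2 ''h'' (nval (Lit 0) m2) (nval (Lit 0) m2)" "ok m3"
      have keep3: "keep ?M m m3"
        by (rule keep_trans[OF keep2]) (simp add: m3 keep_set_cell)
      define J where "J c m' \<longleftrightarrow> bfs_inv B Al (m' ''h'' 0) m' \<and>
        c \<le> (\<Sum>l < m' ''h'' 0. 60 * m ''cnt'' (m' ''Qu'' l) + 40)" for c :: nat and m' :: memory
      have inv_cong: "bfs_inv B Al h m'' = bfs_inv B Al h m'" if "m'' ''tl'' = m' ''tl''" "m'' ''Qu'' = m' ''Qu''"
          "m'' ''W'' = m' ''W''" for h m' m''
        using that unfolding bfs_inv_def elems_def by simp
      show "rt ?M m3 ?loop (\<lambda>d m'. 1 + ncost (Lit 0) + ncost (Lit 0) +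
          (c2 + (1 + ncost (Lit 0) + ncost (Lit 0) + d)) \<le> 200 * unit \<and>
          elems ''W'' m' = reach B Al)"
      proof (rule rt_Loop[where I = J and \<mu> = "\<lambda>c m'. N - m' ''h'' 0"])
        have "bfs_inv B Al 0 m3 = bfs_inv B Al 0 m2" by (rule inv_cong) (simp_all add: m3(1))
        then show "J 0 m3" using m2(3) by (simp add: J_def m3(1))
      next
        fix c m' assume m': "ok m'" "keep ?M m3 m'" "J c m'" "ram_tst (Less (var ''h'') (var ''tl'')) m'"
        note keep' = keep_trans[OF keep3 m'(2)]
        define h where "h = m' ''h'' 0"
        have h: "h < m' ''tl'' 0" "bfs_inv B Al h m'" using m'(3,4) by (auto simp: h_def J_def)
        have hN: "h < N" using bfs_inv_bounds(1)[OF h(2)] h(1) by simp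
        let ?R = "\<lambda>d m''. J (c + ram_tst_cost (Less (var ''h'') (var ''tl'')) + d) m'' \<and>
            N - m'' ''h'' 0 < N - m' ''h'' 0"
        show "rt ?M m' (Seq (vset ''t'' (Cell ''Qu'' (var ''h'')))
            (Seq visit_prog (vset ''h'' (Plus (var ''h'') (Lit 1))))) ?R"
        proof (rule rt_Do_Seq[OF m'(1)])
          fix m4 assume m4: "m4 = set_cell m' ''t'' (nval (Lit 0) m') (nval (Cell ''Qu'' (var ''h'')) m')" "ok m4"
          have keep4: "keep ?M m m4" by (rule keep_trans[OF keep']) (simp add: m4 keep_set_cell)
          have adj4: "adj m4" by (rule adj_keep[OF m(2) keep4]) simp_all
          have eq4: "m4 ''t'' 0 = m4 ''Qu'' h" "m4 ''cnt'' = m ''cnt''" "m4 ''Qu'' = m' ''Qu''" "m4 ''h'' 0 = h"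
            by (simp_all add: m4(1) h_def keepD[OF keep'])
          have inv4: "bfs_inv B Al h m4" using h(2) by (subst inv_cong[of m4 m']) (simp_all add: m4(1))
          have al4: "elems ''al'' m4 = Al" using m(4) elems_keep[OF keep4] by simp
          have tl4: "h < m4 ''tl'' 0" "m4 ''Qu'' h < N" using h bfs_inv_bounds(2)[OF h(2,1)] eq4(3) by (simp_all add: m4(1))
          show "rt ?M m4 (Seq visit_prog (vset ''h'' (Plus (var ''h'') (Lit 1))))
              (\<lambda>d. ?R (1 + ncost (Lit 0) + ncost (Cell ''Qu'' (var ''h'')) + d))"
          proof (rule rt_Seq[OF visit_prog[OF m4(2) adj4 inv4 tl4(1) eq4(1) al4 tl4(2)]])
            fix c5 m5 assume m5: "ok m5" "keep {''i'', ''p'', ''W'', ''Qu'', ''tl''} m4 m5"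
              "c5 \<le> 60 * m4 ''cnt'' (m4 ''Qu'' h) + 9 \<and> bfs_inv B Al (Suc h) m5 \<and>
                  (\<forall>l\<le>h. m5 ''Qu'' l = m4 ''Qu'' l)"
            have h5: "m5 ''h'' 0 = h" using eq4(4) by (simp add: keepD[OF m5(2)])
            have "(\<Sum>l < h. 60 * m ''cnt'' (m5 ''Qu'' l) + 40) = (\<Sum>l < h. 60 * m ''cnt'' (m' ''Qu'' l) + 40)"
              using m5(3) eq4(3) by (intro sum.cong) auto
            moreover have "m5 ''Qu'' h = m' ''Qu'' h" using m5(3) eq4(3) by simp
            moreover have "bfs_inv B Al (Suc h) (set_cell m5 ''h'' 0 (Suc h))"
              using m5(3) by (subst inv_cong[of _ m5]) auto
            ultimately show "rt ?M m5 (vset ''h'' (Plus (var ''h'') (Lit 1)))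
                (\<lambda>d. ?R (1 + ncost (Lit 0) + ncost (Cell ''Qu'' (var ''h'')) + (c5 + d)))"
              using m5(1,3) m'(3) h5 eq4 hN
              by (intro rt_Do) (simp_all add: inputs_def J_def h_def[symmetric])
          qed auto
        qed (simp_all add: inputs_def)
      next
        fix c m' assume m': "J c m'" "\<not> ram_tst (Less (var ''h'') (var ''tl'')) m'"
        define h where "h = m' ''h'' 0"
        have inv: "bfs_inv B Al h m'" "m' ''tl'' 0 = h" using m' by (auto simp: J_def h_def bfs_inv_def)
        have W: "elems ''W'' m' = reach B Al"
        proof (rule antisym)
          show "reach B Al \<subseteq> elems ''W'' m'"
          proof (rule reach_least)
            fix p q assume pq: "p \<in> Al" "q \<in> elems ''W'' m'" "(p, q) \<in> edges"
            then have "q \<in> m' ''Qu'' ` {..<h}" using inv by (simp add: bfs_inv_def)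
            with pq inv(1) show "p \<in> elems ''W'' m'" by (auto simp: bfs_inv_def)
          qed (use inv in \<open>simp add: bfs_inv_def\<close>)
        qed (use inv in \<open>simp add: bfs_inv_def\<close>)
        have "(\<Sum>l<h. m ''cnt'' (m' ''Qu'' l)) = (\<Sum>q \<in> elems ''W'' m'. m ''cnt'' q)"
          using sum.reindex[of "m' ''Qu''" "{..<h}" "m ''cnt''"] inv by (simp add: bfs_inv_def)
        also have "\<dots> \<le> (\<Sum>q<N. m ''cnt'' q)" by (rule sum_mono2) (auto simp: elems_def)
        also have "\<dots> = T" using m(2) by (simp add: adj_def)
        finally have "(\<Sum>l<h. 60 * m ''cnt'' (m' ''Qu'' l) + 40) \<le> 60 * T + 40 * h"
          by (simp add: sum.distrib sum_distrib_left[symmetric])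
        then have "c \<le> 60 * T + 40 * N" using m'(1) bfs_inv_bounds(1)[OF inv(1)] inv(2) by (simp add: J_def h_def)
        with m2(3) W pos show "1 + ncost (Lit 0) + ncost (Lit 0) + (c2 + (1 + ncost (Lit 0) + ncost (Lit 0) +
            (c + ram_tst_cost (Less (var ''h'') (var ''tl''))))) \<le> 200 * unit \<and> elems ''W'' m' = reach B Al"
          by (simp add: unit_def)
      qed (use m3 in simp_all)
    qed (simp_all add: inputs_def)
  qed simp_all
qed (simp_all add: inputs_def)

text \<open>For fixed \<open>X\<close> the universal part of \<open>cpre\<close> does not depend on
  \<open>W\<close> but is a property of single states. The iteration of \<open>W\<close> is
  therefore plain backward reachability from \<open>B\<close> through admissible states.\<close>

lemma x_step_reach:
  "x_step B G X = reach B {p. p < N \<and> p \<notin> G \<and> (p \<in> system \<or>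
      (\<forall>q. (p, q) \<in> edges \<longrightarrow> q \<in> X \<union> dead))}"
proof -
  have "w_step B G X W = B \<union> {p \<in> {p. p < N \<and> p \<notin> G \<and> (p \<in> system \<or>
      (\<forall>q. (p, q) \<in> edges \<longrightarrow> q \<in> X \<union> dead))}. \<exists>q \<in> W. (p, q)
      \<in> edges}" for W
    unfolding w_step_def cpre_def using E_sub by blast
  then show ?thesis unfolding x_step_def reach_def by presburger
qed

lemma prune_prog:
  assumes m: "ok m" "m ''fl'' 0 = 0"
  shows "rt {''i'', ''X'', ''XR'', ''fl''} m prune_prog (\<lambda>c m'. c \<le> 100 * unit \<and>
      elems ''X'' m' = elems ''X'' m \<inter> elems ''W'' m \<and>
    (\<forall>j. m' ''XR'' j = (if \<exists>q \<in> elems ''X'' m - elems ''W'' m. j = m ''o'' 0 + q then 1 else m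
        ''XR'' j)) \<and>
    (m' ''fl'' 0 = 0 \<longleftrightarrow> elems ''X'' m \<subseteq> elems ''W'' m))"
proof -
  define R where "R = elems ''X'' m - elems ''W'' m"
  have R: "q \<in> R \<longleftrightarrow> m ''X'' q \<noteq> 0 \<and> m ''W'' q = 0" if "q < N" for q
    using that by (auto simp: R_def elems_def)
  have R_less: "q < N" if "q \<in> R" for q using that by (simp add: R_def elems_def)
  define XR where "XR k j = (if \<exists>q \<in> R. q < k \<and> j = m ''o'' 0 + q then 1 else m ''XR'' j)" for k j
  define X where "X k q = (if q < k \<and> m ''W'' q = 0 then 0 else m ''X'' q)" for k q
  define fl where "fl k \<longleftrightarrow> (\<forall>q<k. q \<notin> R)" for k
  have in_R: "XR (Suc k) = (XR k)(m ''o'' 0 + k := 1)" "X (Suc k) = (X k)(k := 0)" "\<not> fl (Suc k)" if "k \<in> R" for k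
    using that R[OF R_less[OF that]] by (auto simp: XR_def X_def fl_def less_Suc_eq fun_eq_iff)
  have not_R: "XR (Suc k) = XR k" "X (Suc k) = X k" "fl (Suc k) = fl k" if "k \<notin> R" "k < N" for k
    using that R[OF that(2)] by (auto simp: XR_def X_def fl_def less_Suc_eq fun_eq_iff)
  let ?c = "true_t (and_e (Cell ''X'' (var ''i'')) (not_e (Cell ''W'' (var ''i''))))"
  let ?p = "Seq (aset ''X'' (var ''i'') (Lit 0)) (Seq (aset ''XR'' (Plus (var ''o'') (var ''i'')) (Lit 1))
      (vset ''fl'' (Lit 1)))"
  let ?M = "{''i'', ''X'', ''XR'', ''fl''}"
  define I where "I k m' \<longleftrightarrow> m' ''X'' = X k \<and> m' ''XR'' = XR k \<and>
      (m' ''fl'' 0 = 0 \<longleftrightarrow> fl k)" for k and m' :: memory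
  have "rt ?M m (for_prog ''i'' (var ''nQ'') (Cond ?c ?p Skip)) (\<lambda>c m'. c \<le> 100 * unit \<and> I N m')"
  proof (rule rt_for[where n = N and b = 50 and I = I])
    show "I 0 (set_cell m ''i'' 0 0)" using m(2) by (auto simp: I_def X_def XR_def fl_def)
  next
    fix k m' assume m': "ok m'" "keep ?M m m'" "k < N" "m' ''i'' 0 = k" "I k m'"
    have eq: "m' ''W'' = m ''W''" "m' ''o'' = m ''o''" "m' ''X'' k = m ''X'' k"
      using m'(5) by (simp_all add: keepD[OF m'(2)] I_def X_def)
    have c: "ram_tst ?c m' \<longleftrightarrow> k \<in> R" using R[OF m'(3)] m'(4) eq by simp
    show "rt ?M m' (Cond ?c ?p Skip) (\<lambda>c m''. c \<le> 50 \<and> m'' ''i'' 0 = k \<and>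
        I (Suc k) (set_cell m'' ''i'' 0 (Suc k)))"
    proof (rule rt_Cond)
      assume "ram_tst ?c m'"
      then have k: "k \<in> R" using c by blast
      show "rt ?M m' ?p (\<lambda>c m''. ram_tst_cost ?c + c \<le> 50 \<and> m'' ''i'' 0 = k \<and>
          I (Suc k) (set_cell m'' ''i'' 0 (Suc k)))"
        using m'(1,4,5) eq in_R[OF k]
        by (intro rt_Do_Seq rt_Do) (simp_all add: inputs_def I_def fun_upd_def)
    next
      assume "\<not> ram_tst ?c m'"
      then have k: "k \<notin> R" using c by blast
      show "rt ?M m' Skip (\<lambda>c m''. ram_tst_cost ?c + c \<le> 50 \<and> m'' ''i'' 0 = k \<and>
          I (Suc k) (set_cell m'' ''i'' 0 (Suc k)))"
        using m'(1,4,5) not_R[OF k m'(3)] by (intro rt_Skip) (simp_all add: I_def)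
    qed
  next
    fix c m' assume "I N m'" "c \<le> N * (50 + 9 + ncost (var ''nQ'')) + 6 + ncost (var ''nQ'')"
    then show "c \<le> 100 * unit \<and> I N m'" using unit_ge by simp
  qed (use m in \<open>simp_all add: inputs_def ok_simps\<close>)
  then show ?thesis
    unfolding prune_prog_def
  proof (rule rt_weaken)
    fix c m' assume *: "c \<le> 100 * unit \<and> I N m'"
    have "elems ''X'' m' = elems ''X'' m \<inter> elems ''W'' m" using * by (auto simp: I_def X_def elems_def)
    moreover have "XR N j = (if \<exists>q \<in> R. j = m ''o'' 0 + q then 1 else m ''XR'' j)" for j
      using R_less unfolding XR_def by auto
    moreover have "fl N \<longleftrightarrow> elems ''X'' m \<subseteq> elems ''W'' m"
      using R_less unfolding fl_def R_def by blast
    ultimately show "c \<le> 100 * unit \<and> elems ''X'' m' = elems ''X'' m \<inter> elems ''W'' m \<and>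
      (\<forall>j. m' ''XR'' j = (if \<exists>q \<in> elems ''X'' m - elems ''W'' m. j = m ''o'' 0 + q then 1 else
          m ''XR'' j)) \<and>
      (m' ''fl'' 0 = 0 \<longleftrightarrow> elems ''X'' m \<subseteq> elems ''W'' m)" using * unfolding I_def
          R_def[symmetric] by simp
  qed simp
qed

definition succs :: "nat set" where
  "succs = Domain edges"

definition slot :: "nat \<Rightarrow> memory \<Rightarrow> nat set" where
  "slot a m = {q \<in> succs. m ''XR'' (a + q) = 0}"

lemma succs_sub: "succs \<subseteq> {..<N}"
  using E_sub by (auto simp: succs_def)

lemma succs_card: "card succs \<le> N" "card succs \<le> T" "1 \<le> card succs"
proof -
  show "card succs \<le> N" using card_mono[OF _ succs_sub] by simp
  have eq: "succs = m0 ''src'' ` {..<T}" by (auto simp: succs_def edges_def)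
  show "card succs \<le> T" unfolding eq using card_image_le[of "{..<T}"] by simp
  have "succs \<noteq> {}" unfolding eq using pos by auto
  moreover have "finite succs" unfolding eq by simp
  ultimately show "1 \<le> card succs" by (simp add: Suc_le_eq card_gt_0_iff)
qed

lemma finite_sub_succs: "X \<subseteq> succs \<Longrightarrow> finite X"
  by (rule finite_subset[of _ "{..<N}"]) (use succs_sub in auto)

definition env :: "memory \<Rightarrow> bool" where
  "env m \<longleftrightarrow> adj m \<and> elems ''D'' m = dead \<and> elems ''Z0'' m = succs \<and> m ''sA'' 0 = nA * N"

lemma env_keep:
  assumes "env m" "keep M m m'" "M \<inter> {''cnt'', ''PL'', ''row'', ''D'', ''Z0'', ''sA''} = {}"
  shows "env m'"
proof -
  have "x \<notin> M" if "x \<in> {''cnt'', ''PL'', ''row'', ''D'', ''Z0'', ''sA''}" for x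
    using assms(3) that by blast
  then have out: "''cnt'' \<notin> M" "''PL'' \<notin> M" "''row'' \<notin> M" "''D'' \<notin> M"
      "''Z0'' \<notin> M" "''sA'' \<notin> M"
    by simp_all
  have "adj m'" by (rule adj_keep[OF _ assms(2) out(1-3)]) (use assms(1) in \<open>simp add: env_def\<close>)
  moreover have "elems ''D'' m' = elems ''D'' m" "elems ''Z0'' m' = elems ''Z0'' m" "m' ''sA'' = m ''sA''"
    using elems_keep[OF assms(2)] keepD[OF assms(2)] out by blast+
  ultimately show ?thesis using assms(1) by (simp add: env_def)
qed

text \<open>As \<open>X\<close> starts from what earlier passes left over, the result may be smaller
  than \<open>avoid B G\<close>. It is bounded from both sides instead: it is a post-fixed point,
  and it keeps every \<open>avoid B0 G\<close> for a smaller \<open>B0\<close> that was still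
  intact, in particular the one for the final \<open>Z\<close>. Every search but the last removes a
  state and is paid by the decrease of the slot.\<close>

lemma avoid_prog:
  assumes m: "ok m" "env m" "elems ''bs'' m = B" and G: "\<And>q. q < N \<Longrightarrow>
      q \<in> G \<longleftrightarrow> m0 ''A'' (m ''oa'' 0 + q) \<noteq> 0"
  defines "a \<equiv> m ''o'' 0"
  shows "rt {''gd'', ''bd'', ''al'', ''i'', ''p'', ''W'', ''Qu'', ''tl'', ''h'', ''t'', ''X'', ''XR'', ''fl''} m avoid_prog
    (\<lambda>c m'. c + 500 * unit * card (slot a m') \<le> 600 * unit + 500 * unit * card (slot a m) \<and>
      elems ''X'' m' = slot a m' \<and> slot a m' \<subseteq> avoid B G \<and>
      (\<forall>B0 \<subseteq> B. avoid B0 G \<subseteq> slot a m \<longrightarrow> avoid B0 G \<subseteq> slot a m') \<and>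
      (\<forall>j. \<not> (a \<le> j \<and> j < a + N) \<longrightarrow> m' ''XR'' j = m ''XR'' j))"
proof -
  let ?M = "{''gd'', ''bd'', ''al'', ''i'', ''p'', ''W'', ''Qu'', ''tl'', ''h'', ''t'', ''X'', ''XR'', ''fl''}"
  let ?e1 = "and_e (Cell ''Z0'' (var ''i'')) (not_e (Cell ''XR'' (Plus (var ''o'') (var ''i''))))"
  let ?e2 = "and_e (not_e (Cell ''A'' (Plus (var ''oa'') (var ''i'')))) (or_e (Cell ''sys'' (var ''i''))
      (not_e (Cell ''bd'' (var ''i''))))"
  let ?body = "Seq (succ_prog ''X'') (Seq (map_prog ''al'' (Lit 0) ?e2) (Seq bfs_prog (Seq (vset ''fl'' (Lit 0))
      prune_prog)))"
  define Post where "Post C m' \<longleftrightarrow> C + 500 * unit * card (slot a m') \<le>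
      600 * unit + 500 * unit * card (slot a m) \<and>
      elems ''X'' m' = slot a m' \<and> slot a m' \<subseteq> avoid B G \<and>
      (\<forall>B0 \<subseteq> B. avoid B0 G \<subseteq> slot a m \<longrightarrow> avoid B0 G \<subseteq> slot a m') \<and>
      (\<forall>j. \<not> (a \<le> j \<and> j < a + N) \<longrightarrow> m' ''XR'' j = m ''XR'' j)" for C m'
  have slot_cong: "slot a m'' = slot a m'" if "m'' ''XR'' = m' ''XR''" for m' m''
    using that by (simp add: slot_def)
  \<comment> \<open>The summand for a set flag pays in advance for the search that will remove
    nothing.\<close>
  define I where "I C m' \<longleftrightarrow> elems ''X'' m' = slot a m' \<and> slot a m' \<subseteq> slot a m \<and>
      (\<forall>B0 \<subseteq> B. avoid B0 G \<subseteq> slot a m \<longrightarrow> avoid B0 G \<subseteq> slot a m') \<and>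
      (\<forall>j. \<not> (a \<le> j \<and> j < a + N) \<longrightarrow> m' ''XR'' j = m ''XR'' j) \<and>
      (m' ''fl'' 0 = 0 \<longrightarrow> slot a m' \<subseteq> x_step B G (slot a m')) \<and>
      C + 500 * unit * (card (slot a m') + of_bool (m' ''fl'' 0 \<noteq> 0)) \<le> 500 * unit * card (slot a m) +
          500 * unit" for C m'
  have loop: "rt ?M m2 (Loop (true_t (var ''fl'')) ?body) (\<lambda>d m'. d + 500 * unit * card (slot a m') \<le>
      510 * unit + 500 * unit * card (slot a m) \<and> I 0 m' \<and> m' ''fl'' 0 = 0)"
    if m2: "ok m2" "keep ?M m m2" "I 0 m2" for m2
  proof (rule rt_Loop[where I = I and \<mu> = "\<lambda>c m'. card (slot a m') + of_bool (m' ''fl'' 0 \<noteq> 0)"])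
    fix C m' assume m': "ok m'" "keep ?M m2 m'" "I C m'" "ram_tst (true_t (var ''fl'')) m'"
    note keep' = keep_trans[OF m2(2) m'(2)]
    have fl: "m' ''fl'' 0 \<noteq> 0" using m'(4) by simp
    let ?X = "slot a m'"
    have X: "elems ''X'' m' = ?X" using m'(3) by (simp add: I_def)
    have D: "elems ''D'' m' = dead" using m(2) elems_keep[OF keep'] by (simp add: env_def)
    let ?R = "\<lambda>d m''. I (C + ram_tst_cost (true_t (var ''fl'')) + d) m'' \<and>
        card (slot a m'') + of_bool (m'' ''fl'' 0 \<noteq> 0) < card (slot a m') + of_bool (m' ''fl'' 0 \<noteq> 0)"
    show "rt ?M m' ?body ?R"
    proof (rule rt_Seq[OF succ_prog[OF m'(1)]], simp, simp)
      fix c3 m3 assume m3: "ok m3" "keep {''gd'', ''bd'', ''i''} m' m3" "c3 \<le> 100 * (N + T) \<and>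
        (\<forall>q<N. m3 ''gd'' q \<noteq> 0 \<longleftrightarrow> (\<exists>q' \<in> elems ''X'' m'. (q, q')
            \<in> edges)) \<and>
        (\<forall>q<N. m3 ''bd'' q = 0 \<longleftrightarrow> (\<forall>q'. (q, q') \<in> edges \<longrightarrow>
            q' \<in> elems ''X'' m' \<union> elems ''D'' m'))"
      have oa3: "m3 ''oa'' = m ''oa''" by (simp add: keepD[OF m3(2)] keepD[OF keep'])
      have bd3: "m3 ''bd'' q = 0 \<longleftrightarrow> (\<forall>q'. (q, q') \<in> edges \<longrightarrow>
          q' \<in> ?X \<union> dead)" if "q < N" for q
        using m3(3) that X D by blast
      show "rt ?M m3 (Seq (map_prog ''al'' (Lit 0) ?e2) (Seq bfs_prog (Seq (vset ''fl'' (Lit 0)) prune_prog)))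
          (\<lambda>d. ?R (c3 + d))"
      proof (rule rt_Seq[OF map_prog[OF m3(1), where off = 0 and
            v = "\<lambda>q. of_bool (m0 ''A'' (m ''oa'' 0 + q) = 0 \<and> (m0 ''sys'' q \<noteq> 0 \<or>
                m3 ''bd'' q = 0))"]])
        fix c4 m4 assume m4: "ok m4" "keep {''al'', ''i''} m3 m4" "c4 \<le> (ncost (Lit 0) + ncost ?e2 + 23) * N \<and>
          (\<forall>q<N. m4 ''al'' (0 + q) = of_bool (m0 ''A'' (m ''oa'' 0 + q) = 0 \<and>
              (m0 ''sys'' q \<noteq> 0 \<or> m3 ''bd'' q = 0))) \<and>
          (\<forall>j. \<not> (0 \<le> j \<and> j < 0 + N) \<longrightarrow> m4 ''al'' j = m3 ''al'' j)"
        let ?Al = "{p. p < N \<and> p \<notin> G \<and> (p \<in> system \<or>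
            (\<forall>q. (p, q) \<in> edges \<longrightarrow> q \<in> ?X \<union> dead))}"
        have "q \<in> elems ''al'' m4 \<longleftrightarrow> q \<in> ?Al" for q
          using m4(3) bd3[of q] G[of q] system_iff[of q] by (auto simp: elems_def)
        then have al4: "elems ''al'' m4 = ?Al" by blast
        have keep4: "keep ?M m' m4"
          by (rule keep_trans[of _ _ m3]) (rule keep_mono[OF m3(2)], simp, rule keep_mono[OF m4(2)], simp)
        note keep4' = keep_trans[OF keep' keep4]
        have env4: "env m4" by (rule env_keep[OF m(2) keep4']) simp
        then have adj4: "adj m4" by (simp add: env_def)
        have bs4: "elems ''bs'' m4 = B" using m(3) elems_keep[OF keep4'] by simp
        have eq4: "m4 ''XR'' = m' ''XR''" "m4 ''X'' = m' ''X''"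
          by (simp_all add: keepD[OF m4(2)] keepD[OF m3(2)])
        show "rt ?M m4 (Seq bfs_prog (Seq (vset ''fl'' (Lit 0)) prune_prog)) (\<lambda>d. ?R (c3 + (c4 + d)))"
        proof (rule rt_Seq[OF bfs_prog[OF m4(1) adj4 bs4 al4]], simp)
          fix c5 m5 assume m5: "ok m5" "keep {''i'', ''p'', ''W'', ''Qu'', ''tl'', ''h'', ''t''} m4 m5"
            "c5 \<le> 200 * unit \<and> elems ''W'' m5 = reach B ?Al"
          have W5: "elems ''W'' m5 = x_step B G ?X" using m5(3) unfolding x_step_reach by simp
          have eq5: "m5 ''XR'' = m' ''XR''" "m5 ''X'' = m' ''X''" "m5 ''o'' = m ''o''"
            using eq4 by (simp_all add: keepD[OF m5(2)] keepD[OF keep4'])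
          show "rt ?M m5 (Seq (vset ''fl'' (Lit 0)) prune_prog) (\<lambda>d. ?R (c3 + (c4 + (c5 + d))))"
          proof (rule rt_Do_Seq[OF m5(1)], simp, simp add: inputs_def)
            fix m6 assume m6: "m6 = set_cell m5 ''fl'' (nval (Lit 0) m5) (nval (Lit 0) m5)" "ok m6"
            have eq6: "elems ''X'' m6 = ?X" "elems ''W'' m6 = x_step B G ?X" "m6 ''o'' 0 = a" "m6 ''XR'' = m' ''XR''"
              using eq5 X W5 by (simp_all add: m6(1) elems_def a_def)
            have fl6: "m6 ''fl'' 0 = 0" by (simp add: m6(1))
            show "rt ?M m6 prune_prog (\<lambda>d. ?R (c3 + (c4 + (c5 + (1 + ncost (Lit 0) + ncost (Lit 0) + d)))))"
            proof (rule rt_weaken[OF prune_prog[OF m6(2) fl6]], simp)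
              fix c7 m7 assume "c7 \<le> 100 * unit \<and> elems ''X'' m7 = elems ''X'' m6 \<inter> elems ''W'' m6 \<and>
                (\<forall>j. m7 ''XR'' j = (if \<exists>q \<in> elems ''X'' m6 - elems ''W'' m6. j = m6 ''o'' 0 +
                    q then 1 else m6 ''XR'' j)) \<and>
                (m7 ''fl'' 0 = 0 \<longleftrightarrow> elems ''X'' m6 \<subseteq> elems ''W'' m6)"
              then have c7: "c7 \<le> 100 * unit" and X7: "elems ''X'' m7 = ?X \<inter> x_step B G ?X"
                and XR7: "\<And>j. m7 ''XR'' j = (if \<exists>q \<in> ?X - x_step B G ?X. j = a + q then 1 else m' ''XR'' j)"
                and fl7: "m7 ''fl'' 0 = 0 \<longleftrightarrow> ?X \<subseteq> x_step B G ?X"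
                unfolding eq6 by blast+
              have slot7: "slot a m7 = ?X \<inter> x_step B G ?X"
                by (auto simp: slot_def XR7 split: if_splits)
              have XR7': "m7 ''XR'' j = m ''XR'' j" if "\<not> (a \<le> j \<and> j < a + N)" for j
              proof -
                have "\<not> (\<exists>q \<in> ?X - x_step B G ?X. j = a + q)" using that succs_sub by (auto simp: slot_def)
                then show ?thesis using m'(3) that by (simp add: XR7 I_def)
              qed
              have fin: "finite ?X" using finite_sub_succs by (simp add: slot_def)
              \<comment> \<open>\<open>avoid B0 G\<close> is a fixed point and lies in the current
                \<open>X\<close>, so by monotonicity it survives one more step with the larger
                arguments.\<close>
              have avoid7: "avoid B0 G \<subseteq> slot a m7" if B0: "B0 \<subseteq> B"
                  "avoid B0 G \<subseteq> slot a m" for B0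
              proof -
                have *: "avoid B0 G \<subseteq> ?X" using m'(3) B0 by (simp add: I_def)
                have "avoid B0 G = x_step B0 G (avoid B0 G)"
                  unfolding avoid_def by (rule gfp_unfold[OF mono_x_step])
                also have "\<dots> \<subseteq> x_step B G ?X" by (rule x_step_mono[OF B0(1) *])
                finally show ?thesis using * slot7 by blast
              qed
              have card7: "card (slot a m7) + of_bool (m7 ''fl'' 0 \<noteq> 0) \<le> card ?X"
              proof (cases "?X \<subseteq> x_step B G ?X")
                case True
                then show ?thesis using fl7 slot7 by (simp add: Int_absorb2)
              next
                case False
                then have "card (slot a m7) < card ?X" unfolding slot7 using fin by (intro psubset_card_mono) auto
                then show ?thesis using fl7 False by simp
              qed
              let ?c = "c3 + (c4 + (c5 + (1 + ncost (Lit 0) + ncost (Lit 0) + c7)))"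
              \<comment> \<open>In units, a round costs at most 100 for \<open>succ_prog\<close>, 48
                for \<open>al\<close>, 200 for the search and 100 for pruning; the flag and the test
                fit into the rest.\<close>
              have "?c + ram_tst_cost (true_t (var ''fl'')) \<le> 500 * unit"
                using m3(3) m4(3) m5(3) c7 unit_ge unfolding unit_def[symmetric] by simp
              moreover have "500 * unit * (card (slot a m7) + of_bool (m7 ''fl'' 0 \<noteq> 0)) \<le> 500 * unit * card ?X"
                using card7 by (intro mult_le_mono2)
              moreover have "C + 500 * unit * card ?X + 500 * unit \<le> 500 * unit * card (slot a m) + 500 * unit"
                using m'(3) fl by (simp add: I_def algebra_simps)
              ultimately have cost: "C + ram_tst_cost (true_t (var ''fl'')) + ?c + 500 * unit * (card (slot a m7)
                  + of_bool (m7 ''fl'' 0 \<noteq> 0))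
                  \<le> 500 * unit * card (slot a m) + 500 * unit" by linarith
              have sub7: "slot a m7 \<subseteq> x_step B G (slot a m7)" if "m7 ''fl'' 0 = 0"
              proof -
                have "slot a m7 = ?X" using that fl7 slot7 by blast
                then show ?thesis using that fl7 by simp
              qed
              have "slot a m7 \<subseteq> slot a m" using m'(3) slot7 by (auto simp: I_def)
              moreover have "elems ''X'' m7 = slot a m7" using X7 slot7 by simp
              ultimately have "I (C + ram_tst_cost (true_t (var ''fl'')) + ?c) m7"
                unfolding I_def using cost sub7 avoid7 XR7' by blast
              then show "?R ?c m7" using card7 fl by simp
            qed
          qed
        qed
      qed (use m3 oa3 in \<open>auto simp: inputs_def ok_simps keepD\<close>)
    qed
  next
    fix C m' assume m': "I C m'" "\<not> ram_tst (true_t (var ''fl'')) m'"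
    then have "m' ''fl'' 0 = 0" by simp
    with m'(1) show "C + ram_tst_cost (true_t (var ''fl'')) + 500 * unit * card (slot a m') \<le>
        510 * unit + 500 * unit * card (slot a m) \<and> I 0 m' \<and> m' ''fl'' 0 = 0"
      using unit_ge by (simp add: I_def)
  qed (use m2 in simp_all)
  have "rt ?M m avoid_prog Post"
    unfolding avoid_prog_def
  proof (rule rt_Seq[OF map_prog[OF m(1), where off = 0 and v = "\<lambda>q. of_bool (m ''Z0'' q \<noteq> 0 \<and>
      m ''XR'' (a + q) = 0)"]])
    fix c1 m1 assume m1: "ok m1" "keep {''X'', ''i''} m m1" "c1 \<le> (ncost (Lit 0) + ncost ?e1 + 23) * N \<and>
      (\<forall>q<N. m1 ''X'' (0 + q) = of_bool (m ''Z0'' q \<noteq> 0 \<and> m ''XR'' (a + q) = 0)) \<and>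
      (\<forall>j. \<not> (0 \<le> j \<and> j < 0 + N) \<longrightarrow> m1 ''X'' j = m ''X'' j)"
    have Z0: "q \<in> succs \<longleftrightarrow> q < N \<and> m ''Z0'' q \<noteq> 0" for q
      using m(2) by (auto simp: env_def elems_def)
    have X1: "elems ''X'' m1 = slot a m"
      using m1(3) by (auto simp: elems_def slot_def Z0)
    show "rt ?M m1 (Seq (vset ''fl'' (Lit 1)) (Loop (true_t (var ''fl'')) ?body)) (\<lambda>d. Post (c1 + d))"
    proof (rule rt_Do_Seq[OF m1(1)], simp, simp add: inputs_def)
      fix m2 assume m2: "m2 = set_cell m1 ''fl'' (nval (Lit 0) m1) (nval (Lit 1) m1)" "ok m2"
      have keep2: "keep ?M m m2"
        by (rule keep_trans[of _ _ m1]) (rule keep_mono[OF m1(2)], simp, simp add: m2 keep_set_cell)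
      have eq2: "m2 ''XR'' = m ''XR''" "m2 ''fl'' 0 = 1" "elems ''X'' m2 = slot a m"
        using X1 by (simp_all add: m2(1) keepD[OF m1(2)] elems_def)
      have "slot a m2 = slot a m" using eq2(1) by (rule slot_cong)
      then have "I 0 m2" unfolding I_def using eq2 by simp
      from loop[OF m2(2) keep2 this]
      show "rt ?M m2 (Loop (true_t (var ''fl'')) ?body) (\<lambda>d. Post (c1 + (1 + ncost (Lit 0) + ncost (Lit 1) + d)))"
      proof (rule rt_weaken, simp)
        fix d m' assume *: "d + 500 * unit * card (slot a m') \<le>
            510 * unit + 500 * unit * card (slot a m) \<and> I 0 m' \<and> m' ''fl'' 0 = 0"
        have "c1 + 3 \<le> 60 * unit" using m1(3) unit_ge by simp
        then have "c1 + (1 + ncost (Lit 0) + ncost (Lit 1) + d) + 500 * unit * card (slot a m') \<le>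
            600 * unit + 500 * unit * card (slot a m)"
          using * by simp
        moreover have "slot a m' \<subseteq> avoid B G" unfolding avoid_def by (rule gfp_upperbound)
            (use * in \<open>simp add: I_def\<close>)
        ultimately show "Post (c1 + (1 + ncost (Lit 0) + ncost (Lit 1) + d)) m'"
          using * unfolding Post_def I_def by blast
      qed
    qed
  qed (use m in \<open>auto simp: inputs_def keepD a_def\<close>)
  then show ?thesis unfolding Post_def .
qed

end

text \<open>\<open>oa\<close> plays two roles: it is the offset of an assumption in the input array
  \<open>A\<close> and, relative to \<open>oj\<close>, that of its block in \<open>XR\<close>. Both
  advance by the number of states.\<close>

definition slot_prog :: "(ram_action, ram_test) prog" where
  "slot_prog = Seq (vset ''o'' (Plus (var ''oj'') (var ''oa''))) (Seq avoid_prog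
     (Seq (map_prog ''Yn'' (Lit 0) (or_e (Cell ''Yn'' (var ''i'')) (Cell ''X'' (var ''i''))))
       (vset ''oa'' (Plus (var ''oa'') (var ''nQ'')))))"

abbreviation cpre_e :: nexp where
  "cpre_e \<equiv> and_e (Cell ''gd'' (var ''i'')) (or_e (Cell ''sys'' (var ''i'')) (not_e (Cell ''bd'' (var ''i''))))"

definition ystep_prog :: "(ram_action, ram_test) prog" where
  "ystep_prog = Seq (succ_prog ''Y'')
     (Seq (map_prog ''bs'' (Lit 0) (or_e (Cell ''tg'' (var ''i'')) (or_e (Cell ''Y'' (var ''i'')) cpre_e)))
     (Seq (map_prog ''Yn'' (Lit 0) (Lit 0)) (Seq (vset ''oa'' (var ''oa0''))
     (Seq (for_prog ''b'' (var ''nb'') slot_prog)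
     (Seq (map_prog ''Y'' (Lit 0) (Cell ''Yn'' (var ''i''))) (vset ''oj'' (Plus (var ''oj'') (var ''sA''))))))))"

definition shrink_prog :: "(ram_action, ram_test) prog" where
  "shrink_prog = for_prog ''i'' (var ''nQ'') (Cond (true_t (and_e (Cell ''Z'' (var ''i'')) (not_e (Cell ''Y'' (var ''i'')))))
     (Seq (aset ''Z'' (var ''i'') (Lit 0)) (vset ''zf'' (Lit 1))) Skip)"

definition job_prog :: "string \<Rightarrow> (ram_action, ram_test) prog" where
  "job_prog F = Seq (succ_prog ''Z'') (Seq (map_prog ''tg'' (Lit 0) (and_e (Cell F (Plus (var ''ot'') (var ''i''))) cpre_e))
     (Seq (map_prog ''Y'' (Lit 0) (Lit 0)) (Seq (for_prog ''j'' (var ''nQ'') ystep_prog)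
     (Seq shrink_prog (vset ''ot'' (Plus (var ''ot'') (var ''nQ'')))))))"

text \<open>\<open>oj\<close> is not reset between jobs, so every job and every iterate keeps blocks
  of its own, at the same place in each round. An assumption job avoids its own target, whence
  \<open>oa0\<close> is set to \<open>ot\<close>.\<close>

definition round_prog :: "(ram_action, ram_test) prog" where
  "round_prog = Seq (vset ''oj'' (Lit 0)) (Seq (vset ''ot'' (Lit 0)) (Seq (vset ''nb'' (var ''nA''))
      (Seq (vset ''oa0'' (Lit 0))
     (Seq (for_prog ''g'' (var ''nG'') (job_prog ''G'')) (Seq (vset ''ot'' (Lit 0)) (Seq (vset ''nb'' (Lit 1))
     (for_prog ''g'' (var ''nA'') (Seq (vset ''oa0'' (var ''ot'')) (job_prog ''A'')))))))))"

definition solve_prog :: "(ram_action, ram_test) prog" where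
  "solve_prog = Seq (vset ''zf'' (Lit 1)) (Loop (true_t (var ''zf'')) (Seq (vset ''zf'' (Lit 0)) round_prog))"

definition setup_prog :: "(ram_action, ram_test) prog" where
  "setup_prog = Seq ram_dead_prog (Seq row_prog (Seq fill_prog (Seq (map_prog ''Z0'' (Lit 0) (Lit 0))
     (Seq (scan_prog ''Z0'' (Less (Lit 0) (Lit 1))) (Seq (map_prog ''Z'' (Lit 0) (Cell ''Z0'' (var ''i'')))
     (Seq (vset ''sA'' (Lit 0)) (for_prog ''i'' (var ''nA'') (vset ''sA'' (Plus (var ''sA'') (var ''nQ''))))))))))"

text \<open>The double negation turns a nonzero entry into the value 1 that \<open>accepts\<close>
  asks for. Without transitions there is no play, and \<open>out\<close> keeps its initial
  0.\<close>

definition ram_prog :: "(ram_action, ram_test) prog" where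
  "ram_prog = Cond (true_t (var ''nT'')) (Seq setup_prog (Seq solve_prog
     (vset ''out'' (not_e (not_e (Cell ''Z'' (var ''init''))))))) Skip"

section \<open>The potential of states that can still be removed\<close>

context ram_arena
begin

text \<open>Jobs are numbered with the guarantees first; number \<open>nG + a\<close> belongs to
  assumption \<open>a\<close>, the only set avoided there.\<close>

definition rng :: "nat \<Rightarrow> nat set" where
  "rng k = (if k < nG then {..<nA} else {k - nG})"

definition assum :: "nat \<Rightarrow> nat set" where
  "assum b = {q. q < N \<and> m0 ''A'' (b * N + q) \<noteq> 0}"

definition target :: "nat \<Rightarrow> nat set" where
  "target k = {q. q < N \<and> (if k < nG then m0 ''G'' (k * N + q) else m0 ''A'' ((k - nG) * N + q)) \<noteq> 0}"

definition ram_jobs :: "(nat set \<times> nat set set) set" where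
  "ram_jobs = (\<lambda>k. (target k, assum ` rng k)) ` {..<nG + nA}"

definition sol :: "nat set" where
  "sol = solution ram_jobs"

definition job_stage :: "nat \<Rightarrow> nat set \<Rightarrow> nat set" where
  "job_stage k Z = stage (target k) (assum ` rng k) Z"

definition goal :: "nat \<Rightarrow> nat set" where
  "goal k = target k \<inter> cpre sol sol"

definition y_iter :: "nat \<Rightarrow> nat \<Rightarrow> nat set" where
  "y_iter k j = (y_step (goal k) (assum ` rng k) ^^ j) {}"

definition x_limit :: "nat \<Rightarrow> nat \<Rightarrow> nat \<Rightarrow> nat set" where
  "x_limit k j b = avoid (base (goal k) (y_iter k j)) (assum b)"

text \<open>\<open>y_iter\<close> and \<open>x_limit\<close> are the iterates for the final value of \<open>Z\<close>. The invariant \<open>above\<close> says that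
  only states outside of them have been removed, and \<open>pot\<close>, the number of states that can still
  be removed, pays for the repeated searches.\<close>

definition adr :: "nat \<Rightarrow> nat \<Rightarrow> nat \<Rightarrow> nat" where
  "adr k j b = (k * N + j) * (nA * N) + b * N"

definition slots :: "(nat \<times> nat \<times> nat) set" where
  "slots = (SIGMA k : {..<nG + nA}. {..<N} \<times> rng k)"

definition above :: "memory \<Rightarrow> bool" where
  "above m \<longleftrightarrow> (\<forall>(k, j, b) \<in> slots. x_limit k j b \<subseteq> slot (adr k j b) m)"

definition pot :: "memory \<Rightarrow> nat" where
  "pot m = (\<Sum>(k, j, b) \<in> slots. card (slot (adr k j b) m))"

lemma rng_less: "k < nG + nA \<Longrightarrow> b \<in> rng k \<Longrightarrow> b < nA"
  using pos by (auto simp: rng_def split: if_splits)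

lemma finite_slots: "finite slots"
  by (auto simp: slots_def rng_def)

lemma sol_unfold: "z_step ram_jobs sol = sol"
  unfolding sol_def solution_def by (rule gfp_unfold[OF mono_z_step, symmetric])

lemma z_step_jobs: "z_step ram_jobs Z = (\<Inter>k<nG + nA. job_stage k Z)"
  by (simp add: z_step_def ram_jobs_def job_stage_def)

lemma sol_stage: "k < nG + nA \<Longrightarrow> sol \<subseteq> job_stage k sol"
  using sol_unfold unfolding z_step_jobs by blast

lemma sol_greatest: "(\<And>k. k < nG + nA \<Longrightarrow> Z \<subseteq> job_stage k Z) \<Longrightarrow>
    Z \<subseteq> sol"
  unfolding sol_def solution_def by (rule gfp_upperbound) (auto simp: z_step_jobs)

lemma y_iter_Suc: "y_iter k (Suc j) = (\<Union>b \<in> rng k. x_limit k j b)"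
  by (simp add: y_iter_def x_limit_def y_step_def)

lemma y_iter_N: "y_iter k N = job_stage k sol"
  using stage_iterate[of "target k" "assum ` rng k" sol] by (simp add: y_iter_def job_stage_def goal_def)

text \<open>\<open>cpre\<close> demands a successor, so only \<open>B\<close> could contribute
  states without one.\<close>

lemma avoid_succs:
  assumes "B \<subseteq> succs" shows "avoid B G \<subseteq> succs"
proof -
  have "x_step B G X \<subseteq> succs" for X
    unfolding x_step_def by (rule lfp_lowerbound) (use assms in \<open>auto simp: w_step_def cpre_def succs_def\<close>)
  then show ?thesis unfolding avoid_def by (subst gfp_unfold[OF mono_x_step])
qed

lemma y_iter_succs: "y_iter k j \<subseteq> succs" and x_limit_succs: "x_limit k j b \<subseteq> succs"
proof -
  have cp: "cpre W X \<subseteq> succs" for W X by (auto simp: cpre_def succs_def)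
  show y: "y_iter k j \<subseteq> succs" for j
  proof (induction j)
    case (Suc j)
    have "base (goal k) (y_iter k j) \<subseteq> succs" using Suc cp by (auto simp: base_def goal_def)
    then show ?case unfolding y_iter_Suc x_limit_def using avoid_succs by blast
  qed (simp add: y_iter_def)
  show "x_limit k j b \<subseteq> succs"
    unfolding x_limit_def using cp y by (intro avoid_succs) (auto simp: base_def goal_def)
qed

lemma sol_succs: "sol \<subseteq> succs"
  using sol_stage[of 0] y_iter_succs[of 0 N] pos by (auto simp: y_iter_N)

lemma adr_eq: "adr k j b = ((k * N + j) * nA + b) * N"
  by (simp add: adr_def algebra_simps)

text \<open>Different slots occupy disjoint blocks of \<open>XR\<close>. In nested form the address
  is a number in mixed radix whose digits are split off by division; \<open>k\<close> is the leading
  digit and needs no bound.\<close>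

lemma adr_inject:
  assumes "adr k j b + q = adr k' j' b' + q'" "j < N" "j' < N" "b < nA" "b' < nA" "q < N" "q' < N"
  shows "(k, j, b) = (k', j', b')"
proof -
  have uniq: "x = y \<and> r = s" if "x * n + r = y * n + s" "r < n" "s < n" for x y r s n :: nat
  proof -
    have "(x * n + r) div n = x" "(y * n + s) div n = y" using that(2,3) by simp_all
    then have "x = y" using that(1) by simp
    with that(1) show ?thesis by simp
  qed
  have "(k * N + j) * nA + b = (k' * N + j') * nA + b'"
    using uniq[OF assms(1)[unfolded adr_eq] assms(6,7)] by blast
  from uniq[OF this assms(4,5)] have "k * N + j = k' * N + j'" "b = b'" by auto
  from uniq[OF this(1) assms(2,3)] this(2) show ?thesis by simp
qed

text \<open>Because blocks are disjoint, a change inside one block affects \<open>pot\<close> and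
  \<open>above\<close> only through its own slot. The equation is additive since subtraction of
  naturals truncates.\<close>

lemma slot_update:
  assumes s: "(k, j, b) \<in> slots" and XR: "\<And>i. \<not> (adr k j b \<le> i \<and>
      i < adr k j b + N) \<Longrightarrow> m' ''XR'' i = m ''XR'' i"
  shows "pot m' + card (slot (adr k j b) m) = pot m + card (slot (adr k j b) m')"
    "above m \<Longrightarrow> x_limit k j b \<subseteq> slot (adr k j b) m' \<Longrightarrow> above m'"
proof -
  have other: "slot (adr k' j' b') m' = slot (adr k' j' b') m" if "(k', j', b') \<in> slots"
      "(k', j', b') \<noteq> (k, j, b)" for k' j' b'
  proof -
    have "m' ''XR'' (adr k' j' b' + q) = m ''XR'' (adr k' j' b' + q)" if q: "q < N" for q
    proof (rule XR, rule notI)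
      assume *: "adr k j b \<le> adr k' j' b' + q \<and> adr k' j' b' + q < adr k j b + N"
      then have "adr k' j' b' + q = adr k j b + (adr k' j' b' + q - adr k j b)" "adr k' j' b' + q - adr k j b < N"
        by linarith+
      from adr_inject[OF this(1) _ _ _ _ q this(2)] show False
        using \<open>(k', j', b') \<in> slots\<close> \<open>(k', j', b') \<noteq> (k, j, b)\<close> s rng_less
            by (auto simp: slots_def)
    qed
    then show ?thesis using succs_sub by (auto simp: slot_def)
  qed
  have split: "pot x = card (slot (adr k j b) x) + (\<Sum>(k, j, b) \<in> slots - {(k, j, b)}. card
      (slot (adr k j b) x))" for x
    unfolding pot_def using sum.remove[OF finite_slots s, of "\<lambda>(k, j, b). card (slot (adr k j b) x)"] by simp
  have "(\<Sum>(k, j, b) \<in> slots - {(k, j, b)}. card (slot (adr k j b) m')) = (\<Sum>(k, j, b) \<in> slots -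
      {(k, j, b)}. card (slot (adr k j b) m))"
  proof (rule sum.cong)
    fix x assume "x \<in> slots - {(k, j, b)}"
    then show "(case x of (k, j, b) \<Rightarrow> card (slot (adr k j b) m')) = (case x of (k, j, b) \<Rightarrow>
        card (slot (adr k j b) m))"
      by (cases x) (simp add: other)
  qed simp
  then show "pot m' + card (slot (adr k j b) m) = pot m + card (slot (adr k j b) m')"
    using split[of m] split[of m'] by simp
  show "above m'" if "above m" "x_limit k j b \<subseteq> slot (adr k j b) m'"
    unfolding above_def
  proof (clarify)
    fix k' j' b' q assume *: "(k', j', b') \<in> slots" "q \<in> x_limit k' j' b'"
    show "q \<in> slot (adr k' j' b') m'"
    proof (cases "(k', j', b') = (k, j, b)")
      case False
      then show ?thesis using other[OF *(1) False] * \<open>above m\<close> by (auto simp: above_def)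
    qed (use * that(2) in auto)
  qed
qed

lemma pot_XR_cong: "m' ''XR'' = m ''XR'' \<Longrightarrow> pot m' = pot m" "m' ''XR'' = m ''XR'' \<Longrightarrow>
    above m' = above m"
  by (simp_all add: pot_def above_def slot_def)

section \<open>Loops over assumptions, iterates and jobs\<close>

abbreviation avoid_vars :: "string set" where
  "avoid_vars \<equiv> {''gd'', ''bd'', ''al'', ''i'', ''p'', ''W'', ''Qu'', ''tl'', ''h'', ''t'', ''X'', ''XR'', ''fl''}"

text \<open>The current \<open>B\<close> contains the base for the final \<open>Z\<close>, so by
  monotonicity no state of an \<open>x_limit\<close> is removed. Each slot costs at most 700 units
  beyond the searches paid by \<open>pot\<close>.\<close>

lemma slot_loop:
  assumes m: "ok m" "env m" "elems ''bs'' m = B" "elems ''Yn'' m = {}" "above m"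
    and k: "k < nG + nA" "j < N" "rng k = {lo..<lo + n}"
    and v: "m ''oj'' 0 = (k * N + j) * (nA * N)" "m ''oa'' 0 = lo * N" "m ''nb'' 0 = n"
    and B: "base (goal k) (y_iter k j) \<subseteq> B"
  shows "rt ({''o'', ''oa'', ''b'', ''Yn''} \<union> avoid_vars) m (for_prog ''b'' (var ''nb'') slot_prog)
    (\<lambda>c m'. c + 500 * (unit * pot m') \<le> 800 * (unit * n) + 20 * unit + 500 * (unit * pot m) \<and>
      y_iter k (Suc j) \<subseteq> elems ''Yn'' m' \<and> elems ''Yn'' m' \<subseteq> (\<Union>b \<in> rng k.
          avoid B (assum b)) \<and> above m')"
proof -
  let ?M = "{''o'', ''oa'', ''b'', ''Yn''} \<union> avoid_vars"
  define I where "I b c m' \<longleftrightarrow> m' ''oa'' 0 = (lo + b) * N \<and> above m' \<and>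
    (\<Union>b \<in> {lo..<lo + b}. x_limit k j b) \<subseteq> elems ''Yn'' m' \<and> elems ''Yn'' m' \<subseteq>
        (\<Union>b \<in> {lo..<lo + b}. avoid B (assum b)) \<and>
    c + 500 * (unit * pot m') \<le> 700 * (unit * b) + 500 * (unit * pot m)" for b c m'
  have I_cong: "I b c m'' = I b c m'" if "m'' ''oa'' = m' ''oa''" "m'' ''XR'' = m' ''XR''"
      "m'' ''Yn'' = m' ''Yn''" for b c m' m''
    using that pot_XR_cong[of m'' m'] by (simp add: I_def elems_def)
  show ?thesis
  proof (rule rt_for_amortized[where I = I and n = n, OF m(1)])
    have "I 0 0 m" using m(4,5) v(2) by (simp add: I_def)
    then show "I 0 0 (set_cell m ''b'' 0 0)" by (subst I_cong[of _ m]) simp_all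
  next
    fix b c m' assume m': "ok m'" "keep ?M m m'" "b < n" "m' ''b'' 0 = b" "I b c m'"
    let ?b = "lo + b"
    let ?a = "adr k j ?b"
    have slot: "(k, j, ?b) \<in> slots" using k m'(3) by (simp add: slots_def)
    let ?R = "\<lambda>c' m''. m'' ''b'' 0 = b \<and> I (Suc b) (c + c') (set_cell m'' ''b'' 0 (Suc b))"
    show "rt ?M m' slot_prog ?R"
      unfolding slot_prog_def
    proof (rule rt_Do_Seq[OF m'(1)], simp, simp add: inputs_def)
      fix m1 assume m1: "m1 = set_cell m' ''o'' (nval (Lit 0) m') (nval (Plus (var ''oj'') (var ''oa'')) m')" "ok m1"
      have keep1: "keep ?M m m1" by (rule keep_trans[OF m'(2)]) (simp add: m1 keep_set_cell)
      have env1: "env m1" by (rule env_keep[OF m(2) keep1]) simp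
      have bs1: "elems ''bs'' m1 = B" using m(3) elems_keep[OF keep1] by simp
      have "m' ''oa'' 0 = ?b * N" using m'(5) by (simp add: I_def)
      then have o1: "m1 ''o'' 0 = ?a" "m1 ''oa'' 0 = ?b * N"
        using v(1) by (simp_all add: m1(1) adr_def keepD[OF m'(2)])
      have A1: "q \<in> assum ?b \<longleftrightarrow> m0 ''A'' (m1 ''oa'' 0 + q) \<noteq> 0" if "q < N" for q
        using that by (simp add: assum_def o1)
      have eq1: "m1 ''XR'' = m' ''XR''" "m1 ''Yn'' = m' ''Yn''" "m1 ''b'' 0 = b" using m'(4) by (simp_all add: m1(1))
      show "rt ?M m1 (Seq avoid_prog (Seq (map_prog ''Yn'' (Lit 0) (or_e (Cell ''Yn'' (var ''i'')) (Cell ''X'' (var ''i''))))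
         (vset ''oa'' (Plus (var ''oa'') (var ''nQ''))))) (\<lambda>d. ?R (1 + ncost (Lit 0) + ncost
             (Plus (var ''oj'') (var ''oa'')) + d))"
      proof (rule rt_Seq[OF avoid_prog[OF m1(2) env1 bs1 A1]], assumption, blast)
        fix c2 m2 assume m2: "ok m2" "keep avoid_vars m1 m2"
          "c2 + 500 * unit * card (slot (m1 ''o'' 0) m2) \<le> 600 * unit + 500 * unit * card (slot (m1 ''o'' 0) m1) \<and>
           elems ''X'' m2 = slot (m1 ''o'' 0) m2 \<and> slot (m1 ''o'' 0) m2 \<subseteq> avoid B (assum ?b) \<and>
           (\<forall>B0 \<subseteq> B. avoid B0 (assum ?b) \<subseteq> slot (m1 ''o'' 0) m1 \<longrightarrow>
               avoid B0 (assum ?b) \<subseteq> slot (m1 ''o'' 0) m2) \<and>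
           (\<forall>j. \<not> (m1 ''o'' 0 \<le> j \<and> j < m1 ''o'' 0 + N) \<longrightarrow> m2 ''XR'' j = m1 ''XR'' j)"
        have "above m1 = above m'" using eq1(1) by (rule pot_XR_cong)
        then have above1: "above m1" using m'(5) by (simp add: I_def)
        have pot1: "pot m1 = pot m'" using eq1(1) by (rule pot_XR_cong)
        have c2: "c2 + 500 * unit * card (slot ?a m2) \<le> 600 * unit + 500 * unit * card (slot ?a m1)"
          and X2: "elems ''X'' m2 = slot ?a m2" "slot ?a m2 \<subseteq> avoid B (assum ?b)"
          and keep_low: "\<And>B0. B0 \<subseteq> B \<Longrightarrow>
              avoid B0 (assum ?b) \<subseteq> slot ?a m1 \<Longrightarrow> avoid B0 (assum ?b) \<subseteq> slot ?a m2"
          and XR2: "\<And>j. \<not> (?a \<le> j \<and> j < ?a + N) \<Longrightarrow> m2 ''XR'' j = m1 ''XR'' j"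
          using m2(3) unfolding o1(1) by blast+
        have "x_limit k j ?b \<subseteq> slot ?a m1" using above1 slot by (auto simp: above_def)
        then have low2: "x_limit k j ?b \<subseteq> slot ?a m2" unfolding x_limit_def by (rule keep_low[OF B])
        have above2: "above m2" by (rule slot_update(2)[where m = m1 and m' = m2, OF slot XR2 above1 low2])
        have pot2: "pot m2 + card (slot ?a m1) = pot m1 + card (slot ?a m2)" by (rule slot_update(1)[where m = m1
            and m' = m2, OF slot XR2])
        have "unit * pot m2 + unit * card (slot ?a m1) = unit * pot m' + unit * card (slot ?a m2)"
          using pot2 pot1 by (metis distrib_left)
        with c2 have cost2: "c2 + 500 * (unit * pot m2) \<le> 600 * unit + 500 * (unit * pot m')" by simp
        have eq2: "m2 ''Yn'' = m' ''Yn''" "m2 ''b'' 0 = b" "m2 ''oa'' 0 = ?b * N"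
          using eq1 o1 by (simp_all add: keepD[OF m2(2)])
        let ?e = "or_e (Cell ''Yn'' (var ''i'')) (Cell ''X'' (var ''i''))"
        show "rt ?M m2 (Seq (map_prog ''Yn'' (Lit 0) ?e) (vset ''oa'' (Plus (var ''oa'') (var ''nQ''))))
            (\<lambda>d. ?R (1 + ncost (Lit 0) + ncost (Plus (var ''oj'') (var ''oa'')) + (c2 + d)))"
        proof (rule rt_Seq[OF map_prog[OF m2(1), where off = 0 and v = "\<lambda>q. m2 ''Yn'' q + m2 ''X'' q"]])
          fix c3 m3 assume m3: "ok m3" "keep {''Yn'', ''i''} m2 m3" "c3 \<le> (ncost (Lit 0) + ncost ?e + 23) * N \<and>
            (\<forall>q<N. m3 ''Yn'' (0 + q) = m2 ''Yn'' q + m2 ''X'' q) \<and>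
                (\<forall>j. \<not> (0 \<le> j \<and> j < 0 + N) \<longrightarrow> m3 ''Yn'' j = m2 ''Yn'' j)"
          have Yn3: "elems ''Yn'' m3 = elems ''Yn'' m' \<union> slot ?a m2"
            using m3(3) eq2(1) unfolding X2(1)[symmetric] by (auto simp: elems_def)
          have eq3: "m3 ''XR'' = m2 ''XR''" "m3 ''b'' 0 = b" "m3 ''oa'' 0 = ?b * N" using eq2
              by (simp_all add: keepD[OF m3(2)])
          let ?m4 = "set_cell m3 ''oa'' 0 (Suc ?b * N)"
          let ?c = "1 + ncost (Lit 0) + ncost (Plus (var ''oj'') (var ''oa'')) +
              (c2 + (c3 + (1 + ncost (Lit 0) + ncost (Plus (var ''oa'') (var ''nQ'')))))"
          have "?c + 500 * (unit * pot m2) \<le> 700 * unit + 500 * (unit * pot m')"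
            using cost2 m3(3) unit_ge by simp
          moreover have "c + 500 * (unit * pot m') \<le> 700 * (unit * b) + 500 * (unit * pot m)" using m'(5)
              by (simp add: I_def)
          moreover have "pot ?m4 = pot m2" by (rule pot_XR_cong) (simp add: eq3)
          ultimately have cost: "c + ?c + 500 * (unit * pot ?m4) \<le> 700 * (unit * Suc b) + 500 * (unit * pot m)" by simp
          have "above ?m4" using above2 pot_XR_cong(2)[of ?m4 m2] eq3(1) by simp
          moreover have "{lo..<lo + Suc b} = insert ?b {lo..<?b}" by auto
          moreover have "elems ''Yn'' ?m4 = elems ''Yn'' m3" by (simp add: elems_def)
          ultimately have "I (Suc b) (c + ?c) ?m4"
            unfolding I_def using cost m'(5) Yn3 low2 X2(2) by (auto simp: I_def)
          then have "I (Suc b) (c + ?c) (set_cell ?m4 ''b'' 0 (Suc b))" by (subst I_cong[of _ ?m4])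
              (simp_all add: fun_upd_def)
          moreover have "set_cell m3 ''oa'' (nval (Lit 0) m3) (nval (Plus (var ''oa'') (var ''nQ'')) m3) = ?m4"
            using eq3(3) ok_simps(1)[OF m3(1)] by (simp add: algebra_simps)
          ultimately show "rt ?M m3 (vset ''oa'' (Plus (var ''oa'') (var ''nQ'')))
              (\<lambda>d. ?R (1 + ncost (Lit 0) + ncost (Plus (var ''oj'') (var ''oa'')) + (c2 + (c3 + d))))"
            using eq3(2) m3(1) by (intro rt_Do) (simp_all add: inputs_def)
        qed (simp_all add: inputs_def keepD)
      qed
    qed
  next
    have nu: "n \<le> unit * n" using unit_ge(3) by simp
    fix c m' assume I: "I n c m'"
    have "c + n * 11 + 8 + 500 * (unit * pot m') \<le> 800 * (unit * n) + 20 * unit + 500 * (unit * pot m)"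
      using I nu unit_ge(3) unfolding I_def by linarith
    with I show "c + n * (9 + ncost (var ''nb'')) + (6 + ncost (var ''nb'')) + 500 * (unit * pot m') \<le>
        800 * (unit * n) + 20 * unit + 500 * (unit * pot m) \<and>
      y_iter k (Suc j) \<subseteq> elems ''Yn'' m' \<and> elems ''Yn'' m' \<subseteq> (\<Union>b \<in> rng k.
          avoid B (assum b)) \<and> above m'"
      using k(3) by (simp add: I_def y_iter_Suc)
  next
    fix b c m' assume "keep ?M m m'"
    then show "nval (var ''nb'') m' = n" using v(3) by (simp add: keepD)
  qed (simp_all add: inputs_def)
qed

text \<open>After \<open>j\<close> rounds \<open>Y\<close> lies between \<open>y_iter k j\<close>,
  the iterate for the final \<open>Z\<close>, and \<open>job_stage k Z\<close>. Only after all
  \<open>N\<close> rounds is the lower bound known to reach \<open>job_stage k sol\<close> and hence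
  to contain \<open>sol\<close>; the fixed number of rounds also makes \<open>j\<close> address the
  same slots in every pass.\<close>

lemma y_loop:
  assumes m: "ok m" "env m" "elems ''Y'' m = {}" "above m"
    and k: "k < nG + nA" "rng k = {lo..<lo + n}" "0 < n"
    and v: "m ''oj'' 0 = k * N * (nA * N)" "m ''oa0'' 0 = lo * N" "m ''nb'' 0 = n"
    and Z: "sol \<subseteq> Z" "elems ''tg'' m = target k \<inter> cpre Z Z"
  shows "rt ({''o'', ''oa'', ''b'', ''Yn'', ''bs'', ''Y'', ''oj'', ''j''} \<union> avoid_vars) m
      (for_prog ''j'' (var ''nQ'') ystep_prog)
    (\<lambda>c m'. c + 500 * (unit * pot m') \<le> 2000 * (unit * (N * n)) + 500 * (unit * pot m) \<and>
      sol \<subseteq> elems ''Y'' m' \<and> elems ''Y'' m' \<subseteq> job_stage k Z \<and> above m' \<and>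
          m' ''oj'' 0 = Suc k * N * (nA * N))"
proof -
  let ?M = "{''o'', ''oa'', ''b'', ''Yn'', ''bs'', ''Y'', ''oj'', ''j''} \<union> avoid_vars"
  define Gz where "Gz = target k \<inter> cpre Z Z"
  define As where "As = assum ` rng k"
  have Gz: "goal k \<subseteq> Gz" unfolding goal_def Gz_def using cpre_mono[OF Z(1) Z(1)] by blast
  have stage: "y_step Gz As (job_stage k Z) = job_stage k Z"
    unfolding job_stage_def stage_def Gz_def As_def by (rule lfp_unfold[OF mono_y_step, symmetric])
  define I where "I j c m' \<longleftrightarrow> m' ''oj'' 0 = (k * N + j) * (nA * N) \<and> above m' \<and>
    y_iter k j \<subseteq> elems ''Y'' m' \<and> elems ''Y'' m' \<subseteq> job_stage k Z \<and>
    c + 500 * (unit * pot m') \<le> 1200 * (unit * (j * n)) + 500 * (unit * pot m)" for j c m'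
  have I_cong: "I j c m'' = I j c m'" if "m'' ''oj'' = m' ''oj''" "m'' ''XR'' = m' ''XR''" "m'' ''Y'' = m' ''Y''"
      for j c m' m''
    using that pot_XR_cong[of m'' m'] by (simp add: I_def elems_def)
  show ?thesis
  proof (rule rt_for_amortized[where I = I and n = N, OF m(1)])
    have "I 0 0 m" using m(3,4) v(1) by (simp add: I_def y_iter_def)
    then show "I 0 0 (set_cell m ''j'' 0 0)" by (subst I_cong[of _ m]) simp_all
  next
    fix j c m' assume m': "ok m'" "keep ?M m m'" "j < N" "m' ''j'' 0 = j" "I j c m'"
    let ?Y = "elems ''Y'' m'"
    let ?e1 = "or_e (Cell ''tg'' (var ''i'')) (or_e (Cell ''Y'' (var ''i'')) cpre_e)"
    let ?R = "\<lambda>c' m''. m'' ''j'' 0 = j \<and> I (Suc j) (c + c') (set_cell m'' ''j'' 0 (Suc j))"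
    have D: "elems ''D'' m' = dead" using m(2) elems_keep[OF m'(2)] by (simp add: env_def)
    show "rt ?M m' ystep_prog ?R"
      unfolding ystep_prog_def
    proof (rule rt_Seq[OF succ_prog[OF m'(1)]], simp, simp)
      fix c1 m1 assume m1: "ok m1" "keep {''gd'', ''bd'', ''i''} m' m1" "c1 \<le> 100 * (N + T) \<and>
        (\<forall>q<N. m1 ''gd'' q \<noteq> 0 \<longleftrightarrow> (\<exists>q' \<in> ?Y. (q, q') \<in> edges)) \<and>
        (\<forall>q<N. m1 ''bd'' q = 0 \<longleftrightarrow> (\<forall>q'. (q, q') \<in> edges \<longrightarrow>
            q' \<in> ?Y \<union> elems ''D'' m'))"
      have cp: "q \<in> cpre ?Y ?Y \<longleftrightarrow> m1 ''gd'' q \<noteq> 0 \<and>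
          (m0 ''sys'' q \<noteq> 0 \<or> m1 ''bd'' q = 0)" if "q < N" for q
        using m1(3) that D system_iff[OF that] by (simp add: cpre_def)
      have keep1: "keep ?M m m1" by (rule keep_trans[OF m'(2)]) (rule keep_mono[OF m1(2)], simp)
      have tg1: "elems ''tg'' m1 = Gz" using Z(2) elems_keep[OF keep1] by (simp add: Gz_def)
      have Y1: "elems ''Y'' m1 = ?Y" using elems_keep[OF m1(2)] by simp
      show "rt ?M m1 (Seq (map_prog ''bs'' (Lit 0) ?e1)
         (Seq (map_prog ''Yn'' (Lit 0) (Lit 0)) (Seq (vset ''oa'' (var ''oa0''))
         (Seq (for_prog ''b'' (var ''nb'') slot_prog)
         (Seq (map_prog ''Y'' (Lit 0) (Cell ''Yn'' (var ''i'')))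
             (vset ''oj'' (Plus (var ''oj'') (var ''sA'')))))))) (\<lambda>d. ?R (c1 + d))"
      proof (rule rt_Seq[OF map_prog[OF m1(1), where off = 0 and
            v = "\<lambda>q. m1 ''tg'' q + (m1 ''Y'' q + of_bool (m1 ''gd'' q \<noteq> 0 \<and>
                (m0 ''sys'' q \<noteq> 0 \<or> m1 ''bd'' q = 0)))"]])
        fix c2 m2 assume m2: "ok m2" "keep {''bs'', ''i''} m1 m2" "c2 \<le> (ncost (Lit 0) + ncost ?e1 + 23) * N \<and>
          (\<forall>q<N. m2 ''bs'' (0 + q) = m1 ''tg'' q + (m1 ''Y'' q + of_bool (m1 ''gd'' q \<noteq> 0 \<and>
              (m0 ''sys'' q \<noteq> 0 \<or> m1 ''bd'' q = 0)))) \<and>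
          (\<forall>j. \<not> (0 \<le> j \<and> j < 0 + N) \<longrightarrow> m2 ''bs'' j = m1 ''bs'' j)"
        have bs: "q \<in> elems ''bs'' m2 \<longleftrightarrow> q \<in> elems ''tg'' m1 \<or>
            q \<in> elems ''Y'' m1 \<or> q \<in> cpre ?Y ?Y" if "q < N" for q
          using m2(3) that cp[OF that] by (simp add: elems_def)
        have bs2: "elems ''bs'' m2 = base Gz ?Y"
        proof -
          have "elems x m'' \<subseteq> {..<N}" for x m'' by (auto simp: elems_def)
          then have "elems ''bs'' m2 \<subseteq> {..<N}" "base Gz ?Y \<subseteq> {..<N}"
            using tg1 cpre_sub unfolding base_def by blast+
          then show ?thesis using bs tg1 Y1 unfolding base_def by blast
        qed
        have keep2: "keep ?M m m2" by (rule keep_trans[OF keep1]) (rule keep_mono[OF m2(2)], simp)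
        show "rt ?M m2 (Seq (map_prog ''Yn'' (Lit 0) (Lit 0)) (Seq (vset ''oa'' (var ''oa0''))
         (Seq (for_prog ''b'' (var ''nb'') slot_prog)
         (Seq (map_prog ''Y'' (Lit 0) (Cell ''Yn'' (var ''i'')))
             (vset ''oj'' (Plus (var ''oj'') (var ''sA''))))))) (\<lambda>d. ?R (c1 + (c2 + d)))"
        proof (rule rt_Seq[OF map_prog[OF m2(1), where off = 0 and v = "\<lambda>_. 0"]])
          fix c3 m3 assume m3: "ok m3" "keep {''Yn'', ''i''} m2 m3" "c3 \<le> (ncost (Lit 0) + ncost (Lit 0) + 23) * N \<and>
            (\<forall>q<N. m3 ''Yn'' (0 + q) = 0) \<and> (\<forall>j. \<not> (0 \<le> j \<and> j < 0 + N)
                \<longrightarrow> m3 ''Yn'' j = m2 ''Yn'' j)"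
          have keep3: "keep ?M m m3" by (rule keep_trans[OF keep2]) (rule keep_mono[OF m3(2)], simp)
          have Yn3: "elems ''Yn'' m3 = {}" using m3(3) by (auto simp: elems_def)
          have bs3: "elems ''bs'' m3 = base Gz ?Y" using bs2 elems_keep[OF m3(2)] by simp
          have eq3: "m3 ''oj'' = m' ''oj''" "m3 ''XR'' = m' ''XR''" "m3 ''j'' 0 = j"
            using m'(4) by (simp_all add: keepD[OF m3(2)] keepD[OF m2(2)] keepD[OF m1(2)])
          show "rt ?M m3 (Seq (vset ''oa'' (var ''oa0''))
           (Seq (for_prog ''b'' (var ''nb'') slot_prog)
           (Seq (map_prog ''Y'' (Lit 0) (Cell ''Yn'' (var ''i'')))
               (vset ''oj'' (Plus (var ''oj'') (var ''sA'')))))) (\<lambda>d. ?R (c1 + (c2 + (c3 + d))))"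
          proof (rule rt_Do_Seq[OF m3(1)], simp, simp add: inputs_def)
            fix m4 assume m4: "m4 = set_cell m3 ''oa'' (nval (Lit 0) m3) (nval (var ''oa0'') m3)" "ok m4"
            have keep4: "keep ?M m m4" by (rule keep_trans[OF keep3]) (simp add: m4 keep_set_cell)
            have env4: "env m4" by (rule env_keep[OF m(2) keep4]) simp
            have bs4: "elems ''bs'' m4 = base Gz ?Y" and Yn4: "elems ''Yn'' m4 = {}"
              using bs3 Yn3 by (simp_all add: m4(1) elems_def)
            have XR4: "m4 ''XR'' = m' ''XR''" using eq3(2) by (simp add: m4(1))
            have "above m4 = above m'" "pot m4 = pot m'" using XR4 by (rule pot_XR_cong)+
            with m'(5) have above4: "above m4" and cost4: "c + 500 * (unit * pot m4) \<le>
                1200 * (unit * (j * n)) + 500 * (unit * pot m)"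
              by (simp_all add: I_def)
            have v4: "m4 ''oj'' 0 = (k * N + j) * (nA * N)" "m4 ''oa'' 0 = lo * N" "m4 ''nb'' 0 = n" "m4 ''j'' 0 = j"
              using m'(5) eq3 v by (simp_all add: m4(1) I_def keepD[OF keep3])
            have base4: "base (goal k) (y_iter k j) \<subseteq> base Gz ?Y"
              using m'(5) Gz by (intro base_mono) (simp_all add: I_def)
            show "rt ?M m4 (Seq (for_prog ''b'' (var ''nb'') slot_prog)
               (Seq (map_prog ''Y'' (Lit 0) (Cell ''Yn'' (var ''i''))) (vset ''oj'' (Plus (var ''oj'') (var ''sA'')))))
               (\<lambda>d. ?R (c1 + (c2 + (c3 + (1 + ncost (Lit 0) + ncost (var ''oa0'') + d)))))"
            proof (rule rt_Seq[OF slot_loop[OF m4(2) env4 bs4 Yn4 above4 k(1) m'(3) k(2) v4(1-3) base4]], simp)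
              fix c5 m5 assume m5: "ok m5" "keep ({''o'', ''oa'', ''b'', ''Yn''} \<union> avoid_vars) m4 m5"
                "c5 + 500 * (unit * pot m5) \<le> 800 * (unit * n) + 20 * unit + 500 * (unit * pot m4) \<and>
                 y_iter k (Suc j) \<subseteq> elems ''Yn'' m5 \<and> elems ''Yn'' m5 \<subseteq> (\<Union>b \<in>
                     rng k. avoid (base Gz ?Y) (assum b)) \<and> above m5"
              have eq5: "m5 ''oj'' 0 = (k * N + j) * (nA * N)" "m5 ''j'' 0 = j" using v4 by (simp_all add: keepD[OF m5(2)])
              have sA5: "m5 ''sA'' 0 = nA * N" using env4 by (simp add: env_def keepD[OF m5(2)])
              have "(\<Union>b \<in> rng k. avoid (base Gz ?Y) (assum b)) = y_step Gz As ?Y" by (simp add: y_step_def As_def)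
              also have "\<dots> \<subseteq> y_step Gz As (job_stage k Z)" using m'(5) by (intro y_step_mono)
                  (simp_all add: I_def)
              finally have up5: "elems ''Yn'' m5 \<subseteq> job_stage k Z" using m5(3) stage by blast
              show "rt ?M m5 (Seq (map_prog ''Y'' (Lit 0) (Cell ''Yn'' (var ''i'')))
                  (vset ''oj'' (Plus (var ''oj'') (var ''sA''))))
                (\<lambda>d. ?R (c1 + (c2 + (c3 + (1 + ncost (Lit 0) + ncost (var ''oa0'') + (c5 + d))))))"
              proof (rule rt_Seq[OF map_prog[OF m5(1), where off = 0 and v = "\<lambda>q. m5 ''Yn'' q"]])
                fix c6 m6 assume m6: "ok m6" "keep {''Y'', ''i''} m5 m6" "c6 \<le>
                    (ncost (Lit 0) + ncost (Cell ''Yn'' (var ''i'')) + 23) * N \<and>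
                  (\<forall>q<N. m6 ''Y'' (0 + q) = m5 ''Yn'' q) \<and> (\<forall>j. \<not> (0 \<le> j \<and>
                      j < 0 + N) \<longrightarrow> m6 ''Y'' j = m5 ''Y'' j)"
                have Y6: "elems ''Y'' m6 = elems ''Yn'' m5" using m6(3) by (auto simp: elems_def)
                have eq6: "m6 ''oj'' 0 = (k * N + j) * (nA * N)" "m6 ''j'' 0 = j" "m6 ''sA'' 0 = nA * N"
                    "m6 ''XR'' = m5 ''XR''"
                  using eq5 sA5 by (simp_all add: keepD[OF m6(2)])
                let ?m7 = "set_cell m6 ''oj'' 0 ((k * N + Suc j) * (nA * N))"
                have XR7: "?m7 ''XR'' = m5 ''XR''" using eq6 by simp
                have ap7: "above ?m7 = above m5" "pot ?m7 = pot m5" using XR7 by (rule pot_XR_cong)+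
                have Y7: "elems ''Y'' ?m7 = elems ''Yn'' m5" using Y6 by (simp add: elems_def)
                let ?c = "c1 + (c2 + (c3 + (1 + ncost (Lit 0) + ncost (var ''oa0'') +
                    (c5 + (c6 + (1 + ncost (Lit 0) + ncost (Plus (var ''oj'') (var ''sA''))))))))"
                have "c1 \<le> 100 * unit" using m1(3) by (simp add: unit_def)
                moreover have "c2 + c3 + c6 + 30 \<le> 200 * unit" using m2(3) m3(3) m6(3) unit_ge by simp
                moreover have "unit \<le> unit * n" using k(3) by simp
                ultimately have "?c + 500 * (unit * pot m5) \<le> 1200 * (unit * n) + 500 * (unit * pot m4)"
                  using m5(3) unfolding ncost.simps by linarith
                with cost4 have cost: "c + ?c + 500 * (unit * pot ?m7) \<le>
                    1200 * (unit * (Suc j * n)) + 500 * (unit * pot m)"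
                  unfolding ap7 by (simp add: algebra_simps)
                have "I (Suc j) (c + ?c) ?m7" unfolding I_def Y7 ap7(1) using m5(3) up5 cost by simp
                then have "I (Suc j) (c + ?c) (set_cell ?m7 ''j'' 0 (Suc j))" by (subst I_cong[of _ ?m7])
                    (simp_all add: fun_upd_def)
                moreover have "set_cell m6 ''oj'' (nval (Lit 0) m6) (nval (Plus (var ''oj'') (var ''sA'')) m6) = ?m7"
                  using eq6 by (simp add: algebra_simps)
                ultimately show "rt ?M m6 (vset ''oj'' (Plus (var ''oj'') (var ''sA'')))
                    (\<lambda>d. ?R (c1 + (c2 + (c3 + (1 + ncost (Lit 0) + ncost (var ''oa0'') + (c5 + (c6 + d)))))))"
                  using eq6(2) m6(1) by (intro rt_Do) (simp_all add: inputs_def)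
              qed (simp_all add: inputs_def keepD)
            qed
          qed
        qed (simp_all add: inputs_def)
      qed (simp_all add: inputs_def keepD ok_simps ok_simps(5)[OF m1(1)])
    qed
  next
    fix c m' assume I: "I N c m'"
    have "unit * N \<le> unit * (N * n)" "1 \<le> unit * (N * n)" using k(3) pos unit_ge(3) by simp_all
    moreover have "N * n \<le> unit * (N * n)" using unit_ge(3) by simp
    moreover have "N \<le> unit * N" using unit_ge(3) by simp
    ultimately have "c + N * 11 + 8 + 500 * (unit * pot m') \<le> 2000 * (unit * (N * n)) + 500 * (unit * pot m)"
      using I unfolding I_def by linarith
    moreover have "sol \<subseteq> elems ''Y'' m'" using I sol_stage[OF k(1)] unfolding I_def y_iter_N by blast
    ultimately show "c + N * (9 + ncost (var ''nQ'')) + (6 + ncost (var ''nQ'')) + 500 * (unit * pot m') \<le>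
        2000 * (unit * (N * n)) + 500 * (unit * pot m) \<and>
      sol \<subseteq> elems ''Y'' m' \<and> elems ''Y'' m' \<subseteq> job_stage k Z \<and> above m' \<and>
          m' ''oj'' 0 = Suc k * N * (nA * N)"
      using I by (simp add: I_def algebra_simps)
  qed (simp_all add: inputs_def ok_simps)
qed

lemma shrink_prog:
  assumes m: "ok m"
  shows "rt {''i'', ''Z'', ''zf''} m shrink_prog (\<lambda>c m'. c \<le> 100 * unit \<and>
      elems ''Z'' m' = elems ''Z'' m \<inter> elems ''Y'' m \<and>
    (m' ''zf'' 0 = 0 \<longleftrightarrow> m ''zf'' 0 = 0 \<and> elems ''Z'' m \<subseteq> elems ''Y'' m))"
proof -
  define R where "R = elems ''Z'' m - elems ''Y'' m"
  have R: "q \<in> R \<longleftrightarrow> m ''Z'' q \<noteq> 0 \<and> m ''Y'' q = 0" if "q < N" for q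
    using that by (auto simp: R_def elems_def)
  define X where "X k q = (if q < k \<and> m ''Y'' q = 0 then 0 else m ''Z'' q)" for k q
  define fl where "fl k \<longleftrightarrow> m ''zf'' 0 = 0 \<and> (\<forall>q<k. q \<notin> R)" for k
  have in_R: "X (Suc k) = (X k)(k := 0)" "\<not> fl (Suc k)" if "k \<in> R" "k < N" for k
    using that R[OF that(2)] by (auto simp: X_def fl_def less_Suc_eq fun_eq_iff)
  have not_R: "X (Suc k) = X k" "fl (Suc k) = fl k" if "k \<notin> R" "k < N" for k
    using that R[OF that(2)] by (auto simp: X_def fl_def less_Suc_eq fun_eq_iff)
  let ?c = "true_t (and_e (Cell ''Z'' (var ''i'')) (not_e (Cell ''Y'' (var ''i''))))"
  let ?p = "Seq (aset ''Z'' (var ''i'') (Lit 0)) (vset ''zf'' (Lit 1))"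
  let ?M = "{''i'', ''Z'', ''zf''}"
  define I where "I k m' \<longleftrightarrow> m' ''Z'' = X k \<and> (m' ''zf'' 0 = 0 \<longleftrightarrow> fl k)"
      for k and m' :: memory
  have "rt ?M m (for_prog ''i'' (var ''nQ'') (Cond ?c ?p Skip)) (\<lambda>c m'. c \<le> 100 * unit \<and> I N m')"
  proof (rule rt_for[where n = N and b = 50 and I = I])
    show "I 0 (set_cell m ''i'' 0 0)" by (auto simp: I_def X_def fl_def)
  next
    fix k m' assume m': "ok m'" "keep ?M m m'" "k < N" "m' ''i'' 0 = k" "I k m'"
    have eq: "m' ''Y'' = m ''Y''" "m' ''Z'' k = m ''Z'' k"
      using m'(5) by (simp_all add: keepD[OF m'(2)] I_def X_def)
    have c: "ram_tst ?c m' \<longleftrightarrow> k \<in> R" using R[OF m'(3)] m'(4) eq by simp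
    show "rt ?M m' (Cond ?c ?p Skip) (\<lambda>c m''. c \<le> 50 \<and> m'' ''i'' 0 = k \<and>
        I (Suc k) (set_cell m'' ''i'' 0 (Suc k)))"
    proof (rule rt_Cond)
      assume "ram_tst ?c m'"
      then have k: "k \<in> R" using c by blast
      show "rt ?M m' ?p (\<lambda>c m''. ram_tst_cost ?c + c \<le> 50 \<and> m'' ''i'' 0 = k \<and>
          I (Suc k) (set_cell m'' ''i'' 0 (Suc k)))"
        using m'(1,4,5) eq in_R[OF k m'(3)]
        by (intro rt_Do_Seq rt_Do) (simp_all add: inputs_def I_def fun_upd_def)
    next
      assume "\<not> ram_tst ?c m'"
      then have k: "k \<notin> R" using c by blast
      show "rt ?M m' Skip (\<lambda>c m''. ram_tst_cost ?c + c \<le> 50 \<and> m'' ''i'' 0 = k \<and>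
          I (Suc k) (set_cell m'' ''i'' 0 (Suc k)))"
        using m'(1,4,5) not_R[OF k m'(3)] by (intro rt_Skip) (simp_all add: I_def)
    qed
  next
    fix c m' assume "I N m'" "c \<le> N * (50 + 9 + ncost (var ''nQ'')) + 6 + ncost (var ''nQ'')"
    then show "c \<le> 100 * unit \<and> I N m'" using unit_ge by simp
  qed (use m in \<open>simp_all add: inputs_def ok_simps\<close>)
  then show ?thesis
    unfolding shrink_prog_def
  proof (rule rt_weaken)
    fix c m' assume *: "c \<le> 100 * unit \<and> I N m'"
    have "elems ''Z'' m' = elems ''Z'' m \<inter> elems ''Y'' m" using * by (auto simp: I_def X_def elems_def)
    moreover have "(\<forall>q<N. q \<notin> R) \<longleftrightarrow> elems ''Z'' m \<subseteq> elems ''Y'' m"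
      unfolding R_def elems_def by blast
    ultimately show "c \<le> 100 * unit \<and> elems ''Z'' m' = elems ''Z'' m \<inter> elems ''Y'' m \<and>
      (m' ''zf'' 0 = 0 \<longleftrightarrow> m ''zf'' 0 = 0 \<and> elems ''Z'' m \<subseteq> elems ''Y''
          m)" using * unfolding I_def fl_def by simp
  qed simp
qed

abbreviation job_vars :: "string set" where
  "job_vars \<equiv> {''tg'', ''Z'', ''zf'', ''ot'', ''o'', ''oa'', ''b'', ''Yn'', ''bs'', ''Y'', ''oj'', ''j''}
      \<union> avoid_vars"

text \<open>\<open>Z\<close> is cut down to \<open>Y\<close> in place. The bounds on
  \<open>Y\<close> carry over: \<open>sol\<close> is never cut, and if nothing is removed then
  \<open>Z\<close> lies in \<open>Y\<close> and thus in its own stage.\<close>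

lemma job_prog:
  assumes m: "ok m" "env m" "above m" "sol \<subseteq> elems ''Z'' m"
    and k: "k < nG + nA" "rng k = {lo..<lo + n}" "0 < n"
    and v: "m ''oj'' 0 = k * N * (nA * N)" "m ''oa0'' 0 = lo * N" "m ''nb'' 0 = n"
    and F: "F \<in> {''G'', ''A''}" "\<And>q. q < N \<Longrightarrow> q \<in> target k \<longleftrightarrow>
        m0 F (m ''ot'' 0 + q) \<noteq> 0"
  shows "rt job_vars m (job_prog F) (\<lambda>c m'. c + 500 * (unit * pot m') \<le>
      3000 * (unit * (N * n)) + 500 * (unit * pot m) \<and>
    sol \<subseteq> elems ''Z'' m' \<and> elems ''Z'' m' \<subseteq> elems ''Z'' m \<and>
    (m' ''zf'' 0 = 0 \<longrightarrow> m ''zf'' 0 = 0 \<and> elems ''Z'' m' = elems ''Z'' m \<and>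
        elems ''Z'' m \<subseteq> job_stage k (elems ''Z'' m)) \<and>
    (m' ''zf'' 0 \<noteq> 0 \<longrightarrow> m ''zf'' 0 \<noteq> 0 \<or> elems ''Z'' m' \<noteq> elems ''Z'' m) \<and>
    above m' \<and> m' ''oj'' 0 = Suc k * N * (nA * N) \<and> m' ''ot'' 0 = m ''ot'' 0 + N)"
  unfolding job_prog_def
proof (rule rt_Seq[OF succ_prog[OF m(1)]], simp, simp)
  let ?Z = "elems ''Z'' m"
  let ?Q = "\<lambda>c m'. c + 500 * (unit * pot m') \<le> 3000 * (unit * (N * n)) + 500 * (unit * pot m) \<and>
    sol \<subseteq> elems ''Z'' m' \<and> elems ''Z'' m' \<subseteq> ?Z \<and>
    (m' ''zf'' 0 = 0 \<longrightarrow> m ''zf'' 0 = 0 \<and> elems ''Z'' m' = ?Z \<and> ?Z \<subseteq> job_stage k ?Z) \<and>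
    (m' ''zf'' 0 \<noteq> 0 \<longrightarrow> m ''zf'' 0 \<noteq> 0 \<or> elems ''Z'' m' \<noteq> ?Z) \<and>
    above m' \<and> m' ''oj'' 0 = Suc k * N * (nA * N) \<and> m' ''ot'' 0 = m ''ot'' 0 + N"
  let ?e1 = "and_e (Cell F (Plus (var ''ot'') (var ''i''))) cpre_e"
  let ?rest = "Seq (for_prog ''j'' (var ''nQ'') ystep_prog) (Seq shrink_prog (vset ''ot'' (Plus (var ''ot'') (var ''nQ''))))"
  fix c1 m1 assume m1: "ok m1" "keep {''gd'', ''bd'', ''i''} m m1" "c1 \<le> 100 * (N + T) \<and>
    (\<forall>q<N. m1 ''gd'' q \<noteq> 0 \<longleftrightarrow> (\<exists>q' \<in> ?Z. (q, q') \<in> edges)) \<and>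
    (\<forall>q<N. m1 ''bd'' q = 0 \<longleftrightarrow> (\<forall>q'. (q, q') \<in> edges \<longrightarrow>
        q' \<in> ?Z \<union> elems ''D'' m))"
  have D: "elems ''D'' m = dead" using m(2) by (simp add: env_def)
  have cp: "q \<in> cpre ?Z ?Z \<longleftrightarrow> m1 ''gd'' q \<noteq> 0 \<and> (m0 ''sys'' q \<noteq> 0 \<or>
      m1 ''bd'' q = 0)" if "q < N" for q
    using m1(3) that D system_iff[OF that] by (simp add: cpre_def)
  have F1: "m' F = m0 F" if "ok m'" for m' using F(1) that by (auto simp: ok_simps)
  have F_in: "F \<in> inputs" "F \<noteq> ''i''" using F(1) by (auto simp: inputs_def)
  have keep1: "keep job_vars m m1" by (rule keep_mono[OF m1(2)]) simp
  show "rt job_vars m1 (Seq (map_prog ''tg'' (Lit 0) ?e1) (Seq (map_prog ''Y'' (Lit 0) (Lit 0)) ?rest))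
      (\<lambda>d. ?Q (c1 + d))"
  proof (rule rt_Seq[OF map_prog[OF m1(1), where off = 0 and
        v = "\<lambda>q. of_bool (m0 F (m ''ot'' 0 + q) \<noteq> 0 \<and> m1 ''gd'' q \<noteq> 0 \<and>
            (m0 ''sys'' q \<noteq> 0 \<or> m1 ''bd'' q = 0))"]])
    fix c2 m2 assume m2: "ok m2" "keep {''tg'', ''i''} m1 m2" "c2 \<le> (ncost (Lit 0) + ncost ?e1 + 23) * N \<and>
      (\<forall>q<N. m2 ''tg'' (0 + q) = of_bool (m0 F (m ''ot'' 0 + q) \<noteq> 0 \<and> m1 ''gd'' q \<noteq> 0
          \<and> (m0 ''sys'' q \<noteq> 0 \<or> m1 ''bd'' q = 0))) \<and>
      (\<forall>j. \<not> (0 \<le> j \<and> j < 0 + N) \<longrightarrow> m2 ''tg'' j = m1 ''tg'' j)"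
    have "q \<in> elems ''tg'' m2 \<longleftrightarrow> q \<in> target k \<inter> cpre ?Z ?Z" for q
    proof (cases "q < N")
      case True
      then show ?thesis using m2(3) cp[OF True] F(2)[OF True] by (simp add: elems_def)
    next
      case False
      then show ?thesis by (simp add: elems_def target_def)
    qed
    then have tg2: "elems ''tg'' m2 = target k \<inter> cpre ?Z ?Z" by blast
    have keep2: "keep job_vars m m2" by (rule keep_trans[OF keep1]) (rule keep_mono[OF m2(2)], simp)
    show "rt job_vars m2 (Seq (map_prog ''Y'' (Lit 0) (Lit 0)) ?rest) (\<lambda>d. ?Q (c1 + (c2 + d)))"
    proof (rule rt_Seq[OF map_prog[OF m2(1), where off = 0 and v = "\<lambda>_. 0"]])
      fix c3 m3 assume m3: "ok m3" "keep {''Y'', ''i''} m2 m3" "c3 \<le> (ncost (Lit 0) + ncost (Lit 0) + 23) * N \<and>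
        (\<forall>q<N. m3 ''Y'' (0 + q) = 0) \<and> (\<forall>j. \<not> (0 \<le> j \<and> j < 0 + N)
            \<longrightarrow> m3 ''Y'' j = m2 ''Y'' j)"
      have keep3: "keep job_vars m m3" by (rule keep_trans[OF keep2]) (rule keep_mono[OF m3(2)], simp)
      have env3: "env m3" by (rule env_keep[OF m(2) keep3]) simp
      have Y3: "elems ''Y'' m3 = {}" using m3(3) by (auto simp: elems_def)
      have XR3: "m3 ''XR'' = m ''XR''" by (simp add: keepD[OF m3(2)] keepD[OF m2(2)] keepD[OF m1(2)])
      have ap: "above m3 = above m" "pot m3 = pot m" using XR3 by (rule pot_XR_cong)+
      have above3: "above m3" using ap(1) m(3) by simp
      have v3: "m3 ''oj'' 0 = k * N * (nA * N)" "m3 ''oa0'' 0 = lo * N" "m3 ''nb'' 0 = n" "m3 ''zf'' = m ''zf''"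
          "m3 ''ot'' = m ''ot''"
        using v by (simp_all add: keepD[OF m3(2)] keepD[OF m2(2)] keepD[OF m1(2)])
      have Z3: "elems ''Z'' m3 = ?Z" by (simp add: elems_def keepD[OF m3(2)] keepD[OF m2(2)] keepD[OF m1(2)])
      have tg3: "elems ''tg'' m3 = target k \<inter> cpre ?Z ?Z" using tg2 by (simp add: elems_def keepD[OF m3(2)])
      show "rt job_vars m3 ?rest (\<lambda>d. ?Q (c1 + (c2 + (c3 + d))))"
      proof (rule rt_Seq[OF y_loop[OF m3(1) env3 Y3 above3 k v3(1-3) m(4) tg3]], simp)
        fix c4 m4 assume m4: "ok m4" "keep ({''o'', ''oa'', ''b'', ''Yn'', ''bs'', ''Y'', ''oj'', ''j''} \<union>
            avoid_vars) m3 m4"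
          "c4 + 500 * (unit * pot m4) \<le> 2000 * (unit * (N * n)) + 500 * (unit * pot m3) \<and>
          sol \<subseteq> elems ''Y'' m4 \<and> elems ''Y'' m4 \<subseteq> job_stage k ?Z \<and> above m4 \<and>
              m4 ''oj'' 0 = Suc k * N * (nA * N)"
        have Z4: "elems ''Z'' m4 = ?Z" using Z3 by (simp add: elems_def keepD[OF m4(2)])
        have v4: "m4 ''zf'' = m ''zf''" "m4 ''ot'' = m ''ot''" using v3 by (simp_all add: keepD[OF m4(2)])
        show "rt job_vars m4 (Seq shrink_prog (vset ''ot'' (Plus (var ''ot'') (var ''nQ''))))
            (\<lambda>d. ?Q (c1 + (c2 + (c3 + (c4 + d)))))"
        proof (rule rt_Seq[OF shrink_prog[OF m4(1)]], simp)
          fix c5 m5 assume m5: "ok m5" "keep {''i'', ''Z'', ''zf''} m4 m5" "c5 \<le> 100 * unit \<and>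
              elems ''Z'' m5 = elems ''Z'' m4 \<inter> elems ''Y'' m4 \<and>
            (m5 ''zf'' 0 = 0 \<longleftrightarrow> m4 ''zf'' 0 = 0 \<and> elems ''Z'' m4 \<subseteq> elems ''Y'' m4)"
          let ?m6 = "set_cell m5 ''ot'' 0 (m ''ot'' 0 + N)"
          let ?c = "c1 + (c2 + (c3 + (c4 + (c5 + (1 + ncost (Lit 0) + ncost (Plus (var ''ot'') (var ''nQ'')))))))"
          have XR6: "?m6 ''XR'' = m4 ''XR''" by (simp add: keepD[OF m5(2)])
          have ap6: "above ?m6 = above m4" "pot ?m6 = pot m4" using XR6 by (rule pot_XR_cong)+
          have Z6: "elems ''Z'' ?m6 = ?Z \<inter> elems ''Y'' m4" using m5(3) Z4 by (simp add: elems_def)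
          have v6: "?m6 ''zf'' 0 = 0 \<longleftrightarrow> m ''zf'' 0 = 0 \<and> ?Z \<subseteq> elems ''Y'' m4"
              "?m6 ''oj'' 0 = Suc k * N * (nA * N)" "?m6 ''ot'' 0 = m ''ot'' 0 + N"
            using m5(3) m4(3) v4 Z4 by (simp_all add: keepD[OF m5(2)])
          have "c1 \<le> 100 * unit" using m1(3) by (simp add: unit_def)
          moreover have "c2 + c3 + 20 \<le> 200 * unit" using m2(3) m3(3) unit_ge F(1) by auto
          moreover have "unit \<le> unit * (N * n)" using k(3) pos by simp
          ultimately have "?c + 500 * (unit * pot m4) \<le> 3000 * (unit * (N * n)) + 500 * (unit * pot m)"
            using m4(3)[unfolded ap(2)] m5(3) unfolding ncost.simps by linarith
          then have cost: "?c + 500 * (unit * pot ?m6) \<le> 3000 * (unit * (N * n)) + 500 * (unit * pot m)" unfolding ap6 .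
          have A: "sol \<subseteq> elems ''Z'' ?m6" "elems ''Z'' ?m6 \<subseteq> ?Z" unfolding Z6 using m4(3) m(4) by blast+
          have B: "?m6 ''zf'' 0 = 0 \<Longrightarrow> m ''zf'' 0 = 0 \<and> elems ''Z'' ?m6 = ?Z \<and>
              ?Z \<subseteq> job_stage k ?Z"
            unfolding Z6 v6 using m4(3) by blast
          have C: "?m6 ''zf'' 0 \<noteq> 0 \<Longrightarrow> m ''zf'' 0 \<noteq> 0 \<or> elems ''Z'' ?m6 \<noteq> ?Z"
            unfolding Z6 v6 by (metis inf.cobounded2)
          have "above ?m6" using ap6 m4(3) by simp
          then have "?Q ?c ?m6" using cost A B C v6(2,3) by blast
          moreover have "set_cell m5 ''ot'' (nval (Lit 0) m5) (nval (Plus (var ''ot'') (var ''nQ'')) m5) = ?m6"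
            using v4(2) ok_simps(1)[OF m5(1)] by (simp add: keepD[OF m5(2)])
          ultimately show "rt job_vars m5 (vset ''ot'' (Plus (var ''ot'') (var ''nQ'')))
              (\<lambda>d. ?Q (c1 + (c2 + (c3 + (c4 + (c5 + d))))))"
            using m5(1) by (intro rt_Do) (simp_all only:, simp_all add: inputs_def)
        qed
      qed
    qed (simp_all add: inputs_def)
  qed (use F1 in \<open>simp_all add: inputs_def keepD keepD[OF m1(2)] ok_simps ok_simps(5)[OF m1(1)]\<close>)
qed

text \<open>Up to a constant, the cost of one pass apart from the searches that remove
  states.\<close>

definition weight :: nat where
  "weight = unit * (N * (nG * nA))"

lemma weight_ge: "unit * (N * nA) \<le> weight" "nG * (unit * (N * nA)) = weight" "nG \<le> weight" "nA \<le>
    weight" "1 \<le> weight" "unit \<le> weight"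
  using pos unit_ge(3) by (simp_all add: weight_def)

text \<open>\<open>Z\<close> is the value at the start of the pass, while the array shrinks during
  it. An unset flag certifies that all jobs so far have been tested against the same set.\<close>

definition round_inv :: "nat set \<Rightarrow> nat \<Rightarrow> memory \<Rightarrow> bool" where
  "round_inv Z k m \<longleftrightarrow> above m \<and> sol \<subseteq> elems ''Z'' m \<and>
     (m ''zf'' 0 = 0 \<longrightarrow> elems ''Z'' m = Z \<and> (\<forall>k'<k. Z \<subseteq> job_stage k' Z)) \<and>
     (m ''zf'' 0 \<noteq> 0 \<longrightarrow> elems ''Z'' m \<subset> Z) \<and> m ''oj'' 0 = k * N * (nA * N)"

lemma round_inv_cong:
  "m' ''XR'' = m ''XR'' \<Longrightarrow> m' ''Z'' = m ''Z'' \<Longrightarrow>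
      m' ''zf'' = m ''zf'' \<Longrightarrow> m' ''oj'' = m ''oj'' \<Longrightarrow> round_inv Z k m' = round_inv Z k m"
  using pot_XR_cong(2)[of m' m] by (simp add: round_inv_def elems_def)

lemma round_inv_Suc:
  assumes "round_inv Z k m" "sol \<subseteq> elems ''Z'' m'" "elems ''Z'' m' \<subseteq> elems ''Z'' m"
    "m' ''zf'' 0 = 0 \<longrightarrow> m ''zf'' 0 = 0 \<and> elems ''Z'' m' = elems ''Z'' m \<and>
        elems ''Z'' m \<subseteq> job_stage k (elems ''Z'' m)"
    "m' ''zf'' 0 \<noteq> 0 \<longrightarrow> m ''zf'' 0 \<noteq> 0 \<or> elems ''Z'' m' \<noteq> elems ''Z'' m"
    "above m'" "m' ''oj'' 0 = Suc k * N * (nA * N)"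
  shows "round_inv Z (Suc k) m'"
proof -
  have "elems ''Z'' m' = Z \<and> (\<forall>k'<Suc k. Z \<subseteq> job_stage k' Z)" if "m' ''zf'' 0 = 0"
  proof -
    have "m ''zf'' 0 = 0" "elems ''Z'' m' = elems ''Z'' m" "elems ''Z'' m \<subseteq> job_stage k (elems ''Z'' m)"
      using assms(4) that by blast+
    moreover from this(1) have "elems ''Z'' m = Z" "\<forall>k'<k. Z \<subseteq> job_stage k' Z"
      using assms(1) unfolding round_inv_def by blast+
    ultimately show ?thesis by (auto simp: less_Suc_eq)
  qed
  moreover have "elems ''Z'' m' \<subset> Z" if "m' ''zf'' 0 \<noteq> 0"
  proof (cases "m ''zf'' 0 = 0")
    case True
    then have "elems ''Z'' m = Z" using assms(1) unfolding round_inv_def by blast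
    then show ?thesis using assms(3,5) that True by blast
  next
    case False
    then have "elems ''Z'' m \<subset> Z" using assms(1) unfolding round_inv_def by blast
    then show ?thesis using assms(3) by blast
  qed
  ultimately show ?thesis using assms(2,6,7) unfolding round_inv_def by blast
qed

abbreviation round_vars :: "string set" where
  "round_vars \<equiv> {''g'', ''nb'', ''oa0''} \<union> job_vars"

lemma guarantee_loop:
  assumes m: "ok m" "env m" "round_inv Z 0 m" and v: "m ''ot'' 0 = 0" "m ''nb'' 0 = nA" "m ''oa0'' 0 = 0"
  shows "rt round_vars m (for_prog ''g'' (var ''nG'') (job_prog ''G'')) (\<lambda>c m'. c + 500 * (unit * pot m')
      \<le> 3030 * weight + 500 * (unit * pot m) \<and>
    round_inv Z nG m')"
proof -
  define I where "I k c m' \<longleftrightarrow> round_inv Z k m' \<and> m' ''ot'' 0 = k * N \<and>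
      m' ''nb'' 0 = nA \<and> m' ''oa0'' 0 = 0 \<and>
    c + 500 * (unit * pot m') \<le> 3000 * (k * (unit * (N * nA))) + 500 * (unit * pot m)" for k c m'
  have I_cong: "I k c (set_cell m' ''g'' i x) = I k c m'" for k c m' i x
    using pot_XR_cong(1)[of "set_cell m' ''g'' i x" m'] round_inv_cong[of "set_cell m' ''g'' i x" m' Z k]
        by (simp add: I_def)
  show ?thesis
  proof (rule rt_for_amortized[where I = I and n = nG, OF m(1)])
    show "I 0 0 (set_cell m ''g'' 0 0)" unfolding I_cong using m(3) v by (simp add: I_def)
  next
    fix k c m' assume m': "ok m'" "keep round_vars m m'" "k < nG" "m' ''g'' 0 = k" "I k c m'"
    have env': "env m'" by (rule env_keep[OF m(2) m'(2)]) simp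
    have v': "m' ''oj'' 0 = k * N * (nA * N)" "m' ''oa0'' 0 = 0 * N" "m' ''nb'' 0 = nA" "above m'"
        "sol \<subseteq> elems ''Z'' m'" "round_inv Z k m'"
      using m'(5) unfolding I_def round_inv_def by (blast, simp, blast+)
    have k: "k < nG + nA" "rng k = {0..<0 + nA}" using m'(3) by (simp_all add: rng_def atLeast0LessThan)
    have tgt: "q \<in> target k \<longleftrightarrow> m0 ''G'' (m' ''ot'' 0 + q) \<noteq> 0" if "q < N" for q
      using that m'(3,5) by (simp add: target_def I_def)
    show "rt round_vars m' (job_prog ''G'') (\<lambda>c' m''. m'' ''g'' 0 = k \<and>
        I (Suc k) (c + c') (set_cell m'' ''g'' 0 (Suc k)))"
    proof (rule rt_weaken[OF job_prog[OF m'(1) env' v'(4,5) k pos(3) v'(1-3) _ tgt]], simp, assumption, blast)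
      fix c' m'' assume m'': "ok m''" "keep job_vars m' m''" and post: "c' + 500 * (unit * pot m'') \<le>
          3000 * (unit * (N * nA)) + 500 * (unit * pot m') \<and>
        sol \<subseteq> elems ''Z'' m'' \<and> elems ''Z'' m'' \<subseteq> elems ''Z'' m' \<and>
        (m'' ''zf'' 0 = 0 \<longrightarrow> m' ''zf'' 0 = 0 \<and> elems ''Z'' m'' = elems ''Z'' m' \<and>
            elems ''Z'' m' \<subseteq> job_stage k (elems ''Z'' m')) \<and>
        (m'' ''zf'' 0 \<noteq> 0 \<longrightarrow> m' ''zf'' 0 \<noteq> 0 \<or> elems ''Z'' m'' \<noteq> elems
            ''Z'' m') \<and>
        above m'' \<and> m'' ''oj'' 0 = Suc k * N * (nA * N) \<and> m'' ''ot'' 0 = m' ''ot'' 0 + N"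
      have "round_inv Z (Suc k) m''" by (rule round_inv_Suc[OF v'(6)]) (use post in blast)+
      moreover have "m'' ''g'' 0 = k" "m'' ''nb'' 0 = nA" "m'' ''oa0'' 0 = 0" using m'(4) v'
          by (simp_all add: keepD[OF m''(2)])
      moreover have "m'' ''ot'' 0 = Suc k * N" using post m'(5) by (simp add: I_def)
      moreover have "c + 500 * (unit * pot m') \<le> 3000 * (k * (unit * (N * nA))) + 500 * (unit * pot m)"
          using m'(5) by (simp add: I_def)
      then have "c + c' + 500 * (unit * pot m'') \<le> 3000 * (Suc k * (unit * (N * nA))) + 500 * (unit * pot m)"
        using post unfolding mult_Suc by simp
      ultimately show "m'' ''g'' 0 = k \<and> I (Suc k) (c + c') (set_cell m'' ''g'' 0 (Suc k))" unfolding I_cong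
          by (simp only: I_def)
    qed
  next
    fix c m' assume I: "I nG c m'"
    then have "c + 500 * (unit * pot m') \<le> 3000 * weight + 500 * (unit * pot m)" "round_inv Z nG m'"
      using weight_ge(2) by (simp_all add: I_def)
    moreover have "nG * 11 + 8 \<le> 30 * weight" using weight_ge(3,5) by linarith
    ultimately show "c + nG * (9 + ncost (var ''nG'')) + (6 + ncost (var ''nG'')) + 500 * (unit * pot m') \<le>
        3030 * weight + 500 * (unit * pot m) \<and>
      round_inv Z nG m'" by simp
  qed (simp_all add: inputs_def ok_simps)
qed

text \<open>An assumption job has a single slot per iterate, so all of these jobs together cost
  \<open>nA * (unit * N)\<close> up to a constant, no more than \<open>weight\<close>.\<close>

lemma assumption_loop:
  assumes m: "ok m" "env m" "round_inv Z nG m" and v: "m ''ot'' 0 = 0" "m ''nb'' 0 = 1"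
  shows "rt round_vars m (for_prog ''g'' (var ''nA'') (Seq (vset ''oa0'' (var ''ot'')) (job_prog ''A''))) (\<lambda>c m'.
    c + 500 * (unit * pot m') \<le> 3060 * weight + 500 * (unit * pot m) \<and> round_inv Z (nG + nA) m')"
proof -
  define I where "I a c m' \<longleftrightarrow> round_inv Z (nG + a) m' \<and> m' ''ot'' 0 = a * N \<and>
      m' ''nb'' 0 = 1 \<and>
    c + 500 * (unit * pot m') \<le> 3000 * (a * (unit * (N * 1))) + 10 * a + 500 * (unit * pot m)" for a c m'
  have I_cong: "I k c (set_cell m' ''g'' i x) = I k c m'" for k c m' i x
    using pot_XR_cong(1)[of "set_cell m' ''g'' i x" m'] round_inv_cong[of "set_cell m' ''g'' i x" m' Z "nG + k"]
        by (simp add: I_def)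
  show ?thesis
  proof (rule rt_for_amortized[where I = I and n = nA, OF m(1)])
    show "I 0 0 (set_cell m ''g'' 0 0)" unfolding I_cong using m(3) v by (simp add: I_def)
  next
    fix a c m' assume m': "ok m'" "keep round_vars m m'" "a < nA" "m' ''g'' 0 = a" "I a c m'"
    let ?R = "\<lambda>c' m''. m'' ''g'' 0 = a \<and> I (Suc a) (c + c') (set_cell m'' ''g'' 0 (Suc a))"
    show "rt round_vars m' (Seq (vset ''oa0'' (var ''ot'')) (job_prog ''A'')) ?R"
    proof (rule rt_Do_Seq[OF m'(1)], simp, simp add: inputs_def)
      fix m1 assume m1: "m1 = set_cell m' ''oa0'' (nval (Lit 0) m') (nval (var ''ot'') m')" "ok m1"
      have keep1: "keep round_vars m m1" by (rule keep_trans[OF m'(2)]) (simp add: m1 keep_set_cell)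
      have env1: "env m1" by (rule env_keep[OF m(2) keep1]) simp
      have XR1: "m1 ''XR'' = m' ''XR''" by (simp add: m1(1))
      have "round_inv Z (nG + a) m1 = round_inv Z (nG + a) m'" by (rule round_inv_cong) (simp_all add: m1(1))
      then have ri: "round_inv Z (nG + a) m1" using m'(5) by (simp add: I_def)
      then have v1: "m1 ''oj'' 0 = (nG + a) * N * (nA * N)" "above m1" "sol \<subseteq> elems ''Z'' m1"
        unfolding round_inv_def by blast+
      have v2: "m1 ''oa0'' 0 = a * N" "m1 ''nb'' 0 = 1" "m1 ''ot'' 0 = a * N" "m1 ''g'' 0 = a"
        using m'(4,5) by (simp_all add: m1(1) I_def)
      have pot1: "pot m1 = pot m'" using XR1 by (rule pot_XR_cong)
      have k: "nG + a < nG + nA" "rng (nG + a) = {a..<a + 1}" using m'(3) by (auto simp: rng_def)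
      have tgt: "q \<in> target (nG + a) \<longleftrightarrow> m0 ''A'' (m1 ''ot'' 0 + q) \<noteq> 0" if "q < N" for q
        using that v2(3) by (simp add: target_def)
      show "rt round_vars m1 (job_prog ''A'') (\<lambda>d. ?R (1 + ncost (Lit 0) + ncost (var ''ot'') + d))"
      proof (rule rt_weaken[OF job_prog[OF m1(2) env1 v1(2,3) k zero_less_one v1(1) v2(1,2) _ tgt]], simp, assumption, blast)
        fix c' m'' assume m'': "ok m''" "keep job_vars m1 m''" and post: "c' + 500 * (unit * pot m'') \<le>
            3000 * (unit * (N * 1)) + 500 * (unit * pot m1) \<and>
          sol \<subseteq> elems ''Z'' m'' \<and> elems ''Z'' m'' \<subseteq> elems ''Z'' m1 \<and>
          (m'' ''zf'' 0 = 0 \<longrightarrow> m1 ''zf'' 0 = 0 \<and> elems ''Z'' m'' = elems ''Z'' m1 \<and>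
              elems ''Z'' m1 \<subseteq> job_stage (nG + a) (elems ''Z'' m1)) \<and>
          (m'' ''zf'' 0 \<noteq> 0 \<longrightarrow> m1 ''zf'' 0 \<noteq> 0 \<or> elems ''Z'' m'' \<noteq> elems
              ''Z'' m1) \<and>
          above m'' \<and> m'' ''oj'' 0 = Suc (nG + a) * N * (nA * N) \<and> m'' ''ot'' 0 = m1 ''ot'' 0 + N"
        have "round_inv Z (Suc (nG + a)) m''" by (rule round_inv_Suc[OF ri]) (use post in blast)+
        then have "round_inv Z (nG + Suc a) m''" by simp
        moreover have "m'' ''g'' 0 = a" "m'' ''nb'' 0 = 1" using v2 by (simp_all add: keepD[OF m''(2)])
        moreover have "m'' ''ot'' 0 = Suc a * N" using post v2(3) by simp
        moreover have "c + 500 * (unit * pot m') \<le>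
            3000 * (a * (unit * (N * 1))) + 10 * a + 500 * (unit * pot m)" using m'(5) by (simp add: I_def)
        then have "c + (1 + ncost (Lit 0) + ncost (var ''ot'') + c') + 500 * (unit * pot m'') \<le>
            3000 * (Suc a * (unit * (N * 1))) + 10 * Suc a + 500 * (unit * pot m)"
          using post pot1 unfolding mult_Suc ncost.simps by simp
        ultimately show "?R (1 + ncost (Lit 0) + ncost (var ''ot'') + c') m''" unfolding I_cong by (simp only: I_def)
      qed
    qed
  next
    fix c m' assume I: "I nA c m'"
    have "nA * (unit * (N * 1)) \<le> weight" using weight_ge(1) by (simp add: algebra_simps)
    moreover have "nA * 21 + 8 \<le> 60 * weight" using weight_ge(4,5) by linarith
    ultimately have "c + (nA * 11 + 8) + 500 * (unit * pot m') \<le> 3060 * weight + 500 * (unit * pot m)"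
        "round_inv Z (nG + nA) m'"
      using I unfolding I_def by linarith+
    then show "c + nA * (9 + ncost (var ''nA'')) + (6 + ncost (var ''nA'')) + 500 * (unit * pot m') \<le>
        3060 * weight + 500 * (unit * pot m) \<and>
      round_inv Z (nG + nA) m'" by simp
  qed (simp_all add: inputs_def ok_simps)
qed

lemma round_prog:
  assumes m: "ok m" "env m" "above m" "sol \<subseteq> elems ''Z'' m" "m ''zf'' 0 = 0"
  shows "rt round_vars m round_prog (\<lambda>c m'. c + 500 * (unit * pot m') \<le>
      6200 * weight + 500 * (unit * pot m) \<and> above m' \<and>
    sol \<subseteq> elems ''Z'' m' \<and> (m' ''zf'' 0 = 0 \<longrightarrow> elems ''Z'' m' = sol) \<and>
        (m' ''zf'' 0 \<noteq> 0 \<longrightarrow> elems ''Z'' m' \<subset> elems ''Z'' m))"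
proof -
  let ?m1 = "set_cell (set_cell (set_cell (set_cell m ''oj'' 0 0) ''ot'' 0 0) ''nb'' 0 nA) ''oa0'' 0 0"
  let ?Z = "elems ''Z'' m"
  let ?Q = "\<lambda>c m'. c + 500 * (unit * pot m') \<le> 6200 * weight + 500 * (unit * pot m) \<and> above m' \<and>
    sol \<subseteq> elems ''Z'' m' \<and> (m' ''zf'' 0 = 0 \<longrightarrow> elems ''Z'' m' = sol) \<and>
        (m' ''zf'' 0 \<noteq> 0 \<longrightarrow> elems ''Z'' m' \<subset> ?Z)"
  let ?p2 = "Seq (vset ''ot'' (Lit 0)) (Seq (vset ''nb'' (Lit 1)) (for_prog ''g'' (var ''nA'')
      (Seq (vset ''oa0'' (var ''ot'')) (job_prog ''A''))))"
  have keep1: "keep round_vars m ?m1" by (simp add: keep_def set_cell_def)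
  have env1: "env ?m1" by (rule env_keep[OF m(2) keep1]) simp
  have XR1: "?m1 ''XR'' = m ''XR''" by simp
  have ap1: "above ?m1 = above m" "pot ?m1 = pot m" using XR1 by (rule pot_XR_cong)+
  have ri1: "round_inv ?Z 0 ?m1" using m ap1(1) by (simp add: round_inv_def elems_def)
  have loops: "rt round_vars ?m1 (Seq (for_prog ''g'' (var ''nG'') (job_prog ''G'')) ?p2) (\<lambda>c m'. ?Q
      (c + 20) m')" if ok1: "ok ?m1"
  proof (rule rt_Seq[OF guarantee_loop[OF ok1 env1 ri1] order_refl])
    fix c2 m2 assume m2: "ok m2" "keep round_vars ?m1 m2" "c2 + 500 * (unit * pot m2) \<le>
        3030 * weight + 500 * (unit * pot ?m1) \<and> round_inv ?Z nG m2"
    let ?m3 = "set_cell (set_cell m2 ''ot'' 0 0) ''nb'' 0 1"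
    have keep3: "keep round_vars ?m1 ?m3" by (rule keep_trans[OF m2(2)]) (simp add: keep_def set_cell_def)
    have env3: "env ?m3" by (rule env_keep[OF env1 keep3]) simp
    have XR3: "?m3 ''XR'' = m2 ''XR''" by simp
    have pot3: "pot ?m3 = pot m2" using XR3 by (rule pot_XR_cong)
    have "round_inv ?Z nG ?m3 = round_inv ?Z nG m2" by (rule round_inv_cong) simp_all
    then have ri3: "round_inv ?Z nG ?m3" using m2(3) by simp
    have "rt round_vars ?m3 (for_prog ''g'' (var ''nA'') (Seq (vset ''oa0'' (var ''ot'')) (job_prog ''A'')))
        (\<lambda>c m'. ?Q (c2 + c + 30) m')"
      if ok3: "ok ?m3"
    proof (rule rt_weaken[OF assumption_loop[OF ok3 env3 ri3] order_refl])
      fix c4 m4 assume m4: "c4 + 500 * (unit * pot m4) \<le> 3060 * weight + 500 * (unit * pot ?m3) \<and>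
          round_inv ?Z (nG + nA) m4"
      have "c2 + c4 + 30 + 500 * (unit * pot m4) \<le> 6200 * weight + 500 * (unit * pot m)"
        using m4[unfolded pot3] m2(3)[unfolded ap1(2)] weight_ge(5) by linarith
      \<comment> \<open>A pass without removals shows \<open>Z\<close> to be a post-fixed point of
        \<open>z_step\<close>, hence below \<open>sol\<close>; the other inclusion is invariant.
        Here the two bounds meet.\<close>
      moreover have "elems ''Z'' m4 = sol" if "m4 ''zf'' 0 = 0"
      proof -
        have "elems ''Z'' m4 = ?Z" "\<forall>k<nG + nA. ?Z \<subseteq> job_stage k ?Z"
          using m4 that unfolding round_inv_def by blast+
        then show ?thesis using sol_greatest[of ?Z] m(4) by blast
      qed
      ultimately show "?Q (c2 + c4 + 30) m4" using m4 unfolding round_inv_def by blast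
    qed simp_all
    then show "rt round_vars m2 ?p2 (\<lambda>d. ?Q (c2 + d + 20))"
      using m2(1) by (intro rt_Do_Seq; (simp add: inputs_def)?) (auto elim!: rt_weaken)
  qed simp_all
  show ?thesis
    unfolding round_prog_def
    using m(1) loops by (intro rt_Do_Seq; (simp add: inputs_def ok_simps)?) (auto elim!: rt_weaken simp: ok_simps)
qed

end

section \<open>Number of passes and total cost\<close>

context ram_arena
begin

text \<open>There are \<open>nG * (N * nA)\<close> slots of guarantee jobs and \<open>nA * N\<close>
  of assumption jobs, together at most \<open>2 * (N * (nG * nA))\<close>. With \<open>XR\<close>
  empty each of them is all of \<open>succs\<close>, which contains every
  \<open>x_limit\<close>.\<close>

lemma pot_bound:
  assumes "m ''XR'' = (\<lambda>_. 0)"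
  shows "unit * pot m \<le> 2 * (weight * card succs)" "above m"
proof -
  have slot: "slot a m = succs" for a by (simp add: slot_def assms)
  have "card slots = (\<Sum>k<nG + nA. N * card (rng k))"
    unfolding slots_def by (subst card_SigmaI) (auto simp: rng_def card_cartesian_product)
  also have "\<dots> = (\<Sum>k<nG + nA. if k < nG then N * nA else N)"
    by (rule sum.cong) (auto simp: rng_def)
  also have "\<dots> = nG * (N * nA) + nA * N"
    by (simp add: sum.nat_group[symmetric] lessThan_atLeast0 sum.atLeastLessThan_concat[of 0 nG "nG + nA", symmetric])
  finally have "card slots = nG * (N * nA) + nA * N" .
  moreover have "nA * N \<le> nG * (N * nA)" using pos by simp
  ultimately have le: "card slots \<le> 2 * (N * (nG * nA))" by (simp add: algebra_simps)
  have "pot m = card slots * card succs" by (simp add: pot_def slot split_beta)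
  then have "unit * pot m = card slots * (unit * card succs)" by simp
  also have "\<dots> \<le> 2 * (N * (nG * nA)) * (unit * card succs)" using le by (rule mult_right_mono) simp
  finally show "unit * pot m \<le> 2 * (weight * card succs)" by (simp add: weight_def algebra_simps)
  show "above m" unfolding above_def slot using x_limit_succs by blast
qed

lemma solve_prog:
  assumes m: "ok m" "env m" "above m" "elems ''Z'' m = succs"
  shows "rt ({''zf''} \<union> round_vars) m solve_prog (\<lambda>c m'.
    c \<le> 6300 * weight * (card succs + 2) + 500 * (unit * pot m) \<and> elems ''Z'' m' = sol)"
  unfolding solve_prog_def
proof (rule rt_Do_Seq[OF m(1)], simp, simp add: inputs_def)
  let ?M = "{''zf''} \<union> round_vars"
  \<comment> \<open>The flag accounts for the last pass, in which \<open>Z\<close> does not shrink;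
    so there are at most \<open>card succs + 1\<close> passes.\<close>
  define \<mu> where "\<mu> m' = card (elems ''Z'' m') + of_bool (m' ''zf'' 0 \<noteq> 0)" for m'
  define I where "I c m' \<longleftrightarrow> above m' \<and> sol \<subseteq> elems ''Z'' m' \<and>
      elems ''Z'' m' \<subseteq> succs \<and>
    (m' ''zf'' 0 = 0 \<longrightarrow> elems ''Z'' m' = sol) \<and>
    c + 500 * (unit * pot m') + 6300 * weight * \<mu> m' \<le> 500 * (unit * pot m) + 6300 * weight *
        (card succs + 1)" for c m'
  fix m1 assume m1: "m1 = set_cell m ''zf'' (nval (Lit 0) m) (nval (Lit 1) m)" "ok m1"
  have keep1: "keep ?M m m1" by (simp add: m1 keep_set_cell)
  have env1: "env m1" by (rule env_keep[OF m(2) keep1]) simp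
  have XR1: "m1 ''XR'' = m ''XR''" by (simp add: m1(1))
  have ap1: "above m1 = above m" "pot m1 = pot m" using XR1 by (rule pot_XR_cong)+
  have Z1: "elems ''Z'' m1 = succs" using m(4) by (simp add: m1(1) elems_def)
  have zf1: "m1 ''zf'' 0 = 1" by (simp add: m1(1))
  show "rt ?M m1 (Loop (true_t (var ''zf'')) (Seq (vset ''zf'' (Lit 0)) round_prog))
    (\<lambda>d m'. 1 + ncost (Lit 0) + ncost (Lit 1) + d \<le> 6300 * weight * (card succs + 2) + 500 *
        (unit * pot m) \<and> elems ''Z'' m' = sol)"
  proof (rule rt_Loop[where I = I and \<mu> = "\<lambda>_. \<mu>"])
    show "I 0 m1" using m(3) ap1 Z1 sol_succs zf1 by (simp add: I_def \<mu>_def)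
  next
    fix c m' assume m': "ok m'" "keep ?M m1 m'" "I c m'" "ram_tst (true_t (var ''zf'')) m'"
    let ?R = "\<lambda>c' m''. I (c + ram_tst_cost (true_t (var ''zf'')) + c') m'' \<and> \<mu> m'' < \<mu> m'"
    show "rt ?M m' (Seq (vset ''zf'' (Lit 0)) round_prog) ?R"
    proof (rule rt_Do_Seq[OF m'(1)], simp, simp add: inputs_def)
      fix m2 assume m2: "m2 = set_cell m' ''zf'' (nval (Lit 0) m') (nval (Lit 0) m')" "ok m2"
      have keep2: "keep ?M m1 m2" by (rule keep_trans[OF m'(2)]) (simp add: m2 keep_set_cell)
      have env2: "env m2" by (rule env_keep[OF env1 keep2]) simp
      have XR2: "m2 ''XR'' = m' ''XR''" by (simp add: m2(1))
      have ap2: "above m2 = above m'" "pot m2 = pot m'" using XR2 by (rule pot_XR_cong)+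
      have Z2: "elems ''Z'' m2 = elems ''Z'' m'" by (simp add: m2(1) elems_def)
      have zf2: "m2 ''zf'' 0 = 0" by (simp add: m2(1))
      have I': "above m'" "sol \<subseteq> elems ''Z'' m'" "elems ''Z'' m' \<subseteq> succs"
        "c + 500 * (unit * pot m') + 6300 * weight * \<mu> m' \<le> 500 * (unit * pot m) + 6300 * weight * (card succs + 1)"
        using m'(3) unfolding I_def by blast+
      have pre2: "above m2" "sol \<subseteq> elems ''Z'' m2" using I' ap2(1) Z2 by simp_all
      show "rt ?M m2 round_prog (\<lambda>d. ?R (1 + ncost (Lit 0) + ncost (Lit 0) + d))"
      proof (rule rt_weaken[OF round_prog[OF m2(2) env2 pre2 zf2]])
        fix c3 m3 assume m3: "c3 + 500 * (unit * pot m3) \<le> 6200 * weight + 500 * (unit * pot m2) \<and> above m3 \<and>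
          sol \<subseteq> elems ''Z'' m3 \<and> (m3 ''zf'' 0 = 0 \<longrightarrow> elems ''Z'' m3 = sol) \<and>
              (m3 ''zf'' 0 \<noteq> 0 \<longrightarrow> elems ''Z'' m3 \<subset> elems ''Z'' m2)"
        have sub: "elems ''Z'' m3 \<subseteq> elems ''Z'' m'"
        proof (cases "m3 ''zf'' 0 = 0")
          case True
          with m3 have "elems ''Z'' m3 = sol" by blast
          with I'(2) show ?thesis by simp
        next
          case False
          with m3 Z2 show ?thesis by blast
        qed
        have fin: "finite (elems ''Z'' m')" using I'(3) by (rule finite_sub_succs)
        have "\<mu> m' = card (elems ''Z'' m') + 1" using m'(4) by (simp add: \<mu>_def)
        moreover have "\<mu> m3 \<le> card (elems ''Z'' m')"
        proof (cases "m3 ''zf'' 0 = 0")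
          case True
          then show ?thesis using card_mono[OF fin sub] by (simp add: \<mu>_def)
        next
          case False
          then have "elems ''Z'' m3 \<subset> elems ''Z'' m'" using m3 Z2 by simp
          from psubset_card_mono[OF fin this] show ?thesis by (simp add: \<mu>_def)
        qed
        ultimately have dec: "\<mu> m3 + 1 \<le> \<mu> m'" by simp
        then have "6300 * weight * (\<mu> m3 + 1) \<le> 6300 * weight * \<mu> m'" by (rule mult_left_mono) simp
        then have "6300 * weight * \<mu> m3 + 6300 * weight \<le> 6300 * weight * \<mu> m'"
            by (simp only: distrib_left mult_1_right)
        then have "c + ram_tst_cost (true_t (var ''zf'')) + (1 + ncost (Lit 0) + ncost (Lit 0) + c3) + 500 *
            (unit * pot m3) + 6300 * weight * \<mu> m3 \<le>
            500 * (unit * pot m) + 6300 * weight * (card succs + 1)"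
          using I'(4) m3 weight_ge(5) unfolding ap2 ram_tst_cost.simps ncost.simps by linarith
        moreover have "elems ''Z'' m3 \<subseteq> succs" using sub I'(3) by blast
        ultimately show "?R (1 + ncost (Lit 0) + ncost (Lit 0) + c3) m3" using m3 dec unfolding I_def by simp
      qed simp
    qed
  next
    fix c m' assume *: "I c m'" "\<not> ram_tst (true_t (var ''zf'')) m'"
    then have "elems ''Z'' m' = sol" by (simp add: I_def)
    moreover have "c \<le> 500 * (unit * pot m) + 6300 * weight * (card succs + 1)" using *(1) unfolding I_def by linarith
    moreover have "6300 * weight * (card succs + 2) = 6300 * weight * (card succs + 1) + 6300 * weight"
        by (simp add: distrib_left)
    ultimately show "1 + ncost (Lit 0) + ncost (Lit 1) + (c + ram_tst_cost (true_t (var ''zf''))) \<le>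
        6300 * weight * (card succs + 2) + 500 * (unit * pot m) \<and> elems ''Z'' m' = sol"
      using weight_ge(5) unfolding ram_tst_cost.simps ncost.simps by linarith
  qed (rule m1(2))
qed

abbreviation setup_vars :: "string set" where
  "setup_vars \<equiv> {''gd'', ''bd'', ''i'', ''j'', ''D'', ''acc'', ''row'', ''cnt'', ''PL'', ''Z0'', ''Z'', ''sA''}"

lemma setup_prog:
  assumes m: "ok m"
  shows "rt setup_vars m setup_prog (\<lambda>c m'. c \<le> 300 * (N * unit) + 1000 * unit + 20 * nA \<and>
      env m' \<and> elems ''Z'' m' = succs)"
  unfolding setup_prog_def
proof (rule rt_Seq[OF ram_dead_prog[OF m]], simp)
  let ?Q = "\<lambda>c m'. c \<le> 300 * (N * unit) + 1000 * unit + 20 * nA \<and> env m' \<and> elems ''Z'' m' = succs"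
  let ?p4 = "Seq (vset ''sA'' (Lit 0)) (for_prog ''i'' (var ''nA'') (vset ''sA'' (Plus (var ''sA'') (var ''nQ''))))"
  let ?p3 = "Seq (map_prog ''Z'' (Lit 0) (Cell ''Z0'' (var ''i''))) ?p4"
  let ?p2 = "Seq (map_prog ''Z0'' (Lit 0) (Lit 0)) (Seq (scan_prog ''Z0'' (Less (Lit 0) (Lit 1))) ?p3)"
  fix c1 m1 assume m1: "ok m1" "c1 \<le> 300 * (N * (N + T)) \<and> elems ''D'' m1 = dead"
  show "rt setup_vars m1 (Seq row_prog (Seq fill_prog ?p2)) (\<lambda>d. ?Q (c1 + d))"
  proof (rule rt_Seq[OF row_prog[OF m1(1)]], simp)
    fix c2 m2 assume m2: "ok m2" "keep {''acc'', ''i'', ''row''} m1 m2" "c2 \<le> 100 * N \<and>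
        (\<forall>q<N. m2 ''row'' q = q * T)"
    then have row: "\<forall>q<N. m2 ''row'' q = q * T" by blast
    show "rt setup_vars m2 (Seq fill_prog ?p2) (\<lambda>d. ?Q (c1 + (c2 + d)))"
    proof (rule rt_Seq[OF fill_prog[OF m2(1) row]], simp)
      fix c3 m3 assume m3: "ok m3" "keep {''i'', ''cnt'', ''PL''} m2 m3" "c3 \<le> 100 * (N + T) \<and> adj m3"
      have D3: "elems ''D'' m3 = dead" using m1(2) elems_keep[OF m3(2)] elems_keep[OF m2(2)] by simp
      show "rt setup_vars m3 ?p2 (\<lambda>d. ?Q (c1 + (c2 + (c3 + d))))"
      proof (rule rt_Seq[OF map_prog[OF m3(1), where off = 0 and v = "\<lambda>_. 0"]])
        fix c4 m4 assume m4: "ok m4" "keep {''Z0'', ''i''} m3 m4" "c4 \<le> (ncost (Lit 0) + ncost (Lit 0) + 23) * N \<and>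
          (\<forall>q<N. m4 ''Z0'' (0 + q) = 0) \<and> (\<forall>j. \<not> (0 \<le> j \<and> j < 0 + N)
              \<longrightarrow> m4 ''Z0'' j = m3 ''Z0'' j)"
        show "rt setup_vars m4 (Seq (scan_prog ''Z0'' (Less (Lit 0) (Lit 1))) ?p3)
            (\<lambda>d. ?Q (c1 + (c2 + (c3 + (c4 + d)))))"
        proof (rule rt_Seq[OF scan_prog[OF m4(1), where P = "\<lambda>_. True"]])
          fix c5 m5 assume m5: "ok m5" "keep {''Z0'', ''i''} m4 m5" "c5 \<le>
              (ram_tst_cost (Less (Lit 0) (Lit 1)) + 24) * T \<and>
            (\<forall>q. m5 ''Z0'' q = (if \<exists>k<T. m0 ''src'' k = q \<and> True then 1 else m4 ''Z0'' q))"
          have Z5: "elems ''Z0'' m5 = succs"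
            using m5(3) m4(3) src_less by (auto simp: elems_def succs_def edges_def)
          show "rt setup_vars m5 ?p3 (\<lambda>d. ?Q (c1 + (c2 + (c3 + (c4 + (c5 + d))))))"
          proof (rule rt_Seq[OF map_prog[OF m5(1), where off = 0 and v = "m5 ''Z0''"]])
            fix c6 m6 assume m6: "ok m6" "keep {''Z'', ''i''} m5 m6" "c6 \<le>
                (ncost (Lit 0) + ncost (Cell ''Z0'' (var ''i'')) + 23) * N \<and>
              (\<forall>q<N. m6 ''Z'' (0 + q) = m5 ''Z0'' q) \<and> (\<forall>j. \<not> (0 \<le> j \<and>
                  j < 0 + N) \<longrightarrow> m6 ''Z'' j = m5 ''Z'' j)"
            have Z6: "elems ''Z'' m6 = succs" "elems ''Z0'' m6 = succs"
              using m6(3) unfolding Z5[symmetric] by (auto simp: elems_def keepD[OF m6(2)])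
            have D6: "elems ''D'' m6 = dead"
              using D3 elems_keep[OF m6(2)] elems_keep[OF m5(2)] elems_keep[OF m4(2)] by simp
            have adj6: "adj m6"
              using m3(3) by (simp add: adj_def keepD[OF m6(2)] keepD[OF m5(2)] keepD[OF m4(2)])
            have pc: "c1 + (c2 + (c3 + (c4 + (c5 + c6)))) + 50 \<le> 300 * (N * unit) + 1000 * unit"
              using m1(2) m2(3) m3(3) m4(3) m5(3) m6(3) unit_ge pos by (simp add: unit_def)
            show "rt setup_vars m6 ?p4 (\<lambda>d. ?Q (c1 + (c2 + (c3 + (c4 + (c5 + (c6 + d)))))))"
            proof (rule rt_Do_Seq[OF m6(1)], simp, simp add: inputs_def)
              fix m7 assume m7: "m7 = set_cell m6 ''sA'' (nval (Lit 0) m6) (nval (Lit 0) m6)" "ok m7"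
              have "rt {''i'', ''sA''} m7 (for_prog ''i'' (var ''nA'') (vset ''sA'' (Plus (var ''sA'') (var ''nQ''))))
                (\<lambda>c m'. c \<le> 18 * nA + 8 \<and> m' ''sA'' 0 = nA * N)"
                by (rule rt_for[where n = nA and b = 7 and I = "\<lambda>k m'. m' ''sA'' 0 = k * N"])
                  (use m7 in \<open>auto simp: inputs_def ok_simps intro!: rt_Do\<close>)
              then show "rt setup_vars m7 (for_prog ''i'' (var ''nA'') (vset ''sA'' (Plus (var ''sA'') (var ''nQ''))))
                (\<lambda>d. ?Q (c1 + (c2 + (c3 + (c4 + (c5 + (c6 + (1 + ncost (Lit 0) + ncost (Lit 0) + d))))))))"
              proof (rule rt_weaken)
                fix c8 m8 assume m8: "keep {''i'', ''sA''} m7 m8" "c8 \<le> 18 * nA + 8 \<and> m8 ''sA'' 0 = nA * N"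
                have k8: "m8 x = m6 x" if "x \<notin> {''i'', ''sA''}" for x
                  using that keepD[OF m8(1) that] by (simp add: m7(1))
                have "env m8" "elems ''Z'' m8 = succs"
                  using m8(2) Z6 D6 adj6 by (simp_all add: env_def adj_def elems_def k8)
                then show "?Q (c1 + (c2 + (c3 + (c4 + (c5 + (c6 + (1 + ncost (Lit 0) + ncost (Lit 0) + c8))))))) m8"
                  using pc m8(2) by simp
              qed simp
            qed
          qed (simp_all add: inputs_def keepD ok_simps)
        qed (simp_all add: inputs_def)
      qed (simp_all add: inputs_def)
    qed
  qed
qed

lemma ram_prog_correct:
  assumes "m0 ''XR'' = (\<lambda>_. 0)" "m0 ''init'' 0 < N"
  shows "\<exists>c m. ram_run ram_prog m0 c m \<and> (accepts m \<longleftrightarrow>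
      m0 ''init'' 0 \<in> sol) \<and> c \<le> 100000 * (T * N\<^sup>2 * nG * nA)"
proof -
  let ?K = "T * N\<^sup>2 * nG * nA"
  let ?M = "{''zf'', ''out''} \<union> setup_vars \<union> round_vars"
  have K: "weight * card succs \<le> 2 * ?K"
  proof -
    \<comment> \<open>This is where \<open>succs\<close> matters: in the first summand it is bounded
      by \<open>T\<close>, in the second by \<open>N\<close>. With all states in its place the first
      summand would be \<open>N * N\<close>, which \<open>T\<close> need not control.\<close>
    have "unit * card succs = N * card succs + T * card succs" by (simp add: unit_def distrib_right)
    also have "\<dots> \<le> N * T + T * N" by (intro add_mono mult_left_mono) (simp_all add: succs_card)
    finally have "unit * card succs * (N * (nG * nA)) \<le> (2 * (N * T)) * (N * (nG * nA))"
        by (intro mult_right_mono) (simp_all add: mult.commute)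
    then show ?thesis by (simp add: weight_def power2_eq_square algebra_simps)
  qed
  have w: "weight \<le> weight * card succs" using succs_card(3) by simp
  have "N * unit \<le> weight" using pos by (simp add: weight_def)
  note bounds = this K w weight_ge
  have ok0: "ok m0" by (simp add: ok_def)
  have "rt ?M m0 (Seq setup_prog (Seq solve_prog (vset ''out'' (not_e (not_e (Cell ''Z'' (var ''init'')))))))
    (\<lambda>c m. (accepts m \<longleftrightarrow> m0 ''init'' 0 \<in> sol) \<and> 4 + c \<le> 100000 * ?K)"
  proof (rule rt_Seq[OF setup_prog[OF ok0]], simp)
    fix c1 m1 assume m1: "ok m1" "keep setup_vars m0 m1"
      "c1 \<le> 300 * (N * unit) + 1000 * unit + 20 * nA \<and> env m1 \<and> elems ''Z'' m1 = succs"
    then have env1: "env m1" and Z1: "elems ''Z'' m1 = succs" by blast+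
    have XR1: "m1 ''XR'' = (\<lambda>_. 0)" using keepD[OF m1(2), of "''XR''"] assms(1) by simp
    have pot1: "unit * pot m1 \<le> 2 * (weight * card succs)" "above m1" using XR1 by (rule pot_bound)+
    show "rt ?M m1 (Seq solve_prog (vset ''out'' (not_e (not_e (Cell ''Z'' (var ''init''))))))
      (\<lambda>d m. (accepts m \<longleftrightarrow> m0 ''init'' 0 \<in> sol) \<and> 4 + (c1 + d) \<le> 100000 * ?K)"
    proof (rule rt_Seq[OF solve_prog[OF m1(1) env1 pot1(2) Z1]], simp)
      fix c2 m2 assume m2: "ok m2" "c2 \<le> 6300 * weight * (card succs + 2) + 500 * (unit * pot m1) \<and>
          elems ''Z'' m2 = sol"
      have "6300 * weight * (card succs + 2) = 6300 * (weight * card succs) + 12600 * weight" by (simp add: distrib_left)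
      \<comment> \<open>The test of \<open>nT\<close> costs 4, and 20 covers the final assignment.
        All charges sum to less than \<open>22000 * (weight * card succs)\<close>, that is
        \<open>44000 * ?K\<close>, so the chosen constant is generous.\<close>
      then have "4 + (c1 + (c2 + 20)) \<le> 100000 * ?K" using m1(3) m2(2) pot1(1) bounds by linarith
      moreover have "m2 ''Z'' (m0 ''init'' 0) \<noteq> 0 \<longleftrightarrow> m0 ''init'' 0 \<in> sol"
        using m2(2) assms(2) by (auto simp: elems_def)
      ultimately show "rt ?M m2 (vset ''out'' (not_e (not_e (Cell ''Z'' (var ''init'')))))
        (\<lambda>d m. (accepts m \<longleftrightarrow> m0 ''init'' 0 \<in> sol) \<and> 4 + (c1 + (c2 + d)) \<le>
            100000 * ?K)"
        using m2(1) by (intro rt_Do) (simp_all add: inputs_def accepts_def ok_simps)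
    qed
  qed
  then have "rt ?M m0 ram_prog (\<lambda>c m. (accepts m \<longleftrightarrow> m0 ''init'' 0 \<in> sol) \<and>
      c \<le> 100000 * ?K)"
    unfolding ram_prog_def using m0(2) pos(2) by (intro rt_Cond) (simp_all, erule rt_weaken, simp_all)
  then show ?thesis unfolding rt_def wp_def by blast
qed

end

theorem theorem4:
  shows "(\<exists>(P :: (sym_action, sym_test) prog) (C :: nat).
            \<forall>(H :: 'q game) FA FG. instance_of H FA FG \<longrightarrow>
              (\<exists>c s. sym_run H FA FG P (sym_input FA FG) c s \<and>
                 (accepts (fst s) \<longleftrightarrow> synthesizable H FA FG) \<and>
                 c \<le> C * ((card (states H))\<^sup>2 * length FG * length FA)))
       \<and> (\<exists>(P :: (ram_action, ram_test) prog) (C :: nat).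
            \<forall>(H :: 'q game) FA FG m. instance_of H FA FG \<and> ram_input H FA FG m \<longrightarrow>
              (\<exists>c m'. ram_run P m c m' \<and>
                 (accepts m' \<longleftrightarrow> synthesizable H FA FG) \<and>
                 c \<le> C * max 1 (card (transitions H) * (card (states H))\<^sup>2 * length FG * length FA)))"
proof (rule conjI; rule exI; rule exI; intro allI impI)
  fix H :: "'q game" and FA FG
  assume inst: "instance_of H FA FG"
  interpret sym_game H FA FG
    using inst by unfold_locales (auto simp: instance_of_def)
  have "card (states H) \<noteq> 0"
    using game finite_U by (auto simp: game_graph_def states_def)
  moreover have "length FG \<noteq> 0" "length FA \<noteq> 0" using inst by (simp_all add: instance_of_def)
  ultimately have "card (states H) * 1 * 1 * 1 \<le> card (states H) * card (states H) * length FG * length FA"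
    by (intro mult_le_mono) (simp_all add: Suc_le_eq)
  then have le: "3 * card (states H) \<le> 3 * ((card (states H))\<^sup>2 * length FG * length FA)"
    by (simp add: power2_eq_square)
  show "\<exists>c s. sym_run H FA FG sym_prog (sym_input FA FG) c s \<and>
      (accepts (fst s) \<longleftrightarrow> synthesizable H FA FG) \<and> c \<le>
          3 * ((card (states H))\<^sup>2 * length FG * length FA)"
    using sym_prog_correct le synthesizable_iff_solution[OF FA] by (metis order_trans)
next
  fix H :: "'q game" and FA FG m
  assume "instance_of H FA FG \<and> ram_input H FA FG m"
  then have inst: "instance_of H FA FG" and input: "ram_input H FA FG m" by blast+
  interpret game_arena H using inst by unfold_locales (simp add: instance_of_def)
  have ne: "FA \<noteq> []" "FG \<noteq> []" and F_sub: "\<And>F. F \<in> set FA \<union> set FG \<Longrightarrow>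
      F \<subseteq> states H"
    using inst by (auto simp: instance_of_def)
  define N where "N = card (states H)"
  define T where "T = card (transitions H)"
  from input obtain e where e: "bij_betw e (states H) {..<N}"
    and sizes: "m ''nQ'' 0 = N" "m ''nT'' 0 = T" "m ''nA'' 0 = length FA" "m ''nG'' 0 = length FG"
      "m ''init'' 0 = e (initial H)"
    and sys: "\<forall>q \<in> states H. m ''sys'' (e q) = of_bool (q \<in> sys_states H)"
    and tr: "bij_betw (\<lambda>k. (m ''src'' k, m ''tgt'' k)) {..<T} (map_prod e e ` transitions H)"
    and sets: "\<forall>i < length FA. \<forall>q \<in> states H. m ''A'' (i * N + e q) = of_bool (q \<in> FA ! i)"
      "\<forall>i < length FG. \<forall>q \<in> states H. m ''G'' (i * N + e q) = of_bool (q \<in> FG ! i)"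
    and rest: "\<forall>x i. x \<notin> {''nQ'', ''nT'', ''nA'', ''nG'', ''init'', ''sys'', ''src'', ''tgt'', ''A'', ''G''} \<longrightarrow> m x i = 0"
    unfolding ram_input_def N_def T_def by blast
  have init: "initial H \<in> states H" using game by (simp add: game_graph_def states_def)
  have e_less: "e q < N" if "q \<in> states H" for q using bij_betw_apply[OF e that] by simp
  let ?K = "T * N\<^sup>2 * length FG * length FA"
  have "\<exists>c m'. ram_run ram_prog m c m' \<and> (accepts m' \<longleftrightarrow>
      synthesizable H FA FG) \<and> c \<le> 100000 * max 1 ?K"
  \<comment> \<open>Without transitions there are no plays, so no strategy has a nonempty set of
    plays. The machine stops after one test, whose constant cost is covered by the maximum with
    1.\<close>
  proof (cases "T = 0")
    case True
    have "transitions H = {}"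
      using True finite_subset[OF E_sub] finite_U by (simp add: T_def)
    then have "plays H = {}" using transition_iff by (fastforce simp: plays_def)
    then have "\<not> synthesizable H FA FG"
      by (auto simp: synthesizable_def winning_def compliant_def)
    moreover have "\<not> accepts m" using rest by (simp add: accepts_def)
    moreover have "ram_run ram_prog m (ram_tst_cost (true_t (var ''nT'')) + 0) m"
      unfolding ram_prog_def using True sizes(2) by (intro run.CondF run.Skip) simp
    moreover have "ram_tst_cost (true_t (var ''nT'')) + 0 \<le> 100000 * max 1 ?K" by simp
    ultimately show ?thesis by blast
  next
    case False
    have im: "(\<lambda>k. (m ''src'' k, m ''tgt'' k)) ` {..<T} = map_prod e e ` transitions H"
      using tr by (simp add: bij_betw_def)
    have st: "m ''src'' k < N \<and> m ''tgt'' k < N" if "k < T" for k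
    proof -
      have "(m ''src'' k, m ''tgt'' k) \<in> map_prod e e ` transitions H" using that unfolding im[symmetric] by blast
      then show ?thesis using e_less E_sub by auto
    qed
    interpret R: ram_arena m N T "length FA" "length FG"
      using sizes st False ne e_less[OF init] by unfold_locales auto
    have edges: "R.edges = map_prod e e ` transitions H"
      unfolding im[symmetric] by (auto simp: R.edges_def)
    \<comment> \<open>The machine works on the renumbered arena; \<open>pull\<close> takes its jobs,
      and with them its solution, back to those of \<open>H\<close>.\<close>
    interpret arena_iso "states H" "transitions H" "sys_states H" "{..<N}" R.edges R.system e
      using e edges sys e_less by unfold_locales (auto simp: R.system_def)
    have pull_G: "pull (R.target k) = FG ! k" if "k < length FG" for k
      using that sets(2) e_less F_sub[of "FG ! k"] by (auto simp: pull_def R.target_def)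
    have pull_A: "pull (R.assum k) = FA ! k" if "k < length FA" for k
      using that sets(1) e_less F_sub[of "FA ! k"] by (auto simp: pull_def R.assum_def)
    have pull_T: "pull (R.target (length FG + k)) = FA ! k" if "k < length FA" for k
      using that sets(1) e_less F_sub[of "FA ! k"] by (auto simp: pull_def R.target_def)
    define job where "job k = (pull (R.target k), pull ` R.assum ` R.rng k)" for k
    have job1: "job k = (FG ! k, set FA)" if "k < length FG" for k
    proof -
      have "pull ` R.assum ` {..<length FA} = (\<lambda>k. FA ! k) ` {..<length FA}"
        unfolding image_image by (rule image_cong) (simp_all add: pull_A)
      then show ?thesis using that by (simp add: job_def pull_G R.rng_def set_conv_nth lessThan_def image_Collect)
    qed
    have job2: "job (length FG + k) = (FA ! k, {FA ! k})" if "k < length FA" for k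
      using that by (simp add: job_def pull_T R.rng_def pull_A)
    have "{..<length FG + length FA} = {..<length FG} \<union> (\<lambda>k. length FG + k) ` {..<length FA}"
    proof -
      have "x \<in> (\<lambda>k. length FG + k) ` {..<length FA}" if "x < length FG + length FA" "\<not> x < length FG" for x
        using that by (intro image_eqI[of _ _ "x - length FG"]) auto
      then show ?thesis by auto
    qed
    then have "(\<lambda>(T, As). (pull T, pull ` As)) ` R.ram_jobs =
        job ` {..<length FG} \<union> (\<lambda>k. job (length FG + k)) ` {..<length FA}"
      by (simp add: R.ram_jobs_def image_Un image_image job_def)
    also have "job ` {..<length FG} = (\<lambda>k. (FG ! k, set FA)) ` {..<length FG}"
      by (rule image_cong) (simp_all add: job1)
    also have "(\<lambda>k. job (length FG + k)) ` {..<length FA} = (\<lambda>k. (FA ! k, {FA ! k})) ` {..<length FA}"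
      by (rule image_cong) (simp_all add: job2)
    also have "(\<lambda>k. (FG ! k, set FA)) ` {..<length FG} \<union> (\<lambda>k. (FA ! k, {FA ! k})) `
        {..<length FA} = jobs FA FG"
      by (auto simp: jobs_def set_conv_nth)
    finally have J: "(\<lambda>(T, As). (pull T, pull ` As)) ` R.ram_jobs = jobs FA FG" .
    have "R.ram_jobs \<noteq> {}" using ne by (simp add: R.ram_jobs_def lessThan_empty_iff)
    from pull_solution[OF this] have "pull R.sol = solution (jobs FA FG)" unfolding J R.sol_def .
    then have "initial H \<in> solution (jobs FA FG) \<longleftrightarrow> m ''init'' 0 \<in> R.sol"
      using init sizes(5) by (auto simp: pull_def)
    with synthesizable_iff_solution[OF ne(1)] have iff: "synthesizable H FA FG \<longleftrightarrow>
        m ''init'' 0 \<in> R.sol" by simp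
    have "m ''XR'' = (\<lambda>_. 0)" using rest by (intro ext) simp
    moreover have "m ''init'' 0 < N" using sizes(5) e_less[OF init] by simp
    ultimately obtain c m' where "ram_run ram_prog m c m'" "accepts m' \<longleftrightarrow>
        m ''init'' 0 \<in> R.sol" "c \<le> 100000 * ?K"
      using R.ram_prog_correct by blast
    moreover have "100000 * ?K \<le> 100000 * max 1 ?K" by simp
    ultimately show ?thesis unfolding iff by (meson order_trans)
  qed
  then show "\<exists>c m'. ram_run ram_prog m c m' \<and> (accepts m' \<longleftrightarrow> synthesizable H FA FG) \<and>
      c \<le> 100000 * max 1 (card (transitions H) * (card (states H))\<^sup>2 * length FG * length FA)"
    by (simp add: N_def T_def)
qed

end
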